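(* Let $S\subset[0,\pi/2)$. Then $S$ is a $WR$-set if and only if $S$ is a $G_{\delta\sigma}$-set, i.e. a countable union of $G_\delta$-sets.
   Context: For $s\in[0,\pi/2)$ let $\mathcal{R}_s$ be the family of all open rectangles $R$ in $\mathbb{R}^2$ having slope $s$, i.e. having a side that forms angle $s$ with the abscissa ($x_1$-axis). Let $d(R)$ be the diameter of $R$ and $|\cdot|$ planar Lebesgue measure. For $f\in L^1(\mathbb{R}^2)$, the basis $\mathcal{R}_s$ is said to differentiate the integral of $f$ (written: differentiates $\int f$) if $$\lim_{d(R)\to 0,\ x\in R\in\mathcal{R}_s}\frac{1}{|R|}\int_R f=f(x)$$ for almost every $x\in\mathbb{R}^2$. The upper derivative is $$\overline D_sf(x)=\limsup_{d(R)\to 0,\ x\in R\in\mathcal{R}_s}\frac{1}{|R|}\int_R f .$$ A set $S\subset[0,\pi/2)$ is called a $WR$-set (weak $R$-set) if there exists a function $f\in L^1(\mathbb{R}^2)$ such that $\mathcal{R}_s$ differentiates $\int f$ for every $s\in[0,\pi/2)\setminus S$, and, for every $s\in S$, $\overline D_sf(x)=\infty$ holds for all $x$ in a set of positive measure (which may depend on $s$). A $G_\delta$-set in $[0,\pi/2)$ is a set of the form $\big(\bigcap_{k=1}^\infty G_k\big)\cap[0,\pi/2)$ with $G_k\subset\mathbb{R}$ open. *)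

theory Defs
  imports "HOL-Analysis.Analysis" "HOL-Library.Going_To_Filter"
begin

definition rectangles :: "real \<Rightarrow> (real \<times> real) set set" where
  "rectangles s = {R. \<exists>p a b. 0 < a \<and> 0 < b \<and>
     R = {p + u *\<^sub>R (cos s, sin s) + v *\<^sub>R (- sin s, cos s) | u v.
            0 < u \<and> u < a \<and> 0 < v \<and> v < b}}"

text \<open>The filter, on sets, of the limit \<open>d(R) \<rightarrow> 0\<close>, \<open>x \<in> R \<in> \<R>\<^sub>s\<close>.\<close>

definition rect_filter :: "real \<Rightarrow> real \<times> real \<Rightarrow> (real \<times> real) set filter" where
  "rect_filter s x = diameter going_to (at_right 0) within {R \<in> rectangles s. x \<in> R}"

lemma diameter_rectangle_pos:
  assumes "R \<in> rectangles s"
  shows "0 < diameter R"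
proof -
  let ?e = "(cos s, sin s)" and ?f = "(- sin s, cos s)"
  obtain p a b where ab: "0 < a" "0 < b" and R: "R = {p + u *\<^sub>R ?e + v *\<^sub>R ?f | u v.
      0 < u \<and> u < a \<and> 0 < v \<and> v < b}"
    using assms unfolding rectangles_def by blast
  have bdd: "bounded R"
  proof (rule boundedI)
    fix z assume "z \<in> R"
    then obtain u v where z: "z = p + u *\<^sub>R ?e + v *\<^sub>R ?f"
      and uv: "0 < u" "u < a" "0 < v" "v < b"
      unfolding R by blast
    have "norm z \<le> norm p + norm (u *\<^sub>R ?e) + norm (v *\<^sub>R ?f)"
      unfolding z by (meson norm_triangle_le add_mono order_refl norm_triangle_ineq)
    also have "\<dots> \<le> norm p + a + b"
      using uv by (simp add: norm_Pair del: scaleR_Pair)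
    finally show "norm z \<le> norm p + a + b" .
  qed
  let ?y = "p + (a/3) *\<^sub>R ?e + (b/2) *\<^sub>R ?f" and ?z = "p + (2*a/3) *\<^sub>R ?e + (b/2) *\<^sub>R ?f"
  have mem: "p + u *\<^sub>R ?e + v *\<^sub>R ?f \<in> R" if "0 < u" "u < a" "0 < v" "v < b" for u v
    unfolding R using that by blast
  have "?y \<in> R" "?z \<in> R"
    using ab by (auto intro!: mem simp del: scaleR_Pair)
  then have le: "dist ?y ?z \<le> diameter R"
    using bdd by (rule diameter_bounded_bound[rotated])
  have "?z - ?y = (a/3) *\<^sub>R ?e"
    by (simp add: field_simps)
  then have "dist ?y ?z = a/3"
    using ab by (subst dist_commute, unfold dist_norm) (simp add: norm_Pair del: scaleR_Pair)
  with le ab show ?thesis by simp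
qed

lemma eventually_rect_filter:
  "eventually P (rect_filter s x) \<longleftrightarrow>
     (\<exists>\<delta>>0. \<forall>R\<in>rectangles s. x \<in> R \<and> diameter R < \<delta> \<longrightarrow> P R)"
proof -
  have "eventually P (rect_filter s x) \<longleftrightarrow> (\<exists>Q. eventually Q (at_right (0::real)) \<and>
      (\<forall>R\<in>rectangles s. x \<in> R \<longrightarrow> Q (diameter R) \<longrightarrow> P R))"
    unfolding rect_filter_def going_to_within_def eventually_inf_principal eventually_filtercomap
    by blast
  also have "\<dots> \<longleftrightarrow> (\<exists>\<delta>>0. \<forall>R\<in>rectangles s. x \<in> R \<and> diameter R < \<delta> \<longrightarrow> P R)"
  proof (safe, goal_cases)
    case (1 Q)
    then obtain d where "d > 0" "\<And>y. 0 < y \<Longrightarrow> y < d \<Longrightarrow> Q y"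
      unfolding eventually_at_right_field by blast
    with 1 show ?case by (intro exI[of _ d]) (auto dest: diameter_rectangle_pos)
  next
    case (2 d)
    then show ?case
      by (intro exI[of _ "\<lambda>y. y < d"]) (auto simp: eventually_at_right_field)
  qed
  finally show ?thesis .
qed

definition mean :: "(real \<times> real \<Rightarrow> real) \<Rightarrow> (real \<times> real) set \<Rightarrow> real" where
  "mean f R = (LINT y:R|lebesgue. f y) / measure lebesgue R"

definition differentiates :: "real \<Rightarrow> (real \<times> real \<Rightarrow> real) \<Rightarrow> bool" where
  "differentiates s f \<longleftrightarrow> (AE x in lebesgue. (mean f \<longlongrightarrow> f x) (rect_filter s x))"

definition upper_derivative :: "real \<Rightarrow> (real \<times> real \<Rightarrow> real) \<Rightarrow> real \<times> real \<Rightarrow> ereal" where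
  "upper_derivative s f x = Limsup (rect_filter s x) (\<lambda>R. ereal (mean f R))"

definition WR_set :: "real set \<Rightarrow> bool" where
  "WR_set S \<longleftrightarrow> S \<subseteq> {0..<pi/2} \<and>
     (\<exists>f :: real \<times> real \<Rightarrow> real. integrable lebesgue f \<and>
        (\<forall>s \<in> {0..<pi/2} - S. differentiates s f) \<and>
        (\<forall>s \<in> S. \<exists>A \<in> sets lebesgue. 0 < emeasure lebesgue A \<and>
           (\<forall>x\<in>A. upper_derivative s f x = \<infinity>)))"

definition G_delta_set :: "real set \<Rightarrow> bool" where
  "G_delta_set A \<longleftrightarrow>
     (\<exists>G :: nat \<Rightarrow> real set. (\<forall>k. open (G k)) \<and> A = (\<Inter>k. G k) \<inter> {0..<pi/2})"

lemma G_delta_set_iff_gdelta_in: "G_delta_set A \<longleftrightarrow> gdelta_in (top_of_set {0..<pi/2}) A"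
proof
  assume "G_delta_set A"
  then obtain G :: "nat \<Rightarrow> real set"
    where G: "\<And>k. open (G k)" and A: "A = (\<Inter>k. G k) \<inter> {0..<pi/2}"
    unfolding G_delta_set_def by blast
  have "gdelta_in (top_of_set {0..<pi/2}) (\<Inter>k. G k \<inter> {0..<pi/2})"
    using G by (intro gdelta_in_Inter) (auto intro!: open_imp_gdelta_in openin_open_Int simp: Int_commute[of _ "{0..<pi/2}"])
  also have "(\<Inter>k. G k \<inter> {0..<pi/2}) = A"
    unfolding A by blast
  finally show "gdelta_in (top_of_set {0..<pi/2}) A" .
next
  assume A: "gdelta_in (top_of_set {0..<pi/2}) A"
  then obtain \<U> where U: "countable \<U>" "\<And>U. U \<in> \<U> \<Longrightarrow> openin (top_of_set {0..<pi/2}) U"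
    and AU: "A = {0..<pi/2} \<inter> \<Inter>\<U>"
    unfolding gdelta_in_def relative_to_def intersection_of_def by auto
  let ?V = "insert {0..<pi/2} \<U>"
  define W where "W = from_nat_into ?V"
  have "range W = ?V"
    unfolding W_def using U(1) by (intro range_from_nat_into) auto
  moreover from this have "openin (top_of_set {0..<pi/2}) (W k)" for k
    using U(2) by (metis insertE openin_subtopology_self rangeI)
  then have "\<forall>k. \<exists>G. open G \<and> W k = {0..<pi/2} \<inter> G"
    by (simp add: openin_open)
  then obtain G where G: "\<And>k. open (G k)" "\<And>k. W k = {0..<pi/2} \<inter> G k"
    by metis
  ultimately have "A = (\<Inter>k. W k)"
    unfolding AU by (simp add: \<open>range W = ?V\<close>)
  also have "\<dots> = (\<Inter>k. G k) \<inter> {0..<pi/2}"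
    using G(2) by auto
  finally show "G_delta_set A"
    unfolding G_delta_set_def using G(1) by blast
qed

definition G_delta_sigma_set :: "real set \<Rightarrow> bool" where
  "G_delta_sigma_set S \<longleftrightarrow>
     (\<exists>A :: nat \<Rightarrow> real set. (\<forall>n. G_delta_set (A n)) \<and> S = (\<Union>n. A n))"

end

theory Submission
  imports Defs "HOL-Computational_Algebra.Primes"
begin

text \<open>
  Necessity: for an integrable \<open>f\<close>, the pairs of a slope \<open>s\<close> and a point lying in a rectangle of slope
  \<open>s\<close> and size below \<open>1/n\<close> with mean above \<open>n\<close> form an open set. So the measures of its sections in a ball
  are lower semicontinuous in \<open>s\<close>, and the slopes with a non-null divergence set form a countable
  union of countable intersections of open sets.

  Sufficiency: for every small interval of slopes of length comparable to \<open>e\<close> there are functions of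
  arbitrarily small \<open>L\<^sup>1\<close> norm on the unit ball that have large means on suitable small rectangles with
  slope in the interval, through almost every point up to small measure, and uniformly small means on
  all rectangles whose slope is at distance at least about \<open>e\<close> from the interval. They are sums over
  many scales of lattice translates of a high bump consisting of a thin positive layer next to a thin
  negative layer along an arc of the parabola \<open>x\<^sub>1 = - x\<^sub>2\<^sup>2\<close>: a rectangle with a side tangent to the
  arc can meet the positive layer alone, while one transversal to the arc sees both layers cancel. Covering the members
  of a decreasing sequence of open sets by Whitney intervals and summing such functions handles
  one \<open>G\<^sub>\<delta>\<close> set; countably many of them are handled side by side in disjoint strips.
\<close>

text \<open>The core is a gap between two exponents: with layers of width w, a rectangle tangent to
  the arc gains about w * sqrt w (\<open>prof_tangent\<close>), while cancellation leaves a
  transversal one at most about w^2 (\<open>prof_corner\<close>). For small w the tangent slopes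
  win. A second gain is logarithmic. The points that see a given bump with a large tangent mean fill
  a staircase of dyadic rectangles of equal area (\<open>stair\<close>), so few scales are needed
  until the staircases cover almost everything, and over so few scales the regions spoilt for
  transversal slopes stay small in total. The obstacle is a long transversal rectangle, which may
  run along rows of bumps at many scales at once. Each scale therefore gets a lattice with its own
  shear i/P, P prime. For a given slope at most one of these shears is badly placed in the
  Diophantine sense (\<open>not_generic_unique\<close>), and for a given rectangle at most one scale
  is of intermediate size. At every other scale the mean vanishes or carries an extra factor of
  order 1/(e D).\<close>

section \<open>Rotated coordinates, rectangles, and rotation invariance of plane measure\<close>

definition fu :: "real \<Rightarrow> real \<times> real \<Rightarrow> real" where
  "fu s x = fst x * cos s + snd x * sin s"

definition fv :: "real \<Rightarrow> real \<times> real \<Rightarrow> real" where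
  "fv s x = snd x * cos s - fst x * sin s"

definition rot :: "real \<Rightarrow> real \<times> real \<Rightarrow> real \<times> real" where
  "rot s z = (fst z * cos s - snd z * sin s, fst z * sin s + snd z * cos s)"

text \<open>Inequalities in the rotated coordinates, instead of a corner and two side vectors, make
  openness, rescaling and rotation of rectangles immediate.\<close>

definition rc :: "real \<Rightarrow> real \<Rightarrow> real \<Rightarrow> real \<Rightarrow> real \<Rightarrow> (real \<times> real) set" where
  "rc s a b c d = {x. a < fu s x \<and> fu s x < b \<and> c < fv s x \<and> fv s x < d}"

lemma trig_sq [simp]: "cos s * cos s + sin s * sin s = (1::real)" "sin s * sin s + cos s * cos s = (1::real)"
  using sin_cos_squared_add3[of s] by (auto simp: add.commute)

lemma fu_rot [simp]: "fu s (rot s z) = fst z"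
proof -
  have "fu s (rot s z) = fst z * (cos s * cos s + sin s * sin s)"
    unfolding fu_def rot_def fst_conv snd_conv by algebra
  then show ?thesis by (simp only: trig_sq mult_1_right)
qed

lemma fv_rot [simp]: "fv s (rot s z) = snd z"
proof -
  have "fv s (rot s z) = snd z * (cos s * cos s + sin s * sin s)"
    unfolding fv_def rot_def fst_conv snd_conv by algebra
  then show ?thesis by (simp only: trig_sq mult_1_right)
qed

lemma rot_fu_fv [simp]: "rot s (fu s x, fv s x) = x"
proof (rule prod_eqI)
  have "fst (rot s (fu s x, fv s x)) = fst x * (cos s * cos s + sin s * sin s)"
    unfolding fu_def fv_def rot_def fst_conv snd_conv by algebra
  then show "fst (rot s (fu s x, fv s x)) = fst x" by (simp only: trig_sq mult_1_right)
  have "snd (rot s (fu s x, fv s x)) = snd x * (cos s * cos s + sin s * sin s)"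
    unfolding fu_def fv_def rot_def fst_conv snd_conv by algebra
  then show "snd (rot s (fu s x, fv s x)) = snd x" by (simp only: trig_sq mult_1_right)
qed

lemma rot_add: "rot a (rot b z) = rot (a + b) z"
  by (simp add: rot_def cos_add sin_add algebra_simps)

lemma rot_0 [simp]: "rot 0 z = z"
  by (simp add: rot_def)

lemma rot_minus_eq: "rot (- s) x = (fu s x, fv s x)"
  by (simp add: rot_def fu_def fv_def algebra_simps)

lemma fu_rot': "fu s (rot a x) = fu (s - a) x"
  by (simp add: fu_def rot_def cos_diff sin_diff algebra_simps)

lemma fv_rot': "fv s (rot a x) = fv (s - a) x"
  by (simp add: fv_def rot_def cos_diff sin_diff algebra_simps)

lemma fu_plus_pi2: "fu (s + pi/2) x = fv s x" "fv (s + pi/2) x = - fu s x"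
  by (simp_all add: fu_def fv_def sin_add cos_add)

lemma norm_fu_fv: "norm x = sqrt ((fu s x)\<^sup>2 + (fv s x)\<^sup>2)"
proof -
  have "(fu s x)\<^sup>2 + (fv s x)\<^sup>2 = ((fst x)\<^sup>2 + (snd x)\<^sup>2) * (cos s * cos s + sin s * sin s)"
    unfolding fu_def fv_def by algebra
  then have "(fu s x)\<^sup>2 + (fv s x)\<^sup>2 = (fst x)\<^sup>2 + (snd x)\<^sup>2"
    by (simp only: trig_sq mult_1_right)
  then show ?thesis
    by (cases x) (simp add: norm_Pair)
qed

lemma norm_rot [simp]: "norm (rot s x) = norm x"
  using norm_fu_fv[of "rot s x" s] by (cases x) (simp add: norm_Pair)

lemma abs_fu_le: "\<bar>fu s x\<bar> \<le> norm x"
  unfolding norm_fu_fv[of x s] by (rule real_le_rsqrt) simp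

lemma abs_fv_le: "\<bar>fv s x\<bar> \<le> norm x"
  unfolding norm_fu_fv[of x s] by (rule real_le_rsqrt) simp

lemma norm_le_fu_fv: "norm x \<le> \<bar>fu s x\<bar> + \<bar>fv s x\<bar>"
  unfolding norm_fu_fv[of x s] by (metis sqrt_sum_squares_le_sum_abs)

lemma linear_fu: "linear (fu s)" and linear_fv: "linear (fv s)" and linear_rot: "linear (rot s)"
  by (auto intro!: linearI simp: fu_def fv_def rot_def algebra_simps)

lemmas fu_add = linear_add[OF linear_fu] and fu_diff = linear_diff[OF linear_fu]
  and fu_scaleR = linear_cmul[OF linear_fu]
lemmas fv_add = linear_add[OF linear_fv] and fv_diff = linear_diff[OF linear_fv]
  and fv_scaleR = linear_cmul[OF linear_fv]
lemmas rot_scaleR = linear_cmul[OF linear_rot] and rot_diff = linear_diff[OF linear_rot]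

lemma continuous_on_fu [continuous_intros]: "continuous_on A g \<Longrightarrow> continuous_on A (\<lambda>x. fu s (g x))"
  unfolding fu_def by (intro continuous_intros)

lemma continuous_on_fv [continuous_intros]: "continuous_on A g \<Longrightarrow> continuous_on A (\<lambda>x. fv s (g x))"
  unfolding fv_def by (intro continuous_intros)

lemma continuous_on_rot [continuous_intros]: "continuous_on A g \<Longrightarrow> continuous_on A (\<lambda>x. rot s (g x))"
  unfolding rot_def by (intro continuous_intros)

lemma measurable_frame [measurable]: "fu s \<in> borel_measurable borel" "fv s \<in> borel_measurable borel"
  "rot s \<in> borel_measurable borel"
  by (intro borel_measurable_continuous_onI continuous_intros)+

lemma open_rc: "open (rc s a b c d)"
  unfolding rc_def by (intro open_Collect_conj open_Collect_less continuous_intros)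

lemma rc_sets [measurable]: "rc s a b c d \<in> sets borel"
  using open_rc by auto

lemma rectangles_iff: "R \<in> rectangles s \<longleftrightarrow> (\<exists>a b c d. a < b \<and> c < d \<and> R = rc s a b c d)"
proof
  assume "R \<in> rectangles s"
  then obtain p a b where ab: "0 < a" "0 < b" and R: "R = {p + u *\<^sub>R (cos s, sin s) + v *\<^sub>R (- sin s, cos s) | u v.
            0 < u \<and> u < a \<and> 0 < v \<and> v < b}"
    unfolding rectangles_def by blast
  have "R = rc s (fu s p) (fu s p + a) (fv s p) (fv s p + b)"
  proof (intro set_eqI iffI)
    fix x assume "x \<in> R"
    then obtain u v where x: "x = p + u *\<^sub>R (cos s, sin s) + v *\<^sub>R (- sin s, cos s)" and uv: "0 < u" "u < a" "0 < v" "v < b"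
      unfolding R by blast
    have "x = p + rot s (u, v)" unfolding x by (simp add: rot_def)
    then show "x \<in> rc s (fu s p) (fu s p + a) (fv s p) (fv s p + b)"
      using uv by (simp add: rc_def fu_add fv_add)
  next
    fix x assume "x \<in> rc s (fu s p) (fu s p + a) (fv s p) (fv s p + b)"
    then have "0 < fu s (x - p)" "fu s (x - p) < a" "0 < fv s (x - p)" "fv s (x - p) < b"
      by (auto simp: rc_def fu_diff fv_diff)
    moreover have "x = p + rot s (fu s (x - p), fv s (x - p))" by simp
    then have "x = p + fu s (x-p) *\<^sub>R (cos s, sin s) + fv s (x-p) *\<^sub>R (- sin s, cos s)"
      unfolding rot_def by (cases x; cases p) auto
    ultimately show "x \<in> R" unfolding R by blast
  qed
  then show "\<exists>a b c d. a < b \<and> c < d \<and> R = rc s a b c d"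
    using ab by (intro exI conjI) auto
next
  assume "\<exists>a b c d. a < b \<and> c < d \<and> R = rc s a b c d"
  then obtain a b c d where ab: "a < b" "c < d" and R: "R = rc s a b c d" by blast
  let ?p = "rot s (a, c)"
  have "R = {?p + u *\<^sub>R (cos s, sin s) + v *\<^sub>R (- sin s, cos s) | u v.
            0 < u \<and> u < b - a \<and> 0 < v \<and> v < d - c}"
  proof (intro set_eqI iffI)
    fix x assume "x \<in> R"
    then have "0 < fu s x - a" "fu s x - a < b - a" "0 < fv s x - c" "fv s x - c < d - c"
      by (auto simp: R rc_def)
    moreover have "x = rot s (fu s x, fv s x)" by simp
    then have "x = ?p + (fu s x - a) *\<^sub>R (cos s, sin s) + (fv s x - c) *\<^sub>R (- sin s, cos s)"
      by (simp add: rot_def algebra_simps prod_eq_iff)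
    ultimately show "x \<in> {?p + u *\<^sub>R (cos s, sin s) + v *\<^sub>R (- sin s, cos s) | u v.
            0 < u \<and> u < b - a \<and> 0 < v \<and> v < d - c}" by blast
  next
    fix x assume "x \<in> {?p + u *\<^sub>R (cos s, sin s) + v *\<^sub>R (- sin s, cos s) | u v.
            0 < u \<and> u < b - a \<and> 0 < v \<and> v < d - c}"
    then obtain u v where x: "x = ?p + u *\<^sub>R (cos s, sin s) + v *\<^sub>R (- sin s, cos s)"
      and uv: "0 < u" "u < b - a" "0 < v" "v < d - c" by blast
    have "x = rot s (a + u, c + v)" unfolding x by (simp add: rot_def algebra_simps)
    then show "x \<in> R" using uv by (simp add: R rc_def)
  qed
  then show "R \<in> rectangles s" unfolding rectangles_def using ab by (intro CollectI exI[of _ ?p] exI[of _ "b-a"] exI[of _ "d-c"]) auto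
qed

text \<open>Shears are used twice: three of them make a rotation, and the shear with h y = y^2
  straightens the parabolic layers of \<open>prof\<close> into rectangles
  (\<open>emeasure_parabolic\<close>).\<close>

lemma nn_integral_shear_fst:
  fixes f :: "real \<times> real \<Rightarrow> ennreal" and h :: "real \<Rightarrow> real"
  assumes [measurable]: "f \<in> borel_measurable borel" "h \<in> borel_measurable borel"
  shows "(\<integral>\<^sup>+z. f (fst z + h (snd z), snd z) \<partial>lborel) = (\<integral>\<^sup>+z. f z \<partial>lborel)"
proof -
  have [measurable]: "f \<in> borel_measurable (borel \<Otimes>\<^sub>M borel)" by (simp add: borel_prod)
  have "(\<integral>\<^sup>+z. f (fst z + h (snd z), snd z) \<partial>lborel) = (\<integral>\<^sup>+z. f (fst z + h (snd z), snd z) \<partial>(lborel \<Otimes>\<^sub>M lborel))"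
    by (simp add: lborel_prod)
  also have "\<dots> = (\<integral>\<^sup>+y. \<integral>\<^sup>+x. f (x + h y, y) \<partial>lborel \<partial>lborel)"
    by (subst lborel_pair.nn_integral_snd[symmetric]) auto
  also have "\<dots> = (\<integral>\<^sup>+y. \<integral>\<^sup>+x. f (x, y) \<partial>lborel \<partial>lborel)"
  proof (rule nn_integral_cong)
    fix y
    show "(\<integral>\<^sup>+x. f (x + h y, y) \<partial>lborel) = (\<integral>\<^sup>+x. f (x, y) \<partial>lborel)"
      using nn_integral_real_affine[of "\<lambda>x. f (x, y)" 1 "h y"] by (simp add: add.commute)
  qed
  also have "\<dots> = (\<integral>\<^sup>+z. f z \<partial>(lborel \<Otimes>\<^sub>M lborel))"
    by (subst lborel_pair.nn_integral_snd[symmetric]) auto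
  finally show ?thesis by (simp add: lborel_prod)
qed

lemma nn_integral_shear_snd:
  fixes f :: "real \<times> real \<Rightarrow> ennreal" and h :: "real \<Rightarrow> real"
  assumes [measurable]: "f \<in> borel_measurable borel" "h \<in> borel_measurable borel"
  shows "(\<integral>\<^sup>+z. f (fst z, snd z + h (fst z)) \<partial>lborel) = (\<integral>\<^sup>+z. f z \<partial>lborel)"
proof -
  have [measurable]: "f \<in> borel_measurable (borel \<Otimes>\<^sub>M borel)" by (simp add: borel_prod)
  have "(\<integral>\<^sup>+z. f (fst z, snd z + h (fst z)) \<partial>lborel) = (\<integral>\<^sup>+z. f (fst z, snd z + h (fst z)) \<partial>(lborel \<Otimes>\<^sub>M lborel))"
    by (simp add: lborel_prod)
  also have "\<dots> = (\<integral>\<^sup>+x. \<integral>\<^sup>+y. f (x, y + h x) \<partial>lborel \<partial>lborel)"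
    by (subst lborel.nn_integral_fst[symmetric]) auto
  also have "\<dots> = (\<integral>\<^sup>+x. \<integral>\<^sup>+y. f (x, y) \<partial>lborel \<partial>lborel)"
  proof (rule nn_integral_cong)
    fix x
    show "(\<integral>\<^sup>+y. f (x, y + h x) \<partial>lborel) = (\<integral>\<^sup>+y. f (x, y) \<partial>lborel)"
      using nn_integral_real_affine[of "\<lambda>y. f (x, y)" 1 "h x"] by (simp add: add.commute)
  qed
  also have "\<dots> = (\<integral>\<^sup>+z. f z \<partial>(lborel \<Otimes>\<^sub>M lborel))"
    by (subst lborel.nn_integral_fst[symmetric]) auto
  finally show ?thesis by (simp add: lborel_prod)
qed

text \<open>A rotation by an angle \<open>s\<close> with \<open>cos (s/2) \<noteq> 0\<close> is a product of three shears.\<close>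

lemma nn_integral_rot:
  fixes f :: "real \<times> real \<Rightarrow> ennreal"
  assumes [measurable]: "f \<in> borel_measurable borel"
  shows "(\<integral>\<^sup>+z. f (rot s z) \<partial>lborel) = (\<integral>\<^sup>+z. f z \<partial>lborel)"
proof -
  have *: "(\<integral>\<^sup>+z. f (rot s z) \<partial>lborel) = (\<integral>\<^sup>+z. f z \<partial>lborel)" 
    if [measurable]: "f \<in> borel_measurable borel" and c: "cos (s/2) \<noteq> 0" for f :: "real \<times> real \<Rightarrow> ennreal" and s
  proof -
    let ?t = "tan (s/2)"
    have sn: "sin s = 2 * sin (s/2) * cos (s/2)" using sin_double[of "s/2"] by simp
    have cs: "cos s = (cos (s/2))\<^sup>2 - (sin (s/2))\<^sup>2" using cos_double[of "s/2"] by simp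
    have e: "(sin (s/2))\<^sup>2 + (cos (s/2))\<^sup>2 = 1" by (rule sin_cos_squared_add)
    have t1: "?t * sin s = 1 - cos s"
      using c unfolding sn cs tan_def
      by (simp add: divide_simps) (use e in algebra)
    have t2: "?t * (1 + cos s) = sin s"
      using c unfolding sn cs tan_def
      by (simp add: divide_simps) (use e in algebra)
    let ?g = "\<lambda>z. f (fst z - ?t * snd z, snd z)"
    let ?h = "\<lambda>z. ?g (fst z, snd z + sin s * fst z)"
    let ?k = "\<lambda>z. ?h (fst z - ?t * snd z, snd z)"
    have t1': "sin s * ?t = 1 - cos s" using t1 by (simp add: mult.commute)
    have t2': "?t + ?t * cos s = sin s" using t2 by (simp add: algebra_simps)
    have m: "(\<lambda>z::real \<times> real. (fst z - ?t * snd z, snd z)) \<in> borel_measurable borel"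
      "(\<lambda>z::real \<times> real. (fst z, snd z + sin s * fst z)) \<in> borel_measurable borel"
      by (intro borel_measurable_continuous_onI continuous_intros)+
    have g: "?g \<in> borel_measurable borel"
      by (rule measurable_compose[OF m(1)]) simp
    have h: "?h \<in> borel_measurable borel"
      using measurable_compose[OF m(2) g] by simp
    have kk: "?k z = f (rot s z)" for z
    proof -
      obtain x y where z: "z = (x, y)" by (cases z)
      have 1: "y + sin s * (x - ?t * y) = x * sin s + y * cos s"
        using t1' by (simp add: algebra_simps) algebra
      have 2: "x - ?t * y - ?t * (x * sin s + y * cos s) = x * cos s - y * sin s"
        using t1' t2' by (simp add: algebra_simps) algebra
      show ?thesis by (simp add: z 1 2 rot_def)
    qed
    have "(\<integral>\<^sup>+z. f z \<partial>lborel) = (\<integral>\<^sup>+z. ?g z \<partial>lborel)"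
      using nn_integral_shear_fst[of f "\<lambda>y. - ?t * y"] by simp
    also have "\<dots> = (\<integral>\<^sup>+z. ?h z \<partial>lborel)"
      using nn_integral_shear_snd[of ?g "\<lambda>x. sin s * x"] g by simp
    also have "\<dots> = (\<integral>\<^sup>+z. ?k z \<partial>lborel)"
      using nn_integral_shear_fst[of ?h "\<lambda>y. - ?t * y"] h by simp
    finally show ?thesis using kk by simp
  qed
  show ?thesis
  proof (cases "cos (s/2) = 0")
    case False
    then show ?thesis using * assms by blast
  next
    case True
    \<comment> \<open>The excluded angles are reached by rotating twice by s/2, because cos (s/2) =
      2 * cos (s/4)^2 - 1 cannot vanish together with cos (s/4).\<close>
    then have "cos (s/2/2) \<noteq> 0"
      using cos_double_cos[of "s/2/2"] by auto
    then have "(\<integral>\<^sup>+z. f (rot (s/2) (rot (s/2) z)) \<partial>lborel) = (\<integral>\<^sup>+z. f z \<partial>lborel)"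
      using *[of "\<lambda>z. f (rot (s/2) z)" "s/2"] *[of f "s/2"] by simp
    then show ?thesis by (simp add: rot_add)
  qed
qed

lemma distr_rot: "distr lborel borel (rot s) = lborel"
proof (rule measure_eqI)
  fix A assume "A \<in> sets (distr lborel borel (rot s))"
  then have A[measurable]: "A \<in> sets borel" by simp
  have "emeasure (distr lborel borel (rot s)) A = (\<integral>\<^sup>+z. indicator A (rot s z) \<partial>lborel)"
    by (subst nn_integral_distr[of "rot s" lborel borel "indicator A", symmetric]) auto
  also have "\<dots> = emeasure lborel A"
    by (subst nn_integral_rot) auto
  finally show "emeasure (distr lborel borel (rot s)) A = emeasure lborel A" .
qed simp

lemma integral_rot:
  fixes f :: "real \<times> real \<Rightarrow> real"
  assumes [measurable]: "f \<in> borel_measurable borel"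
  shows "(\<integral>z. f (rot s z) \<partial>lborel) = (\<integral>z. f z \<partial>lborel)"
  by (subst (2) distr_rot[of s, symmetric]) (simp add: integral_distr)

lemma emeasure_rot:
  assumes [measurable]: "A \<in> sets borel"
  shows "emeasure lborel {x. rot s x \<in> A} = emeasure lborel A"
  by (subst (2) distr_rot[of s, symmetric]) (simp add: emeasure_distr vimage_def)

lemma emeasure_rc:
  assumes "a \<le> b" "c \<le> d"
  shows "emeasure lborel (rc s a b c d) = ennreal ((b - a) * (d - c))"
proof -
  have "emeasure lborel (rc s a b c d) = emeasure lborel {x. rot s x \<in> rc s a b c d}"
    by (subst emeasure_rot) auto
  also have "{x. rot s x \<in> rc s a b c d} = {a<..<b} \<times> {c<..<d}"
    by (auto simp: rc_def)
  also have "emeasure lborel ({a<..<b} \<times> {c<..<d}) = emeasure (lborel \<Otimes>\<^sub>M lborel) ({a<..<b} \<times> {c<..<d})"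
    by (simp add: lborel_prod)
  also have "\<dots> = ennreal ((b - a) * (d - c))"
    by (subst lborel.emeasure_pair_measure_Times) (use assms in \<open>auto simp: ennreal_mult\<close>)
  finally show ?thesis .
qed

lemma measure_rc: "a \<le> b \<Longrightarrow> c \<le> d \<Longrightarrow> measure lborel (rc s a b c d) = (b - a) * (d - c)"
  by (simp add: measure_def emeasure_rc)

lemma bounded_rc: "bounded (rc s a b c d)"
proof (rule boundedI)
  fix x assume "x \<in> rc s a b c d"
  then have "a < fu s x" "fu s x < b" "c < fv s x" "fv s x < d" by (auto simp: rc_def)
  then show "norm x \<le> \<bar>a\<bar> + \<bar>b\<bar> + \<bar>c\<bar> + \<bar>d\<bar>"
    using norm_le_fu_fv[of x s] by linarith
qed

lemma dist_rc_le:
  assumes "x \<in> rc s a b c d" "y \<in> rc s a b c d"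
  shows "dist x y \<le> (b - a) + (d - c)"
proof -
  have "dist x y = norm (x - y)" by (simp add: dist_norm)
  also have "\<dots> \<le> \<bar>fu s (x - y)\<bar> + \<bar>fv s (x - y)\<bar>" by (rule norm_le_fu_fv)
  also have "\<dots> \<le> (b - a) + (d - c)" using assms by (auto simp: rc_def fu_diff fv_diff)
  finally show ?thesis .
qed

lemma diameter_rc_le:
  assumes "a \<le> b" "c \<le> d"
  shows "diameter (rc s a b c d) \<le> (b - a) + (d - c)"
  by (rule diameter_le) (use assms dist_rc_le in \<open>auto simp: dist_norm\<close>)

text \<open>The rectangle is open, so its side is only a supremum of distances. Two points inset by
  e/2 give the bound up to e, and e is arbitrary.\<close>

lemma side_le_diameter:
  assumes "a < b" "c < d"
  shows "b - a \<le> diameter (rc s a b c d)" "d - c \<le> diameter (rc s a b c d)"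
proof -
  have mem: "rot s (u, v) \<in> rc s a b c d" if "a < u" "u < b" "c < v" "v < d" for u v
    using that by (auto simp: rc_def)
  have *: "dist (rot s z) (rot s w) = dist z w" for z w
    by (simp add: dist_norm flip: rot_diff)
  have 1: "b - a - e \<le> diameter (rc s a b c d)" if "e > 0" "e < b - a" for e
  proof -
    have "dist (rot s (a + e/2, (c+d)/2)) (rot s (b - e/2, (c+d)/2)) \<le> diameter (rc s a b c d)"
      by (intro diameter_bounded_bound bounded_rc mem) (use that assms in auto)
    moreover have "dist (rot s (a + e/2, (c+d)/2)) (rot s (b - e/2, (c+d)/2)) = b - a - e"
      using that by (simp add: * dist_Pair_Pair dist_real_def)
    ultimately show ?thesis by simp
  qed
  have 2: "d - c - e \<le> diameter (rc s a b c d)" if "e > 0" "e < d - c" for e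
  proof -
    have "dist (rot s ((a+b)/2, c + e/2)) (rot s ((a+b)/2, d - e/2)) \<le> diameter (rc s a b c d)"
      by (intro diameter_bounded_bound bounded_rc mem) (use that assms in auto)
    moreover have "dist (rot s ((a+b)/2, c + e/2)) (rot s ((a+b)/2, d - e/2)) = d - c - e"
      using that by (simp add: * dist_Pair_Pair dist_real_def)
    ultimately show ?thesis by simp
  qed
  show "b - a \<le> diameter (rc s a b c d)"
  proof (rule field_le_epsilon)
    fix e :: real assume "0 < e"
    then show "b - a \<le> diameter (rc s a b c d) + e"
      using 1[of "min e ((b-a)/2)"] assms by (cases "e \<le> (b-a)/2") (auto simp: min_def field_simps)
  qed
  show "d - c \<le> diameter (rc s a b c d)"
  proof (rule field_le_epsilon)
    fix e :: real assume "0 < e"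
    then show "d - c \<le> diameter (rc s a b c d) + e"
      using 2[of "min e ((d-c)/2)"] assms by (cases "e \<le> (d-c)/2") (auto simp: min_def field_simps)
  qed
qed

text \<open>A right angle exchanges the two sides, so that later estimates may take the side along
  \<open>fu\<close> to be the longer one.\<close>

lemma rc_plus_pi2: "rc (s + pi/2) a b c d = rc s (- d) (- c) a b"
  by (auto simp: rc_def fu_plus_pi2)

section \<open>Integrals and means over rectangles\<close>

lemma mean_eq:
  assumes "f \<in> borel_measurable borel"
  shows "mean f (rc s a b c d) = (\<integral>x. indicator (rc s a b c d) x * f x \<partial>lborel) / measure lborel (rc s a b c d)"
  unfolding mean_def set_lebesgue_integral_def
  using assms by (simp add: integral_completion measure_completion)

lemma nn_integral_rc:
  assumes [measurable]: "f \<in> borel_measurable borel"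
  shows "(\<integral>\<^sup>+x. indicator (rc s a b c d) x * f x \<partial>lborel) =
    (\<integral>\<^sup>+v. indicator {c<..<d} v * (\<integral>\<^sup>+u. indicator {a<..<b} u * f (rot s (u, v)) \<partial>lborel) \<partial>lborel)"
proof -
  have [measurable]: "f \<in> borel_measurable (borel \<Otimes>\<^sub>M borel)" by (simp add: borel_prod)
  have [measurable]: "rot s \<in> borel_measurable (borel \<Otimes>\<^sub>M borel)" by (simp add: borel_prod)
  have "(\<integral>\<^sup>+x. indicator (rc s a b c d) x * f x \<partial>lborel) = (\<integral>\<^sup>+x. indicator (rc s a b c d) (rot s x) * f (rot s x) \<partial>lborel)"
    by (rule nn_integral_rot[symmetric]) simp
  also have "\<dots> = (\<integral>\<^sup>+z. indicator {a<..<b} (fst z) * indicator {c<..<d} (snd z) * f (rot s z) \<partial>lborel)"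
    by (rule nn_integral_cong) (auto simp: rc_def indicator_def)
  also have "\<dots> = (\<integral>\<^sup>+z. indicator {a<..<b} (fst z) * indicator {c<..<d} (snd z) * f (rot s z) \<partial>(lborel \<Otimes>\<^sub>M lborel))"
    by (simp add: lborel_prod)
  also have "\<dots> = (\<integral>\<^sup>+v. \<integral>\<^sup>+u. indicator {a<..<b} u * indicator {c<..<d} v * f (rot s (u, v)) \<partial>lborel \<partial>lborel)"
    by (subst lborel_pair.nn_integral_snd[symmetric]) auto
  also have "\<dots> = (\<integral>\<^sup>+v. \<integral>\<^sup>+u. indicator {c<..<d} v * (indicator {a<..<b} u * f (rot s (u, v))) \<partial>lborel \<partial>lborel)"
    by (simp add: ac_simps)
  also have "\<dots> = (\<integral>\<^sup>+v. indicator {c<..<d} v * (\<integral>\<^sup>+u. indicator {a<..<b} u * f (rot s (u, v)) \<partial>lborel) \<partial>lborel)"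
    by (intro nn_integral_cong nn_integral_cmult) auto
  finally show ?thesis .
qed

lemma abs_integral_le_nn:
  fixes f :: "'a \<Rightarrow> real"
  assumes [measurable]: "f \<in> borel_measurable M" and "(\<integral>\<^sup>+x. ennreal \<bar>f x\<bar> \<partial>M) \<le> ennreal k" "k \<ge> 0"
  shows "\<bar>integral\<^sup>L M f\<bar> \<le> k"
proof (cases "integrable M f")
  case True
  then have "ennreal \<bar>integral\<^sup>L M f\<bar> \<le> (\<integral>\<^sup>+x. ennreal \<bar>f x\<bar> \<partial>M)"
    using integral_norm_bound_ennreal[of M f] by simp
  also have "\<dots> \<le> ennreal k" by fact
  finally show ?thesis using assms by simp
\<comment> \<open>A function that is not integrable has integral 0 by convention.\<close>
qed (use assms in \<open>simp add: not_integrable_integral_eq\<close>)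

lemma abs_integral_rc_le_lines:
  assumes [measurable]: "f \<in> borel_measurable borel" and cd: "c \<le> d" and k: "0 \<le> k"
    and lines: "\<And>v. c < v \<Longrightarrow> v < d \<Longrightarrow> (\<integral>\<^sup>+u. indicator {a<..<b} u * ennreal \<bar>f (rot s (u, v))\<bar> \<partial>lborel) \<le> ennreal k"
  shows "\<bar>\<integral>x. indicator (rc s a b c d) x * f x \<partial>lborel\<bar> \<le> k * (d - c)"
proof (rule abs_integral_le_nn)
  have "(\<integral>\<^sup>+x. ennreal \<bar>indicator (rc s a b c d) x * f x\<bar> \<partial>lborel) = (\<integral>\<^sup>+x. indicator (rc s a b c d) x * ennreal \<bar>f x\<bar> \<partial>lborel)"
    by (rule nn_integral_cong) (auto simp: indicator_def)
  also have "\<dots> = (\<integral>\<^sup>+v. indicator {c<..<d} v * (\<integral>\<^sup>+u. indicator {a<..<b} u * ennreal \<bar>f (rot s (u, v))\<bar> \<partial>lborel) \<partial>lborel)"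
    by (rule nn_integral_rc) simp
  also have "\<dots> \<le> (\<integral>\<^sup>+v. ennreal k * indicator {c<..<d} v \<partial>lborel)"
    by (rule nn_integral_mono) (use lines in \<open>auto simp: indicator_def\<close>)
  also have "\<dots> = ennreal (k * (d - c))"
    using cd k by (subst nn_integral_cmult_indicator) (auto simp: ennreal_mult)
  finally show "(\<integral>\<^sup>+x. ennreal \<bar>indicator (rc s a b c d) x * f x\<bar> \<partial>lborel) \<le> ennreal (k * (d - c))" .
qed (use k cd in auto)

text \<open>Fubini along \<open>fu\<close>: when the integral over the rectangle is divided by its
  area, the width d - c cancels. The bound thus depends on the length b - a only, however thin the
  rectangle is.\<close>

lemma abs_mean_le_lines:
  assumes "f \<in> borel_measurable borel" "a < b" "c < d" "0 \<le> k"
    and "\<And>v. c < v \<Longrightarrow> v < d \<Longrightarrow> (\<integral>\<^sup>+u. indicator {a<..<b} u * ennreal \<bar>f (rot s (u, v))\<bar> \<partial>lborel) \<le> ennreal k"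
  shows "\<bar>mean f (rc s a b c d)\<bar> \<le> k / (b - a)"
proof -
  have "\<bar>\<integral>x. indicator (rc s a b c d) x * f x \<partial>lborel\<bar> \<le> k * (d - c)"
    by (rule abs_integral_rc_le_lines) (use assms in auto)
  then have "\<bar>\<integral>x. indicator (rc s a b c d) x * f x \<partial>lborel\<bar> / ((b - a) * (d - c)) \<le> k * (d - c) / ((b - a) * (d - c))"
    using assms by (intro divide_right_mono) auto
  then show ?thesis
    using assms by (simp add: mean_eq measure_rc)
qed

lemma integral_scale:
  fixes f :: "real \<times> real \<Rightarrow> real"
  assumes [measurable]: "f \<in> borel_measurable borel" and "0 < d"
  shows "(\<integral>x. f (x /\<^sub>R d) \<partial>lborel) = d\<^sup>2 * (\<integral>x. f x \<partial>lborel)"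
proof -
  have "(\<integral>x. f (x /\<^sub>R d) \<partial>lborel) = (\<integral>x. f (x /\<^sub>R d) \<partial>(density (distr lborel borel (\<lambda>x. 0 + d *\<^sub>R x)) (\<lambda>_. \<bar>d\<bar>^DIM(real \<times> real))))"
    using assms by (subst lborel_affine[of d 0]) auto
  also have "\<dots> = (\<integral>x. d\<^sup>2 * f x \<partial>lborel)"
    using assms by (simp add: integral_density integral_distr) (simp add: power2_eq_square mult.assoc)
  finally show ?thesis by simp
qed

lemma nn_integral_scale:
  fixes f :: "real \<times> real \<Rightarrow> ennreal"
  assumes [measurable]: "f \<in> borel_measurable borel" and "0 < d"
  shows "(\<integral>\<^sup>+x. f (x /\<^sub>R d) \<partial>lborel) = ennreal (d\<^sup>2) * (\<integral>\<^sup>+x. f x \<partial>lborel)"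
proof -
  have "(\<integral>\<^sup>+x. f (x /\<^sub>R d) \<partial>lborel) = (\<integral>\<^sup>+x. f (x /\<^sub>R d) \<partial>(density (distr lborel borel (\<lambda>x. 0 + d *\<^sub>R x)) (\<lambda>_. \<bar>d\<bar>^DIM(real \<times> real))))"
    using assms by (subst lborel_affine[of d 0]) auto
  also have "\<dots> = (\<integral>\<^sup>+x. ennreal (d\<^sup>2) * f x \<partial>lborel)"
    using assms by (simp add: nn_integral_density nn_integral_distr power2_eq_square ennreal_mult mult.assoc)
  also have "\<dots> = ennreal (d\<^sup>2) * (\<integral>\<^sup>+x. f x \<partial>lborel)"
    by (rule nn_integral_cmult) simp
  finally show ?thesis by simp
qed

lemma emeasure_scale:
  assumes [measurable]: "A \<in> sets borel" and "0 < d"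
  shows "emeasure lborel {x :: real \<times> real. x /\<^sub>R d \<in> A} = ennreal (d\<^sup>2) * emeasure lborel A"
proof -
  have "emeasure lborel {x :: real \<times> real. x /\<^sub>R d \<in> A} = (\<integral>\<^sup>+x. indicator A (x /\<^sub>R d) \<partial>lborel)"
  proof -
    have "{x :: real \<times> real. x /\<^sub>R d \<in> A} \<in> sets lborel" by measurable
    then have "emeasure lborel {x :: real \<times> real. x /\<^sub>R d \<in> A} = (\<integral>\<^sup>+x. indicator {x :: real \<times> real. x /\<^sub>R d \<in> A} x \<partial>lborel)"
      by (rule nn_integral_indicator[symmetric])
    also have "\<dots> = (\<integral>\<^sup>+x. indicator A (x /\<^sub>R d) \<partial>lborel)"
      by (rule nn_integral_cong) (auto split: split_indicator)
    finally show ?thesis .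
  qed
  then show ?thesis using assms by (simp add: nn_integral_scale)
qed

lemma mean_scale:
  assumes [measurable]: "f \<in> borel_measurable borel" and "0 < r" "a < b" "c < d"
  shows "mean (\<lambda>x. f (x /\<^sub>R r)) (rc s a b c d) = mean f (rc s (a/r) (b/r) (c/r) (d/r))"
proof -
  have *: "indicator (rc s a b c d) x = (indicator (rc s (a/r) (b/r) (c/r) (d/r)) (x /\<^sub>R r) :: real)" for x
    using assms(2) by (auto simp: rc_def indicator_def fu_scaleR fv_scaleR field_simps)
  have "(\<integral>x. indicator (rc s a b c d) x * f (x /\<^sub>R r) \<partial>lborel) = r\<^sup>2 * (\<integral>x. indicator (rc s (a/r) (b/r) (c/r) (d/r)) x * f x \<partial>lborel)"
    unfolding * using integral_scale[of "\<lambda>x. indicator (rc s (a/r) (b/r) (c/r) (d/r)) x * f x" r] assms by simp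
  then show ?thesis
    using assms by (simp add: mean_eq measure_rc divide_right_mono) (simp add: field_simps power2_eq_square)
qed

lemma mean_rot:
  assumes [measurable]: "f \<in> borel_measurable borel" and "a < b" "c < d"
  shows "mean (\<lambda>x. f (rot t x)) (rc s a b c d) = mean f (rc (s + t) a b c d)"
proof -
  have *: "indicator (rc s a b c d) x = (indicator (rc (s + t) a b c d) (rot t x) :: real)" for x
    by (auto simp: rc_def indicator_def fu_rot' fv_rot')
  have "(\<integral>x. indicator (rc s a b c d) x * f (rot t x) \<partial>lborel) = (\<integral>x. indicator (rc (s + t) a b c d) x * f x \<partial>lborel)"
    unfolding * using integral_rot[of "\<lambda>x. indicator (rc (s + t) a b c d) x * f x" t] by simp
  then show ?thesis
    using assms by (simp add: mean_eq measure_rc)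
qed

lemma integrable_rc:
  fixes f :: "real \<times> real \<Rightarrow> real"
  assumes [measurable]: "f \<in> borel_measurable borel" and "\<And>x. x \<in> rc s a b c d \<Longrightarrow> \<bar>f x\<bar> \<le> B"
    and "a \<le> b" "c \<le> d"
  shows "integrable lborel (\<lambda>x. indicator (rc s a b c d) x * f x)"
proof (rule integrableI_bounded_set[where A = "rc s a b c d" and B = B])
  show "AE x in lborel. x \<in> rc s a b c d \<longrightarrow> norm (indicator (rc s a b c d) x * f x) \<le> B"
    using assms(2) by auto
qed (use assms in \<open>auto simp: emeasure_rc\<close>)

lemma abs_mean_le:
  assumes [measurable]: "f \<in> borel_measurable borel" and "\<And>x. x \<in> rc s a b c d \<Longrightarrow> \<bar>f x\<bar> \<le> B" 
    and "a < b" "c < d" "0 \<le> B"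
  shows "\<bar>mean f (rc s a b c d)\<bar> \<le> B"
proof -
  have "\<bar>\<integral>x. indicator (rc s a b c d) x * f x \<partial>lborel\<bar> \<le> B * measure lborel (rc s a b c d)"
  proof (rule abs_integral_le_nn)
    have "(\<integral>\<^sup>+x. ennreal \<bar>indicator (rc s a b c d) x * f x\<bar> \<partial>lborel) \<le> (\<integral>\<^sup>+x. ennreal B * indicator (rc s a b c d) x \<partial>lborel)"
      by (rule nn_integral_mono) (use assms(2) in \<open>auto simp: indicator_def intro!: ennreal_leI\<close>)
    also have "\<dots> = ennreal (B * measure lborel (rc s a b c d))"
      using assms by (simp add: nn_integral_cmult_indicator emeasure_rc measure_rc ennreal_mult)
    finally show "(\<integral>\<^sup>+x. ennreal \<bar>indicator (rc s a b c d) x * f x\<bar> \<partial>lborel) \<le> ennreal (B * measure lborel (rc s a b c d))" .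
  qed (use assms in auto)
  moreover have "0 < measure lborel (rc s a b c d)" using assms by (simp add: measure_rc)
  ultimately show ?thesis
    by (simp add: mean_eq abs_divide field_simps)
qed

lemma mean_cong:
  assumes "\<And>x. x \<in> R \<Longrightarrow> f x = g x"
  shows "mean f R = mean g R"
  unfolding mean_def set_lebesgue_integral_def using assms
  by (metis (no_types, lifting) indicator_simps(2) scale_zero_left)

lemma mean_0 [simp]: "mean (\<lambda>x. 0) R = 0"
  by (simp add: mean_def)

lemma mean_const:
  assumes "\<And>x. x \<in> rc s a b c d \<Longrightarrow> f x = k" "a < b" "c < d"
  shows "mean f (rc s a b c d) = k"
proof -
  have "mean f (rc s a b c d) = mean (\<lambda>x. k) (rc s a b c d)"
    using assms by (intro mean_cong) auto
  also have "\<dots> = k"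
    using assms by (simp add: mean_eq measure_rc emeasure_rc)
  finally show ?thesis .
qed

lemma mean_sum:
  assumes "finite I" "\<And>i. i \<in> I \<Longrightarrow> f i \<in> borel_measurable borel" "\<And>i x. i \<in> I \<Longrightarrow> x \<in> rc s a b c d \<Longrightarrow> \<bar>f i x\<bar> \<le> B i"
    and ab: "a < b" "c < d"
  shows "mean (\<lambda>x. \<Sum>i\<in>I. f i x) (rc s a b c d) = (\<Sum>i\<in>I. mean (f i) (rc s a b c d))"
proof -
  have "(\<integral>x. indicator (rc s a b c d) x * (\<Sum>i\<in>I. f i x) \<partial>lborel) = (\<Sum>i\<in>I. \<integral>x. indicator (rc s a b c d) x * f i x \<partial>lborel)"
    unfolding sum_distrib_left
    by (rule Bochner_Integration.integral_sum) (use assms in \<open>auto intro!: integrable_rc[where B = "B _"]\<close>)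
  then show ?thesis
    using assms by (simp add: mean_eq sum_divide_distrib borel_measurable_sum)
qed

section \<open>The two-layer profile along a parabolic arc\<close>

text \<open>The positive layer lies on the convex side, where fst z < - (snd z)^2. A half plane
  bounded by a tangent therefore contains all of it and misses a piece of the negative
  layer.\<close>

definition prof :: "real \<Rightarrow> real \<Rightarrow> real \<times> real \<Rightarrow> real" where
  "prof w T z = (if \<bar>snd z\<bar> < T then
     (if - w < fst z + (snd z)\<^sup>2 \<and> fst z + (snd z)\<^sup>2 < 0 then 1
      else if 0 < fst z + (snd z)\<^sup>2 \<and> fst z + (snd z)\<^sup>2 < w then - 1 else 0) else 0)"

lemma prof_measurable [measurable]: "prof w T \<in> borel_measurable borel"
  unfolding prof_def by (simp flip: borel_prod)

lemma abs_prof_le: "\<bar>prof w T z\<bar> \<le> 1"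
  by (simp add: prof_def)

lemma prof_nonzeroD:
  assumes "prof w T z \<noteq> 0"
  shows "\<bar>snd z\<bar> < T" "\<bar>fst z + (snd z)\<^sup>2\<bar> < w"
  using assms by (auto simp: prof_def split: if_splits)

lemma prof_support:
  assumes "prof w T z \<noteq> 0" "T \<le> 1/4" "w \<le> 1/4"
  shows "\<bar>fst z\<bar> < 1/2" "\<bar>snd z\<bar> < 1/2"
proof -
  have y: "\<bar>snd z\<bar> < 1/4" and x: "\<bar>fst z + (snd z)\<^sup>2\<bar> < 1/4"
    using prof_nonzeroD[OF assms(1)] assms(2,3) by auto
  have "(snd z)\<^sup>2 \<le> (1/4)\<^sup>2" using y by (intro power2_le_iff_abs_le[THEN iffD2]) auto
  then have "(snd z)\<^sup>2 \<le> 1/16" by (simp add: power2_eq_square)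
  moreover have "0 \<le> (snd z)\<^sup>2" by simp
  ultimately show "\<bar>fst z\<bar> < 1/2" "\<bar>snd z\<bar> < 1/2" using x y by linarith+
qed

lemma emeasure_shear:
  fixes h :: "real \<Rightarrow> real"
  assumes [measurable]: "A \<in> sets borel" "h \<in> borel_measurable borel"
  shows "emeasure lborel {z. (fst z + h (snd z), snd z) \<in> A} = emeasure lborel A"
proof -
  have "(\<lambda>z::real \<times> real. (fst z + h (snd z), snd z)) \<in> borel_measurable (borel \<Otimes>\<^sub>M borel)"
    by simp
  then have [measurable]: "(\<lambda>z::real \<times> real. (fst z + h (snd z), snd z)) \<in> borel_measurable borel"
    by (simp add: borel_prod)
  have "{z. (fst z + h (snd z), snd z) \<in> A} \<in> sets lborel" by measurable
  then have "emeasure lborel {z. (fst z + h (snd z), snd z) \<in> A} = (\<integral>\<^sup>+z. indicator {z. (fst z + h (snd z), snd z) \<in> A} z \<partial>lborel)"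
    by (rule nn_integral_indicator[symmetric])
  also have "\<dots> = (\<integral>\<^sup>+z. indicator A (fst z + h (snd z), snd z) \<partial>lborel)"
    by (rule nn_integral_cong) (auto split: split_indicator)
  also have "\<dots> = emeasure lborel A"
    by (subst nn_integral_shear_fst) auto
  finally show ?thesis .
qed

lemma emeasure_lborel_Times:
  assumes "A \<in> sets borel" "B \<in> sets borel"
  shows "emeasure lborel (A \<times> B :: (real \<times> real) set) = emeasure lborel A * emeasure lborel B"
proof -
  have "emeasure lborel (A \<times> B) = emeasure (lborel \<Otimes>\<^sub>M lborel) (A \<times> B)"
    by (simp add: lborel_prod)
  then show ?thesis using assms by (simp add: lborel.emeasure_pair_measure_Times)
qed

lemma Times_sets [measurable (raw)]:
  "A \<in> sets borel \<Longrightarrow> B \<in> sets borel \<Longrightarrow> (A \<times> B :: (real \<times> real) set) \<in> sets borel"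
  by (metis borel_prod pair_measureI)

lemma emeasure_parabolic:
  assumes "a \<le> b" "c \<le> d"
  shows "emeasure lborel {z. a < fst z + (snd z)\<^sup>2 \<and> fst z + (snd z)\<^sup>2 < b \<and> c < snd z \<and> snd z < d} = ennreal ((b - a) * (d - c))"
proof -
  have "{z. a < fst z + (snd z)\<^sup>2 \<and> fst z + (snd z)\<^sup>2 < b \<and> c < snd z \<and> snd z < d}
    = {z. (fst z + (snd z)\<^sup>2, snd z) \<in> {a<..<b} \<times> {c<..<d}}" by auto
  then show ?thesis
    using emeasure_shear[of "{a<..<b} \<times> {c<..<d}" "\<lambda>y. y\<^sup>2"] assms
    by (simp add: emeasure_lborel_Times ennreal_mult Times_sets)
qed

lemma parabolic_sets [measurable]:
  "{z :: real \<times> real. a < fst z + (snd z)\<^sup>2 \<and> fst z + (snd z)\<^sup>2 < b \<and> c < snd z \<and> snd z < d} \<in> sets borel"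
  by (intro borel_open open_Collect_conj open_Collect_less continuous_intros)

lemma prof_eq_indicators:
  "prof w T z = indicator {z. - w < fst z + (snd z)\<^sup>2 \<and> fst z + (snd z)\<^sup>2 < 0 \<and> - T < snd z \<and> snd z < T} z
     - indicator {z. 0 < fst z + (snd z)\<^sup>2 \<and> fst z + (snd z)\<^sup>2 < w \<and> - T < snd z \<and> snd z < T} z"
  by (auto simp: prof_def indicator_def)

lemma
  assumes "0 < w" "0 < T"
  shows integrable_prof: "integrable lborel (prof w T)" 
    and integral_prof: "(\<integral>z. prof w T z \<partial>lborel) = 0"
    and nn_integral_prof: "(\<integral>\<^sup>+z. ennreal \<bar>prof w T z\<bar> \<partial>lborel) = ennreal (4 * w * T)"
proof -
  let ?A = "{z. - w < fst z + (snd z)\<^sup>2 \<and> fst z + (snd z)\<^sup>2 < 0 \<and> - T < snd z \<and> snd z < T}"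
  let ?B = "{z. 0 < fst z + (snd z)\<^sup>2 \<and> fst z + (snd z)\<^sup>2 < w \<and> - T < snd z \<and> snd z < T}"
  have A: "emeasure lborel ?A = ennreal (w * (2 * T))"
    using emeasure_parabolic[of "-w" 0 "-T" T] assms by simp
  have B: "emeasure lborel ?B = ennreal (w * (2 * T))"
    using emeasure_parabolic[of 0 w "-T" T] assms by simp
  have i: "integrable lborel (indicator ?A :: _ \<Rightarrow> real)" "integrable lborel (indicator ?B :: _ \<Rightarrow> real)"
    by (rule integrable_real_indicator; simp add: A B)+
  show "integrable lborel (prof w T)"
    unfolding prof_eq_indicators[abs_def] using i by (rule Bochner_Integration.integrable_diff)
  show "(\<integral>z. prof w T z \<partial>lborel) = 0"
    unfolding prof_eq_indicators[abs_def] using i by (subst Bochner_Integration.integral_diff) (auto simp: measure_def A B)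
  have "(\<integral>\<^sup>+z. ennreal \<bar>prof w T z\<bar> \<partial>lborel) = (\<integral>\<^sup>+z. indicator ?A z + indicator ?B z \<partial>lborel)"
    by (rule nn_integral_cong) (auto simp: prof_eq_indicators indicator_def)
  also have "\<dots> = emeasure lborel ?A + emeasure lborel ?B"
    by (subst nn_integral_add) auto
  also have "\<dots> = ennreal (4 * w * T)"
    using assms by (simp add: A B flip: ennreal_plus)
  finally show "(\<integral>\<^sup>+z. ennreal \<bar>prof w T z\<bar> \<partial>lborel) = ennreal (4 * w * T)" .
qed

text \<open>The support need not be an interval, but it lies in \<open>{a - r..a + r}\<close> for
  any of its points a; this costs a factor 2.\<close>

lemma nn_integral_le_diam:
  fixes f :: "real \<Rightarrow> ennreal"
  assumes "\<And>x. f x \<le> ennreal B" "0 \<le> B" "0 \<le> r" "\<And>x y. f x \<noteq> 0 \<Longrightarrow> f y \<noteq> 0 \<Longrightarrow> \<bar>x - y\<bar> \<le> r"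
  shows "(\<integral>\<^sup>+x. f x \<partial>lborel) \<le> ennreal (B * (2 * r))"
proof (cases "\<exists>x. f x \<noteq> 0")
  case True
  then obtain a where a: "f a \<noteq> 0" by blast
  have "(\<integral>\<^sup>+x. f x \<partial>lborel) \<le> (\<integral>\<^sup>+x. ennreal B * indicator {a - r..a + r} x \<partial>lborel)"
  proof (rule nn_integral_mono)
    fix x
    show "f x \<le> ennreal B * indicator {a - r..a + r} x"
      using assms(1)[of x] assms(4)[OF _ a, of x] by (cases "f x = 0") (auto simp: indicator_def abs_le_iff)
  qed
  also have "\<dots> = ennreal (B * (2 * r))"
    using assms by (simp add: nn_integral_cmult_indicator ennreal_mult)
  finally show ?thesis .
qed simp

text \<open>For |snd z| < e/4 the tangents of the arc are close to the vertical. A rectangle has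
  sides in both directions s and s + pi/2, so transversality means that s stays away from every
  multiple of pi/2.\<close>

definition far :: "real \<Rightarrow> real \<Rightarrow> bool" where
  "far e s \<longleftrightarrow> e \<le> \<bar>sin s\<bar> \<and> e \<le> \<bar>cos s\<bar>"

lemma far_pi2: "far e (s + pi/2) = far e s" "far e (s - pi/2) = far e s"
  by (auto simp: far_def sin_add cos_add sin_diff cos_diff)

text \<open>Along a line of direction s the function fst z + (snd z)^2 has difference quotients of
  size at least e/2 while |snd z| < e/4. The layers, where it is below w in absolute value, thus
  occupy parameters within 4w/e of each other.\<close>

lemma prof_line:
  assumes e: "0 < e" "far e s" and w: "0 < w"
  shows "(\<integral>\<^sup>+u. ennreal \<bar>prof w (e/4) (rot s (u, v) - p)\<bar> \<partial>lborel) \<le> ennreal (8 * w / e)"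
proof -
  have "(\<integral>\<^sup>+u. ennreal \<bar>prof w (e/4) (rot s (u, v) - p)\<bar> \<partial>lborel) \<le> ennreal (1 * (2 * (4 * w / e)))"
  proof (rule nn_integral_le_diam)
    fix u u'
    let ?z = "rot s (u, v) - p" and ?z' = "rot s (u', v) - p"
    assume "ennreal \<bar>prof w (e/4) ?z\<bar> \<noteq> 0" "ennreal \<bar>prof w (e/4) ?z'\<bar> \<noteq> 0"
    then have n: "prof w (e/4) ?z \<noteq> 0" "prof w (e/4) ?z' \<noteq> 0" by auto
    note z = prof_nonzeroD[OF n(1)] and z' = prof_nonzeroD[OF n(2)]
    let ?k = "cos s + (snd ?z + snd ?z') * sin s"
    have "fst ?z + (snd ?z)\<^sup>2 - (fst ?z' + (snd ?z')\<^sup>2) = (fst ?z - fst ?z') + (snd ?z - snd ?z') * (snd ?z + snd ?z')"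
      by (simp add: power2_eq_square algebra_simps)
    also have "\<dots> = (u - u') * ?k"
      by (simp add: rot_def algebra_simps)
    finally have eq: "(u - u') * ?k = fst ?z + (snd ?z)\<^sup>2 - (fst ?z' + (snd ?z')\<^sup>2)" ..
    have "\<bar>(u - u') * ?k\<bar> < 2 * w" unfolding eq using z(2) z'(2) by linarith
    moreover have "\<bar>snd ?z + snd ?z'\<bar> \<le> e/2" using z(1) z'(1) by linarith
    then have "\<bar>(snd ?z + snd ?z') * sin s\<bar> \<le> (e/2) * 1"
      unfolding abs_mult using e(1) by (intro mult_mono) auto
    then have "e / 2 \<le> \<bar>?k\<bar>" using e(2) unfolding far_def by linarith
    then have "\<bar>u - u'\<bar> * (e/2) \<le> \<bar>(u - u') * ?k\<bar>"
      unfolding abs_mult by (intro mult_left_mono) auto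
    ultimately have "\<bar>u - u'\<bar> * (e/2) \<le> 2 * w" by linarith
    then show "\<bar>u - u'\<bar> \<le> 4 * w / e" using e(1) by (simp add: field_simps)
  qed (use abs_prof_le e w in \<open>auto simp: ennreal_leI\<close>)
  then show ?thesis by simp
qed

lemma emeasure_small_values:
  fixes h :: "real \<Rightarrow> real"
  assumes "0 < e" "0 \<le> w" "\<And>y y'. \<bar>y\<bar> < T \<Longrightarrow> \<bar>y'\<bar> < T \<Longrightarrow> e / 2 * \<bar>y - y'\<bar> \<le> \<bar>h y - h y'\<bar>"
  shows "(\<integral>\<^sup>+y. indicator {y. \<bar>y\<bar> < T \<and> \<bar>h y - c\<bar> \<le> w} y \<partial>lborel) \<le> ennreal (8 * w / e)"
proof -
  have "(\<integral>\<^sup>+y. indicator {y. \<bar>y\<bar> < T \<and> \<bar>h y - c\<bar> \<le> w} y \<partial>lborel) \<le> ennreal (1 * (2 * (4 * w / e)))"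
  proof (rule nn_integral_le_diam)
    fix y y' :: real
    assume "indicator {y. \<bar>y\<bar> < T \<and> \<bar>h y - c\<bar> \<le> w} y \<noteq> (0::ennreal)" "indicator {y. \<bar>y\<bar> < T \<and> \<bar>h y - c\<bar> \<le> w} y' \<noteq> (0::ennreal)"
    then have "\<bar>y\<bar> < T" "\<bar>y'\<bar> < T" "\<bar>h y - c\<bar> \<le> w" "\<bar>h y' - c\<bar> \<le> w" by (auto simp: indicator_def split: if_splits)
    then have "e / 2 * \<bar>y - y'\<bar> \<le> 2 * w" using assms(3)[of y y'] by linarith
    then show "\<bar>y - y'\<bar> \<le> 4 * w / e" using assms(1) by (simp add: field_simps)
  qed (use assms in \<open>auto simp: indicator_def\<close>)
  then show ?thesis by simp
qed

lemma prof_slice_integral: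
  assumes "0 < w" "\<bar>y\<bar> < T"
  shows "(\<integral>x. prof w T (x, y) \<partial>lborel) = 0"
proof -
  have eq: "prof w T (x, y) = indicator {- y\<^sup>2 - w<..<- y\<^sup>2} x - indicator {- y\<^sup>2<..<- y\<^sup>2 + w} x" for x
    using assms by (auto simp: prof_def indicator_def)
  show ?thesis
    unfolding eq using assms by (subst Bochner_Integration.integral_diff) auto
qed

text \<open>The positive and the negative layer of \<open>prof\<close> cancel on each horizontal slice that does not
  meet the boundary of the rectangle, and a rectangle with slope far from \<open>0\<close> crosses the layers
  transversally.\<close>

lemma prof_corner:
  assumes e: "0 < e" "far e s" and w: "0 < w"
  shows "\<bar>\<integral>z. indicator (rc s a b c d) z * prof w (e/4) z \<partial>lborel\<bar> \<le> 64 * w\<^sup>2 / e"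
proof -
  let ?T = "e/4" and ?R = "rc s a b c d"
  let ?f = "\<lambda>z. indicator ?R z * prof w ?T z"
  have int: "integrable lborel ?f"
    by (rule integrable_real_mult_indicator[where f = "prof w ?T", simplified, unfolded mult.commute[of _ "indicator _ _"]])
      (use integrable_prof[of w ?T] e w in auto)
  then have int2: "integrable (lborel \<Otimes>\<^sub>M lborel) (\<lambda>z. ?f z)" by (simp add: lborel_prod)
  have "(\<integral>z. ?f z \<partial>lborel) = (\<integral>z. ?f z \<partial>(lborel \<Otimes>\<^sub>M lborel))" by (simp add: lborel_prod)
  also have "\<dots> = (\<integral>y. (\<integral>x. ?f (x, y) \<partial>lborel) \<partial>lborel)"
    using lborel_pair.integral_snd[of "\<lambda>x y. ?f (x, y)"] int2 by (simp add: split_beta')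
  finally have eq: "(\<integral>z. ?f z \<partial>lborel) = (\<integral>y. (\<integral>x. ?f (x, y) \<partial>lborel) \<partial>lborel)" .
  \<comment> \<open>\<open>p y\<close> and \<open>q y\<close> are the rotated coordinates of the arc
    point (- y^2, y). A slice can be cut only if one of them is within w of a side; each of the four
    sides spoils slices of total length 8w/e, and a slice contributes at most 2w. This gives the
    constant 64.\<close>
  define p where "p y = y * sin s - y\<^sup>2 * cos s" for y
  define q where "q y = y * cos s + y\<^sup>2 * sin s" for y
  let ?S = "\<lambda>h c. {y. \<bar>y\<bar> < ?T \<and> \<bar>h y - c\<bar> \<le> w}"
  have bound: "ennreal \<bar>\<integral>x. ?f (x, y) \<partial>lborel\<bar> \<le> ennreal (2 * w) * (indicator (?S p a) y + indicator (?S p b) y + indicator (?S q c) y + indicator (?S q d) y)" for y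
  proof -
    have "(\<integral>\<^sup>+x. ennreal \<bar>?f (x, y)\<bar> \<partial>lborel) \<le> (\<integral>\<^sup>+x. indicator {- y\<^sup>2 - w..- y\<^sup>2 + w} x \<partial>lborel)"
    proof (rule nn_integral_mono)
      fix x
      show "ennreal \<bar>?f (x, y)\<bar> \<le> indicator {- y\<^sup>2 - w..- y\<^sup>2 + w} x"
        using prof_nonzeroD(2)[of w ?T "(x, y)"] abs_prof_le[of w ?T "(x, y)"]
        by (cases "prof w ?T (x, y) = 0") (auto simp: indicator_def abs_less_iff)
    qed
    then have le: "\<bar>\<integral>x. ?f (x, y) \<partial>lborel\<bar> \<le> 2 * w"
      using w by (intro abs_integral_le_nn) (auto simp: measurable_Pair2' simp flip: borel_prod)
    show ?thesis
    proof (cases "y \<in> ?S p a \<union> ?S p b \<union> ?S q c \<union> ?S q d")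
      case True
      then have 1: "(1::ennreal) \<le> indicator (?S p a) y + indicator (?S p b) y + indicator (?S q c) y + indicator (?S q d) y"
        by (auto simp: indicator_def)
      have "ennreal \<bar>\<integral>x. ?f (x, y) \<partial>lborel\<bar> \<le> ennreal (2 * w) * 1"
        using le by (simp add: ennreal_leI)
      also have "\<dots> \<le> ennreal (2 * w) * (indicator (?S p a) y + indicator (?S p b) y + indicator (?S q c) y + indicator (?S q d) y)"
        by (rule mult_left_mono[OF 1]) simp
      finally show ?thesis .
    next
      case False
      have "(\<integral>x. ?f (x, y) \<partial>lborel) = 0"
      proof (cases "\<bar>y\<bar> < ?T \<and> (\<exists>x0. \<bar>x0 + y\<^sup>2\<bar> < w \<and> (x0, y) \<in> ?R)")
        case True
        then obtain x0 where x0: "\<bar>x0 + y\<^sup>2\<bar> < w" "(x0, y) \<in> ?R" by blast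
        have y: "\<bar>y\<bar> < ?T" using True by simp
        have near: "\<bar>fu s (x, y) - p y\<bar> < w" "\<bar>fv s (x, y) - q y\<bar> < w" if "\<bar>x + y\<^sup>2\<bar> < w" for x
        proof -
          have "fu s (x, y) - p y = (x + y\<^sup>2) * cos s" "fv s (x, y) - q y = - (x + y\<^sup>2) * sin s"
            by (simp_all add: fu_def fv_def p_def q_def algebra_simps)
          moreover have "\<bar>(x + y\<^sup>2) * cos s\<bar> \<le> \<bar>x + y\<^sup>2\<bar> * 1" "\<bar>- (x + y\<^sup>2) * sin s\<bar> \<le> \<bar>x + y\<^sup>2\<bar> * 1"
            unfolding abs_mult abs_minus by (intro mult_left_mono; simp)+
          ultimately show "\<bar>fu s (x, y) - p y\<bar> < w" "\<bar>fv s (x, y) - q y\<bar> < w" using that by auto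
        qed
        have nb: "\<not> \<bar>p y - a\<bar> \<le> w" "\<not> \<bar>p y - b\<bar> \<le> w" "\<not> \<bar>q y - c\<bar> \<le> w" "\<not> \<bar>q y - d\<bar> \<le> w"
          using False y by auto
        \<comment> \<open>Each point of the layers on this slice is within w of the arc point in
          both coordinates. As no side is that close to the arc point, all of them lie on the same
          side of each of the four lines.\<close>
        have inR: "(x, y) \<in> ?R" if x: "\<bar>x + y\<^sup>2\<bar> < w" for x
          using near[OF x] near[OF x0(1)] nb x0(2) unfolding rc_def mem_Collect_eq by linarith
        have feq: "?f (x, y) = prof w ?T (x, y)" for x
          using inR[of x] prof_nonzeroD(2)[of w ?T "(x, y)"] by (cases "prof w ?T (x, y) = 0") auto
        have "(\<integral>x. ?f (x, y) \<partial>lborel) = (\<integral>x. prof w ?T (x, y) \<partial>lborel)"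
          unfolding feq ..
        then show ?thesis unfolding prof_slice_integral[OF w y] .
      next
        case False
        have f0: "?f (x, y) = 0" for x
          using prof_nonzeroD[of w ?T "(x, y)"] False by (cases "prof w ?T (x, y) = 0") (auto simp: indicator_def)
        show ?thesis unfolding f0 by simp
      qed
      then show ?thesis by simp
    qed
  qed
  have diffs: "e / 2 * \<bar>y - y'\<bar> \<le> \<bar>p y - p y'\<bar>" "e / 2 * \<bar>y - y'\<bar> \<le> \<bar>q y - q y'\<bar>" if "\<bar>y\<bar> < ?T" "\<bar>y'\<bar> < ?T" for y y'
  proof -
    have yy: "\<bar>y + y'\<bar> \<le> e/2" using that by linarith
    have 1: "\<bar>(y + y') * cos s\<bar> \<le> (e/2) * 1" "\<bar>(y + y') * sin s\<bar> \<le> (e/2) * 1"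
      unfolding abs_mult by (rule mult_mono; use yy e in simp)+
    have 2: "e / 2 \<le> \<bar>sin s - (y + y') * cos s\<bar>" "e / 2 \<le> \<bar>cos s + (y + y') * sin s\<bar>"
      using 1 e(2) unfolding far_def by linarith+
    have 3: "p y - p y' = (sin s - (y + y') * cos s) * (y - y')" "q y - q y' = (cos s + (y + y') * sin s) * (y - y')"
      by (simp_all add: p_def q_def power2_eq_square algebra_simps)
    show "e / 2 * \<bar>y - y'\<bar> \<le> \<bar>p y - p y'\<bar>" "e / 2 * \<bar>y - y'\<bar> \<le> \<bar>q y - q y'\<bar>"
      unfolding 3 abs_mult using 2 by (intro mult_right_mono; simp)+
  qed
  have [measurable]: "p \<in> borel_measurable borel" "q \<in> borel_measurable borel"
    unfolding p_def q_def by measurable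
  note S = emeasure_small_values[OF e(1) less_imp_le[OF w] diffs(1)] emeasure_small_values[OF e(1) less_imp_le[OF w] diffs(2)]
  have "(\<integral>\<^sup>+y. ennreal \<bar>\<integral>x. ?f (x, y) \<partial>lborel\<bar> \<partial>lborel) \<le>
    (\<integral>\<^sup>+y. ennreal (2 * w) * (indicator (?S p a) y + indicator (?S p b) y + indicator (?S q c) y + indicator (?S q d) y) \<partial>lborel)"
    by (intro nn_integral_mono bound)
  also have "\<dots> = ennreal (2 * w) * (\<integral>\<^sup>+y. (indicator (?S p a) y + indicator (?S p b) y + indicator (?S q c) y + indicator (?S q d) y) \<partial>lborel)"
    by (rule nn_integral_cmult) measurable
  also have "(\<integral>\<^sup>+y. (indicator (?S p a) y + indicator (?S p b) y + indicator (?S q c) y + indicator (?S q d) y) \<partial>lborel)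
    = (\<integral>\<^sup>+y. indicator (?S p a) y \<partial>lborel) + (\<integral>\<^sup>+y. indicator (?S p b) y \<partial>lborel) + (\<integral>\<^sup>+y. indicator (?S q c) y \<partial>lborel) + (\<integral>\<^sup>+y. indicator (?S q d) y \<partial>lborel)"
    by (simp add: nn_integral_add)
  also have "\<dots> \<le> ennreal (8*w/e) + ennreal (8*w/e) + ennreal (8*w/e) + ennreal (8*w/e)"
    by (intro add_mono S)
  also have "\<dots> = ennreal (32 * w / e)"
    using e w by (simp flip: ennreal_plus)
  finally have "(\<integral>\<^sup>+y. ennreal \<bar>\<integral>x. ?f (x, y) \<partial>lborel\<bar> \<partial>lborel) \<le> ennreal (2 * w) * ennreal (32 * w / e)"
    by (simp add: mult_left_mono)
  also have "\<dots> = ennreal (64 * w\<^sup>2 / e)"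
    using e w by (simp add: power2_eq_square flip: ennreal_mult)
  finally have bnd: "(\<integral>\<^sup>+y. ennreal \<bar>\<integral>x. ?f (x, y) \<partial>lborel\<bar> \<partial>lborel) \<le> ennreal (64 * w\<^sup>2 / e)" .
  have "integrable lborel (\<lambda>y. \<integral>x. ?f (x, y) \<partial>lborel)"
    using lborel_pair.integrable_snd[of "\<lambda>x y. ?f (x, y)"] int2 by (simp add: split_beta')
  then have meas: "(\<lambda>y. \<integral>x. ?f (x, y) \<partial>lborel) \<in> borel_measurable lborel" by (rule borel_measurable_integrable)
  show ?thesis
    unfolding eq by (rule abs_integral_le_nn[OF meas bnd]) (use e w in simp)
qed

text \<open>On the parabola \<open>fu s\<close> equals cos s * (y * tan s - y^2), which is maximal
  at y = tan s / 2 with value k, so \<open>fu s z = k\<close> is a tangent. The whole positive layer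
  lies below it, and the sides of length at least 4 keep the other edges away. As
  \<open>prof\<close> has integral 0, the rectangle gains at least the area of the negative piece
  beyond the tangent.\<close>

lemma prof_tangent:
  assumes T: "T \<le> 1/4" and w: "0 < w" "sqrt w \<le> T" and s: "0 < cos s" "\<bar>tan s\<bar> \<le> T" and ab: "4 \<le> a" "4 \<le> b"
  defines "k \<equiv> cos s * (tan s)\<^sup>2 / 4"
  shows "w * sqrt w / 2 \<le> (\<integral>z. indicator (rc s (k - a) k (- b) b) z * prof w T z \<partial>lborel)"
proof -
  let ?t = "tan s" and ?R = "rc s (k - a) k (- b) b"
  have T0: "0 < T" using w by (meson less_le_trans real_sqrt_gt_zero)
  have w4: "w \<le> 1/4"
  proof -
    have "sqrt w * sqrt w \<le> T * T" using w T0 by (intro mult_mono) auto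
    also have "\<dots> \<le> (1/4) * (1/4)" using T T0 by (intro mult_mono) auto
    finally show ?thesis using w by simp
  qed
  have t4: "?t\<^sup>2 \<le> 1"
    using s T by (simp add: abs_square_le_1)
  have k: "0 \<le> k" "k \<le> 1"
  proof -
    show "0 \<le> k" using s by (simp add: k_def)
    have "cos s * (tan s)\<^sup>2 \<le> 1 * 1" using t4 s by (intro mult_mono) auto
    then show "k \<le> 1" by (simp add: k_def)
  qed
  have fu_eq: "fu s z = cos s * (fst z + snd z * ?t)" for z
    using s by (simp add: fu_def tan_def field_simps)
  \<comment> \<open>The offset of z from the tangent is, up to the factor cos s, (fst z + (snd z)^2)
    - (snd z - tan s / 2)^2. On W the first term exceeds w/4 and the square is at most w/4, so W
    lies beyond the tangent.\<close>
  define W where "W = {z :: real \<times> real. w/4 < fst z + (snd z)\<^sup>2 \<and> fst z + (snd z)\<^sup>2 < w \<and> ?t/2 - sqrt w/2 < snd z \<and> snd z < ?t/2 + sqrt w/2}"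
  have [measurable]: "W \<in> sets borel" unfolding W_def by (rule parabolic_sets)
  have eW: "emeasure lborel W = ennreal (3/4 * w * sqrt w)"
    unfolding W_def using w by (subst emeasure_parabolic) (auto simp: field_simps)
  have WR: "z \<notin> ?R" if "z \<in> W" for z
  proof
    assume "z \<in> ?R"
    then have "cos s * (fst z + snd z * ?t) < cos s * (?t\<^sup>2/4)" by (auto simp: rc_def fu_eq k_def)
    then have "fst z + snd z * ?t < ?t\<^sup>2/4" using s by simp
    moreover have "(snd z - ?t/2)\<^sup>2 \<le> (sqrt w/2)\<^sup>2"
    proof (intro power2_le_iff_abs_le[THEN iffD2])
      show "\<bar>snd z - ?t/2\<bar> \<le> sqrt w/2" using that unfolding W_def mem_Collect_eq by linarith
    qed (use w in simp)
    then have "(snd z - ?t/2)\<^sup>2 \<le> w/4" using w by (simp add: power_divide)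
    then have "(snd z)\<^sup>2 - snd z * ?t + ?t\<^sup>2/4 \<le> w/4" by (simp add: power2_eq_square algebra_simps)
    ultimately show False using that by (auto simp: W_def)
  qed
  have pR: "z \<in> ?R" if "prof w T z = 1" for z
  proof -
    have n: "prof w T z \<noteq> 0" using that by simp
    have q: "fst z + (snd z)\<^sup>2 < 0" using that by (auto simp: prof_def split: if_splits)
    have sup: "\<bar>fst z\<bar> < 1/2" "\<bar>snd z\<bar> < 1/2" using prof_support[OF n T w4] by auto
    have nz: "norm z \<le> 1" using norm_le_fu_fv[of z 0] sup by (simp add: fu_def fv_def)
    have "0 \<le> (snd z - ?t/2)\<^sup>2" by simp
    then have "fst z + snd z * ?t < ?t\<^sup>2/4" using q by (simp add: power2_eq_square algebra_simps)
    then have "fu s z < k" unfolding fu_eq k_def using s by simp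
    moreover have "\<bar>fu s z\<bar> \<le> 1" "\<bar>fv s z\<bar> \<le> 1" using nz abs_fu_le[of s z] abs_fv_le[of s z] by auto
    ultimately show ?thesis using k ab by (auto simp: rc_def)
  qed
  have Wm: "prof w T z = - 1" if "z \<in> W" for z
  proof -
    have "\<bar>snd z\<bar> < T" using that s w by (auto simp: W_def)
    then show ?thesis using that w by (auto simp: W_def prof_def)
  qed
  \<comment> \<open>Restriction to the rectangle keeps every value 1 and drops the value -1 on W;
    dropping further values -1 only helps.\<close>
  have pw: "prof w T z + indicator W z \<le> indicator ?R z * prof w T z" for z
  proof (cases "z \<in> W")
    case True then show ?thesis using WR Wm by simp
  next
    case False
    have "prof w T z = 1 \<or> prof w T z = 0 \<or> prof w T z = - 1" by (simp add: prof_def)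
    then show ?thesis using False pR[of z] by (auto simp: indicator_def)
  qed
  have ip: "integrable lborel (prof w T)" using integrable_prof w T0 by blast
  have iW: "integrable lborel (indicator W :: _ \<Rightarrow> real)"
    by (rule integrable_real_indicator) (auto simp: eW)
  have iR: "integrable lborel (\<lambda>z. indicator ?R z * prof w T z)"
    by (rule integrable_real_mult_indicator[where f = "prof w T", simplified, unfolded mult.commute[of _ "indicator _ _"]])
      (use ip in auto)
  have "w * sqrt w / 2 \<le> 3/4 * w * sqrt w" using w by simp
  also have "\<dots> = (\<integral>z. prof w T z + indicator W z \<partial>lborel)"
    using w T0 by (subst Bochner_Integration.integral_add[OF ip iW]) (simp add: integral_prof measure_def eW)
  also have "\<dots> \<le> (\<integral>z. indicator ?R z * prof w T z \<partial>lborel)"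
    by (rule integral_mono[OF _ iR pw]) (use ip iW in auto)
  finally show ?thesis .
qed

text \<open>At a point of local constancy every sufficiently small rectangle of any slope has mean
  exactly f x. Each block is thus differentiated almost everywhere by every basis, and only tails of
  the series of blocks need estimates.\<close>

definition loc_const :: "(real \<times> real \<Rightarrow> real) \<Rightarrow> real \<times> real \<Rightarrow> bool" where
  "loc_const f x \<longleftrightarrow> eventually (\<lambda>y. f y = f x) (nhds x)"

lemma eventually_sign:
  fixes h :: "real \<times> real \<Rightarrow> real"
  assumes "continuous_on UNIV h" "h x \<noteq> 0"
  shows "eventually (\<lambda>y. (h y < 0) = (h x < 0)) (nhds x)"
proof -
  have "isCont h x" using assms(1) continuous_on_eq_continuous_at[of UNIV h] by blast
  then have t: "(h \<longlongrightarrow> h x) (nhds x)" by (simp add: isCont_def tendsto_at_iff_tendsto_nhds)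
  show ?thesis
  proof (cases "h x < 0")
    case True
    then show ?thesis using order_tendstoD(2)[OF t True] by (auto elim: eventually_mono)
  next
    case False
    then have "0 < h x" using assms by simp
    from order_tendstoD(1)[OF t this] show ?thesis
      by (rule eventually_mono) (use False in auto)
  qed
qed

lemma loc_const_prof: "AE z in lborel. loc_const (prof w T) z"
proof -
  have para: "AE z in lborel. fst z + (snd z)\<^sup>2 \<noteq> k" for k :: real
  proof -
    have "emeasure lborel {z. (fst z + (snd z)\<^sup>2, snd z) \<in> {k} \<times> UNIV} = 0"
      by (subst emeasure_shear[where h = "\<lambda>y. y\<^sup>2"]) (auto simp: emeasure_lborel_Times Times_sets)
    moreover have "closed {z :: real \<times> real. fst z + (snd z)\<^sup>2 = k}"
      by (intro closed_Collect_eq continuous_intros)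
    ultimately have "{z :: real \<times> real. fst z + (snd z)\<^sup>2 = k} \<in> null_sets lborel"
      by (auto simp: null_sets_def)
    then show ?thesis by (rule AE_I') auto
  qed
  have hor: "AE z :: real \<times> real in lborel. snd z \<noteq> k" for k :: real
  proof -
    have "emeasure lborel (UNIV \<times> {k} :: (real \<times> real) set) = 0"
      by (subst emeasure_lborel_Times) auto
    then have "(UNIV \<times> {k} :: (real \<times> real) set) \<in> null_sets lborel"
      by (simp add: Times_sets null_sets_def)
    then show ?thesis by (rule AE_I') auto
  qed
  have main: "loc_const (prof w T) x"
    if x: "fst x + (snd x)\<^sup>2 \<noteq> 0" "fst x + (snd x)\<^sup>2 \<noteq> w" "fst x + (snd x)\<^sup>2 \<noteq> - w" "snd x \<noteq> T" "snd x \<noteq> - T" for x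
  proof -
    have e1: "eventually (\<lambda>y. (\<bar>snd y\<bar> - T < 0) = (\<bar>snd x\<bar> - T < 0)) (nhds x)"
      by (rule eventually_sign) (use x in \<open>auto intro!: continuous_intros\<close>)
    have e2: "eventually (\<lambda>y. (fst y + (snd y)\<^sup>2 < 0) = (fst x + (snd x)\<^sup>2 < 0)) (nhds x)"
      by (rule eventually_sign) (use x in \<open>auto intro!: continuous_intros\<close>)
    have e3: "eventually (\<lambda>y. (- (fst y + (snd y)\<^sup>2) < 0) = (- (fst x + (snd x)\<^sup>2) < 0)) (nhds x)"
      by (rule eventually_sign) (use x in \<open>auto intro!: continuous_intros\<close>)
    have e4: "eventually (\<lambda>y. (fst y + (snd y)\<^sup>2 - w < 0) = (fst x + (snd x)\<^sup>2 - w < 0)) (nhds x)"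
      by (rule eventually_sign) (use x in \<open>auto intro!: continuous_intros\<close>)
    have e5: "eventually (\<lambda>y. (- w - (fst y + (snd y)\<^sup>2) < 0) = (- w - (fst x + (snd x)\<^sup>2) < 0)) (nhds x)"
      by (rule eventually_sign) (use x in \<open>auto intro!: continuous_intros\<close>)
    show ?thesis
      unfolding loc_const_def using e1 e2 e3 e4 e5
    proof eventually_elim
      case (elim y)
      have "(\<bar>snd y\<bar> < T) = (\<bar>snd x\<bar> < T)" using elim(1) by linarith
      moreover have "(fst y + (snd y)\<^sup>2 < 0) = (fst x + (snd x)\<^sup>2 < 0)" by (rule elim(2))
      moreover have "(0 < fst y + (snd y)\<^sup>2) = (0 < fst x + (snd x)\<^sup>2)" using elim(3) by linarith
      moreover have "(fst y + (snd y)\<^sup>2 < w) = (fst x + (snd x)\<^sup>2 < w)" using elim(4) by linarith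
      moreover have "(- w < fst y + (snd y)\<^sup>2) = (- w < fst x + (snd x)\<^sup>2)" using elim(5) by linarith
      ultimately show ?case by (simp only: prof_def)
    qed
  qed
  show ?thesis
    using para[of 0] para[of w] para[of "- w"] hor[of T] hor[of "- T"]
    by eventually_elim (rule main)
qed

section \<open>Sheared lattices and averages of periodic functions\<close>

text \<open>Rows at distance D, each shifted by g * D against the row below. The density of the
  centres is independent of g, while g decides which slopes align with many centres.\<close>

definition lat :: "real \<Rightarrow> real \<Rightarrow> int \<times> int \<Rightarrow> real \<times> real" where
  "lat D g p = (D * (of_int (fst p) + g * of_int (snd p)), D * of_int (snd p))"

text \<open>Rounding first to the nearest row and then to the nearest centre in it: half-open
  squares around the centres tile the plane like bricks, whatever g is.\<close>

definition cidx :: "real \<Rightarrow> real \<Rightarrow> real \<times> real \<Rightarrow> int \<times> int" where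
  "cidx D g z = (\<lfloor>fst z / D - g * of_int \<lfloor>snd z / D + 1/2\<rfloor> + 1/2\<rfloor>, \<lfloor>snd z / D + 1/2\<rfloor>)"

definition ctr :: "real \<Rightarrow> real \<Rightarrow> real \<times> real \<Rightarrow> real \<times> real" where
  "ctr D g z = lat D g (cidx D g z)"

definition cell :: "real \<Rightarrow> (real \<times> real) set" where
  "cell D = {- D/2..<D/2} \<times> {- D/2..<D/2}"

definition per :: "real \<Rightarrow> real \<Rightarrow> (real \<times> real \<Rightarrow> 'a) \<Rightarrow> real \<times> real \<Rightarrow> 'a" where
  "per D g h z = h (z - ctr D g z)"

lemma cell_sets [measurable]: "cell D \<in> sets borel"
  unfolding cell_def by (rule Times_sets) auto

lemma emeasure_cell: "0 < D \<Longrightarrow> emeasure lborel (cell D) = ennreal (D\<^sup>2)"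
  unfolding cell_def by (subst emeasure_lborel_Times) (auto simp: ennreal_mult[symmetric] power2_eq_square)

lemma floor_half_iff: "\<lfloor>x + 1/2\<rfloor> = n \<longleftrightarrow> - 1/2 \<le> x - of_int n \<and> x - of_int n < (1/2::real)"
  by (simp add: floor_eq_iff) linarith

lemma mem_cell_iff:
  assumes "0 < D"
  shows "z - lat D g p \<in> cell D \<longleftrightarrow> cidx D g z = p"
proof -
  have half: "- D/2 \<le> x \<longleftrightarrow> - 1/2 \<le> x/D" "x < D/2 \<longleftrightarrow> x/D < 1/2" for x
    using assms by (auto simp: field_simps)
  have 1: "(snd z - D * of_int (snd p))/D = snd z/D - of_int (snd p)"
    "(fst z - D * (of_int (fst p) + g * of_int (snd p)))/D = (fst z/D - g * of_int (snd p)) - of_int (fst p)"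
    using assms by (auto simp: field_simps)
  have "z - lat D g p \<in> cell D \<longleftrightarrow>
    (- 1/2 \<le> fst z/D - g * of_int (snd p) - of_int (fst p) \<and> fst z/D - g * of_int (snd p) - of_int (fst p) < 1/2) \<and>
    (- 1/2 \<le> snd z/D - of_int (snd p) \<and> snd z/D - of_int (snd p) < 1/2)"
    unfolding cell_def lat_def mem_Times_iff fst_diff snd_diff fst_conv snd_conv atLeastLessThan_iff half 1 ..
  also have "\<dots> \<longleftrightarrow> \<lfloor>fst z/D - g * of_int (snd p) + 1/2\<rfloor> = fst p \<and> \<lfloor>snd z/D + 1/2\<rfloor> = snd p"
    unfolding floor_half_iff ..
  also have "\<dots> \<longleftrightarrow> cidx D g z = p"
    by (cases p) (auto simp: cidx_def)
  finally show ?thesis .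
qed

lemma diff_ctr_in_cell: "0 < D \<Longrightarrow> z - ctr D g z \<in> cell D"
  unfolding ctr_def by (simp add: mem_cell_iff)

lemma ctr_eqI: "0 < D \<Longrightarrow> z - lat D g p \<in> cell D \<Longrightarrow> ctr D g z = lat D g p"
  unfolding ctr_def by (simp add: mem_cell_iff)

lemma norm_cell:
  assumes "z \<in> cell D" "0 < D"
  shows "norm z \<le> D"
  using assms norm_le_fu_fv[of z 0] by (auto simp: cell_def fu_def fv_def mem_Times_iff)

lemma ctr_measurable [measurable]: "ctr D g \<in> borel_measurable borel"
proof -
  have "(\<lambda>z. (D * (of_int \<lfloor>fst z / D - g * of_int \<lfloor>snd z / D + 1/2\<rfloor> + 1/2\<rfloor> + g * of_int \<lfloor>snd z / D + 1/2\<rfloor>),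
     D * of_int \<lfloor>snd z / D + 1/2\<rfloor>)) \<in> borel_measurable (borel \<Otimes>\<^sub>M borel :: (real \<times> real) measure)"
    by (intro borel_measurable_Pair) measurable
  then show ?thesis
    by (simp add: ctr_def[abs_def] lat_def cidx_def borel_prod)
qed

lemma per_measurable [measurable]:
  fixes h :: "real \<times> real \<Rightarrow> real"
  assumes [measurable]: "h \<in> borel_measurable borel"
  shows "per D g h \<in> borel_measurable borel"
  unfolding per_def[abs_def] by measurable

lemma integral_translate:
  fixes f :: "real \<times> real \<Rightarrow> real"
  assumes [measurable]: "f \<in> borel_measurable borel"
  shows "(\<integral>x. f (x - p) \<partial>lborel) = (\<integral>x. f x \<partial>lborel)"
proof -
  have "(\<integral>x. f x \<partial>lborel) = (\<integral>x. f x \<partial>(distr lborel borel ((+) (- p))))"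
    by (simp add: lborel_distr_plus)
  also have "\<dots> = (\<integral>x. f (- p + x) \<partial>lborel)"
    by (rule integral_distr) auto
  finally show ?thesis by simp
qed

text \<open>V is the union of the rescaled cells contained in U. There are finitely many, since U is
  bounded, and each contributes the same integral, so the average over V is exact.\<close>

lemma
  fixes h :: "real \<times> real \<Rightarrow> real" and g :: real
  assumes U: "bounded U" and D: "0 < D" and d: "0 < d" and [measurable]: "h \<in> borel_measurable borel"
    and H: "\<And>z. \<bar>h z\<bar> \<le> H"
  defines "V \<equiv> {x. \<forall>y. cidx D g (y /\<^sub>R d) = cidx D g (x /\<^sub>R d) \<longrightarrow> y \<in> U}"
  shows cells_sets: "V \<in> sets borel" and integral_cells:
    "(\<integral>x. indicator V x * per D g h (x /\<^sub>R d) \<partial>lborel) = (\<integral>z. indicator (cell D) z * h z \<partial>lborel) / D\<^sup>2 * measure lborel V"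
proof -
  define P where "P = {p. \<forall>y. cidx D g (y /\<^sub>R d) = p \<longrightarrow> y \<in> U}"
  obtain b where b: "\<And>x. x \<in> U \<Longrightarrow> norm x \<le> b" using U by (auto simp: bounded_iff)
  have cl: "cidx D g ((d *\<^sub>R lat D g p) /\<^sub>R d) = p" for p
    using d D mem_cell_iff[OF D, of "lat D g p" g p] by (auto simp: cell_def zero_prod_def)
  have "finite P"
  proof -
    define K where "K = \<lceil>b / (d * D) * (1 + \<bar>g\<bar>)\<rceil>"
    have "P \<subseteq> {- K..K} \<times> {- K..K}"
    proof
      fix p assume "p \<in> P"
      then have "d *\<^sub>R lat D g p \<in> U" using cl unfolding P_def by blast
      then have n: "norm (d *\<^sub>R lat D g p) \<le> b" by (rule b)
      have b0: "0 \<le> b" using n norm_ge_zero order_trans by blast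
      have "\<bar>d * (D * of_int (snd p))\<bar> \<le> b" "\<bar>d * (D * (of_int (fst p) + g * of_int (snd p)))\<bar> \<le> b"
        using norm_snd_le[where x = "fst (d *\<^sub>R lat D g p)" and y = "snd (d *\<^sub>R lat D g p)"] norm_fst_le[where x = "fst (d *\<^sub>R lat D g p)" and y = "snd (d *\<^sub>R lat D g p)"] n
        by (auto simp: lat_def)
      moreover have "\<bar>z\<bar> \<le> b / (d * D)" if "\<bar>d * (D * z)\<bar> \<le> b" for z
      proof -
        have "\<bar>z\<bar> * (d * D) \<le> b" using that d D by (simp add: abs_mult mult.commute mult.left_commute)
        then show ?thesis using d D by (simp add: pos_le_divide_eq)
      qed
      ultimately have 1: "\<bar>of_int (snd p)\<bar> \<le> b / (d * D)" and 2: "\<bar>of_int (fst p) + g * of_int (snd p)\<bar> \<le> b / (d * D)"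
        by blast+
      have "\<bar>of_int (fst p) :: real\<bar> \<le> \<bar>of_int (fst p) + g * of_int (snd p)\<bar> + \<bar>g * of_int (snd p)\<bar>" by linarith
      also have "\<dots> \<le> b / (d * D) + \<bar>g\<bar> * (b / (d * D))"
        unfolding abs_mult using 1 2 by (intro add_mono mult_left_mono) auto
      also have "b / (d * D) + \<bar>g\<bar> * (b / (d * D)) = b / (d * D) * (1 + \<bar>g\<bar>)" by algebra
      finally have 3: "\<bar>of_int (fst p) :: real\<bar> \<le> b / (d * D) * (1 + \<bar>g\<bar>)" .
      have "b / (d * D) * 1 \<le> b / (d * D) * (1 + \<bar>g\<bar>)" using b0 d D by (intro mult_left_mono) auto
      with 1 have 4: "\<bar>of_int (snd p) :: real\<bar> \<le> b / (d * D) * (1 + \<bar>g\<bar>)" by simp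
      have "\<bar>of_int (fst p) :: real\<bar> \<le> of_int K" "\<bar>of_int (snd p) :: real\<bar> \<le> of_int K"
        using 3 4 le_of_int_ceiling[of "b / (d * D) * (1 + \<bar>g\<bar>)"] unfolding K_def by linarith+
      then have "\<bar>fst p\<bar> \<le> K" "\<bar>snd p\<bar> \<le> K" by linarith+
      then show "p \<in> {- K..K} \<times> {- K..K}" by (cases p) auto
    qed
    then show ?thesis by (rule finite_subset) auto
  qed
  have mc: "indicator (cell D) (x /\<^sub>R d - lat D g p) = (if cidx D g (x /\<^sub>R d) = p then 1 else 0 :: real)" for x p
    using mem_cell_iff[OF D, of "x /\<^sub>R d" g p] by (auto simp: indicator_def)
  have VP: "x \<in> V \<longleftrightarrow> cidx D g (x /\<^sub>R d) \<in> P" for x by (auto simp: V_def P_def)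
  have eq: "indicator V x * per D g k (x /\<^sub>R d) = (\<Sum>p\<in>P. indicator (cell D) (x /\<^sub>R d - lat D g p) * k (x /\<^sub>R d - lat D g p))" 
    for x and k :: "real \<times> real \<Rightarrow> real"
  proof -
    have "(\<Sum>p\<in>P. indicator (cell D) (x /\<^sub>R d - lat D g p) * k (x /\<^sub>R d - lat D g p))
      = (\<Sum>p\<in>P. if cidx D g (x /\<^sub>R d) = p then k (x /\<^sub>R d - lat D g p) else 0)"
      unfolding mc by (rule sum.cong) auto
    also have "\<dots> = (if cidx D g (x /\<^sub>R d) \<in> P then k (x /\<^sub>R d - ctr D g (x /\<^sub>R d)) else 0)"
      using \<open>finite P\<close> by (simp add: sum.delta' ctr_def)
    finally show ?thesis by (simp add: VP per_def indicator_def)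
  qed
  have "indicator V = (\<lambda>x. \<Sum>p\<in>P. indicator (cell D) (x /\<^sub>R d - lat D g p) :: real)"
    using eq[of _ "\<lambda>_. 1"] by (auto simp: per_def)
  then have "(indicator V :: _ \<Rightarrow> real) \<in> borel_measurable borel" by simp
  then show V: "V \<in> sets borel" by (simp add: borel_measurable_indicator_iff)
  have one: "(\<integral>x. indicator V x * per D g k (x /\<^sub>R d) \<partial>lborel) = real (card P) * (d\<^sup>2 * (\<integral>z. indicator (cell D) z * k z \<partial>lborel))"
    if [measurable]: "k \<in> borel_measurable borel" and kb: "\<And>z. \<bar>k z\<bar> \<le> B" for k B
  proof -
    have int1: "(\<integral>x. indicator (cell D) (x /\<^sub>R d - lat D g p) * k (x /\<^sub>R d - lat D g p) \<partial>lborel) = d\<^sup>2 * (\<integral>z. indicator (cell D) z * k z \<partial>lborel)" for p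
      using integral_scale[of "\<lambda>x. indicator (cell D) (x - lat D g p) * k (x - lat D g p)" d] d
        integral_translate[of "\<lambda>x. indicator (cell D) x * k x" "lat D g p"] by simp
    have int2: "integrable lborel (\<lambda>x. indicator (cell D) (x /\<^sub>R d - lat D g p) * k (x /\<^sub>R d - lat D g p))" for p
    proof (rule integrableI_bounded_set[where A = "cball 0 (d * (D + norm (lat D g p))) :: (real \<times> real) set" and B = B])
      show "AE x :: real \<times> real in lborel. x \<in> cball 0 (d * (D + norm (lat D g p))) \<longrightarrow> norm (indicator (cell D) (x /\<^sub>R d - lat D g p) * k (x /\<^sub>R d - lat D g p)) \<le> B"
        using kb order_trans[OF abs_ge_zero kb] by (auto simp: indicator_def)
      show "AE x :: real \<times> real in lborel. x \<notin> cball 0 (d * (D + norm (lat D g p))) \<longrightarrow> indicator (cell D) (x /\<^sub>R d - lat D g p) * k (x /\<^sub>R d - lat D g p) = 0"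
      proof (intro AE_I2 impI)
        fix x :: "real \<times> real" assume x: "x \<notin> cball 0 (d * (D + norm (lat D g p)))"
        have "x /\<^sub>R d - lat D g p \<notin> cell D"
        proof
          assume "x /\<^sub>R d - lat D g p \<in> cell D"
          then have "norm (x /\<^sub>R d - lat D g p) \<le> D" using norm_cell D by blast
          moreover have "norm a \<le> D + norm p" if "norm (a - p) \<le> D" for a p :: "real \<times> real"
            using that norm_triangle_sub[of a p] by simp
          ultimately have "norm (x /\<^sub>R d) \<le> D + norm (lat D g p)" by blast
          then have "norm x \<le> d * (D + norm (lat D g p))" using d by (simp add: field_simps)
          then show False using x by simp
        qed
        then show "indicator (cell D) (x /\<^sub>R d - lat D g p) * k (x /\<^sub>R d - lat D g p) = 0" by simp
      qed
      show "emeasure lborel (cball 0 (d * (D + norm (lat D g p))) :: (real \<times> real) set) < \<infinity>"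
        using emeasure_bounded_finite by blast
    qed (auto)
    show ?thesis
      unfolding eq using int2 by (subst Bochner_Integration.integral_sum) (auto simp: int1)
  qed
  \<comment> \<open>The constant function 1 counts the cells, which eliminates
    \<open>card P\<close>.\<close>
  have "measure lborel V = (\<integral>x. indicator V x * per D g (\<lambda>_. 1) (x /\<^sub>R d) \<partial>lborel)"
    using V by (simp add: per_def)
  also have "\<dots> = real (card P) * (d\<^sup>2 * D\<^sup>2)"
    by (subst one[of _ 1]) (auto simp: measure_def emeasure_cell D)
  finally show "(\<integral>x. indicator V x * per D g h (x /\<^sub>R d) \<partial>lborel) = (\<integral>z. indicator (cell D) z * h z \<partial>lborel) / D\<^sup>2 * measure lborel V"
    using D by (subst one[OF assms(4) H]) (simp add: field_simps)
qed

text \<open>Only cells cut by the boundary of U disturb the exact average over whole cells. Their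
  points in U are within 2 * d * D of the complement, hence in N; the integral over them and their
  share of \<open>measure lborel U\<close> cost at most H * n each.\<close>

lemma periodic_average:
  fixes h :: "real \<times> real \<Rightarrow> real"
  assumes U: "bounded U" "U \<in> sets borel" and D: "0 < D" and d: "0 < d" and h [measurable]: "h \<in> borel_measurable borel"
    and H: "\<And>z. \<bar>h z\<bar> \<le> H"
    and N: "N \<in> sets borel" "emeasure lborel N \<le> ennreal n" "0 \<le> n" "\<And>x y. x \<in> U - N \<Longrightarrow> dist x y \<le> 2 * d * D \<Longrightarrow> y \<in> U"
  shows "\<bar>(\<integral>x. indicator U x * per D g h (x /\<^sub>R d) \<partial>lborel) - (\<integral>z. indicator (cell D) z * h z \<partial>lborel) / D\<^sup>2 * measure lborel U\<bar> \<le> 2 * H * n"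
proof -
  define V where "V = {x. \<forall>y. cidx D g (y /\<^sub>R d) = cidx D g (x /\<^sub>R d) \<longrightarrow> y \<in> U}"
  note cells = cells_sets[OF U(1) D d h H, of g, folded V_def] integral_cells[OF U(1) D d h H, of g, folded V_def]
  note [measurable] = U(2) cells(1) N(1)
  have VU: "V \<subseteq> U" unfolding V_def by blast
  have UV: "U - V \<subseteq> N"
  proof
    fix x assume x: "x \<in> U - V"
    then obtain y where y: "cidx D g (y /\<^sub>R d) = cidx D g (x /\<^sub>R d)" "y \<notin> U" unfolding V_def by blast
    let ?p = "ctr D g (x /\<^sub>R d)"
    have "norm (x /\<^sub>R d - ?p) \<le> D" "norm (y /\<^sub>R d - ?p) \<le> D"
      using norm_cell[OF diff_ctr_in_cell[OF D, of "x /\<^sub>R d" g] D] norm_cell[OF diff_ctr_in_cell[OF D, of "y /\<^sub>R d" g] D] y(1) by (simp_all add: ctr_def)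
    moreover have "norm (a - b) \<le> 2 * D" if "norm (a - p) \<le> D" "norm (b - p) \<le> D" for a b p :: "real \<times> real"
      using that norm_triangle_ineq4[of "a - p" "b - p"] by simp
    ultimately have "norm (x /\<^sub>R d - y /\<^sub>R d) \<le> 2 * D" by blast
    moreover have "norm (x /\<^sub>R d - y /\<^sub>R d) = dist x y / d"
      unfolding scaleR_diff_right[symmetric] dist_norm using d by (simp add: divide_inverse mult.commute)
    ultimately have "dist x y \<le> 2 * d * D" using d by (simp add: pos_divide_le_eq mult.commute mult.left_commute)
    then show "x \<in> N" using N(4)[of x y] x y by blast
  qed
  have finU: "emeasure lborel U < \<infinity>" using emeasure_bounded_finite U by blast
  have finV: "emeasure lborel V < \<infinity>" using finU VU emeasure_mono[of V U lborel] by (simp add: order_le_less_trans)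
  have n: "measure lborel (U - V) \<le> n"
  proof -
    have "emeasure lborel (U - V) \<le> ennreal n" using emeasure_mono[OF UV, of lborel] N by (auto intro: order_trans)
    then show ?thesis using N(3) by (simp add: measure_def enn2real_leI)
  qed
  have H0: "0 \<le> H" using H[of 0] by linarith
  let ?f = "\<lambda>x. per D g h (x /\<^sub>R d)"
  have f: "\<bar>?f x\<bar> \<le> H" for x by (simp add: per_def H)
  have int: "integrable lborel (\<lambda>x. indicator A x * ?f x)" if [measurable]: "A \<in> sets borel" and "emeasure lborel A < \<infinity>" for A
  proof (rule integrableI_bounded_set[where A = A and B = H])
    show "AE x in lborel. x \<in> A \<longrightarrow> norm (indicator A x * ?f x) \<le> H" using f by (auto simp: indicator_def)
  qed (use that in auto)
  have finUV: "emeasure lborel (U - V) < \<infinity>" using finU emeasure_mono[of "U - V" U lborel] by (simp add: order_le_less_trans)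
  have "(\<integral>x. indicator U x * ?f x \<partial>lborel) = (\<integral>x. indicator V x * ?f x + indicator (U - V) x * ?f x \<partial>lborel)"
    by (rule Bochner_Integration.integral_cong) (use VU in \<open>auto simp: indicator_def\<close>)
  also have "(\<integral>x. indicator V x * ?f x + indicator (U - V) x * ?f x \<partial>lborel) = (\<integral>x. indicator V x * ?f x \<partial>lborel) + (\<integral>x. indicator (U - V) x * ?f x \<partial>lborel)"
    by (rule Bochner_Integration.integral_add) (use int finV finUV in auto)
  finally have 1: "(\<integral>x. indicator U x * ?f x \<partial>lborel) = (\<integral>z. indicator (cell D) z * h z \<partial>lborel) / D\<^sup>2 * measure lborel V + (\<integral>x. indicator (U - V) x * ?f x \<partial>lborel)"
    unfolding cells(2) .
  have "\<bar>\<integral>x. indicator (U - V) x * ?f x \<partial>lborel\<bar> \<le> H * measure lborel (U - V)"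
  proof (rule abs_integral_le_nn)
    have "(\<integral>\<^sup>+x. ennreal \<bar>indicator (U - V) x * ?f x\<bar> \<partial>lborel) \<le> (\<integral>\<^sup>+x. ennreal H * indicator (U - V) x \<partial>lborel)"
      by (rule nn_integral_mono) (use f in \<open>auto simp: indicator_def intro!: ennreal_leI\<close>)
    also have "\<dots> = ennreal (H * measure lborel (U - V))"
      using H0 finUV by (simp add: nn_integral_cmult_indicator ennreal_mult emeasure_eq_ennreal_measure)
    finally show "(\<integral>\<^sup>+x. ennreal \<bar>indicator (U - V) x * ?f x\<bar> \<partial>lborel) \<le> ennreal (H * measure lborel (U - V))" .
  qed (use H0 in auto)
  also have "\<dots> \<le> H * n" using n H0 by (rule mult_left_mono)
  finally have 2: "\<bar>\<integral>x. indicator (U - V) x * ?f x \<partial>lborel\<bar> \<le> H * n" .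
  have mU: "measure lborel U = measure lborel V + measure lborel (U - V)"
    using VU finU finV by (subst measure_Diff) (auto intro!: less_imp_neq[THEN not_sym] simp: less_top)
  have "\<bar>\<integral>z. indicator (cell D) z * h z \<partial>lborel\<bar> \<le> H * D\<^sup>2"
  proof (rule abs_integral_le_nn)
    have "(\<integral>\<^sup>+x. ennreal \<bar>indicator (cell D) x * h x\<bar> \<partial>lborel) \<le> (\<integral>\<^sup>+x. ennreal H * indicator (cell D) x \<partial>lborel)"
      by (rule nn_integral_mono) (use H in \<open>auto simp: indicator_def intro!: ennreal_leI\<close>)
    also have "\<dots> = ennreal (H * D\<^sup>2)"
      using H0 D by (simp add: nn_integral_cmult_indicator ennreal_mult emeasure_cell)
    finally show "(\<integral>\<^sup>+x. ennreal \<bar>indicator (cell D) x * h x\<bar> \<partial>lborel) \<le> ennreal (H * D\<^sup>2)" .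
  qed (use H0 in auto)
  then have "\<bar>(\<integral>z. indicator (cell D) z * h z \<partial>lborel) / D\<^sup>2\<bar> \<le> H" using D by (simp add: abs_divide field_simps)
  then have 3: "\<bar>(\<integral>z. indicator (cell D) z * h z \<partial>lborel) / D\<^sup>2\<bar> * measure lborel (U - V) \<le> H * n"
    using n H0 by (intro mult_mono) auto
  have "\<bar>(\<integral>z. indicator (cell D) z * h z \<partial>lborel) / D\<^sup>2 * measure lborel (U - V)\<bar> \<le> H * n"
    using 3 by (simp only: abs_mult abs_of_nonneg[OF measure_nonneg])
  moreover have "\<bar>c * v + r - c * (v + m)\<bar> \<le> 2 * k" if "\<bar>c * m\<bar> \<le> k" "\<bar>r\<bar> \<le> k" for c v r m k :: real
    using that by (simp add: distrib_left abs_le_iff)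
  ultimately show ?thesis using 2 unfolding 1 mU mult.assoc by blast
qed

section \<open>One lattice of bumps: small means on transversal rectangles\<close>

text \<open>A dyadic version of a hyperbolic region |u| * |v| \<le> const * t. A rectangle of length
  about 2^j can see a large mean only if its area is below t, hence its width below t / 2^j; its
  points are then that close to the bump across. The constants 4 and 3 leave room for the size of
  the bump.\<close>

definition pollut :: "nat \<Rightarrow> real \<Rightarrow> real \<Rightarrow> (real \<times> real) set" where
  "pollut J t s = {z. \<exists>j\<le>J. \<bar>fu s z\<bar> \<le> 4 * 2^j \<and> \<bar>fv s z\<bar> \<le> 3 + t / 2^j}"

lemma pollut_pi: "pollut J t (s + pi/2 + pi/2) = pollut J t s"
  unfolding pollut_def fu_plus_pi2 by simp

lemma pollut_sets [measurable]: "pollut J t s \<in> sets borel"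
proof -
  have "pollut J t s = (\<Union>j\<in>{..J}. {z. \<bar>fu s z\<bar> \<le> 4 * 2^j \<and> \<bar>fv s z\<bar> \<le> 3 + t / 2^j})"
    by (auto simp: pollut_def)
  also have "\<dots> \<in> sets borel"
    by (intro sets.finite_UN borel_closed closed_Collect_conj closed_Collect_le continuous_intros) auto
  finally show ?thesis .
qed

text \<open>The box at level j has area 48 * 2^j + 16 * t. The first part is geometric in j; the
  second is the same at all levels and yields the logarithmic factor J + 1.\<close>

lemma emeasure_pollut:
  assumes "0 \<le> t"
  shows "emeasure lborel (pollut J t s) \<le> ennreal (96 * 2^J + 16 * t * (J + 1))"
proof -
  let ?B = "\<lambda>j. ({- (4 * 2^j)..4 * 2^j} \<times> {- (3 + t / 2^j)..3 + t / 2^j}) :: (real \<times> real) set"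
  have "pollut J t s = {z. rot (- s) z \<in> (\<Union>j\<in>{..J}. ?B j)}"
    by (auto simp: pollut_def rot_minus_eq abs_le_iff minus_le_iff)
  then have "emeasure lborel (pollut J t s) = emeasure lborel {z. rot (- s) z \<in> (\<Union>j\<in>{..J}. ?B j)}"
    by simp
  also have "\<dots> = emeasure lborel (\<Union>j\<in>{..J}. ?B j)"
    by (rule emeasure_rot) (auto intro!: Times_sets sets.finite_UN)
  also have "\<dots> \<le> (\<Sum>j\<in>{..J}. emeasure lborel (?B j))"
    by (rule emeasure_subadditive_finite) (auto intro!: Times_sets)
  also have "\<dots> = (\<Sum>j\<in>{..J}. ennreal (48 * 2^j + 16 * t))"
  proof (rule sum.cong[OF refl])
    fix j
    have eq: "(8 * 2^j) * (2 * (3 + t / 2^j)) = 48 * 2^j + 16 * t" by (simp add: distrib_left)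
    have "- (3 + t / 2^j) \<le> 3 + t / 2^j" using assms by (simp add: add_nonneg_nonneg)
    then have "emeasure lborel {- (3 + t / 2^j)..3 + t / 2^j} = ennreal (2 * (3 + t / 2^j))"
      by (subst emeasure_lborel_Icc) auto
    moreover have "emeasure lborel {- (4 * 2^j)..4 * 2^j :: real} = ennreal (8 * 2^j)"
      by (subst emeasure_lborel_Icc) auto
    ultimately have "emeasure lborel (?B j) = ennreal (8 * 2^j) * ennreal (2 * (3 + t / 2^j))"
      by (subst emeasure_lborel_Times) auto
    also have "\<dots> = ennreal ((8 * 2^j) * (2 * (3 + t / 2^j)))"
      using assms by (subst ennreal_mult) auto
    finally show "emeasure lborel (?B j) = ennreal (48 * 2^j + 16 * t)" unfolding eq .
  qed
  also have "\<dots> = ennreal (\<Sum>j\<in>{..J}. 48 * 2^j + 16 * t)"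
    using assms by (intro sum_ennreal) auto
  also have "\<dots> \<le> ennreal (96 * 2^J + 16 * t * (J + 1))"
  proof (rule ennreal_leI)
    have "(\<Sum>j\<in>{..J}. (2::real)^j) \<le> 2 * 2^J"
      by (induction J) auto
    then show "(\<Sum>j\<in>{..J}. 48 * 2^j + 16 * t) \<le> 96 * 2^J + 16 * t * (J + 1)"
      unfolding sum.distrib sum_distrib_left[symmetric] by simp
  qed
  finally show ?thesis .
qed

lemma card_int_interval:
  fixes a b :: real
  assumes "S \<subseteq> {k :: int. a \<le> of_int k \<and> of_int k \<le> b}" "a \<le> b + 1"
  shows "finite S" "real (card S) \<le> b - a + 1"
proof -
  have sub: "S \<subseteq> {\<lceil>a\<rceil>..\<lfloor>b\<rfloor>}" using assms(1) by (auto simp: ceiling_le_iff le_floor_iff)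
  then show "finite S" using finite_subset by blast
  have "card S \<le> card {\<lceil>a\<rceil>..\<lfloor>b\<rfloor>}" using sub by (intro card_mono) auto
  then have "real (card S) \<le> real (nat (\<lfloor>b\<rfloor> - \<lceil>a\<rceil> + 1))" by simp
  also have "\<dots> \<le> b - a + 1"
  proof (cases "0 \<le> \<lfloor>b\<rfloor> - \<lceil>a\<rceil> + 1")
    case True
    then have "real (nat (\<lfloor>b\<rfloor> - \<lceil>a\<rceil> + 1)) = of_int \<lfloor>b\<rfloor> - of_int \<lceil>a\<rceil> + 1" by simp
    then show ?thesis using of_int_floor_le[of b] le_of_int_ceiling[of a] by linarith
  qed (use assms(2) in auto)
  finally show "real (card S) \<le> b - a + 1" .
qed

text \<open>H is the height of the bump, D the spacing of the lattice, e' the tolerated mean.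
  \<open>Ht\<close> is the corner bound of \<open>prof_corner\<close>: area at least t suffices for
  a mean up to e'. \<open>HL\<close> is the chord bound of \<open>prof_line\<close>: length at least
  2^J suffices. \<open>De\<close> allows a line at most one hit per row, and t \<le> 8 * 2^J keeps
  the spoilt region inside one cell.\<close>

locale bump =
  fixes e w D H e' t :: real and J :: nat
  assumes e: "0 < e" "e \<le> 1" and w: "0 < w" "w \<le> 1/4" and H: "0 < H" and e': "0 < e'"
    and D_eq: "D = 64 * 2^J" and De: "2 / e < D" and t: "0 \<le> t" "t \<le> 8 * 2^J"
    and Ht: "H * (64 * w\<^sup>2 / e) \<le> e' * t" and HL: "H * (8 * w / e) \<le> e' * 2^J"
begin

lemma D64: "64 \<le> D" unfolding D_eq by simp

lemma D0: "0 < D" using D64 by linarith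

definition bmp :: "real \<times> real \<Rightarrow> real" where
  "bmp z = H * prof w (e/4) z"

definition F :: "real \<Rightarrow> real \<times> real \<Rightarrow> real" where
  "F g = per D g bmp"

lemma bmp_measurable [measurable]: "bmp \<in> borel_measurable borel"
  unfolding bmp_def[abs_def] by measurable

lemma F_measurable [measurable]: "F g \<in> borel_measurable borel"
  unfolding F_def by measurable

lemma abs_bmp_le: "\<bar>bmp z\<bar> \<le> H"
  using abs_prof_le[of w "e/4" z] H by (simp add: bmp_def abs_mult mult_left_le)

lemma abs_F_le: "\<bar>F g z\<bar> \<le> H"
  by (simp add: F_def per_def abs_bmp_le)

lemma bmp_support:
  assumes "bmp z \<noteq> 0"
  shows "\<bar>fst z\<bar> < 1/2" "\<bar>snd z\<bar> < 1/2" "norm z < 1"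
proof -
  show 1: "\<bar>fst z\<bar> < 1/2" "\<bar>snd z\<bar> < 1/2"
    using assms prof_support[of w "e/4" z] e w by (auto simp: bmp_def)
  then show "norm z < 1" using norm_le_fu_fv[of z 0] by (simp add: fu_def fv_def)
qed

lemma bmp_cell: "bmp z \<noteq> 0 \<Longrightarrow> z \<in> cell D"
  using bmp_support[of z] D64 by (cases z) (auto simp: cell_def)

lemma F_eq_bmp: "bmp (z - lat D g p) \<noteq> 0 \<Longrightarrow> F g z = bmp (z - lat D g p)"
  using ctr_eqI[OF D0 bmp_cell] by (simp add: F_def per_def)

lemma F_nonzero: "F g z \<noteq> 0 \<Longrightarrow> F g z = bmp (z - lat D g (cidx D g z)) \<and> bmp (z - lat D g (cidx D g z)) \<noteq> 0"
  by (simp add: F_def per_def ctr_def)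

definition hit :: "real \<Rightarrow> real \<Rightarrow> real \<Rightarrow> real \<Rightarrow> real \<Rightarrow> (int \<times> int) set" where
  "hit g s v a b = {p. \<exists>u. a < u \<and> u < b \<and> bmp (rot s (u, v) - lat D g p) \<noteq> 0}"

lemma line_le_hits:
  assumes "far e s" "finite (hit g s v a b)"
  shows "(\<integral>\<^sup>+u. indicator {a<..<b} u * ennreal \<bar>F g (rot s (u, v))\<bar> \<partial>lborel) \<le> ennreal (card (hit g s v a b) * (e' * 2^J))"
proof -
  let ?P = "hit g s v a b"
  have m: "(\<lambda>u. ennreal \<bar>prof w (e/4) (rot s (u, v) - p)\<bar>) \<in> borel_measurable borel" for p
  proof -
    have "(\<lambda>u. rot s (u, v) - p) \<in> borel_measurable borel"
      by (intro borel_measurable_continuous_onI continuous_intros)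
    then show ?thesis by measurable
  qed
  have "(\<integral>\<^sup>+u. indicator {a<..<b} u * ennreal \<bar>F g (rot s (u, v))\<bar> \<partial>lborel)
    \<le> (\<integral>\<^sup>+u. (\<Sum>p\<in>?P. ennreal H * ennreal \<bar>prof w (e/4) (rot s (u, v) - lat D g p)\<bar>) \<partial>lborel)"
  proof (rule nn_integral_mono)
    fix u
    show "indicator {a<..<b} u * ennreal \<bar>F g (rot s (u, v))\<bar> \<le> (\<Sum>p\<in>?P. ennreal H * ennreal \<bar>prof w (e/4) (rot s (u, v) - lat D g p)\<bar>)"
    proof (cases "a < u \<and> u < b \<and> F g (rot s (u, v)) \<noteq> 0")
      case True
      let ?p = "cidx D g (rot s (u, v))"
      have n: "F g (rot s (u, v)) = bmp (rot s (u, v) - lat D g ?p)" "bmp (rot s (u, v) - lat D g ?p) \<noteq> 0"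
        using F_nonzero True by auto
      then have "?p \<in> ?P" unfolding hit_def using True by blast
      then have "ennreal H * ennreal \<bar>prof w (e/4) (rot s (u, v) - lat D g ?p)\<bar> \<le> (\<Sum>p\<in>?P. ennreal H * ennreal \<bar>prof w (e/4) (rot s (u, v) - lat D g p)\<bar>)"
        using assms(2) by (intro member_le_sum) auto
      moreover have "indicator {a<..<b} u * ennreal \<bar>F g (rot s (u, v))\<bar> = ennreal H * ennreal \<bar>prof w (e/4) (rot s (u, v) - lat D g ?p)\<bar>"
        unfolding n(1) using True H by (simp add: bmp_def abs_mult ennreal_mult)
      ultimately show ?thesis by simp
    qed (auto simp: indicator_def)
  qed
  also have "\<dots> = (\<Sum>p\<in>?P. ennreal H * (\<integral>\<^sup>+u. ennreal \<bar>prof w (e/4) (rot s (u, v) - lat D g p)\<bar> \<partial>lborel))"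
    using m by (subst nn_integral_sum) (auto simp: nn_integral_cmult)
  also have "\<dots> \<le> (\<Sum>p\<in>?P. ennreal (e' * 2^J))"
  proof (rule sum_mono)
    fix p
    have "ennreal H * (\<integral>\<^sup>+u. ennreal \<bar>prof w (e/4) (rot s (u, v) - lat D g p)\<bar> \<partial>lborel) \<le> ennreal H * ennreal (8 * w / e)"
      using prof_line[OF e(1) assms(1) w(1)] by (intro mult_left_mono) auto
    also have "\<dots> \<le> ennreal (e' * 2^J)"
      using HL H e w by (subst ennreal_mult[symmetric]) (auto intro!: ennreal_leI)
    finally show "ennreal H * (\<integral>\<^sup>+u. ennreal \<bar>prof w (e/4) (rot s (u, v) - lat D g p)\<bar> \<partial>lborel) \<le> ennreal (e' * 2^J)" .
  qed
  also have "\<dots> = ennreal (card ?P * (e' * 2^J))"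
    using e' by (simp add: ennreal_mult ennreal_of_nat_eq_real_of_nat)
  finally show ?thesis .
qed

lemma hit_snd:
  assumes "p \<in> hit g s v a b" "a \<le> b"
  shows "\<bar>D * of_int (snd p) - (((a + b)/2) * sin s + v * cos s)\<bar> \<le> (b - a)/2 + 1/2"
proof -
  obtain u where u: "a < u" "u < b" "bmp (rot s (u, v) - lat D g p) \<noteq> 0" using assms by (auto simp: hit_def)
  have 1: "\<bar>u * sin s + v * cos s - D * of_int (snd p)\<bar> < 1/2"
    using bmp_support(2)[OF u(3)] by (simp add: rot_def lat_def)
  have um: "\<bar>u - (a + b)/2\<bar> \<le> (b - a)/2" using u(1,2) unfolding abs_le_iff by (simp add: field_simps)
  have "\<bar>(u - (a + b)/2) * sin s\<bar> \<le> (b - a)/2 * 1"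
    unfolding abs_mult using assms(2) by (intro mult_mono um) auto
  then have 2: "\<bar>u * sin s - ((a + b)/2) * sin s\<bar> \<le> (b - a)/2" by (simp add: left_diff_distrib)
  show ?thesis using 1 2 by linarith
qed

text \<open>A line of direction s moves horizontally by D * cot s from one row to the next, and the
  centres by D * g. Measured in units of D, the phase against the centres thus advances by cot s - g
  per row, and a hit needs it within 1 / (e * D) of an integer. Counting hits becomes a question
  about multiples of cot s - g modulo 1.\<close>

lemma hit_phase:
  assumes p: "p \<in> hit g s v a b" and far: "far e s"
  shows "\<bar>of_int (snd p) * (cos s / sin s - g) - v / (D * sin s) - of_int (fst p)\<bar> \<le> 1 / (e * D)"
proof -
  obtain u where u: "a < u" "u < b" "bmp (rot s (u, v) - lat D g p) \<noteq> 0" using p by (auto simp: hit_def)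
  define x where "x = u * cos s - v * sin s"
  define y where "y = u * sin s + v * cos s"
  have 1: "\<bar>x - D * (of_int (fst p) + g * of_int (snd p))\<bar> < 1/2" "\<bar>y - D * of_int (snd p)\<bar> < 1/2"
    using bmp_support[OF u(3)] by (auto simp: rot_def lat_def x_def y_def)
  have s: "e \<le> \<bar>sin s\<bar>" "sin s \<noteq> 0" using far e by (auto simp: far_def)
  have "y * cos s - v = x * sin s"
    unfolding x_def y_def using sin_cos_squared_add[of s] by algebra
  then have xy: "x = (y * cos s - v) / sin s" using s by (simp add: field_simps)
  define c where "c = cos s / sin s"
  have c: "\<bar>c\<bar> \<le> 1 / e"
    unfolding c_def abs_divide using s e by (intro frac_le) auto
  have eq: "D * (of_int (snd p) * (c - g) - v / (D * sin s) - of_int (fst p))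
    = (x - D * (of_int (fst p) + g * of_int (snd p))) - (y - D * of_int (snd p)) * c"
    unfolding xy c_def using D0 s(2) by (simp add: field_simps)
  have "\<bar>(y - D * of_int (snd p)) * c\<bar> \<le> (1/2) * (1/e)"
    unfolding abs_mult using 1 c by (intro mult_mono) auto
  moreover have "1/2 \<le> (1/2) * (1/e)" using e by simp
  ultimately have "\<bar>D * (of_int (snd p) * (c - g) - v / (D * sin s) - of_int (fst p))\<bar> \<le> 1 / e"
    unfolding eq using 1 by linarith
  then have "D * \<bar>of_int (snd p) * (c - g) - v / (D * sin s) - of_int (fst p)\<bar> \<le> 1 / e"
    using D0 by (simp add: abs_mult)
  then show ?thesis unfolding c_def[symmetric] using D0 e by (simp add: field_simps)
qed

text \<open>Two hits in one row have the same phase, and \<open>De\<close> gives 1 / (e * D) < 1/2,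
  so the nearest integers agree.\<close>

lemma inj_hit:
  assumes "far e s"
  shows "inj_on snd (hit g s v a b)"
proof (rule inj_onI)
  fix p q assume pq: "p \<in> hit g s v a b" "q \<in> hit g s v a b" "snd p = snd q"
  have "1 / (e * D) < 1/2" using De e D0 by (simp add: field_simps)
  then have "\<bar>real_of_int (fst p) - of_int (fst q)\<bar> < 1"
    using hit_phase[OF pq(1) assms] hit_phase[OF pq(2) assms] unfolding pq(3) by linarith
  then have "fst p = fst q" by linarith
  then show "p = q" using pq(3) by (simp add: prod_eq_iff)
qed

text \<open>There is at most one hit per row, and the rows met by a segment of length b - a have
  heights, in multiples of D, within an interval of length b - a + 1.\<close>

lemma
  assumes "far e s" "a \<le> b"
  shows finite_hit: "finite (hit g s v a b)" and card_hit: "real (card (hit g s v a b)) \<le> (b - a + 1) / D + 1"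
proof -
  let ?m = "((a + b)/2) * sin s + v * cos s"
  let ?h = "(b - a)/2 + 1/2"
  have sub: "snd ` hit g s v a b \<subseteq> {k. (?m - ?h)/D \<le> of_int k \<and> of_int k \<le> (?m + ?h)/D}"
  proof
    fix k assume "k \<in> snd ` hit g s v a b"
    then obtain p where p: "p \<in> hit g s v a b" "k = snd p" by blast
    have "\<bar>D * of_int k - ?m\<bar> \<le> ?h" using hit_snd[OF p(1) assms(2)] p(2) by simp
    then show "k \<in> {k. (?m - ?h)/D \<le> of_int k \<and> of_int k \<le> (?m + ?h)/D}"
      using D0 by (auto simp: pos_divide_le_eq pos_le_divide_eq mult.commute abs_le_iff)
  qed
  have le: "(?m - ?h)/D \<le> (?m + ?h)/D + 1" 
  proof -
    have "(?m - ?h)/D \<le> (?m + ?h)/D" using D0 assms by (intro divide_right_mono) auto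
    then show ?thesis by simp
  qed
  note c = card_int_interval[OF sub le]
  show "finite (hit g s v a b)" using c(1) inj_hit[OF assms(1)] finite_imageD by blast
  have "real (card (hit g s v a b)) = real (card (snd ` hit g s v a b))"
    using card_image[OF inj_hit[OF assms(1)]] by simp
  also have "\<dots> \<le> (?m + ?h)/D - (?m - ?h)/D + 1" by (rule c(2))
  also have "\<dots> = (b - a + 1)/D + 1" by (simp add: diff_divide_distrib[symmetric])
  finally show "real (card (hit g s v a b)) \<le> (b - a + 1) / D + 1" .
qed

lemma mean_le_hits:
  assumes "far e s" "a < b" "c < d" "\<And>v. real (card (hit g s v a b)) \<le> n"
  shows "\<bar>mean (F g) (rc s a b c d)\<bar> \<le> n * (e' * 2^J) / (b - a)"
proof (rule abs_mean_le_lines)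
  have n: "0 \<le> n" using assms(4)[of 0] by linarith
  then show "0 \<le> n * (e' * 2^J)" using e' by simp
  fix v
  have "(\<integral>\<^sup>+u. indicator {a<..<b} u * ennreal \<bar>F g (rot s (u, v))\<bar> \<partial>lborel) \<le> ennreal (card (hit g s v a b) * (e' * 2^J))"
    using assms by (intro line_le_hits finite_hit) auto
  also have "\<dots> \<le> ennreal (n * (e' * 2^J))"
    using assms(4) e' by (intro ennreal_leI mult_right_mono) auto
  finally show "(\<integral>\<^sup>+u. indicator {a<..<b} u * ennreal \<bar>F g (rot s (u, v))\<bar> \<partial>lborel) \<le> ennreal (n * (e' * 2^J))" .
qed (use assms in auto)

lemma norm_lat_diff: 
  assumes "p \<noteq> q"
  shows "D \<le> norm (lat D g p - lat D g q)"
proof (cases "snd p = snd q")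
  case True
  then have "fst p \<noteq> fst q" using assms by (simp add: prod_eq_iff)
  then have "1 \<le> \<bar>real_of_int (fst p) - of_int (fst q)\<bar>" by linarith
  then have "D * 1 \<le> D * \<bar>real_of_int (fst p) - of_int (fst q)\<bar>" using D0 by (intro mult_left_mono) auto
  also have "\<dots> = \<bar>fst (lat D g p - lat D g q)\<bar>" proof -
    have "fst (lat D g p - lat D g q) = D * (real_of_int (fst p) - of_int (fst q))" using True by (simp add: lat_def algebra_simps)
    then show ?thesis using D0 by (simp add: abs_mult)
  qed
  also have "\<dots> \<le> norm (lat D g p - lat D g q)" using abs_fu_le[of 0 "lat D g p - lat D g q"] by (simp add: fu_def)
  finally show ?thesis by simp
next
  case False
  then have "1 \<le> \<bar>real_of_int (snd p) - of_int (snd q)\<bar>" by linarith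
  then have "D * 1 \<le> D * \<bar>real_of_int (snd p) - of_int (snd q)\<bar>" using D0 by (intro mult_left_mono) auto
  also have "\<dots> = \<bar>snd (lat D g p - lat D g q)\<bar>" proof -
    have "snd (lat D g p - lat D g q) = D * (real_of_int (snd p) - of_int (snd q))" by (simp add: lat_def algebra_simps)
    then show ?thesis using D0 by (simp add: abs_mult)
  qed
  also have "\<dots> \<le> norm (lat D g p - lat D g q)" using abs_fv_le[of 0 "lat D g p - lat D g q"] by (simp add: fv_def)
  finally show ?thesis by simp
qed

text \<open>Distinct centres are at least D apart and bumps have radius below 1, so a set of
  diameter below D - 2 meets one bump only.\<close>

lemma F_near:
  assumes y: "F g y \<noteq> 0" and z: "dist y z < D - 2"
  shows "F g z = bmp (z - lat D g (cidx D g y))"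
proof (cases "F g z = 0")
  case True
  then show ?thesis using F_eq_bmp by metis
next
  case False
  have "cidx D g z = cidx D g y"
  proof (rule ccontr)
    assume "cidx D g z \<noteq> cidx D g y"
    then have "D \<le> norm (lat D g (cidx D g z) - lat D g (cidx D g y))" by (rule norm_lat_diff)
    moreover have "norm (y - lat D g (cidx D g y)) < 1" "norm (z - lat D g (cidx D g z)) < 1"
      using F_nonzero[OF y] F_nonzero[OF False] bmp_support(3) by auto
    moreover have "norm (p - q) \<le> norm (y - q) + norm (z - p) + dist y z" for p q
    proof -
      have "norm (p - q) \<le> norm ((y - q) - (z - p)) + norm (z - y)"
        using norm_triangle_ineq[of "(y - q) - (z - p)" "z - y"] by simp
      then show ?thesis using norm_triangle_ineq4[of "y - q" "z - p"] by (simp add: dist_norm norm_minus_commute)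
    qed
    note this[of "lat D g (cidx D g z)" "lat D g (cidx D g y)"]
    ultimately show False using z by linarith
  qed
  then show ?thesis using F_nonzero[OF False] by simp
qed

lemma pollut_cell: "z \<in> pollut J t s \<Longrightarrow> z \<in> cell D"
proof -
  assume "z \<in> pollut J t s"
  then obtain j where j: "j \<le> J" "\<bar>fu s z\<bar> \<le> 4 * 2^j" "\<bar>fv s z\<bar> \<le> 3 + t / 2^j" by (auto simp: pollut_def)
  have "(2::real)^j \<le> 2^J" using j(1) by (simp add: power_increasing)
  moreover have "t / 2^j \<le> t / 1" using t by (intro divide_left_mono) auto
  ultimately have "norm z \<le> 15 * 2^J" using j(2,3) norm_le_fu_fv[of z s] t one_le_power[of "2::real" J] by linarith
  then have "norm z < D/2" unfolding D_eq using one_le_power[of "2::real" J] by linarith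
  moreover have "\<bar>fst z\<bar> \<le> norm z" "\<bar>snd z\<bar> \<le> norm z" using abs_fu_le[of 0 z] abs_fv_le[of 0 z] by (auto simp: fu_def fv_def)
  ultimately show "z \<in> cell D" unfolding cell_def mem_Times_iff by auto
qed

definition bad :: "real \<Rightarrow> (real \<times> real) set" where
  "bad s = pollut J t s \<union> pollut J t (s + pi/2)"

lemma bad_pi2: "bad (s + pi/2) = bad s"
  unfolding bad_def using pollut_pi[of J t s] by auto

lemma bad_cell: "bad s \<subseteq> cell D"
  unfolding bad_def using pollut_cell by blast

lemma bad_sets [measurable]: "bad s \<in> sets borel"
  unfolding bad_def by measurable

text \<open>The first bound comes from cancellation and is governed by the area, the second from
  chords and is governed by the length. Together, a mean above e' forces area below t and length
  below 2^J, which is what \<open>pollut\<close> records.\<close>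

lemma mean_bmp:
  assumes far: "far e s" and ab: "a < b" "c < d"
  shows "\<bar>mean (\<lambda>z. bmp (z - q)) (rc s a b c d)\<bar> * ((b - a) * (d - c)) \<le> e' * t"
    "\<bar>mean (\<lambda>z. bmp (z - q)) (rc s a b c d)\<bar> * (b - a) \<le> e' * 2^J"
proof -
  have ind: "indicator (rc s a b c d) z = (indicator (rc s (a - fu s q) (b - fu s q) (c - fv s q) (d - fv s q)) (z - q) :: real)" for z
    by (auto simp: rc_def indicator_def fu_diff fv_diff)
  let ?I = "\<integral>z. indicator (rc s a b c d) z * bmp (z - q) \<partial>lborel"
  have "?I = (\<integral>z. indicator (rc s (a - fu s q) (b - fu s q) (c - fv s q) (d - fv s q)) z * bmp z \<partial>lborel)"
    unfolding ind by (rule integral_translate) measurable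
  also have "\<dots> = H * (\<integral>z. indicator (rc s (a - fu s q) (b - fu s q) (c - fv s q) (d - fv s q)) z * prof w (e/4) z \<partial>lborel)"
    by (simp add: bmp_def mult.left_commute)
  finally have I: "?I = H * (\<integral>z. indicator (rc s (a - fu s q) (b - fu s q) (c - fv s q) (d - fv s q)) z * prof w (e/4) z \<partial>lborel)" .
  have "\<bar>?I\<bar> \<le> H * (64 * w\<^sup>2 / e)"
    unfolding I abs_mult abs_of_pos[OF H] using H by (intro mult_left_mono prof_corner[OF e(1) far w(1)]) auto
  with Ht have 1: "\<bar>?I\<bar> \<le> e' * t" by linarith
  have m: "mean (\<lambda>z. bmp (z - q)) (rc s a b c d) = ?I / ((b - a) * (d - c))"
    using ab by (subst mean_eq) (auto simp: measure_rc)
  show "\<bar>mean (\<lambda>z. bmp (z - q)) (rc s a b c d)\<bar> * ((b - a) * (d - c)) \<le> e' * t"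
    unfolding m abs_divide using 1 ab by simp
  have "\<bar>mean (\<lambda>z. bmp (z - q)) (rc s a b c d)\<bar> \<le> (e' * 2^J) / (b - a)"
  proof (rule abs_mean_le_lines)
    fix v
    have mm: "(\<lambda>u. ennreal \<bar>prof w (e/4) (rot s (u, v) - q)\<bar>) \<in> borel_measurable borel"
    proof -
      have "(\<lambda>u. rot s (u, v) - q) \<in> borel_measurable borel"
        by (intro borel_measurable_continuous_onI continuous_intros)
      then show ?thesis by measurable
    qed
    have "(\<integral>\<^sup>+u. indicator {a<..<b} u * ennreal \<bar>bmp (rot s (u, v) - q)\<bar> \<partial>lborel) \<le> (\<integral>\<^sup>+u. ennreal H * ennreal \<bar>prof w (e/4) (rot s (u, v) - q)\<bar> \<partial>lborel)"
      by (rule nn_integral_mono) (use H in \<open>auto simp: indicator_def bmp_def abs_mult ennreal_mult\<close>)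
    also have "\<dots> = ennreal H * (\<integral>\<^sup>+u. ennreal \<bar>prof w (e/4) (rot s (u, v) - q)\<bar> \<partial>lborel)"
      by (rule nn_integral_cmult) (use mm in simp)
    also have "\<dots> \<le> ennreal H * ennreal (8 * w / e)"
      using prof_line[OF e(1) far w(1)] by (intro mult_left_mono) auto
    also have "\<dots> \<le> ennreal (e' * 2^J)"
      using HL H e w by (subst ennreal_mult[symmetric]) (auto intro!: ennreal_leI)
    finally show "(\<integral>\<^sup>+u. indicator {a<..<b} u * ennreal \<bar>bmp (rot s (u, v) - q)\<bar> \<partial>lborel) \<le> ennreal (e' * 2^J)" .
  qed (use ab e' in auto)
  then show "\<bar>mean (\<lambda>z. bmp (z - q)) (rc s a b c d)\<bar> * (b - a) \<le> e' * 2^J"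
    using ab by (simp add: pos_le_divide_eq)
qed

text \<open>A short rectangle meeting a bump forces each of its points that sees a large mean into
  the cross \<open>bad s\<close> around that bump.\<close>

lemma unpolluted:
  assumes far: "far e s" and ab: "a < b" "c < d" "d - c \<le> b - a" and short: "b - a < D/4"
    and x: "x \<in> rc s a b c d" "x - ctr D g x \<notin> bad s"
  shows "\<bar>mean (F g) (rc s a b c d)\<bar> \<le> e'" "b - a < 1 \<Longrightarrow> mean (F g) (rc s a b c d) = 0"
proof -
  let ?R = "rc s a b c d"
  have main: "\<bar>mean (F g) ?R\<bar> \<le> e' \<and> (b - a < 1 \<longrightarrow> mean (F g) ?R = 0)"
  proof (cases "\<exists>y\<in>?R. F g y \<noteq> 0")
    case False
    then have "mean (F g) ?R = 0" by (intro mean_const[OF _ ab(1,2)]) auto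
    then show ?thesis using e' by simp
  next
    case True
    then obtain y where y: "y \<in> ?R" "F g y \<noteq> 0" by blast
    let ?q = "lat D g (cidx D g y)"
    have eq: "F g z = bmp (z - ?q)" if "z \<in> ?R" for z
    proof (rule F_near[OF y(2)])
      have "dist y z \<le> (b - a) + (d - c)" by (rule dist_rc_le[OF y(1) that])
      then show "dist y z < D - 2" using ab(3) short D64 by linarith
    qed
    have yq: "norm (y - ?q) < 1" using F_nonzero[OF y(2)] bmp_support(3) by blast
    have "\<bar>fu s (x - y)\<bar> < b - a" "\<bar>fv s (x - y)\<bar> < d - c"
      using x(1) y(1) by (auto simp: rc_def fu_diff fv_diff)
    moreover have "\<bar>fu s (y - ?q)\<bar> < 1" "\<bar>fv s (y - ?q)\<bar> < 1"
      using yq abs_fu_le[of s "y - ?q"] abs_fv_le[of s "y - ?q"] by linarith+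
    moreover have "fu s (x - ?q) = fu s (x - y) + fu s (y - ?q)" "fv s (x - ?q) = fv s (x - y) + fv s (y - ?q)"
      by (simp_all add: fu_diff fv_diff)
    ultimately have xq: "\<bar>fu s (x - ?q)\<bar> < b - a + 1" "\<bar>fv s (x - ?q)\<bar> < d - c + 1"
      by linarith+
    have np: "x - ?q \<notin> pollut J t s"
    proof
      assume *: "x - ?q \<in> pollut J t s"
      then have "ctr D g x = ?q" using ctr_eqI[OF D0 pollut_cell[OF *]] by simp
      with * x(2) show False by (simp add: bad_def)
    qed
    have long: "1 \<le> b - a"
    proof (rule ccontr)
      assume "\<not> 1 \<le> b - a"
      then have "\<bar>fu s (x - ?q)\<bar> \<le> 4 * 2^0" "\<bar>fv s (x - ?q)\<bar> \<le> 3 + t / 2^0"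
        using xq ab(3) t by auto
      then show False using np unfolding pollut_def by blast
    qed
    define j where "j = nat \<lfloor>log 2 (b - a)\<rfloor>"
    have l0: "0 \<le> log 2 (b - a)" using long by simp
    have "of_int \<lfloor>log 2 (b - a)\<rfloor> = real j" using l0 by (simp add: j_def)
    then have jl: "real j \<le> log 2 (b - a)" "log 2 (b - a) < real j + 1"
      using floor_correct[of "log 2 (b - a)"] by linarith+
    have j1: "2^j \<le> b - a" using jl(1) long by (simp add: le_log_iff powr_realpow)
    have "b - a < 2 powr (real j + 1)" using jl(2) long by (simp add: log_less_iff)
    also have "\<dots> = 2 * 2^j" by (simp add: powr_add powr_realpow)
    finally have j2: "b - a < 2 * 2^j" .
    have mq: "mean (F g) ?R = mean (\<lambda>z. bmp (z - ?q)) ?R" by (rule mean_cong) (rule eq)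
    note mb = mean_bmp[OF far ab(1,2), of ?q, folded mq]
    have "\<bar>mean (F g) ?R\<bar> \<le> e'"
    proof (rule ccontr)
      assume "\<not> \<bar>mean (F g) ?R\<bar> \<le> e'"
      then have gt: "e' < \<bar>mean (F g) ?R\<bar>" by simp
      have "e' * (b - a) < \<bar>mean (F g) ?R\<bar> * (b - a)" using gt ab by (intro mult_strict_right_mono) auto
      then have "e' * (b - a) < e' * 2^J" using mb(2) by linarith
      then have "b - a < 2^J" using e' by simp
      then have "(2::real)^j < 2^J" using j1 by linarith
      then have jJ: "j \<le> J" by (metis less_imp_le power_strict_increasing_iff one_less_numeral_iff semiring_norm(76))
      have "e' * ((b - a) * (d - c)) < \<bar>mean (F g) ?R\<bar> * ((b - a) * (d - c))" using gt ab by (intro mult_strict_right_mono) auto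
      then have "e' * ((b - a) * (d - c)) < e' * t" using mb(1) by linarith
      then have "(b - a) * (d - c) < t" using e' by simp
      moreover have "2^j * (d - c) \<le> (b - a) * (d - c)" using j1 ab by (intro mult_right_mono) auto
      ultimately have "d - c < t / 2^j" by (simp add: pos_less_divide_eq mult.commute)
      then have "\<bar>fv s (x - ?q)\<bar> \<le> 3 + t / 2^j" using xq by linarith
      moreover have "\<bar>fu s (x - ?q)\<bar> \<le> 4 * 2^j" using xq j2 one_le_power[of "2::real" j] by linarith
      ultimately show False using np jJ unfolding pollut_def by blast
    qed
    then show ?thesis using long by simp
  qed
  show "\<bar>mean (F g) ?R\<bar> \<le> e'" using main by blast
  show "b - a < 1 \<Longrightarrow> mean (F g) ?R = 0" using main by blast
qed

text \<open>A rectangle of length at least D/4 has at most 9 * (b - a) / D hits per chord, each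
  worth e' * 2^J. As D = 64 * 2^J, the mean is at most 9/64 * e'. This is still too weak for a sum
  over many scales; \<open>mean_generic\<close> improves it.\<close>

lemma mean_F_le:
  assumes far: "far e s" and ab: "a < b" "c < d" "d - c \<le> b - a"
    and x: "x \<in> rc s a b c d" "x - ctr D g x \<notin> bad s"
  shows "\<bar>mean (F g) (rc s a b c d)\<bar> \<le> e'"
proof (cases "b - a < D/4")
  case True
  then show ?thesis using unpolluted(1) assms by blast
next
  case False
  let ?r = "b - a"
  have n: "real (card (hit g s v a b)) \<le> 9 * ?r / D" for v
  proof -
    have "real (card (hit g s v a b)) \<le> (?r + 1)/D + 1" using card_hit[OF far] ab by simp
    also have "\<dots> = (?r + 1 + D)/D" using D0 by (simp add: field_simps)
    also have "\<dots> \<le> 9 * ?r / D" using D0 D64 False by (intro divide_right_mono) auto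
    finally show ?thesis .
  qed
  have "\<bar>mean (F g) (rc s a b c d)\<bar> \<le> 9 * ?r / D * (e' * 2^J) / ?r"
    by (rule mean_le_hits[OF far ab(1,2) n])
  also have "9 * ?r / D * (e' * 2^J) / ?r = 9 / 64 * e'"
  proof -
    have "?r \<noteq> 0" "(2::real)^J \<noteq> 0" using ab by auto
    moreover have "9 * r / (64 * p) * (e' * p) / r = 9 / 64 * e'" if "r \<noteq> 0" "p \<noteq> 0" for r p :: real
      using that by simp
    ultimately show ?thesis unfolding D_eq by blast
  qed
  also have "\<dots> \<le> e'" using e' by simp
  finally show ?thesis .
qed

end

text \<open>Translates of \<open>S\<close> by well-spaced multiples of \<open>q\<close> are pairwise disjoint, which bounds the density of \<open>S\<close>.\<close>

lemma card_close_phases: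
  fixes S :: "int set" and \<theta> \<rho> \<nu> A B :: real and q Q zq :: int
  assumes S: "S \<subseteq> {k. A \<le> of_int k \<and> of_int k \<le> B}" "A \<le> B"
    and close: "\<And>k k'. k \<in> S \<Longrightarrow> k' \<in> S \<Longrightarrow> \<exists>z::int. \<bar>of_int (k - k') * \<theta> - of_int z\<bar> \<le> \<rho>"
    and \<rho>: "0 < \<rho>" "\<rho> < 1/2" and q: "1 \<le> q" "q \<le> Q" and \<nu>: "0 < \<nu>" "\<nu> \<le> \<bar>of_int q * \<theta> - of_int zq\<bar>" "\<bar>of_int q * \<theta> - of_int zq\<bar> \<le> \<rho>"
  shows "real (card S) \<le> 4 * \<rho> * (B - A + 1 + of_int Q / (2 * \<nu>))"
proof -
  define \<psi> where "\<psi> = of_int q * \<theta> - of_int zq"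
  \<comment> \<open>With these choices the phase step r * |\<psi>| lies between \<rho> and 2 *
    \<rho>, and n steps move the phase by at most 1/2. Two translates by different multiples of r *
    q then differ in phase by more than \<rho> modulo 1 and cannot meet. So n + 1 > 1 / (4 * \<rho>)
    disjoint copies fit into the interval prolonged by n * r * q.\<close>
  define r where "r = \<lfloor>\<rho> / \<bar>\<psi>\<bar>\<rfloor> + 1"
  define n where "n = \<lfloor>1 / (4 * \<rho>)\<rfloor>"
  have \<psi>: "0 < \<bar>\<psi>\<bar>" "\<nu> \<le> \<bar>\<psi>\<bar>" "\<bar>\<psi>\<bar> \<le> \<rho>" using \<nu> by (auto simp: \<psi>_def)
  have "\<rho> / \<bar>\<psi>\<bar> < of_int r" "of_int r \<le> \<rho> / \<bar>\<psi>\<bar> + 1" unfolding r_def by linarith+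
  then have r: "\<rho> < of_int r * \<bar>\<psi>\<bar>" "of_int r * \<bar>\<psi>\<bar> \<le> \<rho> + \<bar>\<psi>\<bar>"
    using \<psi>(1) by (auto simp: field_simps)
  have r1: "1 \<le> r" unfolding r_def using \<rho> \<psi> by simp
  have n: "0 \<le> n" "of_int n \<le> 1 / (4 * \<rho>)" "1 / (4 * \<rho>) < of_int n + 1"
    using \<rho> floor_correct[of "1 / (4 * \<rho>)"] by (auto simp: n_def)
  define T where "T = {0..n}"
  define h where "h = (\<lambda>(i, k). k + i * r * q)"
  have inj: "inj_on h (T \<times> S)"
  proof (rule inj_onI, clarify)
    fix i k j l
    assume ik: "i \<in> T" "k \<in> S" "j \<in> T" "l \<in> S" and eq: "h (i, k) = h (j, l)"
    have kl: "k - l = (j - i) * r * q" using eq by (simp add: h_def algebra_simps)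
    have "i = j"
    proof (rule ccontr)
      assume "i \<noteq> j"
      define m where "m = j - i"
      have m: "1 \<le> \<bar>m\<bar>" "\<bar>m\<bar> \<le> n" using \<open>i \<noteq> j\<close> ik by (auto simp: T_def m_def)
      obtain z where z: "\<bar>of_int (k - l) * \<theta> - of_int z\<bar> \<le> \<rho>" using close ik by blast
      define y where "y = of_int m * of_int r * \<psi>"
      define z' where "z' = z - m * r * zq"
      have "of_int (k - l) * \<theta> - of_int z = y - of_int z'"
        unfolding kl m_def[symmetric] y_def z'_def \<psi>_def by (simp add: algebra_simps)
      with z have yz: "\<bar>y - of_int z'\<bar> \<le> \<rho>" by simp
      have ya: "\<bar>y\<bar> = of_int \<bar>m\<bar> * (of_int r * \<bar>\<psi>\<bar>)" using r1 by (simp add: y_def abs_mult)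
      have "1 * (of_int r * \<bar>\<psi>\<bar>) \<le> of_int \<bar>m\<bar> * (of_int r * \<bar>\<psi>\<bar>)" using m r1 by (intro mult_right_mono) auto
      then have y1: "\<rho> < \<bar>y\<bar>" using r(1) unfolding ya by linarith
      have r2: "of_int r * \<bar>\<psi>\<bar> \<le> 2 * \<rho>" using r \<psi> by linarith
      have "of_int \<bar>m\<bar> * (of_int r * \<bar>\<psi>\<bar>) \<le> of_int n * (2 * \<rho>)"
        by (rule mult_mono[OF _ r2]) (use m n r1 in auto)
      also have "\<dots> \<le> 1 / (4 * \<rho>) * (2 * \<rho>)" using n \<rho> by (intro mult_right_mono) auto
      also have "\<dots> = 1/2" using \<rho> by simp
      finally have y2: "\<bar>y\<bar> \<le> 1/2" unfolding ya .
      have "z' \<noteq> 0" using yz y1 by auto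
      then have "1 \<le> \<bar>real_of_int z'\<bar>" by linarith
      then show False using yz y2 \<rho> by linarith
    qed
    then show "i = j \<and> k = l" using kl by simp
  qed
  have sub: "h ` (T \<times> S) \<subseteq> {k. A \<le> of_int k \<and> of_int k \<le> B + of_int (n * r * q)}"
  proof (clarify)
    fix i k assume ik: "i \<in> T" "k \<in> S"
    have "0 \<le> i * (r * q)" "i * (r * q) \<le> n * (r * q)" using ik r1 q by (auto simp: T_def intro!: mult_right_mono)
    then have "0 \<le> (of_int (i * r * q) :: real)" "(of_int (i * r * q) :: real) \<le> of_int (n * r * q)"
      by (simp_all only: of_int_0_le_iff of_int_le_iff mult.assoc)
    moreover have "A \<le> of_int k" "of_int k \<le> B" using S ik by auto
    ultimately show "A \<le> of_int (h (i, k)) \<and> of_int (h (i, k)) \<le> B + of_int (n * r * q)"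
      unfolding h_def by auto
  qed
  have nrq: "0 \<le> (of_int (n * r * q) :: real)" using n r1 q by simp
  have "real (card (T \<times> S)) = real (card (h ` (T \<times> S)))" using inj by (simp add: card_image)
  also have "\<dots> \<le> B + of_int (n * r * q) - A + 1"
    by (rule card_int_interval(2)[OF sub]) (use S(2) nrq in linarith)
  finally have "real (card (T \<times> S)) \<le> B - A + 1 + of_int (n * r * q)" by simp
  moreover have "real (card (T \<times> S)) = (of_int n + 1) * real (card S)"
    using n by (simp add: T_def card_cartesian_product)
  moreover have "(of_int (n * r * q) :: real) \<le> of_int Q / (2 * \<nu>)"
  proof -
    have "of_int r * \<nu> \<le> of_int r * \<bar>\<psi>\<bar>" using \<psi> r1 by (intro mult_left_mono) auto
    then have "of_int r * \<nu> \<le> 2 * \<rho>" using r \<psi> by linarith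
    then have "of_int r \<le> 2 * \<rho> / \<nu>" using \<nu> by (simp add: field_simps)
    then have "of_int n * of_int r * of_int q \<le> 1 / (4 * \<rho>) * (2 * \<rho> / \<nu>) * (of_int Q :: real)"
      using n r1 q \<rho> \<nu> by (intro mult_mono) auto
    also have "\<dots> = of_int Q / (2 * \<nu>)" using \<rho> \<nu> by (simp add: field_simps)
    finally show ?thesis by simp
  qed
  moreover have "1 / (4 * \<rho>) * real (card S) \<le> (of_int n + 1) * real (card S)"
    using n by (intro mult_right_mono) auto
  ultimately have "1 / (4 * \<rho>) * real (card S) \<le> B - A + 1 + of_int Q / (2 * \<nu>)" by linarith
  then show ?thesis using \<rho> by (simp add: field_simps)
qed

section \<open>Several scales: the Diophantine choice of the shears\<close>

text \<open>A lower bound opposite to Dirichlet's theorem. Together they supply the q that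
  \<open>card_close_phases\<close> needs, with a phase that is small but not too small.\<close>

definition generic :: "int \<Rightarrow> real \<Rightarrow> real \<Rightarrow> bool" where
  "generic Q \<nu> \<theta> \<longleftrightarrow> (\<forall>q z::int. 1 \<le> q \<longrightarrow> q \<le> Q \<longrightarrow> \<nu> \<le> \<bar>of_int q * \<theta> - of_int z\<bar>)"

text \<open>Combining the two good approximations eliminates \<beta> and leaves an integer of
  absolute value below 1, hence 0. Then P divides q * q' * (j - i), although P is prime and each
  factor would be nonzero and smaller than P in absolute value. So any slope is unlucky with at most
  one of the shears i/P.\<close>

lemma not_generic_unique:
  fixes Q P :: int and i j :: nat
  assumes P: "prime P" "Q < P" "int i < P" "int j < P" and Q: "1 \<le> Q" and \<nu>: "\<nu> * (2 * of_int Q * of_int P) \<le> 1"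
    and i: "\<not> generic Q \<nu> (\<beta> - i / of_int P)" and j: "\<not> generic Q \<nu> (\<beta> - j / of_int P)"
  shows "i = j"
proof (rule ccontr)
  assume "i \<noteq> j"
  obtain q z where q: "1 \<le> q" "q \<le> Q" "\<bar>of_int q * (\<beta> - i / of_int P) - of_int z\<bar> < \<nu>" using i by (auto simp: generic_def not_le)
  obtain q' z' where q': "1 \<le> q'" "q' \<le> Q" "\<bar>of_int q' * (\<beta> - j / of_int P) - of_int z'\<bar> < \<nu>" using j by (auto simp: generic_def not_le)
  have P0: "0 < (of_int P :: real)" using P Q by simp
  let ?u = "of_int q * (\<beta> - i / of_int P) - of_int z :: real" and ?v = "of_int q' * (\<beta> - j / of_int P) - of_int z' :: real"
  define N where "N = q * q' * (int j - int i) - P * (q' * z - q * z')"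
  have "of_int N = of_int P * (of_int q' * ?u - of_int q * ?v)"
    unfolding N_def using P0 by (simp add: field_simps)
  moreover have "\<bar>of_int q' * ?u - of_int q * ?v\<bar> < of_int q' * \<nu> + of_int q * \<nu>"
  proof -
    have "\<bar>of_int q' * ?u\<bar> < of_int q' * \<nu>" "\<bar>of_int q * ?v\<bar> < of_int q * \<nu>"
      unfolding abs_mult using q q' by auto
    then show ?thesis by linarith
  qed
  moreover have "of_int q' * \<nu> + of_int q * \<nu> \<le> 2 * of_int Q * \<nu>"
  proof -
    have "0 \<le> \<nu>" using q by linarith
    then have "of_int q' * \<nu> \<le> of_int Q * \<nu>" "of_int q * \<nu> \<le> of_int Q * \<nu>" using q q' by (auto intro!: mult_right_mono)
    then show ?thesis by linarith
  qed
  ultimately have "\<bar>of_int N :: real\<bar> < of_int P * (2 * of_int Q * \<nu>)" using P0 by (auto simp: abs_mult)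
  also have "\<dots> \<le> 1" using \<nu> by (simp add: mult_ac)
  finally have "N = 0" by linarith
  then have "P dvd q * q' * (int j - int i)" unfolding N_def by (metis dvd_triv_left eq_iff_diff_eq_0)
  then have "P dvd q \<or> P dvd q' \<or> P dvd int j - int i"
    using P(1) by (simp add: prime_dvd_mult_iff)
  moreover have "\<not> P dvd q" "\<not> P dvd q'" using q q' P zdvd_not_zless[of q P] zdvd_not_zless[of q' P] by auto
  moreover have "\<not> P dvd int j - int i"
  proof
    assume "P dvd int j - int i"
    then have "P \<le> \<bar>int j - int i\<bar>" using \<open>i \<noteq> j\<close> by (intro zdvd_imp_le) auto
    then show False using P by linarith
  qed
  ultimately show False by blast
qed

lemma sum_indicator_card:
  assumes "finite A" "X \<subseteq> A"
  shows "(\<Sum>i\<in>A. indicator X i :: real) = card X"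
proof -
  have "(\<Sum>i\<in>A. indicator X i :: real) = (\<Sum>i\<in>A. if i \<in> X then 1 else 0)"
    by (rule sum.cong) (auto simp: indicator_def)
  also have "\<dots> = card X"
    using assms by (simp add: sum.If_cases Int_absorb1)
  finally show ?thesis .
qed

text \<open>M layers with rapidly decreasing scales \<open>dd i\<close> and shears i/P.
  \<open>QD\<close> makes Dirichlet's error 1/Q at most the window 2 / (e * D) of two hits, and
  \<open>De8\<close> keeps that window below 1/2. \<open>dd_dec\<close> ensures that a rectangle is
  of intermediate length, neither shorter than the unit of a layer nor long enough for
  equidistribution, for at most one layer.\<close>

locale rounds = bump +
  fixes M :: nat and P Q :: int and \<nu> :: real and dd :: "nat \<Rightarrow> real"
  assumes De8: "8 / e \<le> D" and P: "prime P" "Q < P" "int M < P" and Q1: "1 \<le> Q" and QD: "e * D / 2 \<le> of_int Q"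
    and \<nu>: "0 < \<nu>" "\<nu> * (2 * of_int Q * of_int P) \<le> 1"
    and dd0: "\<And>i. 0 < dd i" and dd_dec: "\<And>i. dd (Suc i) * (1 + D + D * of_int Q / (2 * \<nu>)) \<le> dd i"
begin

text \<open>From this length on, the boundary terms of the hit count in \<open>mean_generic\<close>
  are at most its main term.\<close>

definition A0 :: real where "A0 = 1 + D + D * of_int Q / (2 * \<nu>)"

lemma A0_1: "1 \<le> A0"
  unfolding A0_def using D0 Q1 \<nu> by simp

lemma dd_less: "i < j \<Longrightarrow> dd j * A0 \<le> dd i"
proof (induction j)
  case (Suc j)
  have 1: "dd (Suc j) * A0 \<le> dd j" using dd_dec[of j] by (simp add: A0_def)
  show ?case
  proof (cases "i = j")
    case False
    then have "dd j * A0 \<le> dd i" using Suc by simp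
    moreover have "dd j * 1 \<le> dd j * A0" using A0_1 dd0[of j] by (intro mult_left_mono) auto
    ultimately show ?thesis using 1 by linarith
  qed (use 1 in simp)
qed simp

text \<open>Dirichlet's theorem gives q \<le> Q with phase at most \<rho> = 2 / (e * D), genericity
  bounds that phase below by \<nu>, and \<open>card_close_phases\<close> leaves a fraction of order
  \<rho> of the rows as hits. The gain over \<open>mean_F_le\<close> is a factor of order 1 / (e *
  D), enough to sum over M layers.\<close>

lemma mean_generic:
  assumes far: "far e s" and gen: "generic Q \<nu> (cos s / sin s - g)" and ab: "a < b" "c < d" and long: "A0 \<le> b - a"
  shows "\<bar>mean (F g) (rc s a b c d)\<bar> \<le> 16 * e' * 2^J / (e * D\<^sup>2)"
proof -
  let ?r = "b - a" and ?\<rho> = "2 / (e * D)"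
  let ?\<theta> = "cos s / sin s - g"
  have eD: "8 \<le> e * D" using De8 e by (simp add: field_simps)
  have \<rho>: "0 < ?\<rho>" "?\<rho> < 1/2" using eD D0 e by (auto simp: field_simps)
  obtain q z where q: "0 < q" "q \<le> Q" "\<bar>of_int q * ?\<theta> - of_int z\<bar> < 1 / of_int Q"
  proof -
    have "0 < nat Q" "int (nat Q) = Q" "real (nat Q) = of_int Q" using Q1 by auto
    then show thesis using Dirichlet_approx[of "nat Q" ?\<theta>] that by metis
  qed
  have Q\<rho>: "1 / of_int Q \<le> ?\<rho>" using QD eD Q1 by (simp add: field_simps)
  have n: "real (card (hit g s v a b)) \<le> 4 * ?\<rho> * (2 * ?r / D)" for v
  proof -
    let ?m = "((a + b)/2) * sin s + v * cos s"
    let ?h = "(b - a)/2 + 1/2"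
    have sub: "snd ` hit g s v a b \<subseteq> {k. (?m - ?h)/D \<le> of_int k \<and> of_int k \<le> (?m + ?h)/D}"
    proof
      fix k assume "k \<in> snd ` hit g s v a b"
      then obtain p where p: "p \<in> hit g s v a b" "k = snd p" by blast
      have "\<bar>D * of_int k - ?m\<bar> \<le> ?h" using hit_snd[OF p(1)] ab p(2) by simp
      then show "k \<in> {k. (?m - ?h)/D \<le> of_int k \<and> of_int k \<le> (?m + ?h)/D}"
        using D0 by (auto simp: pos_divide_le_eq pos_le_divide_eq mult.commute abs_le_iff)
    qed
    have "real (card (hit g s v a b)) = real (card (snd ` hit g s v a b))"
      using card_image[OF inj_hit[OF far]] by simp
    also have "\<dots> \<le> 4 * ?\<rho> * ((?m + ?h)/D - (?m - ?h)/D + 1 + of_int Q / (2 * \<nu>))"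
    proof (rule card_close_phases[OF sub, where q = q and zq = z and \<theta> = ?\<theta>])
      show "(?m - ?h)/D \<le> (?m + ?h)/D" using D0 ab by (intro divide_right_mono) auto
      fix k k' assume "k \<in> snd ` hit g s v a b" "k' \<in> snd ` hit g s v a b"
      then obtain p p' where p: "p \<in> hit g s v a b" "k = snd p" and p': "p' \<in> hit g s v a b" "k' = snd p'" by blast
      have "\<bar>of_int (k - k') * ?\<theta> - of_int (fst p - fst p')\<bar> \<le> 1 / (e * D) + 1 / (e * D)"
      proof -
        have "\<bar>x - x' - (y - y')\<bar> \<le> k + k" if "\<bar>x - w - y\<bar> \<le> k" "\<bar>x' - w - y'\<bar> \<le> k" for x x' y y' w k :: real
          using that by linarith
        from this[OF hit_phase[OF p(1) far] hit_phase[OF p'(1) far]] show ?thesis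
          unfolding p(2) p'(2) of_int_diff left_diff_distrib[of "of_int (snd p)" "of_int (snd p')"] .
      qed
      then show "\<exists>z::int. \<bar>of_int (k - k') * ?\<theta> - of_int z\<bar> \<le> ?\<rho>" by (intro exI[of _ "fst p - fst p'"]) (simp add: mult.commute)
    qed (use q Q\<rho> \<rho> \<nu> gen in \<open>auto simp: generic_def\<close>)
    also have "(?m + ?h)/D - (?m - ?h)/D + 1 + of_int Q / (2 * \<nu>) = (?r + A0) / D"
    proof -
      have "(?m + ?h)/D - (?m - ?h)/D = (?r + 1)/D" by (simp add: diff_divide_distrib[symmetric])
      moreover have "A0 / D = 1/D + 1 + of_int Q / (2 * \<nu>)" unfolding A0_def add_divide_distrib using D0 by simp
      ultimately show ?thesis by (simp add: add_divide_distrib)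
    qed
    also have "4 * ?\<rho> * ((?r + A0) / D) \<le> 4 * ?\<rho> * (2 * ?r / D)" using \<rho> D0 long by (intro mult_left_mono divide_right_mono) auto
    finally show ?thesis .
  qed
  have "\<bar>mean (F g) (rc s a b c d)\<bar> \<le> 4 * ?\<rho> * (2 * ?r / D) * (e' * 2^J) / ?r"
    by (rule mean_le_hits[OF far ab n])
  also have "\<dots> = 16 * e' * 2^J / (e * D\<^sup>2)"
  proof -
    have "4 * (2 / (e * D)) * (2 * r / D) * (e' * p) / r = 16 * e' * p / (e * D\<^sup>2)" if "r \<noteq> 0" for r p :: real
      using that D0 e by (simp add: field_simps power2_eq_square)
    moreover have "?r \<noteq> 0" using ab by simp
    ultimately show ?thesis by blast
  qed
  finally show ?thesis .
qed

definition gam :: "nat \<Rightarrow> real" where "gam i = i / of_int P"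

definition f :: "nat \<Rightarrow> real \<times> real \<Rightarrow> real" where
  "f i x = F (gam i) (x /\<^sub>R dd i)"

definition Z :: "real \<Rightarrow> nat \<Rightarrow> (real \<times> real) set" where
  "Z s i = {x. x /\<^sub>R dd i - ctr D (gam i) (x /\<^sub>R dd i) \<in> bad s}"

lemma f_measurable [measurable]: "f i \<in> borel_measurable borel"
  unfolding f_def[abs_def] by measurable

lemma abs_f_le: "\<bar>f i x\<bar> \<le> H"
  by (simp add: f_def abs_F_le)

text \<open>A layer contributes 0 if the rectangle is shorter than \<open>dd i\<close>, at most e'
  if its length is intermediate or the shear is not generic, and the small amount of
  \<open>mean_generic\<close> otherwise. Each of the two exceptional situations (\<open>?Y\<close>
  and \<open>?X\<close>) occurs for at most one layer, whence 2 * e'.\<close>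

lemma abs_mean_sum_long:
  assumes far: "far e s" and ab: "a < b" "c < d" "d - c \<le> b - a" and x: "x \<in> rc s a b c d" "\<And>i. i < M \<Longrightarrow> x \<notin> Z s i"
  shows "\<bar>mean (\<lambda>x. \<Sum>i<M. f i x) (rc s a b c d)\<bar> \<le> M * (16 * e' * 2^J / (e * D\<^sup>2)) + 2 * e'"
proof -
  let ?R = "rc s a b c d" and ?k = "16 * e' * 2^J / (e * D\<^sup>2)"
  let ?X = "{i. i < M \<and> \<not> generic Q \<nu> (cos s / sin s - gam i)}"
  let ?Y = "{i. i < M \<and> dd i \<le> b - a \<and> b - a < A0 * dd i}"
  have k0: "0 \<le> ?k" using e e' by simp
  have one: "\<bar>mean (f i) ?R\<bar> \<le> ?k + e' * indicator ?X i + e' * indicator ?Y i" if i: "i < M" for i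
  proof -
    have d0: "0 < dd i" by (rule dd0)
    let ?a = "a / dd i" and ?b = "b / dd i" and ?c = "c / dd i" and ?d = "d / dd i" and ?x = "x /\<^sub>R dd i"
    have m: "mean (f i) ?R = mean (F (gam i)) (rc s ?a ?b ?c ?d)"
      unfolding f_def[abs_def] by (rule mean_scale) (use ab d0 in auto)
    have ab': "?a < ?b" "?c < ?d" "?d - ?c \<le> ?b - ?a"
      using ab d0 by (auto simp: divide_strict_right_mono diff_divide_distrib[symmetric] divide_right_mono)
    have x': "?x \<in> rc s ?a ?b ?c ?d"
      using x(1) d0 by (auto simp: rc_def fu_scaleR fv_scaleR field_simps)
    have xb: "?x - ctr D (gam i) ?x \<notin> bad s" using x(2)[OF i] by (simp add: Z_def)
    have le: "\<bar>mean (f i) ?R\<bar> \<le> e'" unfolding m by (rule mean_F_le[OF far ab' x' xb])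
    have eq: "?b - ?a = (b - a) / dd i" by (simp add: diff_divide_distrib)
    consider "b - a < dd i" | "i \<in> ?Y" | "A0 * dd i \<le> b - a" using i by fastforce
    then show ?thesis
    proof cases
      case 1
      then have "?b - ?a < 1" unfolding eq using d0 by (simp add: pos_divide_less_eq)
      moreover from this have "?b - ?a < D / 4" using D64 by linarith
      ultimately have "mean (f i) ?R = 0" unfolding m using unpolluted(2)[OF far ab' _ x' xb] by blast
      then show ?thesis using k0 e' by simp
    next
      case 2
      then show ?thesis using le k0 e' by (simp add: indicator_def)
    next
      case 3
      show ?thesis
      proof (cases "i \<in> ?X")
        case True
        then show ?thesis using le k0 e' by (simp add: indicator_def)
      next
        case False
        then have "\<bar>mean (f i) ?R\<bar> \<le> ?k"
          unfolding m using i 3 d0 by (intro mean_generic[OF far _ ab'(1,2)]) (auto simp: eq pos_le_divide_eq)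
        then show ?thesis using e' by (simp add: indicator_def)
      qed
    qed
  qed
  have X: "card ?X \<le> 1"
  proof -
    have "i = j" if "i \<in> ?X" "j \<in> ?X" for i j
    proof (rule not_generic_unique[OF P(1,2) _ _ Q1 \<nu>(2)])
      show "int i < P" "int j < P" using that P(3) by auto
      show "\<not> generic Q \<nu> (cos s / sin s - real i / of_int P)" "\<not> generic Q \<nu> (cos s / sin s - real j / of_int P)" using that by (auto simp: gam_def)
    qed
    then show ?thesis by (subst card_le_Suc0_iff_eq[THEN iffD2, unfolded One_nat_def[symmetric]]) auto
  qed
  have Y: "card ?Y \<le> 1"
  proof -
    have "\<not> i < j" if "i \<in> ?Y" "j \<in> ?Y" for i j
      using that dd_less[of i j] by (auto simp: mult.commute)
    then have "i = j" if "i \<in> ?Y" "j \<in> ?Y" for i j using that by (meson linorder_neqE_nat)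
    then show ?thesis by (subst card_le_Suc0_iff_eq[THEN iffD2, unfolded One_nat_def[symmetric]]) auto
  qed
  have "mean (\<lambda>x. \<Sum>i<M. f i x) ?R = (\<Sum>i<M. mean (f i) ?R)"
    by (rule mean_sum[where B = "\<lambda>_. H"]) (use ab abs_f_le in auto)
  then have "\<bar>mean (\<lambda>x. \<Sum>i<M. f i x) ?R\<bar> \<le> (\<Sum>i<M. \<bar>mean (f i) ?R\<bar>)" by simp
  also have "\<dots> \<le> (\<Sum>i<M. ?k + e' * indicator ?X i + e' * indicator ?Y i)"
    by (intro sum_mono one) auto
  also have "\<dots> = M * ?k + e' * (\<Sum>i<M. indicator ?X i) + e' * (\<Sum>i<M. indicator ?Y i)"
    by (simp add: sum.distrib sum_distrib_left)
  also have "(\<Sum>i<M. indicator ?X i :: real) = card ?X"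
    by (rule sum_indicator_card) auto
  also have "(\<Sum>i<M. indicator ?Y i :: real) = card ?Y"
    by (rule sum_indicator_card) auto
  also have "M * ?k + e' * card ?X + e' * card ?Y \<le> M * ?k + e' * 1 + e' * 1"
    using X Y e' by (intro add_mono mult_left_mono) auto
  finally show ?thesis by simp
qed

lemma abs_mean_sum:
  assumes far: "far e s" and R: "R \<in> rectangles s" and x: "x \<in> R" "\<And>i. i < M \<Longrightarrow> x \<notin> Z s i"
  shows "\<bar>mean (\<lambda>x. \<Sum>i<M. f i x) R\<bar> \<le> M * (16 * e' * 2^J / (e * D\<^sup>2)) + 2 * e'"
proof -
  obtain a b c d where ab: "a < b" "c < d" and R': "R = rc s a b c d" using R unfolding rectangles_iff by blast
  show ?thesis
  proof (cases "d - c \<le> b - a")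
    case True
    then show ?thesis using abs_mean_sum_long[OF far ab] x R' by simp
  next
    case False
    have R'': "R = rc (s + pi/2) c d (- b) (- a)" unfolding R' rc_plus_pi2 by simp
    have "x \<notin> Z (s + pi/2) i" if "i < M" for i using x(2)[OF that] by (simp add: Z_def bad_pi2)
    then show ?thesis
      using abs_mean_sum_long[of "s + pi/2" c d "- b" "- a" x] far ab x(1) False unfolding R''[symmetric] far_pi2 by simp
  qed
qed

end

section \<open>Measures of periodic sets inside the unit ball\<close>

abbreviation V1 :: "(real \<times> real) set" where "V1 \<equiv> ball 0 1"

lemma emeasure_ball_le: "emeasure lborel (ball (0 :: real \<times> real) r) \<le> ennreal (4 * r\<^sup>2)"
proof (cases "0 \<le> r")
  case True
  have "ball (0 :: real \<times> real) r \<subseteq> {- r..r} \<times> {- r..r}"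
  proof
    fix z :: "real \<times> real" assume "z \<in> ball 0 r"
    then have "norm z < r" by simp
    moreover have "\<bar>fst z\<bar> \<le> norm z" "\<bar>snd z\<bar> \<le> norm z" using abs_fu_le[of 0 z] abs_fv_le[of 0 z] by (auto simp: fu_def fv_def)
    ultimately show "z \<in> {- r..r} \<times> {- r..r}" by (cases z) auto
  qed
  then have "emeasure lborel (ball (0 :: real \<times> real) r) \<le> emeasure lborel ({- r..r} \<times> {- r..r})"
    by (intro emeasure_mono) (auto intro: Times_sets)
  also have "\<dots> = ennreal (2 * r) * ennreal (2 * r)"
    using True by (subst emeasure_lborel_Times) auto
  also have "\<dots> = ennreal (4 * r\<^sup>2)" using True by (simp add: ennreal_mult[symmetric] power2_eq_square)
  finally show ?thesis .
qed (simp add: ball_empty)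

lemma measure_ball_le: "measure lborel (ball (0 :: real \<times> real) r) \<le> 4 * r\<^sup>2"
  using emeasure_ball_le[of r] by (simp add: measure_def enn2real_leI)

text \<open>By scaling, the annulus takes the fraction 2h - h^2 of the area of the ball, and that
  area is at most 4.\<close>

lemma emeasure_ball_annulus:
  assumes "0 \<le> h"
  shows "emeasure lborel (V1 - ball 0 (1 - h)) \<le> ennreal (8 * h)"
proof (cases "h < 1")
  case True
  let ?r = "1 - h"
  have r: "0 < ?r" using True by simp
  have "ball 0 ?r = {x :: real \<times> real. x /\<^sub>R ?r \<in> V1}"
    using r by (auto simp: divide_inverse[symmetric] field_simps)
  then have eq: "emeasure lborel (ball (0 :: real \<times> real) ?r) = ennreal (?r\<^sup>2) * emeasure lborel V1"
    using emeasure_scale[of V1 ?r] r by simp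
  have fin: "emeasure lborel V1 = ennreal (measure lborel V1)"
    by (rule emeasure_eq_ennreal_measure) (use emeasure_ball_le[of 1] in \<open>auto simp: top_unique\<close>)
  have "emeasure lborel (V1 - ball 0 ?r) = emeasure lborel V1 - emeasure lborel (ball (0 :: real \<times> real) ?r)"
    by (rule emeasure_Diff) (use assms in \<open>auto simp: eq fin ennreal_mult_eq_top_iff\<close>)
  also have "\<dots> = ennreal (measure lborel V1 - ?r\<^sup>2 * measure lborel V1)"
    unfolding eq fin by (simp add: ennreal_mult[symmetric] ennreal_minus)
  also have "\<dots> \<le> ennreal (8 * h)"
  proof (rule ennreal_leI)
    have "measure lborel V1 - ?r\<^sup>2 * measure lborel V1 = (2 * h - h\<^sup>2) * measure lborel V1"
      by (simp add: power2_eq_square algebra_simps)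
    also have "\<dots> \<le> (2 * h) * 4"
      using measure_ball_le[of 1] assms True by (intro mult_mono) auto
    finally show "measure lborel V1 - ?r\<^sup>2 * measure lborel V1 \<le> 8 * h" by simp
  qed
  finally show ?thesis .
next
  case False
  have "emeasure lborel (V1 - ball 0 (1 - h)) \<le> emeasure lborel V1" by (intro emeasure_mono) auto
  also have "\<dots> \<le> ennreal (4 * 1\<^sup>2)" by (rule emeasure_ball_le)
  also have "\<dots> \<le> ennreal (8 * h)" using False by (intro ennreal_leI) auto
  finally show ?thesis .
qed

lemma dist_same_cell:
  assumes D: "0 < D" and d: "0 < d" and eq: "ctr D g (x /\<^sub>R d) = ctr D g (y /\<^sub>R d)"
  shows "dist x y \<le> 2 * d * D"
proof -
  let ?p = "ctr D g (x /\<^sub>R d)"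
  have "norm (x /\<^sub>R d - ?p) \<le> D" "norm (y /\<^sub>R d - ?p) \<le> D"
    using norm_cell[OF diff_ctr_in_cell[OF D, of "x /\<^sub>R d" g] D] norm_cell[OF diff_ctr_in_cell[OF D, of "y /\<^sub>R d" g] D] eq by simp_all
  then have "norm (x /\<^sub>R d - y /\<^sub>R d) \<le> 2 * D"
    using norm_triangle_ineq4[of "x /\<^sub>R d - ?p" "y /\<^sub>R d - ?p"] by simp
  moreover have "norm (x /\<^sub>R d - y /\<^sub>R d) = dist x y / d"
    unfolding scaleR_diff_right[symmetric] dist_norm using d by (simp add: divide_inverse mult.commute)
  ultimately show ?thesis using d by (simp add: pos_divide_le_eq mult.commute mult.left_commute)
qed

text \<open>Two points of one rescaled cell are at distance at most 2 * d * D \<le> 1, so the cells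
  meeting the unit ball lie in the ball of radius 2. Its area is estimated by 16.\<close>

lemma density_le:
  fixes h :: "real \<times> real \<Rightarrow> real"
  assumes D: "0 < D" and d: "0 < d" "2 * d * D \<le> 1" and h: "h \<in> borel_measurable borel" and H: "\<And>z. 0 \<le> h z" "\<And>z. h z \<le> H"
  shows "(\<integral>\<^sup>+x. indicator V1 x * ennreal (per D g h (x /\<^sub>R d)) \<partial>lborel) \<le> ennreal (16 * (\<integral>z. indicator (cell D) z * h z \<partial>lborel) / D\<^sup>2)"
proof -
  define V where "V = {x. \<forall>y. cidx D g (y /\<^sub>R d) = cidx D g (x /\<^sub>R d) \<longrightarrow> y \<in> (ball 0 2 :: (real \<times> real) set)}"
  have H': "\<bar>h z\<bar> \<le> H" for z using H[of z] by simp
  note cells = cells_sets[OF bounded_ball D d(1) h H', of g 0 2, folded V_def] integral_cells[OF bounded_ball D d(1) h H', of g 0 2, folded V_def]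
  note [measurable] = cells(1) h
  have V2: "V \<subseteq> ball 0 2" unfolding V_def by blast
  have sub: "V1 \<subseteq> V"
  proof
    fix x :: "real \<times> real" assume x: "x \<in> V1"
    have "y \<in> ball 0 2" if "cidx D g (y /\<^sub>R d) = cidx D g (x /\<^sub>R d)" for y
    proof -
      have "dist x y \<le> 1" using dist_same_cell[OF D d(1), of g x y] that d(2) by (simp add: ctr_def)
      then show ?thesis using x dist_triangle[of 0 y x] by simp
    qed
    then show "x \<in> V" unfolding V_def by blast
  qed
  have mV: "emeasure lborel V \<le> ennreal 16"
    using emeasure_mono[OF V2, of lborel] emeasure_ball_le[of 2] by (simp add: order_trans)
  have int: "integrable lborel (\<lambda>x. indicator V x * per D g h (x /\<^sub>R d))"
  proof (rule integrableI_bounded_set[where A = V and B = H])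
    show "AE x in lborel. x \<in> V \<longrightarrow> norm (indicator V x * per D g h (x /\<^sub>R d)) \<le> H" using H' by (auto simp: per_def)
  qed (use mV in \<open>auto simp: order_le_less_trans\<close>)
  have "(\<integral>\<^sup>+x. indicator V1 x * ennreal (per D g h (x /\<^sub>R d)) \<partial>lborel) \<le> (\<integral>\<^sup>+x. ennreal (indicator V x * per D g h (x /\<^sub>R d)) \<partial>lborel)"
    by (rule nn_integral_mono) (use sub in \<open>auto simp: indicator_def\<close>)
  also have "\<dots> = ennreal (\<integral>x. indicator V x * per D g h (x /\<^sub>R d) \<partial>lborel)"
    by (rule nn_integral_eq_integral[OF int]) (use H in \<open>auto simp: per_def\<close>)
  also have "\<dots> \<le> ennreal (16 * (\<integral>z. indicator (cell D) z * h z \<partial>lborel) / D\<^sup>2)"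
  proof (rule ennreal_leI)
    have "measure lborel V \<le> 16" using mV by (simp add: measure_def enn2real_leI)
    moreover have "0 \<le> (\<integral>z. indicator (cell D) z * h z \<partial>lborel) / D\<^sup>2" using H by (intro divide_nonneg_nonneg integral_nonneg) auto
    ultimately have "(\<integral>z. indicator (cell D) z * h z \<partial>lborel) / D\<^sup>2 * measure lborel V \<le> (\<integral>z. indicator (cell D) z * h z \<partial>lborel) / D\<^sup>2 * 16"
      by (rule mult_left_mono)
    then show "(\<integral>x. indicator V x * per D g h (x /\<^sub>R d) \<partial>lborel) \<le> 16 * (\<integral>z. indicator (cell D) z * h z \<partial>lborel) / D\<^sup>2"
      unfolding cells(2) by (simp add: mult.commute)
  qed
  finally show ?thesis .
qed

lemma per_set_measurable [measurable]:
  assumes [measurable]: "W \<in> sets borel"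
  shows "{x. x /\<^sub>R d - ctr D g (x /\<^sub>R d) \<in> W} \<in> sets borel"
proof -
  have "(\<lambda>x. x /\<^sub>R d - ctr D g (x /\<^sub>R d)) \<in> borel_measurable borel" by measurable
  then have "(\<lambda>x. x /\<^sub>R d - ctr D g (x /\<^sub>R d)) -` W \<inter> space borel \<in> sets borel" by (rule measurable_sets) fact
  then show ?thesis by (simp add: vimage_def)
qed

lemma emeasure_density_le:
  assumes D: "0 < D" and d: "0 < d" "2 * d * D \<le> 1" and W: "W \<in> sets borel" "W \<subseteq> cell D"
    and le: "emeasure lborel W \<le> ennreal k" "0 \<le> k"
  shows "emeasure lborel (V1 \<inter> {x. x /\<^sub>R d - ctr D g (x /\<^sub>R d) \<in> W}) \<le> ennreal (16 * k / D\<^sup>2)"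
proof -
  note [measurable] = W(1)
  have "emeasure lborel (V1 \<inter> {x. x /\<^sub>R d - ctr D g (x /\<^sub>R d) \<in> W}) = (\<integral>\<^sup>+x. indicator (V1 \<inter> {x. x /\<^sub>R d - ctr D g (x /\<^sub>R d) \<in> W}) x \<partial>lborel)"
    by (rule nn_integral_indicator[symmetric]) measurable
  also have "\<dots> = (\<integral>\<^sup>+x. indicator V1 x * ennreal (per D g (indicator W) (x /\<^sub>R d)) \<partial>lborel)"
    by (rule nn_integral_cong) (auto simp: per_def indicator_def)
  also have "\<dots> \<le> ennreal (16 * (\<integral>z. indicator (cell D) z * indicator W z \<partial>lborel) / D\<^sup>2)"
    by (rule density_le[OF D d, where H = 1]) (auto simp: indicator_def)
  also have "(\<integral>z. indicator (cell D) z * indicator W z \<partial>lborel) = (\<integral>z. indicator W z \<partial>lborel :: real)"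
    by (rule Bochner_Integration.integral_cong) (use W in \<open>auto simp: indicator_def\<close>)
  also have "\<dots> = measure lborel W" by simp
  also have "ennreal (16 * measure lborel W / D\<^sup>2) \<le> ennreal (16 * k / D\<^sup>2)"
  proof -
    have "measure lborel W \<le> k" using le by (simp add: measure_def enn2real_leI)
    then show ?thesis using D by (intro ennreal_leI divide_right_mono) auto
  qed
  finally show ?thesis .
qed

section \<open>Large means on tangent rectangles at almost every point\<close>

text \<open>The level k of \<open>prof_tangent\<close>: the line \<open>fu s z = kap s\<close> is
  tangent to the parabola.\<close>

definition kap :: "real \<Rightarrow> real" where "kap s = cos s * (tan s)\<^sup>2 / 4"

text \<open>All these rectangles have one side on the tangent and the same area 2 * 2^(m+4), so each
  of them has the same lower bound for the mean of a bump. Their union is of order m times larger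
  than a single one, which is the logarithmic gain.\<close>

definition stair :: "nat \<Rightarrow> real \<Rightarrow> (real \<times> real) set" where
  "stair m s = (\<Union>j\<in>{..m}. rc s (kap s - 2^(j+2)) (kap s) (- (2^(m+2-j))) (2^(m+2-j)))"

text \<open>A thickened boundary of the rectangles of \<open>stair\<close>: every point within
  distance h of the stair that is not in it lies here.\<close>

definition shell :: "nat \<Rightarrow> real \<Rightarrow> real \<Rightarrow> (real \<times> real) set" where
  "shell m s h = (\<Union>j\<in>{..m}. rc s (kap s - 2^(j+2) - h) (kap s + h) (- (2^(m+2-j)) - h) (2^(m+2-j) + h)
      - rc s (kap s - 2^(j+2)) (kap s) (- (2^(m+2-j))) (2^(m+2-j)))"

lemma stair_sets [measurable]: "stair m s \<in> sets borel"
  unfolding stair_def by (intro sets.finite_UN) auto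

lemma shell_sets [measurable]: "shell m s h \<in> sets borel"
  unfolding shell_def by (intro sets.finite_UN) auto

lemma pow_le: "j \<le> m \<Longrightarrow> (2::real)^(j+2) \<le> 4 * 2^m" "(2::real)^(m+2-j) \<le> 4 * 2^m"
proof -
  have "(2::real)^(j+2) \<le> 2^(m+2)" if "j \<le> m" using that by (intro power_increasing) auto
  then show "j \<le> m \<Longrightarrow> (2::real)^(j+2) \<le> 4 * 2^m" by simp
  have "(2::real)^(m+2-j) \<le> 2^(m+2)" by (intro power_increasing) auto
  then show "(2::real)^(m+2-j) \<le> 4 * 2^m" by simp
qed

text \<open>The halves farthest from the tangent, with depth between 2^(j+1) and 2^(j+2), are
  disjoint for different j, and each has area 2^(m+4).\<close>

lemma emeasure_stair: "ennreal (m * 2^(m+4)) \<le> emeasure lborel (stair m s)"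
proof -
  let ?R = "\<lambda>j. rc s (kap s - 2^(j+2)) (kap s - 2^(j+1)) (- (2^(m+2-j))) (2^(m+2-j))"
  have disj: "disjoint_family_on ?R {1..m}"
  proof -
    have lt: "?R i \<inter> ?R j = {}" if "i < j" for i j :: nat
    proof -
      have "(2::real)^(i+2) \<le> 2^(j+1)" using that by (intro power_increasing) auto
      then show ?thesis by (auto simp: rc_def)
    qed
    show ?thesis unfolding disjoint_family_on_def
    proof (intro ballI impI)
      fix i j :: nat assume "i \<noteq> j"
      then show "?R i \<inter> ?R j = {}" using lt[of i j] lt[of j i] by (cases "i < j") auto
    qed
  qed
  have "ennreal (m * 2^(m+4)) = (\<Sum>j\<in>{1..m}. ennreal (2^(m+4)))"
    by (simp add: ennreal_mult ennreal_of_nat_eq_real_of_nat)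
  also have "\<dots> = (\<Sum>j\<in>{1..m}. emeasure lborel (?R j))"
  proof (rule sum.cong[OF refl])
    fix j assume j: "j \<in> {1..m}"
    have "(j+1) + (m+2-j) = m+3" using j by auto
    then have p3: "(2::real)^(j+1) * 2^(m+2-j) = 2^(m+3)" by (metis power_add)
    have gen: "(2 * y - y) * (2 * x) = 2 * (y * x)" for x y :: real by (simp add: algebra_simps)
    have "(2^(j+2) - 2^(j+1)) * (2 * 2^(m+2-j)) = 2 * ((2::real)^(j+1) * 2^(m+2-j))"
      using gen[of "2^(j+1)" "2^(m+2-j)"] by simp
    also have "\<dots> = 2^(m+4)" unfolding p3 by (simp add: power_add)
    finally have p4: "(2^(j+2) - 2^(j+1)) * (2 * 2^(m+2-j)) = (2::real)^(m+4)" .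
    have "emeasure lborel (?R j) = ennreal ((kap s - 2^(j+1) - (kap s - 2^(j+2))) * (2^(m+2-j) - - (2^(m+2-j))))"
      by (rule emeasure_rc) auto
    moreover have "(kap s - 2^(j+1) - (kap s - 2^(j+2))) * (2^(m+2-j) - - (2^(m+2-j))) = (2^(j+2) - 2^(j+1)) * (2 * 2^(m+2-j))" by simp
    ultimately show "ennreal (2^(m+4)) = emeasure lborel (?R j)" unfolding p4 by presburger
  qed
  also have "\<dots> = emeasure lborel (\<Union>j\<in>{1..m}. ?R j)"
    by (rule sum_emeasure[OF _ disj]) auto
  also have "\<dots> \<le> emeasure lborel (stair m s)"
  proof (rule emeasure_mono)
    show "(\<Union>j\<in>{1..m}. ?R j) \<subseteq> stair m s"
    proof
      fix x assume "x \<in> (\<Union>j\<in>{1..m}. ?R j)"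
      then obtain j where j: "j \<in> {1..m}" "x \<in> ?R j" by blast
      have "(0::real) < 2^(j+1)" by simp
      then have "x \<in> rc s (kap s - 2^(j+2)) (kap s) (- (2^(m+2-j))) (2^(m+2-j))"
        using j(2) unfolding rc_def mem_Collect_eq by linarith
      then show "x \<in> stair m s" unfolding stair_def using j(1) by auto
    qed
  qed auto
  finally show ?thesis .
qed

lemma emeasure_shell:
  assumes "0 \<le> h" "h \<le> 1"
  shows "emeasure lborel (shell m s h) \<le> ennreal ((real m + 1) * (32 * 2^m) * h)"
proof -
  let ?A = "\<lambda>j. rc s (kap s - 2^(j+2) - h) (kap s + h) (- (2^(m+2-j)) - h) (2^(m+2-j) + h)"
  let ?B = "\<lambda>j. rc s (kap s - 2^(j+2)) (kap s) (- (2^(m+2-j))) (2^(m+2-j))"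
  have "emeasure lborel (shell m s h) \<le> (\<Sum>j\<in>{..m}. emeasure lborel (?A j - ?B j))"
    unfolding shell_def by (rule emeasure_subadditive_finite) auto
  also have "\<dots> \<le> (\<Sum>j\<in>{..m}. ennreal (32 * 2^m * h))"
  proof (rule sum_mono)
    fix j assume j: "j \<in> {..m}"
    let ?a = "(2::real)^(j+2)" and ?b = "(2::real)^(m+2-j)"
    have ab: "?a \<le> 4 * 2^m" "?b \<le> 4 * 2^m" "0 < ?a" "0 < ?b" "(1::real) \<le> 2^m" using pow_le j by auto
    have eA: "emeasure lborel (?A j) = ennreal ((?a + 2*h) * (2 * ?b + 2*h))"
      using emeasure_rc[of "kap s - ?a - h" "kap s + h" "- ?b - h" "?b + h" s] assms ab by (simp add: algebra_simps)
    have eB: "emeasure lborel (?B j) = ennreal (?a * (2 * ?b))"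
      using emeasure_rc[of "kap s - ?a" "kap s" "- ?b" "?b" s] ab by simp
    have "emeasure lborel (?A j - ?B j) = emeasure lborel (?A j) - emeasure lborel (?B j)"
    proof (rule emeasure_Diff)
      show "?B j \<subseteq> ?A j" using assms by (auto simp: rc_def)
      show "emeasure lborel (?B j) \<noteq> \<infinity>" unfolding eB by simp
    qed simp_all
    also have "\<dots> = ennreal ((?a + 2*h) * (2 * ?b + 2*h) - ?a * (2 * ?b))"
      unfolding eA eB using ab by (subst ennreal_minus) auto
    also have "\<dots> \<le> ennreal (32 * 2^m * h)"
    proof (rule ennreal_leI)
      have "(?a + 2*h) * (2 * ?b + 2*h) - ?a * (2 * ?b) = (2 * ?a + 4 * ?b + 4 * h) * h" by (simp add: algebra_simps)
      also have "\<dots> \<le> (32 * 2^m) * h" using ab assms by (intro mult_right_mono) linarith+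
      finally show "(?a + 2*h) * (2 * ?b + 2*h) - ?a * (2 * ?b) \<le> 32 * 2^m * h" .
    qed
    finally show "emeasure lborel (?A j - ?B j) \<le> ennreal (32 * 2^m * h)" .
  qed
  also have "\<dots> = ennreal ((real m + 1) * (32 * 2^m) * h)"
    using assms by (subst sum_ennreal) (auto simp: algebra_simps)
  finally show ?thesis .
qed

lemma kap_bounds:
  assumes "0 < cos s" "\<bar>tan s\<bar> \<le> 1"
  shows "0 \<le> kap s" "kap s \<le> 1"
proof -
  have "(tan s)\<^sup>2 \<le> 1" using assms by (simp add: abs_square_le_1)
  then have "cos s * (tan s)\<^sup>2 \<le> 1 * 1" using assms by (intro mult_mono) auto
  then show "kap s \<le> 1" by (simp add: kap_def)
  show "0 \<le> kap s" using assms by (simp add: kap_def)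
qed

text \<open>\<open>Hmu\<close> equates the guaranteed integral of the bump over a tangent rectangle
  with B1 times the area 2 * 2^(m+4). The ratio K of consecutive scales is so large that cells of a
  finer layer are tiny for all coarser ones (\<open>KD\<close>) and that finer layers have means at
  most 1/M on rectangles of a coarser scale (\<open>KM\<close>).\<close>

locale stage = rounds +
  fixes m :: nat and B1 K d0 :: real
  assumes B1: "0 < B1" and Hmu: "H * (w * sqrt w / 2) = 2 * 2^(m+4) * B1" and sw: "sqrt w \<le> e / 4"
    and mJ: "m \<le> J" and dd_eq: "\<And>i. dd i = d0 / K^i" and d0: "0 < d0" "2 * d0 * D \<le> 1"
    and K1: "1 \<le> K" and KD: "2 * D \<le> K" and KM: "4 * H * D * M \<le> K"
begin

definition near :: "real \<Rightarrow> bool" where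
  "near s \<longleftrightarrow> 0 < cos s \<and> \<bar>tan s\<bar> \<le> e / 4"

lemma near_kap: "near s \<Longrightarrow> 0 \<le> kap s" "near s \<Longrightarrow> kap s \<le> 1"
  using kap_bounds[of s] e by (auto simp: near_def)

lemma dd_mono: "i \<le> j \<Longrightarrow> dd j \<le> dd i"
  unfolding dd_eq using d0 K1 by (intro divide_left_mono power_increasing) auto

lemma dd_le_d0: "dd i \<le> d0"
  using dd_mono[of 0 i] by (simp add: dd_eq)

lemma dd_K: "i < j \<Longrightarrow> dd j * K \<le> dd i"
proof -
  assume "i < j"
  then have "K ^ (i + 1) \<le> K ^ j" using K1 by (intro power_increasing) auto
  then have "d0 / K ^ j \<le> d0 / K ^ (i + 1)" using d0 K1 by (intro divide_left_mono) auto
  then have "dd j * K \<le> d0 / K ^ (i + 1) * K" unfolding dd_eq using K1 by (intro mult_right_mono) auto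
  also have "\<dots> = dd i" unfolding dd_eq using K1 by simp
  finally show "dd j * K \<le> dd i" .
qed

lemma dd_D: "2 * dd i * D \<le> 1"
proof -
  have "2 * dd i * D \<le> 2 * d0 * D" using dd_le_d0[of i] D0 by (intro mult_right_mono mult_left_mono) auto
  then show ?thesis using d0 by linarith
qed

lemma m_D: "64 * 2^m \<le> D"
  unfolding D_eq using mJ by (auto intro: power_increasing)

lemma cell_if_small:
  assumes "norm z \<le> 11 * 2^m"
  shows "z \<in> cell D"
proof -
  have "norm z < D/2" using m_D assms one_le_power[of "2::real" m] by linarith
  moreover have "\<bar>fst z\<bar> \<le> norm z" "\<bar>snd z\<bar> \<le> norm z" using abs_fu_le[of 0 z] abs_fv_le[of 0 z] by (auto simp: fu_def fv_def)
  ultimately show "z \<in> cell D" unfolding cell_def mem_Times_iff by auto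
qed

lemma rect_cell:
  assumes s: "near s" and j: "j \<le> m" and h: "h \<le> 1"
    and z: "z \<in> rc s (kap s - 2^(j+2) - h) (kap s + h) (- (2^(m+2-j)) - h) (2^(m+2-j) + h)"
  shows "z \<in> cell D"
proof (rule cell_if_small)
  have ab: "(2::real)^(j+2) \<le> 4 * 2^m" "(2::real)^(m+2-j) \<le> 4 * 2^m" "(1::real) \<le> 2^m" using pow_le j by auto
  have "\<bar>fu s z\<bar> \<le> 4 * 2^m + 2" "\<bar>fv s z\<bar> \<le> 4 * 2^m + 1"
    using z ab h near_kap[OF s] unfolding rc_def mem_Collect_eq by linarith+
  then show "norm z \<le> 11 * 2^m" using norm_le_fu_fv[of z s] ab by linarith
qed

lemma stair_cell: "near s \<Longrightarrow> stair m s \<subseteq> cell D"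
  unfolding stair_def using rect_cell[of s _ 0] by fastforce

lemma shell_cell: "near s \<Longrightarrow> h \<le> 1 \<Longrightarrow> shell m s h \<subseteq> cell D"
  unfolding shell_def using rect_cell by fastforce

definition G :: "real \<Rightarrow> nat \<Rightarrow> (real \<times> real) set" where
  "G s i = {x. x /\<^sub>R dd i - ctr D (gam i) (x /\<^sub>R dd i) \<in> stair m s}"

lemma G_sets [measurable]: "G s i \<in> sets borel"
  unfolding G_def by measurable

definition sh :: "real \<Rightarrow> real \<Rightarrow> nat \<Rightarrow> (real \<times> real) set" where
  "sh s h l = {x. x /\<^sub>R dd l - ctr D (gam l) (x /\<^sub>R dd l) \<in> shell m s (h / dd l)}"

lemma sh_sets [measurable]: "sh s h l \<in> sets borel"
  unfolding sh_def by measurable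

text \<open>The displacement h is at most the unit \<open>dd l\<close> of the layer, so the moved
  point stays in the cell of the same centre, where only the thickened rectangles have to be
  compared.\<close>

lemma near_stair_point:
  assumes s: "near s" and y: "y \<in> G s l" and d: "dist x y \<le> h" and h: "h \<le> dd l"
  shows "x \<in> G s l \<or> x \<in> sh s h l"
proof -
  let ?q = "ctr D (gam l) (y /\<^sub>R dd l)" and ?h = "h / dd l"
  let ?z = "x /\<^sub>R dd l - ?q"
  have dl: "0 < dd l" by (rule dd0)
  have h1: "?h \<le> 1" using h dl by simp
  obtain j where j: "j \<le> m" and yj: "y /\<^sub>R dd l - ?q \<in> rc s (kap s - 2^(j+2)) (kap s) (- (2^(m+2-j))) (2^(m+2-j))"
    using y by (auto simp: G_def stair_def)
  have "\<bar>fu s (?z - (y /\<^sub>R dd l - ?q))\<bar> \<le> ?h" "\<bar>fv s (?z - (y /\<^sub>R dd l - ?q))\<bar> \<le> ?h"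
  proof -
    have "norm (?z - (y /\<^sub>R dd l - ?q)) = dist x y / dd l"
      using dl by (simp add: dist_norm divide_inverse mult.commute flip: scaleR_diff_right)
    also have "\<dots> \<le> ?h" using d dl by (simp add: divide_right_mono)
    finally show "\<bar>fu s (?z - (y /\<^sub>R dd l - ?q))\<bar> \<le> ?h" "\<bar>fv s (?z - (y /\<^sub>R dd l - ?q))\<bar> \<le> ?h"
      using abs_fu_le abs_fv_le order_trans by blast+
  qed
  then have z: "?z \<in> rc s (kap s - 2^(j+2) - ?h) (kap s + ?h) (- (2^(m+2-j)) - ?h) (2^(m+2-j) + ?h)"
    using yj unfolding fu_diff[of s ?z] fv_diff[of s ?z] rc_def mem_Collect_eq by linarith
  have "ctr D (gam l) (x /\<^sub>R dd l) = ?q"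
    using ctr_eqI[OF D0, of "x /\<^sub>R dd l" "gam l" "cidx D (gam l) (y /\<^sub>R dd l)"] rect_cell[OF s j h1 z] by (simp add: ctr_def)
  then show ?thesis using z j unfolding G_def sh_def stair_def shell_def by auto
qed

lemma emeasure_sh:
  assumes s: "near s" and h: "0 \<le> h" "h \<le> dd l"
  shows "emeasure lborel (V1 \<inter> sh s h l) \<le> ennreal (8 * (real m + 1) * (h / dd l) / D)"
proof -
  have dl: "0 < dd l" by (rule dd0)
  have h1: "0 \<le> h / dd l" "h / dd l \<le> 1" using h dl by auto
  have "emeasure lborel (V1 \<inter> sh s h l) \<le> ennreal (16 * ((real m + 1) * (32 * 2^m) * (h / dd l)) / D\<^sup>2)"
    unfolding sh_def
    by (rule emeasure_density_le[OF D0 dl dd_D shell_sets shell_cell[OF s h1(2)] emeasure_shell[OF h1]])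
      (use h1 in \<open>intro mult_nonneg_nonneg; simp\<close>)
  also have "\<dots> \<le> ennreal (8 * (real m + 1) * (h / dd l) / D)"
  proof (rule ennreal_leI)
    have "16 * ((real m + 1) * (32 * 2^m) * (h / dd l)) \<le> 16 * ((real m + 1) * (D/2) * (h / dd l))"
      using m_D h1 by (intro mult_left_mono mult_right_mono) auto
    then have "16 * ((real m + 1) * (32 * 2^m) * (h / dd l)) / D\<^sup>2 \<le> 16 * ((real m + 1) * (D/2) * (h / dd l)) / D\<^sup>2"
      by (intro divide_right_mono) auto
    also have "\<dots> = 8 * (real m + 1) * (h / dd l) / D" using D0 by (simp add: power2_eq_square)
    finally show "16 * ((real m + 1) * (32 * 2^m) * (h / dd l)) / D\<^sup>2 \<le> 8 * (real m + 1) * (h / dd l) / D" .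
  qed
  finally show ?thesis .
qed

text \<open>A lower bound for the proportion of a cell that \<open>stair\<close> fills.\<close>

definition p :: real where "p = m * 2^(m+4) / D\<^sup>2"

text \<open>Twice the measure that boundary cells can spoil in one step of
  \<open>uncovered\<close>.\<close>

definition err :: real where "err = 32 * D * d0 + 32 * M * (real m + 1) / K"

lemma p_bounds: "0 \<le> p" "p \<le> 1"
proof -
  show "0 \<le> p" by (simp add: p_def)
  have "real m \<le> 2^m" by (metis less_exp less_imp_le of_nat_le_iff of_nat_power of_nat_numeral)
  then have "real m * 2^(m+4) \<le> 2^m * (16 * 2^m)" by (simp add: power_add mult_mono)
  also have "\<dots> \<le> D * D" using m_D by (intro mult_mono) (auto intro: order_trans[OF _ m_D])
  finally show "p \<le> 1" using D0 by (simp add: p_def power2_eq_square)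
qed

text \<open>The layers behave like independent trials. The part left uncovered by the first n layers
  is coarse compared with the cells of layer n, so by \<open>periodic_average\<close> the next
  stairs cover at least the proportion p of it, up to boundary cells.\<close>

lemma uncovered:
  assumes s: "near s"
  shows "n \<le> M \<Longrightarrow> measure lborel (V1 - (\<Union>i<n. G s i)) \<le> 4 * (1 - p)^n + n * err"
proof (induction n)
  case 0
  show ?case using measure_ball_le[of 1] by simp
next
  case (Suc n)
  let ?U = "V1 - (\<Union>i<n. G s i)"
  have nM: "n < M" using Suc.prems by simp
  \<comment> \<open>Two points in one cell of layer n are at distance at most h.\<close>
  define h where "h = 2 * dd n * D"
  have h0: "0 \<le> h" using dd0[of n] D0 by (simp add: h_def)
  have hl: "h * K \<le> 2 * D * dd l" if "l < n" for l
  proof -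
    have "h * K = 2 * D * (dd n * K)" by (simp add: h_def)
    also have "\<dots> \<le> 2 * D * dd l" using dd_K[OF that] D0 by (intro mult_left_mono) auto
    finally show ?thesis .
  qed
  have hdl: "h / dd l \<le> 2 * D / K" if "l < n" for l
    using hl[OF that] dd0[of l] K1 by (simp add: field_simps)
  have h_le: "h \<le> dd l" if "l < n" for l
  proof -
    have "2 * D * dd l \<le> K * dd l" using KD dd0[of l] by (intro mult_right_mono) auto
    then have "K * h \<le> K * dd l" using hl[OF that] by (simp add: mult.commute)
    then show ?thesis using K1 by simp
  qed
  \<comment> \<open>All points of \<open>?U\<close> within h of its complement: near the unit
    circle, or near a stair of an earlier layer.\<close>
  let ?N = "(V1 - ball 0 (1 - h)) \<union> (\<Union>l\<in>{..<n}. V1 \<inter> sh s h l)"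
  let ?n = "16 * D * d0 + 16 * M * (real m + 1) / K"
  have [measurable]: "?U \<in> sets borel" by (intro sets.Diff sets.finite_UN) auto
  have Nsets: "?N \<in> sets borel" by (intro sets.Un sets.Diff sets.finite_UN) auto
  have N: "emeasure lborel ?N \<le> ennreal ?n"
  proof -
    have "emeasure lborel ?N \<le> emeasure lborel (V1 - ball 0 (1 - h)) + emeasure lborel (\<Union>l\<in>{..<n}. V1 \<inter> sh s h l)"
      by (rule emeasure_subadditive) (auto intro!: sets.Diff sets.finite_UN)
    also have "\<dots> \<le> ennreal (8 * h) + (\<Sum>l\<in>{..<n}. emeasure lborel (V1 \<inter> sh s h l))"
      using h0 by (intro add_mono emeasure_ball_annulus emeasure_subadditive_finite) auto
    also have "\<dots> \<le> ennreal (8 * h) + (\<Sum>l\<in>{..<n}. ennreal (16 * (real m + 1) / K))"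
    proof (intro add_left_mono sum_mono)
      fix l assume "l \<in> {..<n}"
      then have l: "l < n" by simp
      have "emeasure lborel (V1 \<inter> sh s h l) \<le> ennreal (8 * (real m + 1) * (h / dd l) / D)"
        by (rule emeasure_sh[OF s h0 h_le[OF l]])
      also have "\<dots> \<le> ennreal (16 * (real m + 1) / K)"
      proof (rule ennreal_leI)
        have "8 * (real m + 1) * (h / dd l) / D \<le> 8 * (real m + 1) * (2 * D / K) / D"
          using hdl[OF l] D0 by (intro divide_right_mono mult_left_mono) auto
        also have "\<dots> = 16 * (real m + 1) / K" using D0 by simp
        finally show "8 * (real m + 1) * (h / dd l) / D \<le> 16 * (real m + 1) / K" .
      qed
      finally show "emeasure lborel (V1 \<inter> sh s h l) \<le> ennreal (16 * (real m + 1) / K)" .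
    qed
    also have "\<dots> = ennreal (8 * h + n * (16 * (real m + 1) / K))"
      using h0 K1 by (subst sum_ennreal) (auto simp flip: ennreal_plus)
    also have "\<dots> \<le> ennreal ?n"
    proof (rule ennreal_leI)
      have "8 * h \<le> 16 * D * d0" unfolding h_def using dd_le_d0[of n] D0 by simp
      moreover have "n * (16 * (real m + 1) / K) \<le> M * (16 * (real m + 1) / K)"
        using nM K1 by (intro mult_right_mono) auto
      ultimately show "8 * h + n * (16 * (real m + 1) / K) \<le> ?n" by (simp add: mult.assoc mult.left_commute)
    qed
    finally show ?thesis .
  qed
  have n0: "0 \<le> ?n" using D0 d0 K1 by simp
  have closed: "y \<in> ?U" if x: "x \<in> ?U - ?N" and xy: "dist x y \<le> 2 * dd n * D" for x y
  proof -
    have "norm x < 1 - h" using x by auto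
    moreover have "norm y \<le> norm x + dist x y" using norm_triangle_sub[of y x] by (simp add: dist_norm norm_minus_commute)
    ultimately have "y \<in> V1" using xy by (simp add: h_def)
    moreover have "y \<notin> G s l" if "l < n" for l
    proof
      assume "y \<in> G s l"
      then have "x \<in> G s l \<or> x \<in> sh s h l"
        using near_stair_point[OF s _ _ h_le[OF that]] xy by (simp add: h_def)
      then show False using x that by auto
    qed
    ultimately show ?thesis by auto
  qed
  have bdd: "bounded ?U" by (rule bounded_subset[OF bounded_ball[of 0 1]]) auto
  have avg: "\<bar>(\<integral>x. indicator ?U x * per D (gam n) (indicator (stair m s)) (x /\<^sub>R dd n) \<partial>lborel)
     - (\<integral>z. indicator (cell D) z * indicator (stair m s) z \<partial>lborel) / D\<^sup>2 * measure lborel ?U\<bar> \<le> 2 * 1 * ?n"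
    by (rule periodic_average[OF bdd _ D0 dd0 _ _ Nsets N n0 closed]) (auto simp: indicator_def)
  have finU: "emeasure lborel A < \<infinity>" if "A \<subseteq> V1" for A
  proof -
    have "emeasure lborel A \<le> emeasure lborel V1" using that by (intro emeasure_mono) auto
    also have "\<dots> \<le> ennreal (4 * 1\<^sup>2)" by (rule emeasure_ball_le)
    also have "\<dots> < \<infinity>" by simp
    finally show ?thesis .
  qed
  have i1: "(\<integral>x. indicator ?U x * per D (gam n) (indicator (stair m s)) (x /\<^sub>R dd n) \<partial>lborel) = measure lborel (?U \<inter> G s n)"
  proof -
    have "(\<integral>x. indicator ?U x * per D (gam n) (indicator (stair m s)) (x /\<^sub>R dd n) \<partial>lborel) = (\<integral>x. (indicator (?U \<inter> G s n) x :: real) \<partial>lborel)"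
      by (rule Bochner_Integration.integral_cong) (auto simp: per_def G_def indicator_def)
    then show ?thesis by simp
  qed
  have fs: "emeasure lborel (stair m s) < \<infinity>"
    using emeasure_mono[OF stair_cell[OF s], of lborel] by (auto simp: emeasure_cell D0 order_le_less_trans)
  have "real m * 2^(m+4) \<le> measure lborel (stair m s)"
    using emeasure_stair[of m s] fs by (simp add: emeasure_eq_ennreal_measure)
  moreover have "(\<integral>z. indicator (cell D) z * indicator (stair m s) z \<partial>lborel) = measure lborel (stair m s)"
  proof -
    have "(\<integral>z. indicator (cell D) z * indicator (stair m s) z \<partial>lborel) = (\<integral>z. indicator (stair m s) z \<partial>lborel :: real)"
      by (rule Bochner_Integration.integral_cong) (use stair_cell[OF s] in \<open>auto simp: indicator_def\<close>)
    then show ?thesis by simp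
  qed
  ultimately have "p * measure lborel ?U \<le> (\<integral>z. indicator (cell D) z * indicator (stair m s) z \<partial>lborel) / D\<^sup>2 * measure lborel ?U"
    unfolding p_def by (intro mult_right_mono divide_right_mono) auto
  then have G: "p * measure lborel ?U - 2 * ?n \<le> measure lborel (?U \<inter> G s n)"
    using avg unfolding i1 by linarith
  have split: "V1 - (\<Union>i<Suc n. G s i) = ?U - (?U \<inter> G s n)" by (auto simp: less_Suc_eq)
  have "measure lborel (?U - (?U \<inter> G s n)) = measure lborel ?U - measure lborel (?U \<inter> G s n)"
  proof (rule measure_Diff)
    show "emeasure lborel ?U \<noteq> \<infinity>" using finU[of ?U] by fastforce
    show "?U \<in> sets lborel" by simp
    show "?U \<inter> G s n \<in> sets lborel" using \<open>?U \<in> sets borel\<close> by simp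
  qed auto
  then have "measure lborel (V1 - (\<Union>i<Suc n. G s i)) = measure lborel ?U - measure lborel (?U \<inter> G s n)"
    unfolding split .
  also have "\<dots> \<le> (1 - p) * measure lborel ?U + err"
    using G by (simp add: err_def algebra_simps)
  also have "\<dots> \<le> (1 - p) * (4 * (1 - p)^n + n * err) + err"
    using Suc p_bounds by (intro add_right_mono mult_left_mono) auto
  also have "\<dots> \<le> 4 * (1 - p)^Suc n + (n * err) + err"
  proof -
    have "0 \<le> n * err" unfolding err_def using D0 d0 K1 by simp
    then have "(1 - p) * (n * err) \<le> 1 * (n * err)" using p_bounds by (intro mult_right_mono) auto
    then show ?thesis by (simp add: algebra_simps)
  qed
  finally show ?case by (simp add: algebra_simps)
qed

lemma integral_bmp: "(\<integral>z. bmp z \<partial>lborel) = 0"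
  unfolding bmp_def using integral_prof[of w "e/4"] e w by simp

lemma integral_cell_bmp: "(\<integral>z. indicator (cell D) z * bmp z \<partial>lborel) = 0"
proof -
  have "(\<integral>z. indicator (cell D) z * bmp z \<partial>lborel) = (\<integral>z. bmp z \<partial>lborel)"
    by (rule Bochner_Integration.integral_cong) (use bmp_cell in \<open>auto simp: indicator_def\<close>)
  then show ?thesis by (simp add: integral_bmp)
qed

text \<open>The finer layer has integral 0 over each of its cells, so only cells cut by the boundary
  of the rectangle contribute. They lie in a strip of width h along that boundary, and h /
  \<open>dd i\<close> \<le> 2 * D / K makes their share at most 1/M by \<open>KM\<close>.\<close>

lemma fine_mean:
  assumes il: "i < l" and ab: "4 * dd i \<le> b - a" "8 * dd i \<le> d - c"
  shows "\<bar>mean (f l) (rc s a b c d)\<bar> * M \<le> 1"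
proof -
  let ?R = "rc s a b c d" and ?A = "b - a" and ?B = "d - c"
  define h where "h = 2 * dd l * D"
  have di: "0 < dd i" "0 < dd l" by (rule dd0)+
  have h0: "0 < h" using di D0 by (simp add: h_def)
  have "h * K = 2 * D * (dd l * K)" by (simp add: h_def)
  also have "\<dots> \<le> 2 * D * dd i" using dd_K[OF il] D0 by (intro mult_left_mono) auto
  finally have hK: "h * K \<le> 2 * D * dd i" .
  also have "\<dots> \<le> K * dd i" using KD di by (intro mult_right_mono) auto
  finally have hi: "h \<le> dd i" using K1 by simp
  have ab': "a < b" "c < d" using ab di by linarith+
  let ?S = "rc s (a + h) (b - h) (c + h) (d - h)"
  have eS: "emeasure lborel ?S = ennreal ((?A - 2*h) * (?B - 2*h))"
    using emeasure_rc[of "a + h" "b - h" "c + h" "d - h" s] ab hi di by (simp add: algebra_simps)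
  have eR: "emeasure lborel ?R = ennreal (?A * ?B)" using ab' by (simp add: emeasure_rc)
  have "emeasure lborel (?R - ?S) = emeasure lborel ?R - emeasure lborel ?S"
  proof (rule emeasure_Diff)
    show "?S \<subseteq> ?R" using h0 by (auto simp: rc_def)
    show "emeasure lborel ?S \<noteq> \<infinity>" unfolding eS by simp
  qed auto
  also have "\<dots> = ennreal (?A * ?B - (?A - 2*h) * (?B - 2*h))"
    unfolding eR eS using ab hi di by (intro ennreal_minus mult_nonneg_nonneg) auto
  also have "\<dots> \<le> ennreal (2 * h * (?A + ?B))"
  proof (rule ennreal_leI)
    have "?A * ?B - (?A - 2*h) * (?B - 2*h) = 2 * h * (?A + ?B) - 4 * h\<^sup>2" by (simp add: power2_eq_square algebra_simps)
    then show "?A * ?B - (?A - 2*h) * (?B - 2*h) \<le> 2 * h * (?A + ?B)" by simp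
  qed
  finally have N: "emeasure lborel (?R - ?S) \<le> ennreal (2 * h * (?A + ?B))" .
  have closed: "y \<in> ?R" if x: "x \<in> ?R - (?R - ?S)" and xy: "dist x y \<le> 2 * dd l * D" for x y
  proof -
    have "\<bar>fu s x - fu s y\<bar> \<le> h" "\<bar>fv s x - fv s y\<bar> \<le> h"
      using abs_fu_le[of s "x - y"] abs_fv_le[of s "x - y"] xy by (auto simp: h_def dist_norm fu_diff fv_diff)
    then show ?thesis using x unfolding rc_def by auto
  qed
  have "\<bar>(\<integral>x. indicator ?R x * per D (gam l) bmp (x /\<^sub>R dd l) \<partial>lborel) - (\<integral>z. indicator (cell D) z * bmp z \<partial>lborel) / D\<^sup>2 * measure lborel ?R\<bar> \<le> 2 * H * (2 * h * (?A + ?B))"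
    by (rule periodic_average[OF bounded_rc _ D0 dd0 _ abs_bmp_le _ N _ closed]) (use h0 ab' in auto)
  then have I: "\<bar>\<integral>x. indicator ?R x * f l x \<partial>lborel\<bar> \<le> 4 * H * h * (?A + ?B)"
    unfolding integral_cell_bmp by (simp add: f_def F_def)
  have "\<bar>mean (f l) ?R\<bar> = \<bar>\<integral>x. indicator ?R x * f l x \<partial>lborel\<bar> / (?A * ?B)"
    using ab' by (simp add: mean_eq measure_rc abs_mult)
  also have "\<dots> \<le> (4 * H * h * (?A + ?B)) / (?A * ?B)"
    using I ab' by (intro divide_right_mono) auto
  also have "\<dots> = 4 * H * h * (1 / ?A + 1 / ?B)" using ab' by (simp add: field_simps)
  also have "\<dots> \<le> 4 * H * h * (1 / (4 * dd i) + 1 / (8 * dd i))"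
    using H h0 ab ab' di by (intro mult_left_mono add_mono divide_left_mono) auto
  also have "\<dots> \<le> 2 * H * (h / dd i)" using H h0 di by (simp add: field_simps)
  also have "\<dots> \<le> 2 * H * (2 * D / K)"
    using hK H di K1 by (intro mult_left_mono) (auto simp: field_simps)
  finally have "\<bar>mean (f l) ?R\<bar> \<le> 4 * H * D / K" by simp
  then have "\<bar>mean (f l) ?R\<bar> * M \<le> 4 * H * D / K * M" by (intro mult_right_mono) auto
  also have "\<dots> \<le> 1" using KM K1 by (simp add: field_simps)
  finally show ?thesis .
qed

definition box2 :: "(real \<times> real) set" where "box2 = {-2..2} \<times> {-2..2}"

text \<open>The points near a bump of layer i. Outside this sparse set the layer vanishes in the
  whole disc of radius \<open>dd i\<close> (\<open>coarse_zero\<close>), hence on every rectangle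
  that belongs to a finer scale.\<close>

definition W :: "nat \<Rightarrow> (real \<times> real) set" where
  "W i = {x. x /\<^sub>R dd i - ctr D (gam i) (x /\<^sub>R dd i) \<in> box2}"

lemma W_sets [measurable]: "W i \<in> sets borel"
  unfolding W_def by (rule per_set_measurable) (simp add: box2_def Times_sets)

lemma box2_cell: "box2 \<subseteq> cell D"
  unfolding box2_def cell_def using D64 by auto

lemma emeasure_W: "emeasure lborel (V1 \<inter> W i) \<le> ennreal (256 / D\<^sup>2)"
proof -
  have "emeasure lborel box2 \<le> ennreal 16"
    unfolding box2_def by (subst emeasure_lborel_Times) (auto simp: ennreal_mult[symmetric])
  from emeasure_density_le[OF D0 dd0 dd_D _ box2_cell this, of i "gam i"] show ?thesis
    unfolding W_def box2_def by (simp add: Times_sets)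
qed

lemma coarse_zero:
  assumes x: "x \<notin> W l" and xy: "dist x y \<le> dd l"
  shows "f l y = 0"
proof (rule ccontr)
  assume "f l y \<noteq> 0"
  then have n: "F (gam l) (y /\<^sub>R dd l) \<noteq> 0" by (simp add: f_def)
  let ?q = "lat D (gam l) (cidx D (gam l) (y /\<^sub>R dd l))"
  have dl: "0 < dd l" by (rule dd0)
  have yq: "\<bar>fst (y /\<^sub>R dd l - ?q)\<bar> < 1/2" "\<bar>snd (y /\<^sub>R dd l - ?q)\<bar> < 1/2"
    using F_nonzero[OF n] bmp_support by blast+
  have "norm (x /\<^sub>R dd l - y /\<^sub>R dd l) = dist x y / dd l"
    using dl by (simp add: dist_norm divide_inverse mult.commute flip: scaleR_diff_right)
  also have "\<dots> \<le> 1" using xy dl by simp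
  finally have "\<bar>fst (x /\<^sub>R dd l - y /\<^sub>R dd l)\<bar> \<le> 1" "\<bar>snd (x /\<^sub>R dd l - y /\<^sub>R dd l)\<bar> \<le> 1"
    using abs_fu_le[of 0 "x /\<^sub>R dd l - y /\<^sub>R dd l"] abs_fv_le[of 0 "x /\<^sub>R dd l - y /\<^sub>R dd l"] by (auto simp: fu_def fv_def)
  then have b: "x /\<^sub>R dd l - ?q \<in> box2" using yq unfolding box2_def mem_Times_iff fst_diff snd_diff atLeastAtMost_iff by linarith
  then have "ctr D (gam l) (x /\<^sub>R dd l) = ?q" using ctr_eqI[OF D0] box2_cell by blast
  then show False using b x by (simp add: W_def)
qed

text \<open>The rectangle of the stair containing x gets mean at least B1 from its own layer.
  Coarser layers vanish on it because x avoids their \<open>W l\<close>, and the finer ones cost at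
  most 1/M each, so the loss is at most 1. The lower bound for the area later provides the \<gamma>
  of \<open>blk\<close>.\<close>

lemma good_mean:
  assumes s: "near s" and x: "x \<in> G s i" and iM: "i < M" and W: "\<And>l. l < i \<Longrightarrow> x \<notin> W l"
  shows "\<exists>R\<in>rectangles s. x \<in> R \<and> diameter R \<le> d0 * D \<and> (dd M)\<^sup>2 \<le> measure lborel R \<and> B1 - 1 \<le> mean (\<lambda>x. \<Sum>i<M. f i x) R"
proof -
  let ?g = "gam i" and ?d = "dd i"
  let ?q = "lat D ?g (cidx D ?g (x /\<^sub>R ?d))"
  have d: "0 < ?d" by (rule dd0)
  obtain j where j: "j \<le> m" and xj: "x /\<^sub>R ?d - ?q \<in> rc s (kap s - 2^(j+2)) (kap s) (- (2^(m+2-j))) (2^(m+2-j))"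
    using x by (auto simp: G_def stair_def ctr_def)
  let ?A = "(2::real)^(j+2)" and ?B = "(2::real)^(m+2-j)"
  have A: "4 \<le> ?A" "?A \<le> 4 * 2^m" using pow_le(1)[OF j] one_le_power[of "2::real" j] by auto
  have B: "4 \<le> ?B" "?B \<le> 4 * 2^m"
  proof -
    have "(2::real)^2 \<le> 2^(m+2-j)" using j by (intro power_increasing) auto
    then show "4 \<le> ?B" by simp
  qed (rule pow_le(2))
  have "(j+2) + (m+2-j) = m+4" using j by auto
  then have AB: "?A * ?B = 2^(m+4)" by (metis power_add)
  let ?a = "fu s ?q + kap s - ?A" and ?b = "fu s ?q + kap s" and ?c = "fv s ?q - ?B" and ?e = "fv s ?q + ?B"
  let ?R = "rc s (?d * ?a) (?d * ?b) (?d * ?c) (?d * ?e)"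
  have ab: "?d * ?a < ?d * ?b" "?d * ?c < ?d * ?e"
    by (rule mult_strict_left_mono[OF _ d]; use A B in linarith)+
  have sides: "?d * ?b - ?d * ?a = ?d * ?A" "?d * ?e - ?d * ?c = ?d * (2 * ?B)"
    by (simp_all add: algebra_simps)
  have Rr: "?R \<in> rectangles s" unfolding rectangles_iff using ab by blast
  have xR: "x \<in> ?R"
  proof -
    have "?a < fu s (x /\<^sub>R ?d)" "fu s (x /\<^sub>R ?d) < ?b" "?c < fv s (x /\<^sub>R ?d)" "fv s (x /\<^sub>R ?d) < ?e"
      using xj unfolding rc_def mem_Collect_eq fu_diff fv_diff by linarith+
    then have "?d * ?a < ?d * fu s (x /\<^sub>R ?d)" "?d * fu s (x /\<^sub>R ?d) < ?d * ?b" "?d * ?c < ?d * fv s (x /\<^sub>R ?d)" "?d * fv s (x /\<^sub>R ?d) < ?d * ?e"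
      using d by (auto intro: mult_strict_left_mono)
    moreover have "?d * fu s (x /\<^sub>R ?d) = fu s x" "?d * fv s (x /\<^sub>R ?d) = fv s x"
      using d by (auto simp: fu_scaleR fv_scaleR)
    ultimately show ?thesis unfolding rc_def by simp
  qed
  have diamD: "?d * ?A + ?d * (2 * ?B) \<le> ?d * D"
  proof -
    have "?A + 2 * ?B \<le> D" using A B m_D one_le_power[of "2::real" m] by linarith
    then have "?d * (?A + 2 * ?B) \<le> ?d * D" using d by (intro mult_left_mono) auto
    then show ?thesis by (simp add: algebra_simps)
  qed
  have "diameter ?R \<le> (?d * ?b - ?d * ?a) + (?d * ?e - ?d * ?c)" using ab by (intro diameter_rc_le) auto
  also have "\<dots> \<le> d0 * D" unfolding sides using diamD dd_le_d0[of i] D0 mult_right_mono[of ?d d0 D] by linarith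
  finally have diam: "diameter ?R \<le> d0 * D" .
  have meas: "(dd M)\<^sup>2 \<le> measure lborel ?R"
  proof -
    have "dd M \<le> ?d" using iM by (intro dd_mono) auto
    moreover have "?d * 1 \<le> ?d * ?A" "?d * 1 \<le> ?d * (2 * ?B)"
      by (rule mult_left_mono; use A B d in linarith)+
    ultimately have le: "dd M \<le> ?d * ?A" "dd M \<le> ?d * (2 * ?B)" by linarith+
    have "dd M * dd M \<le> (?d * ?A) * (?d * (2 * ?B))"
      by (rule mult_mono[OF le]) (use dd0[of M] le in linarith)+
    moreover have "measure lborel ?R = (?d * ?A) * (?d * (2 * ?B))"
      unfolding measure_rc[OF less_imp_le[OF ab(1)] less_imp_le[OF ab(2)]] sides ..
    ultimately show ?thesis unfolding power2_eq_square by linarith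
  qed
  have fi: "B1 \<le> mean (f i) ?R"
  proof -
    let ?R' = "rc s ?a ?b ?c ?e" and ?Rz = "rc s (kap s - ?A) (kap s) (- ?B) ?B"
    have "mean (f i) ?R = mean (F ?g) (rc s (?d * ?a / ?d) (?d * ?b / ?d) (?d * ?c / ?d) (?d * ?e / ?d))"
      unfolding f_def[abs_def] by (rule mean_scale) (use ab d in auto)
    also have "\<dots> = mean (F ?g) ?R'" using d by simp
    also have "\<dots> = mean (\<lambda>z. bmp (z - ?q)) ?R'"
    proof (rule mean_cong)
      fix z assume z: "z \<in> ?R'"
      have "z - ?q \<in> rc s (kap s - 2^(j+2) - 0) (kap s + 0) (- (2^(m+2-j)) - 0) (2^(m+2-j) + 0)"
        using z unfolding rc_def mem_Collect_eq fu_diff fv_diff by auto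
      then have "z - ?q \<in> cell D" by (rule rect_cell[OF s j zero_le_one])
      then have "ctr D ?g z = ?q" by (rule ctr_eqI[OF D0])
      then show "F ?g z = bmp (z - ?q)" by (simp add: F_def per_def)
    qed
    also have "\<dots> = (\<integral>z. indicator ?R' z * bmp (z - ?q) \<partial>lborel) / ((?b - ?a) * (?e - ?c))"
      using A B by (subst mean_eq) (auto simp: measure_rc)
    also have "(\<integral>z. indicator ?R' z * bmp (z - ?q) \<partial>lborel) = (\<integral>z. indicator ?Rz (z - ?q) * bmp (z - ?q) \<partial>lborel)"
      by (rule Bochner_Integration.integral_cong) (auto simp: rc_def indicator_def fu_diff fv_diff)
    also have "\<dots> = (\<integral>z. indicator ?Rz z * bmp z \<partial>lborel)"
      by (rule integral_translate) measurable
    also have "\<dots> = H * (\<integral>z. indicator ?Rz z * prof w (e/4) z \<partial>lborel)"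
      by (simp add: bmp_def mult.left_commute)
    finally have m: "mean (f i) ?R = H * (\<integral>z. indicator ?Rz z * prof w (e/4) z \<partial>lborel) / (?A * (2 * ?B))" by simp
    have "w * sqrt w / 2 \<le> (\<integral>z. indicator ?Rz z * prof w (e/4) z \<partial>lborel)"
      unfolding kap_def by (rule prof_tangent) (use e w sw s A B in \<open>auto simp: near_def\<close>)
    then have "H * (w * sqrt w / 2) \<le> H * (\<integral>z. indicator ?Rz z * prof w (e/4) z \<partial>lborel)" using H by (intro mult_left_mono) auto
    then have "2 * 2^(m+4) * B1 / (?A * (2 * ?B)) \<le> mean (f i) ?R"
      unfolding m Hmu using A B by (intro divide_right_mono) auto
    moreover have "?A * (2 * ?B) = 2 * 2^(m+4)" using AB by simp
    ultimately show ?thesis by simp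
  qed
  have others: "\<bar>mean (f l) ?R\<bar> * M \<le> 1" if "l < M" "l \<noteq> i" for l
  proof (cases "l < i")
    case True
    have "mean (f l) ?R = 0"
    proof (rule mean_const[OF _ ab])
      fix y assume y: "y \<in> ?R"
      have "dist x y \<le> (?d * ?b - ?d * ?a) + (?d * ?e - ?d * ?c)" by (rule dist_rc_le[OF xR y])
      also have "\<dots> \<le> ?d * D" using diamD unfolding sides .
      also have "\<dots> \<le> ?d * K" using KD D0 d by (intro mult_left_mono) auto
      also have "\<dots> \<le> dd l" by (rule dd_K[OF True])
      finally show "f l y = 0" by (rule coarse_zero[OF W[OF True]])
    qed
    then show ?thesis by simp
  next
    case False
    then have "i < l" using that by simp
    then show ?thesis
    proof (rule fine_mean)
      show "4 * ?d \<le> ?d * ?b - ?d * ?a" "8 * ?d \<le> ?d * ?e - ?d * ?c" unfolding sides using A B d by auto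
    qed
  qed
  have "mean (\<lambda>x. \<Sum>i<M. f i x) ?R = (\<Sum>i<M. mean (f i) ?R)"
    by (rule mean_sum[where B = "\<lambda>_. H"]) (use ab abs_f_le in auto)
  also have "\<dots> = mean (f i) ?R + (\<Sum>l\<in>{..<M} - {i}. mean (f l) ?R)"
    using iM by (simp add: sum.remove)
  also have "(\<Sum>l\<in>{..<M} - {i}. mean (f l) ?R) \<ge> (\<Sum>l\<in>{..<M} - {i}. - (1 / M))"
  proof (rule sum_mono)
    fix l assume "l \<in> {..<M} - {i}"
    then have "\<bar>mean (f l) ?R\<bar> * M \<le> 1" using others by auto
    then have "\<bar>mean (f l) ?R\<bar> \<le> 1 / M" using iM by (simp add: field_simps)
    then show "- (1 / M) \<le> mean (f l) ?R" by linarith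
  qed
  moreover have "(\<Sum>l\<in>{..<M} - {i}. - (1 / M)) \<ge> (- 1 :: real)"
  proof -
    have "(\<Sum>l\<in>{..<M} - {i}. - (1 / real M)) = - (real (M - 1) / real M)"
      using iM by simp
    moreover have "real (M - 1) / real M \<le> 1" using iM by (simp add: field_simps)
    ultimately show ?thesis by linarith
  qed
  ultimately have "B1 - 1 \<le> mean (\<lambda>x. \<Sum>i<M. f i x) ?R" using fi by linarith
  then show ?thesis using Rr xR diam meas by blast
qed

end

section \<open>Transport of null sets and of local constancy\<close>

lemma AE_affine:
  assumes "AE z in lborel. P (z :: real \<times> real)" and d: "0 < d"
  shows "AE x in lborel. P (x /\<^sub>R d - q)"
proof -
  obtain N where N: "{z. \<not> P z} \<subseteq> N" "N \<in> null_sets lborel"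
    using assms(1) by (auto elim!: AE_E simp: null_sets_def)
  have [measurable]: "N \<in> sets borel" using N(2) by (simp add: null_sets_def)
  have "{y :: real \<times> real. y - q \<in> N} = (+) (- q) -` N \<inter> space lborel" by auto
  then have "emeasure lborel {y. y - q \<in> N} = emeasure (distr lborel borel ((+) (- q))) N"
    by (subst emeasure_distr) auto
  also have "\<dots> = 0" using N(2) by (simp add: lborel_distr_plus null_sets_def)
  finally have 0: "emeasure lborel {y. y - q \<in> N} = 0" .
  have m: "{y :: real \<times> real. y - q \<in> N} \<in> sets borel" by measurable
  have "emeasure lborel {x. x /\<^sub>R d \<in> {y. y - q \<in> N}} = 0"
    using emeasure_scale[OF m d] 0 by simp
  moreover have "{x :: real \<times> real. x /\<^sub>R d \<in> {y. y - q \<in> N}} \<in> sets borel" by measurable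
  ultimately have "{x. x /\<^sub>R d \<in> {y. y - q \<in> N}} \<in> null_sets lborel" by (simp add: null_sets_def)
  then show ?thesis by (rule AE_I') (use N(1) in auto)
qed

lemma AE_rot:
  assumes "AE z in lborel. P (z :: real \<times> real)"
  shows "AE x in lborel. P (rot a x)"
proof -
  obtain N where N: "{z. \<not> P z} \<subseteq> N" "N \<in> null_sets lborel"
    using assms(1) by (auto elim!: AE_E simp: null_sets_def)
  have [measurable]: "N \<in> sets borel" using N(2) by (simp add: null_sets_def)
  have "emeasure lborel {x. rot a x \<in> N} = 0" using emeasure_rot[of N a] N(2) by (simp add: null_sets_def)
  moreover have "{x. rot a x \<in> N} \<in> sets borel" by measurable
  ultimately have "{x. rot a x \<in> N} \<in> null_sets lborel" by (simp add: null_sets_def)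
  then show ?thesis by (rule AE_I') (use N(1) in auto)
qed

lemma loc_const_cong:
  assumes "loc_const g x" "r > 0" "\<And>y. dist x y < r \<Longrightarrow> f y = g y"
  shows "loc_const f x"
proof -
  have "eventually (\<lambda>y. dist x y < r) (nhds x)" using assms(2) by (auto simp: eventually_nhds_metric dist_commute)
  then show ?thesis using assms(1) unfolding loc_const_def
  proof eventually_elim
    case (elim y)
    then show ?case using assms(3)[of y] assms(3)[of x] assms(2) by simp
  qed
qed

lemma loc_const_compose:
  assumes "loc_const g (h x)" "continuous_on UNIV h"
  shows "loc_const (\<lambda>x. g (h x)) (x :: real \<times> real)"
proof -
  have "isCont h x" using assms(2) continuous_on_eq_continuous_at[of UNIV h] by blast
  then have "filterlim h (nhds (h x)) (nhds x)" by (simp add: isCont_def tendsto_at_iff_tendsto_nhds)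
  then show ?thesis using assms(1) unfolding loc_const_def filterlim_iff by blast
qed

lemma loc_const_sum:
  assumes "finite I" "\<And>i. i \<in> I \<Longrightarrow> loc_const (f i) x"
  shows "loc_const (\<lambda>x. \<Sum>i\<in>I. f i x) x"
proof -
  have "eventually (\<lambda>y. \<forall>i\<in>I. f i y = f i x) (nhds x)"
    using assms by (simp add: eventually_ball_finite_distrib loc_const_def)
  then show ?thesis unfolding loc_const_def by (rule eventually_mono) (auto intro: sum.cong)
qed

section \<open>Blocks: interface, construction and choice of parameters\<close>

text \<open>The bounds \<Lambda> and \<gamma> are recorded for the blocks chosen afterwards. On a
  rectangle witnessing a large mean of a later block, this one can do harm at most \<Lambda>; on a
  witness of this block, of area at least \<gamma>, a later one can do harm at most its L1 norm
  divided by \<gamma>.\<close>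

definition blk :: "real set \<Rightarrow> real set \<Rightarrow> real \<Rightarrow> real \<Rightarrow> real \<Rightarrow> (real \<times> real \<Rightarrow> real) \<Rightarrow> real \<Rightarrow> real \<Rightarrow> bool" where
  "blk C Far \<epsilon> B \<delta> f \<Lambda> \<gamma> \<longleftrightarrow> f \<in> borel_measurable borel \<and> (\<forall>x. \<bar>f x\<bar> \<le> \<Lambda>) \<and> 0 < \<gamma> \<and>
     (\<integral>\<^sup>+x. indicator V1 x * ennreal \<bar>f x\<bar> \<partial>lborel) \<le> ennreal \<epsilon> \<and> (AE x in lborel. loc_const f x) \<and>
     (\<forall>s\<in>C. \<exists>N\<in>sets borel. emeasure lborel N \<le> ennreal \<epsilon> \<and> (\<forall>x\<in>V1 - N. \<exists>R\<in>rectangles s.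
        x \<in> R \<and> R \<subseteq> V1 \<and> diameter R < \<delta> \<and> \<gamma> \<le> measure lborel R \<and> B < mean f R)) \<and>
     (\<forall>s\<in>Far. \<exists>N\<in>sets borel. emeasure lborel N \<le> ennreal \<epsilon> \<and> (\<forall>x\<in>V1 - N. \<forall>R\<in>rectangles s.
        x \<in> R \<longrightarrow> \<bar>mean f R\<bar> \<le> \<epsilon>))"

definition blockable :: "real set \<Rightarrow> real set \<Rightarrow> bool" where
  "blockable C Far \<longleftrightarrow> (\<forall>\<epsilon>>0. \<forall>B. \<forall>\<delta>>0. \<exists>f \<Lambda> \<gamma>. blk C Far \<epsilon> B \<delta> f \<Lambda> \<gamma>)"

lemma blkD:
  assumes "blk C Far \<epsilon> B \<delta> f \<Lambda> \<gamma>"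
  shows "f \<in> borel_measurable borel" "\<bar>f x\<bar> \<le> \<Lambda>" "0 < \<gamma>"
    "(\<integral>\<^sup>+x. indicator V1 x * ennreal \<bar>f x\<bar> \<partial>lborel) \<le> ennreal \<epsilon>" "AE x in lborel. loc_const f x"
    "s \<in> C \<Longrightarrow> \<exists>N\<in>sets borel. emeasure lborel N \<le> ennreal \<epsilon> \<and> (\<forall>x\<in>V1 - N. \<exists>R\<in>rectangles s.
        x \<in> R \<and> R \<subseteq> V1 \<and> diameter R < \<delta> \<and> \<gamma> \<le> measure lborel R \<and> B < mean f R)"
    "s \<in> Far \<Longrightarrow> \<exists>N\<in>sets borel. emeasure lborel N \<le> ennreal \<epsilon> \<and> (\<forall>x\<in>V1 - N. \<forall>R\<in>rectangles s.
        x \<in> R \<longrightarrow> \<bar>mean f R\<bar> \<le> \<epsilon>)"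
  using assms unfolding blk_def by blast+

context stage
begin

text \<open>Within distance \<open>dd i\<close> of x at most one bump of the layer is visible, but
  which one depends on x. Local constancy is therefore required of the translates around all
  countably many centres at once.\<close>

lemma loc_const_f: "AE x in lborel. loc_const (f i) x"
proof -
  have "AE x in lborel. \<forall>q. loc_const (prof w (e/4)) (x /\<^sub>R dd i - lat D (gam i) q)"
    unfolding AE_all_countable by (intro allI AE_affine loc_const_prof dd0)
  then show ?thesis
  proof (rule AE_mp, intro AE_I2 impI)
    fix x assume x: "\<forall>q. loc_const (prof w (e/4)) (x /\<^sub>R dd i - lat D (gam i) q)"
    let ?z = "x /\<^sub>R dd i"
    have di: "0 < dd i" by (rule dd0)
    have dist: "dist (a /\<^sub>R dd i) (b /\<^sub>R dd i) = dist a b / dd i" for a b :: "real \<times> real"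
      using di by (simp add: dist_norm divide_inverse mult.commute flip: scaleR_diff_right)
    show "loc_const (f i) x"
    proof (cases "\<exists>y. dist x y < dd i \<and> f i y \<noteq> 0")
      case True
      then obtain y where y: "dist x y < dd i" "F (gam i) (y /\<^sub>R dd i) \<noteq> 0" by (auto simp: f_def)
      let ?q = "cidx D (gam i) (y /\<^sub>R dd i)"
      have "loc_const (\<lambda>x. bmp (x /\<^sub>R dd i - lat D (gam i) ?q)) x"
      proof (rule loc_const_compose[of bmp])
        show "loc_const bmp (?z - lat D (gam i) ?q)"
          using x[rule_format, of ?q] unfolding loc_const_def bmp_def by (auto elim: eventually_mono)
      qed (intro continuous_intros)
      then show ?thesis
      proof (rule loc_const_cong[OF _ di])
        fix y' assume y': "dist x y' < dd i"
        have "dist y y' < 2 * dd i" using y(1) y' dist_triangle2[of y y' x] by (simp add: dist_commute)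
        then have "dist (y /\<^sub>R dd i) (y' /\<^sub>R dd i) < 2" unfolding dist using di by (simp add: field_simps)
        then have "dist (y /\<^sub>R dd i) (y' /\<^sub>R dd i) < D - 2" using D64 by linarith
        from F_near[OF y(2) this] show "f i y' = bmp (y' /\<^sub>R dd i - lat D (gam i) ?q)" by (simp add: f_def)
      qed
    next
      case False
      have "loc_const (\<lambda>_. 0) x" by (simp add: loc_const_def)
      then show ?thesis by (rule loc_const_cong[OF _ di]) (use False in auto)
    qed
  qed
qed

lemma L1_f: "(\<integral>\<^sup>+x. indicator V1 x * ennreal \<bar>f i x\<bar> \<partial>lborel) \<le> ennreal (16 * (H * w * e) / D\<^sup>2)"
proof -
  have nn: "(\<integral>\<^sup>+z. ennreal \<bar>bmp z\<bar> \<partial>lborel) = ennreal (H * w * e)"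
  proof -
    have "(\<integral>\<^sup>+z. ennreal \<bar>bmp z\<bar> \<partial>lborel) = (\<integral>\<^sup>+z. ennreal H * ennreal \<bar>prof w (e/4) z\<bar> \<partial>lborel)"
      by (rule nn_integral_cong) (use H in \<open>auto simp: bmp_def abs_mult ennreal_mult\<close>)
    also have "\<dots> = ennreal H * ennreal (4 * w * (e/4))"
      using nn_integral_prof[of w "e/4"] w e by (simp add: nn_integral_cmult)
    finally show ?thesis using H w e by (simp add: ennreal_mult[symmetric] mult.assoc)
  qed
  have "(\<integral>z. indicator (cell D) z * \<bar>bmp z\<bar> \<partial>lborel) = (\<integral>z. \<bar>bmp z\<bar> \<partial>lborel)"
    by (rule Bochner_Integration.integral_cong) (use bmp_cell in \<open>auto simp: indicator_def\<close>)
  also have "\<dots> = H * w * e"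
    by (subst integral_eq_nn_integral) (use H w e in \<open>auto simp: nn\<close>)
  finally have I: "(\<integral>z. indicator (cell D) z * \<bar>bmp z\<bar> \<partial>lborel) = H * w * e" .
  have "(\<integral>\<^sup>+x. indicator V1 x * ennreal \<bar>f i x\<bar> \<partial>lborel) = (\<integral>\<^sup>+x. indicator V1 x * ennreal (per D (gam i) (\<lambda>z. \<bar>bmp z\<bar>) (x /\<^sub>R dd i)) \<partial>lborel)"
    by (rule nn_integral_cong) (simp add: f_def F_def per_def)
  also have "\<dots> \<le> ennreal (16 * (\<integral>z. indicator (cell D) z * \<bar>bmp z\<bar> \<partial>lborel) / D\<^sup>2)"
    by (rule density_le[OF D0 dd0 dd_D, where H = H]) (auto simp: abs_bmp_le)
  finally show ?thesis unfolding I .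
qed

definition S :: "real \<times> real \<Rightarrow> real" where "S x = (\<Sum>i<M. f i x)"

lemma S_measurable [measurable]: "S \<in> borel_measurable borel"
  unfolding S_def[abs_def] by measurable

lemma abs_S_le: "\<bar>S x\<bar> \<le> M * H"
proof -
  have "\<bar>S x\<bar> \<le> (\<Sum>i<M. \<bar>f i x\<bar>)" unfolding S_def by (rule sum_abs)
  also have "\<dots> \<le> (\<Sum>i<M. H)" by (intro sum_mono abs_f_le)
  finally show ?thesis by simp
qed

lemma L1_S: "(\<integral>\<^sup>+x. indicator V1 x * ennreal \<bar>S x\<bar> \<partial>lborel) \<le> ennreal (M * (16 * (H * w * e) / D\<^sup>2))"
proof -
  have "(\<integral>\<^sup>+x. indicator V1 x * ennreal \<bar>S x\<bar> \<partial>lborel) \<le> (\<integral>\<^sup>+x. (\<Sum>i<M. indicator V1 x * ennreal \<bar>f i x\<bar>) \<partial>lborel)"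
  proof (rule nn_integral_mono)
    fix x
    have "ennreal \<bar>S x\<bar> \<le> ennreal (\<Sum>i<M. \<bar>f i x\<bar>)" unfolding S_def by (intro ennreal_leI sum_abs)
    also have "\<dots> = (\<Sum>i<M. ennreal \<bar>f i x\<bar>)" by simp
    finally show "indicator V1 x * ennreal \<bar>S x\<bar> \<le> (\<Sum>i<M. indicator V1 x * ennreal \<bar>f i x\<bar>)"
      by (auto simp: indicator_def)
  qed
  also have "\<dots> = (\<Sum>i<M. (\<integral>\<^sup>+x. indicator V1 x * ennreal \<bar>f i x\<bar> \<partial>lborel))"
  proof (rule nn_integral_sum)
    fix i
    have "(\<lambda>x. \<bar>f i x\<bar>) \<in> borel_measurable borel" by (intro borel_measurable_abs f_measurable)
    then have "(\<lambda>x. ennreal \<bar>f i x\<bar>) \<in> borel_measurable borel" by (rule measurable_compose[OF _ measurable_ennreal])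
    moreover have "V1 \<in> sets borel" by simp
    ultimately have "(\<lambda>x. indicator V1 x * ennreal \<bar>f i x\<bar>) \<in> borel_measurable borel"
      by (intro borel_measurable_times_ennreal borel_measurable_indicator)
    then show "(\<lambda>x. indicator V1 x * ennreal \<bar>f i x\<bar>) \<in> borel_measurable lborel" by simp
  qed
  also have "\<dots> \<le> (\<Sum>i<M. ennreal (16 * (H * w * e) / D\<^sup>2))"
    by (intro sum_mono L1_f)
  also have "\<dots> = ennreal (M * (16 * (H * w * e) / D\<^sup>2))"
    using H w e D0 by (subst sum_ennreal) auto
  finally show ?thesis .
qed

lemma far_S:
  assumes s: "far e s"
  shows "\<exists>N\<in>sets borel. emeasure lborel N \<le> ennreal (M * (32 * (96 * 2^J + 16 * t * (J + 1)) / D\<^sup>2)) \<and>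
    (\<forall>x\<in>V1 - N. \<forall>R\<in>rectangles s. x \<in> R \<longrightarrow> \<bar>mean S R\<bar> \<le> M * (16 * e' * 2^J / (e * D\<^sup>2)) + 2 * e')"
proof (intro bexI conjI ballI impI)
  let ?N = "\<Union>i\<in>{..<M}. V1 \<inter> Z s i" and ?k = "96 * 2^J + 16 * t * (J + 1)"
  have k0: "0 \<le> ?k" using t by simp
  have [measurable]: "Z s i \<in> sets borel" for i unfolding Z_def by measurable
  show "?N \<in> sets borel" by (intro sets.finite_UN) auto
  have "emeasure lborel (bad s) \<le> emeasure lborel (pollut J t s) + emeasure lborel (pollut J t (s + pi/2))"
    unfolding bad_def by (rule emeasure_subadditive) auto
  also have "\<dots> \<le> ennreal ?k + ennreal ?k"
    using emeasure_pollut[OF t(1)] by (intro add_mono) auto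
  also have "\<dots> = ennreal (2 * ?k)" using k0 by (simp flip: ennreal_plus)
  finally have b: "emeasure lborel (bad s) \<le> ennreal (2 * ?k)" .
  have "emeasure lborel ?N \<le> (\<Sum>i\<in>{..<M}. emeasure lborel (V1 \<inter> Z s i))"
    by (rule emeasure_subadditive_finite) auto
  also have "\<dots> \<le> (\<Sum>i\<in>{..<M}. ennreal (16 * (2 * ?k) / D\<^sup>2))"
  proof (rule sum_mono)
    fix i
    show "emeasure lborel (V1 \<inter> Z s i) \<le> ennreal (16 * (2 * ?k) / D\<^sup>2)"
      unfolding Z_def by (rule emeasure_density_le[OF D0 dd0 dd_D bad_sets bad_cell b]) (use k0 in simp)
  qed
  also have "\<dots> = ennreal (M * (32 * ?k / D\<^sup>2))"
    using k0 D0 by (subst sum_ennreal) (auto simp: mult.assoc)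
  finally show "emeasure lborel ?N \<le> ennreal (M * (32 * ?k / D\<^sup>2))" .
  fix x R assume "x \<in> V1 - ?N" "R \<in> rectangles s" "x \<in> R"
  then show "\<bar>mean S R\<bar> \<le> M * (16 * e' * 2^J / (e * D\<^sup>2)) + 2 * e'"
    unfolding S_def[abs_def] by (intro abs_mean_sum[OF s]) auto
qed

text \<open>Three kinds of points are given up: those in no stair, those close to the unit circle,
  for which the rectangle might leave the ball, and those near a bump.\<close>

lemma near_S:
  assumes s: "near s"
  shows "\<exists>N\<in>sets borel. emeasure lborel N \<le> ennreal (4 * (1 - p)^M + M * err + 8 * (d0 * D) + M * (256 / D\<^sup>2)) \<and>
    (\<forall>x\<in>V1 - N. \<exists>R\<in>rectangles s. x \<in> R \<and> R \<subseteq> V1 \<and> diameter R \<le> d0 * D \<and> (dd M)\<^sup>2 \<le> measure lborel R \<and> B1 - 1 \<le> mean S R)"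
proof -
  let ?U = "V1 - (\<Union>i<M. G s i)" and ?A = "V1 - ball 0 (1 - d0 * D)" and ?B = "\<Union>i\<in>{..<M}. V1 \<inter> W i"
  have U: "?U \<in> sets borel" by (intro sets.Diff sets.finite_UN) auto
  have A: "?A \<in> sets borel" by auto
  have B: "?B \<in> sets borel" by (intro sets.finite_UN) auto
  have N: "?U \<union> ?A \<union> ?B \<in> sets borel" using U A B by (intro sets.Un)
  have err0: "0 \<le> err" unfolding err_def using D0 d0 K1 by simp
  have finU: "emeasure lborel ?U < \<infinity>"
  proof -
    have "emeasure lborel ?U \<le> emeasure lborel V1" by (intro emeasure_mono) auto
    also have "\<dots> \<le> ennreal (4 * 1\<^sup>2)" by (rule emeasure_ball_le)
    also have "\<dots> < \<infinity>" by simp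
    finally show ?thesis .
  qed
  have eU: "emeasure lborel ?U \<le> ennreal (4 * (1 - p)^M + M * err)"
  proof -
    have "emeasure lborel ?U = ennreal (measure lborel ?U)"
      by (rule emeasure_eq_ennreal_measure) (use finU in fastforce)
    also have "\<dots> \<le> ennreal (4 * (1 - p)^M + M * err)" by (intro ennreal_leI uncovered s) simp
    finally show ?thesis .
  qed
  have eA: "emeasure lborel ?A \<le> ennreal (8 * (d0 * D))" using d0 D0 by (intro emeasure_ball_annulus) simp
  have eB: "emeasure lborel ?B \<le> ennreal (M * (256 / D\<^sup>2))"
  proof -
    have "emeasure lborel ?B \<le> (\<Sum>i\<in>{..<M}. emeasure lborel (V1 \<inter> W i))"
      by (rule emeasure_subadditive_finite) auto
    also have "\<dots> \<le> (\<Sum>i\<in>{..<M}. ennreal (256 / D\<^sup>2))" by (intro sum_mono emeasure_W)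
    also have "\<dots> = ennreal (M * (256 / D\<^sup>2))" by (subst sum_ennreal) auto
    finally show ?thesis .
  qed
  have "emeasure lborel (?U \<union> ?A \<union> ?B) \<le> emeasure lborel (?U \<union> ?A) + emeasure lborel ?B"
    by (rule emeasure_subadditive) (use U A B in auto)
  also have "\<dots> \<le> (emeasure lborel ?U + emeasure lborel ?A) + emeasure lborel ?B"
    by (intro add_right_mono emeasure_subadditive) (use U A in auto)
  also have "\<dots> \<le> (ennreal (4 * (1 - p)^M + M * err) + ennreal (8 * (d0 * D))) + ennreal (M * (256 / D\<^sup>2))"
    by (intro add_mono eU eA eB)
  also have "\<dots> = ennreal (4 * (1 - p)^M + M * err + 8 * (d0 * D) + M * (256 / D\<^sup>2))"
    using p_bounds err0 d0 D0 by (simp flip: ennreal_plus)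
  finally have le: "emeasure lborel (?U \<union> ?A \<union> ?B) \<le> ennreal (4 * (1 - p)^M + M * err + 8 * (d0 * D) + M * (256 / D\<^sup>2))" .
  have ex: "\<exists>R\<in>rectangles s. x \<in> R \<and> R \<subseteq> V1 \<and> diameter R \<le> d0 * D \<and> (dd M)\<^sup>2 \<le> measure lborel R \<and> B1 - 1 \<le> mean S R"
    if x: "x \<in> V1 - (?U \<union> ?A \<union> ?B)" for x
  proof -
  from x obtain i where i: "i < M" "x \<in> G s i" by auto
  have W: "x \<notin> W l" if "l < i" for l using x that i by auto
  obtain R where R: "R \<in> rectangles s" "x \<in> R" "diameter R \<le> d0 * D" "(dd M)\<^sup>2 \<le> measure lborel R" "B1 - 1 \<le> mean (\<lambda>x. \<Sum>i<M. f i x) R"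
    using good_mean[OF s i(2,1) W] by blast
  have "R \<subseteq> V1"
  proof
    fix y assume y: "y \<in> R"
    obtain a b c d where "R = rc s a b c d" using R(1) unfolding rectangles_iff by blast
    then have "dist x y \<le> d0 * D" using diameter_bounded_bound[OF _ R(2) y] bounded_rc R(3) by fastforce
    moreover have "norm x < 1 - d0 * D" using x by auto
    moreover have "norm y \<le> norm x + dist x y" using norm_triangle_sub[of y x] by (simp add: dist_norm norm_minus_commute)
    ultimately show "y \<in> V1" by simp
  qed
  then show ?thesis
    using R unfolding S_def[abs_def] by blast
  qed
  show ?thesis by (intro bexI[of _ "?U \<union> ?A \<union> ?B"] conjI ballI le ex N)
qed

lemma loc_const_S: "AE x in lborel. loc_const S x"
proof -
  have "AE x in lborel. \<forall>i\<in>{..<M}. loc_const (f i) x"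
    by (rule AE_finite_allI) (auto intro: loc_const_f)
  then show ?thesis
  proof (rule AE_mp, intro AE_I2 impI)
    fix x assume "\<forall>i\<in>{..<M}. loc_const (f i) x"
    then show "loc_const S x" unfolding S_def[abs_def] by (intro loc_const_sum) auto
  qed
qed

end

lemma measurable_indicator_abs:
  fixes f :: "real \<times> real \<Rightarrow> real"
  assumes "f \<in> borel_measurable borel"
  shows "(\<lambda>x. indicator V1 x * ennreal \<bar>f x\<bar>) \<in> borel_measurable borel"
proof -
  have "(\<lambda>x. \<bar>f x\<bar>) \<in> borel_measurable borel" by (intro borel_measurable_abs assms)
  then have "(\<lambda>x. ennreal \<bar>f x\<bar>) \<in> borel_measurable borel" by (rule measurable_compose[OF _ measurable_ennreal])
  moreover have "V1 \<in> sets borel" by simp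
  ultimately show ?thesis
    by (intro borel_measurable_times_ennreal borel_measurable_indicator)
qed

text \<open>The number M of layers is about \<omega> / \<open>pr\<close>, where \<open>pr\<close> =
  m * 2^(m+4) / D^2 is the density of the stair. The set spoilt for far slopes then has measure of
  order (2^J + t * J) / (m * 2^m). With 2^J = 2^(m+4) * \<open>L0\<close> the first part is of order
  \<open>L0\<close> / m and vanishes as m grows. The second does not decay with m, since J is
  comparable to m; it is of order \<sigma> = sqrt w, the quotient of w^2 and w * sqrt w. Hence
  \<sigma> is fixed first, then \<open>L0\<close>, then m, and only then the arithmetic and the
  scales.\<close>

lemma blockable_base:
  assumes e: "0 < e" "e \<le> 1"
  shows "blockable {s. 0 < cos s \<and> \<bar>tan s\<bar> \<le> e / 4} {s. far e s}"
  unfolding blockable_def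
proof (intro allI impI)
  fix \<epsilon> B \<delta> :: real assume \<epsilon>: "0 < \<epsilon>" and \<delta>: "0 < \<delta>"
  define B1 where "B1 = \<bar>B\<bar> + 2"
  define e' where "e' = \<epsilon> / 8"
  define c where "c = e * e'"
  define \<omega> where "\<omega> = max 1 (ln (32 / \<epsilon>))"
  \<comment> \<open>\<sigma> is sqrt w. The second bound makes the part of \<open>E3\<close> that
    does not decay with m at most \<epsilon>/2; there 512 collects the 256 of t and the 2 of J + 1
    \<le> 2 * m.\<close>
  define \<sigma> where "\<sigma> = min (e / 4) (\<epsilon> * c / (2 * (32 * 16 * 512 * (\<omega> + 1) * B1)))"
  define w where "w = \<sigma>\<^sup>2"
  have B1: "0 < B1" "2 \<le> B1" and e': "0 < e'" and c: "0 < c" and \<omega>: "1 \<le> \<omega>" "0 < \<omega>"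
    using \<epsilon> e by (auto simp: B1_def e'_def c_def \<omega>_def)
  have "32 / \<epsilon> \<le> exp \<omega>"
    using \<epsilon> by (metis \<omega>_def exp_ln divide_pos_pos exp_le_cancel_iff max.cobounded2 zero_less_numeral)
  then have exp\<omega>: "4 * exp (- \<omega>) \<le> \<epsilon> / 8"
    using \<epsilon> by (simp add: exp_minus field_simps)
  have \<sigma>: "0 < \<sigma>" "\<sigma> \<le> e / 4" "\<sigma> \<le> 1/4"
  proof -
    show "0 < \<sigma>" using e \<epsilon> c \<omega> B1 by (simp add: \<sigma>_def)
    show "\<sigma> \<le> e / 4" unfolding \<sigma>_def by (rule min.cobounded1)
    then show "\<sigma> \<le> 1/4" using e by linarith
  qed
  have \<sigma>A: "32 * 16 * 512 * (\<omega> + 1) * B1 * \<sigma> / c \<le> \<epsilon> / 2"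
  proof -
    let ?k = "32 * 16 * 512 * (\<omega> + 1) * B1"
    have k: "0 < ?k" using \<omega> B1 by simp
    have "\<sigma> \<le> \<epsilon> * c / (2 * ?k)" unfolding \<sigma>_def by (rule min.cobounded2)
    then have "?k * \<sigma> \<le> ?k * (\<epsilon> * c / (2 * ?k))" using k by (intro mult_left_mono) auto
    also have "\<dots> = \<epsilon> * c / 2" using k by (simp add: field_simps)
    finally show ?thesis using c by (simp add: pos_divide_le_eq)
  qed
  have sw: "sqrt w = \<sigma>" using \<sigma> by (simp add: w_def)
  have w: "0 < w" "w \<le> 1/4"
  proof -
    show "0 < w" using \<sigma> by (simp add: w_def)
    have "\<sigma> * \<sigma> \<le> (1/4) * (1/4)" using \<sigma> by (intro mult_mono) auto
    then show "w \<le> 1/4" by (simp add: w_def power2_eq_square)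
  qed
  \<comment> \<open>The first summand serves the chord condition \<open>HL\<close> and the bound on
    t, the second the condition 8 / e \<le> D. Neither depends on m.\<close>
  obtain J0 :: nat where J0: "32 * B1 / (\<sigma> * c) + 1 / e < 2 ^ J0"
    using real_arch_pow[of 2 "32 * B1 / (\<sigma> * c) + 1 / e"] by auto
  define L0 :: real where "L0 = 2 ^ J0"
  have L0: "32 * B1 / (\<sigma> * c) \<le> L0" "1 / e \<le> L0" "1 \<le> L0"
  proof -
    have "0 \<le> 32 * B1 / (\<sigma> * c)" "0 \<le> 1 / e" using B1 \<sigma> c e by auto
    then show "32 * B1 / (\<sigma> * c) \<le> L0" "1 / e \<le> L0" using J0 unfolding L0_def by linarith+
    show "1 \<le> L0" unfolding L0_def by simp
  qed
  \<comment> \<open>X1/m, X2/m, X3/m and X4/m will bound the decaying parts of \<open>E3\<close>,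
    \<open>E2\<close>, \<open>E1\<close> and \<open>E4\<close>.\<close>
  define X1 where "X1 = 32 * 96 * (\<omega> + 1) * L0"
  define X2 where "X2 = 16 * e' * (\<omega> + 1) * L0 / e"
  define X3 where "X3 = 64 * (\<omega> + 1) * e * B1 / \<sigma>"
  define X4 where "X4 = 256 * (\<omega> + 1)"
  have X0: "0 \<le> X1" "0 \<le> X2" "0 \<le> X3" "0 \<le> X4"
    using \<omega> L0 e' e B1 \<sigma> by (auto simp: X1_def X2_def X3_def X4_def)
  obtain m :: nat where m: "5 + real J0 + 2 * X1 / \<epsilon> + 2 * X2 / \<epsilon> + X3 / \<epsilon> + 8 * X4 / \<epsilon> < m"
    using reals_Archimedean2 by blast
  have nn: "0 \<le> 2 * X1 / \<epsilon>" "0 \<le> 2 * X2 / \<epsilon>" "0 \<le> X3 / \<epsilon>" "0 \<le> 8 * X4 / \<epsilon>" using X0 \<epsilon> by auto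
  have m5: "5 + real J0 \<le> m" and mX: "2 * X1 / \<epsilon> \<le> m" "2 * X2 / \<epsilon> \<le> m" "X3 / \<epsilon> \<le> m" "8 * X4 / \<epsilon> \<le> m" and m0: "0 < real m"
    using m nn by linarith+
  have X: "X1 / m \<le> \<epsilon> / 2" "X2 / m \<le> \<epsilon> / 2" "X3 / m \<le> \<epsilon>" "X4 / m \<le> \<epsilon> / 8"
    using mX \<epsilon> m0 by (auto simp: field_simps)
  define tg :: real where "tg = 2^(m+4)"
  define J where "J = m + 4 + J0"
  have J2: "2^J = tg * L0" by (simp add: J_def tg_def L0_def power_add)
  define D where "D = 64 * (2::real)^J"
  \<comment> \<open>H solves \<open>Hmu\<close> for a tangent mean B1, and t is then the value for
    which \<open>Ht\<close> is an equality.\<close>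
  define H where "H = 4 * tg * B1 / (w * \<sigma>)"
  define t where "t = 256 * tg * B1 * \<sigma> / c"
  have tg: "0 < tg" "1 \<le> tg" by (simp_all add: tg_def)
  have D: "0 < D" "64 \<le> D" by (simp_all add: D_def)
  have H: "0 < H" using tg B1 w \<sigma> by (simp add: H_def)
  have t0: "0 \<le> t" using tg B1 \<sigma> c by (simp add: t_def)
  have t8: "t \<le> 8 * 2^J"
  proof -
    have "\<sigma> * \<sigma> \<le> 1 * 1" using \<sigma> by (intro mult_mono) auto
    then have "\<sigma> \<le> 1 / \<sigma>" using \<sigma> by (simp add: field_simps)
    then have "256 * B1 * \<sigma> / c \<le> 256 * B1 * (1 / \<sigma>) / c" using B1 c by (intro divide_right_mono mult_left_mono) auto
    also have "\<dots> = 8 * (32 * B1 / (\<sigma> * c))" by simp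
    also have "\<dots> \<le> 8 * L0" using L0 by linarith
    finally have "tg * (256 * B1 * \<sigma> / c) \<le> tg * (8 * L0)" using tg by (intro mult_left_mono) auto
    then show ?thesis by (simp add: t_def J2 mult_ac)
  qed
  define pr where "pr = m * tg / D\<^sup>2"
  have pr0: "0 < pr" using m0 tg D by (simp add: pr_def)
  have pr1: "pr \<le> 1"
  proof -
    have "real m \<le> 2^m" by (metis less_exp less_imp_le of_nat_le_iff of_nat_power of_nat_numeral)
    also have "\<dots> \<le> tg" unfolding tg_def by (intro power_increasing) auto
    finally have "real m \<le> tg" .
    moreover have "tg * 1 \<le> tg * L0" using tg L0 by (intro mult_left_mono) auto
    ultimately have "real m \<le> D" "tg \<le> D" using tg(1) unfolding D_def J2 by linarith+
    then have "real m * tg \<le> D * D" using tg by (intro mult_mono) auto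
    then show ?thesis using D by (simp add: pr_def power2_eq_square)
  qed
  \<comment> \<open>The least number of layers with \<open>pr\<close> * M \<ge> \<omega>, so that (1
    - \<open>pr\<close>)^M \<le> exp (- \<omega>).\<close>
  define M where "M = nat \<lceil>\<omega> / pr\<rceil>"
  have M: "\<omega> / pr \<le> M" "real M \<le> (\<omega> + 1) / pr"
  proof -
    have "0 \<le> \<omega> / pr" using \<omega> pr0 by simp
    then have "real M = of_int \<lceil>\<omega> / pr\<rceil>" unfolding M_def by simp
    then have "\<omega> / pr \<le> M" "real M \<le> \<omega> / pr + 1" by linarith+
    moreover have "\<omega> / pr + 1 \<le> (\<omega> + 1) / pr" using pr0 pr1 by (simp add: field_simps)
    ultimately show "\<omega> / pr \<le> M" "real M \<le> (\<omega> + 1) / pr" by linarith+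
  qed
  define q where "q = (\<omega> + 1) / (m * tg)"
  have q0: "0 < q" using \<omega> m0 tg by (simp add: q_def)
  have MD: "M / D\<^sup>2 \<le> q"
  proof -
    have "M / D\<^sup>2 \<le> ((\<omega> + 1) / pr) / D\<^sup>2" using M by (intro divide_right_mono) auto
    also have "\<dots> = q" using D m0 tg by (simp add: pr_def q_def)
    finally show ?thesis .
  qed
  define Q where "Q = \<lceil>e * D / 2\<rceil> + 1"
  have Q: "1 \<le> Q" "e * D / 2 \<le> of_int Q"
  proof -
    have "0 \<le> e * D / 2" using e D by simp
    then show "1 \<le> Q" unfolding Q_def by (simp add: le_ceiling_iff)
    show "e * D / 2 \<le> of_int Q" unfolding Q_def by linarith
  qed
  \<comment> \<open>A prime above both the denominators allowed in \<open>generic\<close> and the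
    number of layers, as \<open>not_generic_unique\<close> requires.\<close>
  obtain P' :: nat where P': "prime P'" "nat Q + M < P'" using bigger_prime by blast
  define P where "P = int P'"
  have P: "prime P" "Q < P" "int M < P" using P' by (auto simp: P_def)
  define \<nu> where "\<nu> = 1 / (2 * of_int Q * of_int P :: real)"
  have PQ: "0 < (of_int P :: real)" "0 < (of_int Q :: real)" using P Q by linarith+
  have \<nu>: "0 < \<nu>" "\<nu> * (2 * of_int Q * of_int P) \<le> 1" using PQ by (auto simp: \<nu>_def)
  define A where "A = 1 + D + D * of_int Q / (2 * \<nu>)"
  define K3 where "K3 = 256 * (real M)\<^sup>2 * (real m + 1) / \<epsilon>"
  \<comment> \<open>A sum of nonnegative terms dominates each of them: D and H enter through
    \<open>KD\<close> and \<open>KM\<close>, A is the growth demanded by \<open>dd_dec\<close>, and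
    K3 makes the shell part of the error at most \<epsilon>/8.\<close>
  define K where "K = 1 + 2 * D + 4 * H * D * M + A + K3"
  have K0: "0 \<le> 4 * H * D * M" "0 \<le> A" "0 \<le> K3" using H D \<epsilon> \<nu> PQ by (auto simp: A_def K3_def)
  have K: "1 \<le> K" "2 * D \<le> K" "4 * H * D * M \<le> K" "A \<le> K" "K3 \<le> K" using K0 D unfolding K_def by linarith+
  \<comment> \<open>The four bounds serve, in turn, the inclusion of cells in the ball of radius 2,
    the diameters below \<delta>, the rim of the unit ball, and the rim part of the error summed
    over all layers.\<close>
  define d0 where "d0 = min (min (1 / (2 * D)) (\<delta> / (2 * D))) (min (\<epsilon> / (64 * D)) (\<epsilon> / (256 * D * (M + 1))))"
  have d0: "0 < d0" using D \<delta> \<epsilon> by (auto simp: d0_def)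
  have d0_le: "d0 \<le> 1 / (2 * D)" "d0 \<le> \<delta> / (2 * D)" "d0 \<le> \<epsilon> / (64 * D)" "d0 \<le> \<epsilon> / (256 * D * (M + 1))" by (auto simp: d0_def)
  have d0D: "2 * d0 * D \<le> 1" "d0 * D < \<delta>" "8 * (d0 * D) \<le> \<epsilon> / 8"
    using d0_le(1-3) D \<delta> by (auto simp: field_simps)
  have "d0 * (256 * D * (M + 1)) \<le> \<epsilon>" using d0_le(4) D by (simp add: pos_le_divide_eq)
  moreover have "d0 * (256 * D * M) \<le> d0 * (256 * D * (M + 1))" using d0 D by (intro mult_left_mono) auto
  ultimately have d0M: "M * (32 * D * d0) \<le> \<epsilon> / 8" by (simp add: mult_ac)
  define dd where "dd i = d0 / K^i" for i :: nat
  have dd_dec: "dd (Suc i) * (1 + D + D * of_int Q / (2 * \<nu>)) \<le> dd i" for i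
  proof -
    have "dd (Suc i) * A \<le> dd (Suc i) * K" using K d0 by (intro mult_left_mono) (auto simp: dd_def)
    also have "\<dots> = dd i" using K by (simp add: dd_def)
    finally show ?thesis by (simp add: A_def)
  qed
  interpret st: stage e w D H e' t J M P Q \<nu> dd m B1 K d0
  proof unfold_locales
    show "8 / e \<le> D"
    proof -
      have "8 * (1/e) \<le> 64 * (1 * L0)" using L0 e by linarith
      also have "\<dots> \<le> 64 * (tg * L0)" using tg L0 by (intro mult_left_mono mult_right_mono) auto
      finally show ?thesis by (simp add: D_def J2)
    qed
    then show "2 / e < D" using e by (simp add: field_simps)
    show "H * (64 * w\<^sup>2 / e) \<le> e' * t"
    proof -
      have "H * w\<^sup>2 = 4 * tg * B1 * \<sigma>"
        unfolding H_def w_def using \<sigma> by (simp add: power2_eq_square)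
      moreover have "H * (64 * w\<^sup>2 / e) = 64 * (H * w\<^sup>2) / e" by simp
      ultimately have "H * (64 * w\<^sup>2 / e) = 256 * tg * B1 * \<sigma> / e" by simp
      moreover have "e' * t = 256 * tg * B1 * \<sigma> / e" using e' by (simp add: t_def c_def)
      ultimately show ?thesis by linarith
    qed
    show "H * (8 * w / e) \<le> e' * 2^J"
    proof -
      have "H * (8 * w / e) = e' * (tg * (32 * B1 / (\<sigma> * c)))"
        unfolding H_def c_def using w e' e by (simp add: field_simps)
      also have "\<dots> \<le> e' * (tg * L0)" using L0 tg e' by (intro mult_left_mono) auto
      finally show ?thesis by (simp add: J2)
    qed
    show "H * (w * sqrt w / 2) = 2 * 2^(m+4) * B1"
      unfolding sw H_def tg_def[symmetric] using w \<sigma> by (simp add: field_simps)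
    show "sqrt w \<le> e / 4" unfolding sw by (rule \<sigma>(2))
    show "m \<le> J" by (simp add: J_def)
    show "0 < dd i" for i using d0 K by (simp add: dd_def)
  qed (fact e w H e' t0 t8 P Q \<nu> dd_dec B1 d0 d0D K | simp add: D_def dd_def)+
  have pp: "st.p = pr" by (simp add: st.p_def pr_def tg_def)
  have near: "st.near s \<longleftrightarrow> 0 < cos s \<and> \<bar>tan s\<bar> \<le> e / 4" for s by (rule st.near_def)
  have E1: "M * (16 * (H * w * e) / D\<^sup>2) \<le> \<epsilon>"
  proof -
    have "M * (16 * (H * w * e) / D\<^sup>2) = (M / D\<^sup>2) * (16 * (H * w * e))" by simp
    also have "\<dots> \<le> q * (16 * (H * w * e))" using MD H w e by (intro mult_right_mono) auto
    also have "\<dots> = X3 / m"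
      unfolding q_def H_def X3_def using w \<sigma> m0 tg by (simp add: field_simps)
    finally show ?thesis using X by linarith
  qed
  have E2: "M * (16 * e' * 2^J / (e * D\<^sup>2)) + 2 * e' \<le> \<epsilon>"
  proof -
    have "M * (16 * e' * 2^J / (e * D\<^sup>2)) = (M / D\<^sup>2) * (16 * e' * (tg * L0) / e)" by (simp add: J2)
    also have "\<dots> \<le> q * (16 * e' * (tg * L0) / e)" using MD e' tg L0 e by (intro mult_right_mono) auto
    also have "\<dots> = X2 / m" unfolding q_def X2_def using m0 tg(1) by (simp add: divide_simps)
    finally show ?thesis using X \<epsilon> unfolding e'_def by linarith
  qed
  have E3: "M * (32 * (96 * 2^J + 16 * t * (J + 1)) / D\<^sup>2) \<le> \<epsilon>"
  proof -
    have J1: "real (J + 1) \<le> 2 * m" using m5 by (simp add: J_def)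
    have "M * (32 * (96 * 2^J + 16 * t * (J + 1)) / D\<^sup>2) = (M / D\<^sup>2) * (32 * (96 * (tg * L0) + 16 * t * (J + 1)))" by (simp add: J2)
    also have "\<dots> \<le> q * (32 * (96 * (tg * L0) + 16 * t * (J + 1)))"
      using MD tg L0 t0 by (intro mult_right_mono mult_nonneg_nonneg add_nonneg_nonneg) auto
    also have "\<dots> \<le> q * (32 * (96 * (tg * L0) + 16 * t * (2 * m)))"
      using q0 t0 J1 by (intro mult_left_mono add_left_mono) auto
    also have "\<dots> = X1 / m + 32 * 16 * 512 * (\<omega> + 1) * B1 * \<sigma> / c"
    proof -
      have qt: "q * tg = (\<omega> + 1) / m" using tg(1) by (simp add: q_def)
      have gen: "q * (32 * (96 * (tg * L0) + 16 * t * (2 * m))) = (q * tg) * (32 * 96 * L0) + (q * tg * m) * (32 * 16 * 512 * B1 * \<sigma> / c)"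
        unfolding t_def by (simp add: algebra_simps)
      have qm: "q * tg * m = \<omega> + 1" using qt m0 by simp
      have r: "a * (k * b * d / c) = k * a * b * d / c" "a / m * (h * k * b) = h * k * a * b / m" for a b c d h k :: real by simp_all
      show ?thesis unfolding gen qm unfolding qt X1_def r ..
    qed
    finally show ?thesis using X \<sigma>A by linarith
  qed
  have E4: "4 * (1 - pr)^M + M * st.err + 8 * (d0 * D) + M * (256 / D\<^sup>2) \<le> \<epsilon>"
  proof -
    have "(1 - pr)^M \<le> exp (- pr)^M" using pr1 exp_ge_add_one_self[of "- pr"] by (intro power_mono) auto
    also have "\<dots> = exp (- (pr * M))" by (simp add: exp_of_nat_mult[symmetric] mult.commute)
    also have "\<dots> \<le> exp (- \<omega>)" using M(1) pr0 by (simp add: pos_divide_le_eq mult.commute)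
    finally have 1: "4 * (1 - pr)^M \<le> \<epsilon> / 8" using exp\<omega> by linarith
    have "M * (32 * M * (real m + 1) / K) \<le> \<epsilon> / 8"
    proof -
      have "256 * (real M)\<^sup>2 * (real m + 1) \<le> \<epsilon> * K" using K(5) \<epsilon> by (simp add: K3_def pos_divide_le_eq mult.commute)
      then have "8 * (M * (32 * M * (real m + 1))) \<le> \<epsilon> * K" by (simp add: power2_eq_square mult_ac)
      then show ?thesis using K(1) by (simp add: pos_divide_le_eq field_simps)
    qed
    then have 2: "M * st.err \<le> \<epsilon> / 8 + \<epsilon> / 8" using d0M unfolding st.err_def distrib_left by linarith
    have "M * (256 / D\<^sup>2) = (M / D\<^sup>2) * 256" by simp
    also have "\<dots> \<le> q * 256" using MD by (intro mult_right_mono) auto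
    also have "\<dots> \<le> X4 / m"
    proof -
      have "q * 256 = X4 / (m * tg)" by (simp add: q_def X4_def)
      also have "\<dots> \<le> X4 / (m * 1)" using X0 m0 tg by (intro divide_left_mono mult_left_mono) auto
      finally show ?thesis by simp
    qed
    finally have 3: "M * (256 / D\<^sup>2) \<le> \<epsilon> / 8" using X by linarith
    show ?thesis using 1 2 3 d0D(3) \<epsilon> by linarith
  qed
  show "\<exists>f \<Lambda> \<gamma>. blk {s. 0 < cos s \<and> \<bar>tan s\<bar> \<le> e / 4} {s. far e s} \<epsilon> B \<delta> f \<Lambda> \<gamma>"
    unfolding blk_def
  proof (rule exI[of _ st.S], rule exI[of _ "M * H"], rule exI[of _ "(dd M)\<^sup>2"], intro conjI allI ballI)
    show "st.S \<in> borel_measurable borel" by (rule st.S_measurable)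
    show "\<bar>st.S x\<bar> \<le> M * H" for x by (rule st.abs_S_le)
    show "0 < (dd M)\<^sup>2" using st.dd0[of M] by simp
    show "(\<integral>\<^sup>+x. indicator V1 x * ennreal \<bar>st.S x\<bar> \<partial>lborel) \<le> ennreal \<epsilon>"
      using order_trans[OF st.L1_S ennreal_leI[OF E1]] .
    show "AE x in lborel. loc_const st.S x" by (rule st.loc_const_S)
    fix s assume "s \<in> {s. 0 < cos s \<and> \<bar>tan s\<bar> \<le> e / 4}"
    then have "st.near s" by (simp add: near)
    from st.near_S[OF this] obtain N where N: "N \<in> sets borel" "emeasure lborel N \<le> ennreal (4 * (1 - pr)^M + M * st.err + 8 * (d0 * D) + M * (256 / D\<^sup>2))"
      "\<And>x. x \<in> V1 - N \<Longrightarrow> \<exists>R\<in>rectangles s. x \<in> R \<and> R \<subseteq> V1 \<and> diameter R \<le> d0 * D \<and> (dd M)\<^sup>2 \<le> measure lborel R \<and> B1 - 1 \<le> mean st.S R"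
      unfolding pp by blast
    have "B < B1 - 1" by (simp add: B1_def)
    then have "\<exists>R\<in>rectangles s. x \<in> R \<and> R \<subseteq> V1 \<and> diameter R < \<delta> \<and> (dd M)\<^sup>2 \<le> measure lborel R \<and> B < mean st.S R" if xN: "x \<in> V1 - N" for x
    proof -
      obtain R where R: "R \<in> rectangles s" "x \<in> R" "R \<subseteq> V1" "diameter R \<le> d0 * D" "(dd M)\<^sup>2 \<le> measure lborel R" "B1 - 1 \<le> mean st.S R"
        using N(3)[OF xN] by blast
      show ?thesis
        by (intro bexI[OF _ R(1)] conjI R(2,3,5) order_le_less_trans[OF R(4) d0D(2)] less_le_trans[OF \<open>B < B1 - 1\<close> R(6)])
    qed
    then show "\<exists>N\<in>sets borel. emeasure lborel N \<le> ennreal \<epsilon> \<and> (\<forall>x\<in>V1 - N. \<exists>R\<in>rectangles s.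
        x \<in> R \<and> R \<subseteq> V1 \<and> diameter R < \<delta> \<and> (dd M)\<^sup>2 \<le> measure lborel R \<and> B < mean st.S R)"
      using N(1) order_trans[OF N(2) ennreal_leI[OF E4]] by blast
  next
    fix s assume "s \<in> {s. far e s}"
    then have "far e s" by simp
    from st.far_S[OF this] obtain N where N: "N \<in> sets borel" "emeasure lborel N \<le> ennreal (M * (32 * (96 * 2^J + 16 * t * (J + 1)) / D\<^sup>2))"
      "\<And>x R. x \<in> V1 - N \<Longrightarrow> R \<in> rectangles s \<Longrightarrow> x \<in> R \<Longrightarrow> \<bar>mean st.S R\<bar> \<le> M * (16 * e' * 2^J / (e * D\<^sup>2)) + 2 * e'"
      by blast
    show "\<exists>N\<in>sets borel. emeasure lborel N \<le> ennreal \<epsilon> \<and> (\<forall>x\<in>V1 - N. \<forall>R\<in>rectangles s. x \<in> R \<longrightarrow> \<bar>mean st.S R\<bar> \<le> \<epsilon>)"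
      by (intro bexI[OF _ N(1)] conjI ballI impI order_trans[OF N(2) ennreal_leI[OF E3]] order_trans[OF N(3) E2])
  qed
qed

lemma blockable_rot:
  assumes "blockable C Far"
  shows "blockable {s. s - a \<in> C} {s. s - a \<in> Far}"
  unfolding blockable_def
proof (intro allI impI)
  fix \<epsilon> B \<delta> :: real assume \<epsilon>: "0 < \<epsilon>" and \<delta>: "0 < \<delta>"
  obtain f \<Lambda> \<gamma> where "blk C Far \<epsilon> B \<delta> f \<Lambda> \<gamma>" using assms \<epsilon> \<delta> unfolding blockable_def by blast
  note f = blkD[OF this]
  note [measurable] = f(1)
  let ?g = "\<lambda>x. f (rot (- a) x)"
  have V: "rot (- a) x \<in> V1 \<longleftrightarrow> x \<in> V1" for x by simp
  have mean: "mean ?g (rc s u v c d) = mean f (rc (s - a) u v c d)" if "u < v" "c < d" for s u v c d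
    using mean_rot[OF f(1) that, of "- a" s] by simp
  have mem: "rot (- a) x \<in> rc (s - a) u v c d \<longleftrightarrow> x \<in> rc s u v c d" for x s u v c d
    by (simp add: rc_def fu_rot' fv_rot')
  have N: "{x. rot (- a) x \<in> N} \<in> sets borel \<and> emeasure lborel {x. rot (- a) x \<in> N} = emeasure lborel N" if [measurable]: "N \<in> sets borel" for N
  proof
    show "{x. rot (- a) x \<in> N} \<in> sets borel" by measurable
  qed (rule emeasure_rot[OF that])
  show "\<exists>f \<Lambda> \<gamma>. blk {s. s - a \<in> C} {s. s - a \<in> Far} \<epsilon> B \<delta> f \<Lambda> \<gamma>"
    unfolding blk_def
  proof (rule exI[of _ ?g], rule exI[of _ \<Lambda>], rule exI[of _ \<gamma>], intro conjI allI ballI)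
    show "?g \<in> borel_measurable borel" by measurable
    show "\<bar>?g x\<bar> \<le> \<Lambda>" for x by (rule f(2))
    show "0 < \<gamma>" by (rule f(3))
    have "(\<integral>\<^sup>+x. indicator V1 x * ennreal \<bar>?g x\<bar> \<partial>lborel) = (\<integral>\<^sup>+x. indicator V1 (rot (- a) x) * ennreal \<bar>?g x\<bar> \<partial>lborel)"
      by (rule nn_integral_cong) (simp add: indicator_def)
    also have "\<dots> = (\<integral>\<^sup>+x. indicator V1 x * ennreal \<bar>f x\<bar> \<partial>lborel)"
      by (rule nn_integral_rot) (rule measurable_indicator_abs[OF f(1)])
    finally show "(\<integral>\<^sup>+x. indicator V1 x * ennreal \<bar>?g x\<bar> \<partial>lborel) \<le> ennreal \<epsilon>" using f(4) by simp
    show "AE x in lborel. loc_const ?g x"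
      using AE_rot[OF f(5), of "- a"]
    proof (rule AE_mp, intro AE_I2 impI)
      fix x assume "loc_const f (rot (- a) x)"
      then show "loc_const ?g x" by (rule loc_const_compose) (intro continuous_intros)
    qed
  next
    fix s assume "s \<in> {s. s - a \<in> C}"
    then obtain N' where N': "N' \<in> sets borel" "emeasure lborel N' \<le> ennreal \<epsilon>" "\<And>x. x \<in> V1 - N' \<Longrightarrow> \<exists>R\<in>rectangles (s - a).
        x \<in> R \<and> R \<subseteq> V1 \<and> diameter R < \<delta> \<and> \<gamma> \<le> measure lborel R \<and> B < mean f R"
      using f(6)[of "s - a"] by blast
    let ?N = "{x. rot (- a) x \<in> N'}"
    have ex: "\<exists>R\<in>rectangles s. x \<in> R \<and> R \<subseteq> V1 \<and> diameter R < \<delta> \<and> \<gamma> \<le> measure lborel R \<and> B < mean ?g R" if x: "x \<in> V1 - ?N" for x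
    proof -
      have "rot (- a) x \<in> V1 - N'" using x V by simp
      then obtain R where R: "R \<in> rectangles (s - a)" "rot (- a) x \<in> R" "R \<subseteq> V1" "diameter R < \<delta>" "\<gamma> \<le> measure lborel R" "B < mean f R"
        using N'(3) by blast
      then obtain u v c d where uv: "u < v" "c < d" and Req: "R = rc (s - a) u v c d" unfolding rectangles_iff by blast
      let ?R = "rc s u v c d"
      have "diameter ?R \<le> diameter R"
      proof (rule diameter_le)
        show "?R \<noteq> {} \<or> 0 \<le> diameter R" using diameter_ge_0[OF bounded_rc, of "s - a" u v c d] Req by simp
        fix y z assume yz: "y \<in> ?R" "z \<in> ?R"
        have "norm (y - z) = norm (rot (- a) y - rot (- a) z)" by (simp flip: rot_diff)
        also have "\<dots> = dist (rot (- a) y) (rot (- a) z)" by (simp add: dist_norm)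
        also have "\<dots> \<le> diameter R"
          unfolding Req by (rule diameter_bounded_bound[OF bounded_rc]) (use yz mem in auto)
        finally show "norm (y - z) \<le> diameter R" .
      qed
      moreover have "?R \<subseteq> V1"
      proof
        fix y assume "y \<in> ?R"
        then have "rot (- a) y \<in> R" using mem Req by simp
        then have "rot (- a) y \<in> V1" using R(3) by blast
        then show "y \<in> V1" using V by simp
      qed
      moreover have "measure lborel ?R = measure lborel R" using uv by (simp add: Req measure_rc)
      moreover have "?R \<in> rectangles s" unfolding rectangles_iff using uv by blast
      moreover have "x \<in> ?R" using R(2) mem Req by simp
      moreover have "mean ?g ?R = mean f R" using mean[OF uv] Req by simp
      ultimately show ?thesis using R(4-6) by (intro bexI[of _ ?R]) auto
    qed
    show "\<exists>N\<in>sets borel. emeasure lborel N \<le> ennreal \<epsilon> \<and> (\<forall>x\<in>V1 - N. \<exists>R\<in>rectangles s.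
        x \<in> R \<and> R \<subseteq> V1 \<and> diameter R < \<delta> \<and> \<gamma> \<le> measure lborel R \<and> B < mean ?g R)"
      using N[OF N'(1)] N'(2) by (intro bexI[of _ ?N] conjI ballI ex) auto
  next
    fix s assume "s \<in> {s. s - a \<in> Far}"
    then obtain N' where N': "N' \<in> sets borel" "emeasure lborel N' \<le> ennreal \<epsilon>" "\<And>x R. x \<in> V1 - N' \<Longrightarrow> R\<in>rectangles (s - a) \<Longrightarrow>
        x \<in> R \<Longrightarrow> \<bar>mean f R\<bar> \<le> \<epsilon>"
      using f(7)[of "s - a"] by blast
    let ?N = "{x. rot (- a) x \<in> N'}"
    have ex: "\<bar>mean ?g R\<bar> \<le> \<epsilon>" if x: "x \<in> V1 - ?N" and R: "R \<in> rectangles s" "x \<in> R" for x R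
    proof -
      obtain u v c d where uv: "u < v" "c < d" and Req: "R = rc s u v c d" using R unfolding rectangles_iff by blast
      have "rot (- a) x \<in> V1 - N'" using x V by simp
      moreover have "rc (s - a) u v c d \<in> rectangles (s - a)" unfolding rectangles_iff using uv by blast
      moreover have "rot (- a) x \<in> rc (s - a) u v c d" using R(2) mem Req by simp
      ultimately show ?thesis unfolding Req mean[OF uv] by (rule N'(3))
    qed
    show "\<exists>N\<in>sets borel. emeasure lborel N \<le> ennreal \<epsilon> \<and> (\<forall>x\<in>V1 - N. \<forall>R\<in>rectangles s. x \<in> R \<longrightarrow> \<bar>mean ?g R\<bar> \<le> \<epsilon>)"
      using N[OF N'(1)] N'(2) by (intro bexI[of _ ?N] conjI ballI impI ex) auto
  qed
qed

lemma blockable_mono: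
  assumes "blockable C Far" "C' \<subseteq> C" "Far' \<subseteq> Far"
  shows "blockable C' Far'"
proof -
  have "blk C' Far' \<epsilon> B \<delta> f \<Lambda> \<gamma>" if "blk C Far \<epsilon> B \<delta> f \<Lambda> \<gamma>" for \<epsilon> B \<delta> f \<Lambda> \<gamma>
    using blkD[OF that] assms(2,3) unfolding blk_def by blast
  note * = this
  show ?thesis
    unfolding blockable_def
  proof (intro allI impI)
    fix \<epsilon> B \<delta> :: real assume "0 < \<epsilon>" "0 < \<delta>"
    then obtain f \<Lambda> \<gamma> where "blk C Far \<epsilon> B \<delta> f \<Lambda> \<gamma>" using assms(1) unfolding blockable_def by blast
    then show "\<exists>f \<Lambda> \<gamma>. blk C' Far' \<epsilon> B \<delta> f \<Lambda> \<gamma>" using * by blast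
  qed
qed

text \<open>For |x| \<le> e/8 the cosine is at least 1/2, so |tan x| \<le> 2 * |x| \<le> e/4 and the
  rotated interval is within reach of \<open>blockable_base\<close>.\<close>

lemma blockable_interval:
  assumes e: "0 < e" "e \<le> 1"
  shows "blockable {s. \<bar>s - a\<bar> \<le> e / 8} {s. far e (s - a)}"
proof (rule blockable_mono[OF blockable_rot[OF blockable_base[OF e], of a]])
  show "{s. \<bar>s - a\<bar> \<le> e / 8} \<subseteq> {s. s - a \<in> {s. 0 < cos s \<and> \<bar>tan s\<bar> \<le> e / 4}}"
  proof
    fix s assume "s \<in> {s. \<bar>s - a\<bar> \<le> e / 8}"
    then have x: "\<bar>s - a\<bar> \<le> e / 8" by simp
    let ?x = "s - a"
    have c: "1/2 \<le> cos ?x"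
    proof -
      have "\<bar>sin (?x/2)\<bar> \<le> \<bar>?x/2\<bar>" by (rule abs_sin_x_le_abs_x)
      also have "\<dots> \<le> 1/2" using x e by simp
      finally have "\<bar>sin (?x/2)\<bar> \<le> 1/2" .
      then have "(sin (?x/2))\<^sup>2 \<le> (1/2)\<^sup>2" by (intro power2_le_iff_abs_le[THEN iffD2]) auto
      moreover have "2 * (?x/2) = ?x" by simp
      then have "cos ?x = 1 - 2 * (sin (?x/2))\<^sup>2" using cos_double_sin[of "?x/2"] by metis
      ultimately show ?thesis by (simp add: power2_eq_square)
    qed
    have s: "\<bar>sin ?x\<bar> \<le> \<bar>?x\<bar>" by (rule abs_sin_x_le_abs_x)
    have "\<bar>tan ?x\<bar> = \<bar>sin ?x\<bar> / cos ?x" using c by (simp add: tan_def)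
    also have "\<dots> \<le> (e / 8) / (1/2)" using s x c e by (intro frac_le) auto
    finally show "s \<in> {s. s - a \<in> {s. 0 < cos s \<and> \<bar>tan s\<bar> \<le> e / 4}}" using c by simp
  qed
qed auto

lemma blockable_trivial: "blockable {} UNIV"
  unfolding blockable_def blk_def
  by (intro allI impI exI[of _ "\<lambda>_. 0"] exI[of _ "0::real"] exI[of _ "1::real"] conjI)
     (auto simp: loc_const_def intro!: bexI[of _ "{}"])

section \<open>Summing a sequence of blocks\<close>

lemma upper_derivative_infI:
  assumes "\<And>k::nat. \<exists>R\<in>rectangles s. x \<in> R \<and> diameter R < 1 / (real k + 1) \<and> real k \<le> mean f R"
  shows "upper_derivative s f x = \<infinity>"
proof -
  have "(SUP R\<in>Collect P. ereal (mean f R)) = \<infinity>" if P: "eventually P (rect_filter s x)" for P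
  proof (rule SUP_PInfty)
    fix n :: nat
    obtain \<delta> where \<delta>: "\<delta> > 0" "\<And>R. R \<in> rectangles s \<Longrightarrow> x \<in> R \<Longrightarrow> diameter R < \<delta> \<Longrightarrow> P R"
      using P unfolding eventually_rect_filter by blast
    obtain k0 :: nat where k0: "1 / \<delta> < k0" using reals_Archimedean2 by blast
    define k where "k = max n k0"
    obtain R where R: "R \<in> rectangles s" "x \<in> R" "diameter R < 1 / (real k + 1)" "real k \<le> mean f R" using assms[of k] by blast
    have "1 / \<delta> < real k + 1" using k0 by (simp add: k_def)
    then have "1 / (real k + 1) < \<delta>" using \<delta>(1) by (simp add: field_simps)
    then have "P R" using \<delta>(2) R by simp
    moreover have "ereal (real n) \<le> ereal (mean f R)" using R(4) by (simp add: k_def)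
    ultimately show "\<exists>R\<in>Collect P. ereal (real n) \<le> ereal (mean f R)" by auto
  qed
  then have "\<infinity> \<le> Limsup (rect_filter s x) (\<lambda>R. ereal (mean f R))"
    unfolding Limsup_def by (intro INF_greatest) auto
  then show ?thesis by (simp add: upper_derivative_def)
qed

lemma rect_subset_ball:
  assumes "R \<in> rectangles s" "x \<in> R" "diameter R < r"
  shows "R \<subseteq> ball x r"
proof
  fix y assume y: "y \<in> R"
  obtain a b c d where "R = rc s a b c d" using assms(1) unfolding rectangles_iff by blast
  then have "dist x y \<le> diameter R" using diameter_bounded_bound[OF _ assms(2) y] bounded_rc by blast
  then show "y \<in> ball x r" using assms(3) by simp
qed

lemma small_rectangle:
  assumes "r > 0"
  shows "\<exists>R\<in>rectangles s. x \<in> R \<and> diameter R < r"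
proof -
  let ?R = "rc s (fu s x - r/8) (fu s x + r/8) (fv s x - r/8) (fv s x + r/8)"
  have "diameter ?R \<le> r/2" using diameter_rc_le[of "fu s x - r/8" "fu s x + r/8" "fv s x - r/8" "fv s x + r/8" s] assms by simp
  then have "diameter ?R < r" using assms by simp
  moreover have "x \<in> ?R" using assms by (simp add: rc_def)
  moreover have "fu s x - r/8 < fu s x + r/8" "fv s x - r/8 < fv s x + r/8" using assms by auto
  then have "?R \<in> rectangles s" unfolding rectangles_iff by blast
  ultimately show ?thesis by blast
qed

lemma loc_const_ballE:
  assumes "loc_const f x"
  obtains r where "r > 0" "\<And>y. y \<in> ball x r \<Longrightarrow> f y = f x"
  using assms unfolding loc_const_def eventually_nhds_metric by (auto simp: dist_commute)

lemma summable_pow_half: "summable (\<lambda>l. (1/2::real)^(l+1))" "(\<Sum>l. (1/2::real)^(l+1)) = 1"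
  using power_half_series by (auto simp: sums_iff)

lemma tail_pow_half: "(\<lambda>l. (1/2::real)^(l+n+1)) sums (1/2)^n"
proof -
  have "(\<lambda>l. (1/2::real)^n * (1/2)^Suc l) sums ((1/2)^n * 1)" by (rule sums_mult[OF power_half_series])
  then show ?thesis by (simp add: power_add mult_ac)
qed

text \<open>Block n is asked for means above n + 1 plus the suprema of all earlier blocks, and for
  an L1 norm below 2^-(n+1) times every earlier area bound. The recursion carries L, the sum of the
  earlier \<Lambda>, and g, the minimum of 1 and the earlier \<gamma>.\<close>

lemma block_sequence:
  fixes C Far :: "nat \<Rightarrow> real set"
  assumes bl: "\<And>n. blockable (C n) (Far n)"
  obtains f :: "nat \<Rightarrow> real \<times> real \<Rightarrow> real" and \<Lambda> \<gamma> g :: "nat \<Rightarrow> real"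
  where "\<And>n. blk (C n) (Far n) ((1/2)^(n+1) * g n) (real n + (\<Sum>l<n. \<Lambda> l) + 1) (1 / (real n + 1)) (f n) (\<Lambda> n) (\<gamma> n)"
    "\<And>n. 0 < g n" "\<And>n. g n \<le> 1" "\<And>l n. l < n \<Longrightarrow> g n \<le> \<gamma> l"
proof -
  define P :: "nat \<Rightarrow> (real \<times> real \<Rightarrow> real) \<times> real \<times> real \<times> real \<times> real \<Rightarrow> bool" where
    "P n x = (case x of (f, \<Lambda>, \<gamma>, L, g) \<Rightarrow> 0 < g \<and> g \<le> 1 \<and> blk (C n) (Far n) ((1/2)^(n+1) * g) (real n + L + 1) (1 / (real n + 1)) f \<Lambda> \<gamma>)" for n x
  define Q :: "nat \<Rightarrow> (real \<times> real \<Rightarrow> real) \<times> real \<times> real \<times> real \<times> real \<Rightarrow> (real \<times> real \<Rightarrow> real) \<times> real \<times> real \<times> real \<times> real \<Rightarrow> bool" where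
    "Q n x y = (case x of (f, \<Lambda>, \<gamma>, L, g) \<Rightarrow> case y of (f', \<Lambda>', \<gamma>', L', g') \<Rightarrow> L' = L + \<Lambda> \<and> g' = min g \<gamma>)" for n x y
  have ex: "\<exists>f \<Lambda> \<gamma>. blk (C n) (Far n) ((1/2)^(n+1) * g) (real n + L + 1) (1 / (real n + 1)) f \<Lambda> \<gamma>" if "0 < g" for n g L
    using bl[of n] that unfolding blockable_def by simp
  have P0: "\<exists>x. P 0 x \<and> fst (snd (snd (snd x))) = 0"
  proof -
    obtain f \<Lambda> \<gamma> where "blk (C 0) (Far 0) ((1/2)^(0+1) * 1) (real 0 + 0 + 1) (1 / (real 0 + 1)) f \<Lambda> \<gamma>"
      using ex[of 1 0 0] by auto
    then show ?thesis by (intro exI[of _ "(f, \<Lambda>, \<gamma>, 0, 1)"]) (auto simp: P_def)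
  qed
  have step: "\<exists>y. P (Suc n) y \<and> Q n x y" if "P n x" for n x
  proof -
    obtain f \<Lambda> \<gamma> L g where x: "x = (f, \<Lambda>, \<gamma>, L, g)" by (cases x) auto
    have *: "0 < g" "g \<le> 1" "0 < \<gamma>" using that blkD(3) unfolding P_def x by auto
    then have g': "0 < min g \<gamma>" "min g \<gamma> \<le> 1" by auto
    obtain f' \<Lambda>' \<gamma>' where "blk (C (Suc n)) (Far (Suc n)) ((1/2)^(Suc n+1) * min g \<gamma>) (real (Suc n) + (L + \<Lambda>) + 1) (1 / (real (Suc n) + 1)) f' \<Lambda>' \<gamma>'"
      using ex[OF g'(1), of "Suc n" "L + \<Lambda>"] by blast
    then show ?thesis using g' by (intro exI[of _ "(f', \<Lambda>', \<gamma>', L + \<Lambda>, min g \<gamma>)"]) (auto simp: P_def Q_def x)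
  qed
  obtain x0 where x0: "P 0 x0" "fst (snd (snd (snd x0))) = 0" using P0 by blast
  \<comment> \<open>Dependent choice leaves the first element open; it is pinned to x0, because L
    must start at 0 to be the sum of the earlier \<Lambda>.\<close>
  define P' where "P' n x \<longleftrightarrow> P n x \<and> (n = 0 \<longrightarrow> x = x0)" for n x
  obtain X where X: "\<And>n. P' n (X n)" "\<And>n. Q n (X n) (X (Suc n))"
    using dependent_nat_choice[of P' Q] x0 step unfolding P'_def by (metis nat.distinct(1))
  define f where "f n = fst (X n)" for n
  define \<Lambda> where "\<Lambda> n = fst (snd (X n))" for n
  define \<gamma> where "\<gamma> n = fst (snd (snd (X n)))" for n
  define L where "L n = fst (snd (snd (snd (X n))))" for n
  define g where "g n = snd (snd (snd (snd (X n))))" for n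
  have Xeq: "X n = (f n, \<Lambda> n, \<gamma> n, L n, g n)" for n by (simp add: f_def \<Lambda>_def \<gamma>_def L_def g_def)
  have P: "0 < g n" "g n \<le> 1" "blk (C n) (Far n) ((1/2)^(n+1) * g n) (n + L n + 1) (1 / (real n + 1)) (f n) (\<Lambda> n) (\<gamma> n)" for n
    using X(1)[of n] unfolding P'_def P_def Xeq by auto
  have Q: "L (Suc n) = L n + \<Lambda> n" "g (Suc n) = min (g n) (\<gamma> n)" for n
    using X(2)[of n] unfolding Q_def Xeq by auto
  have "L 0 = 0" using X(1)[of 0] x0(2) by (simp add: P'_def L_def)
  then have L: "L n = (\<Sum>l<n. \<Lambda> l)" for n by (induction n) (auto simp: Q)
  have g: "g n \<le> \<gamma> l" if "l < n" for l n
    using that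
  proof (induction n)
    case (Suc n)
    then show ?case by (cases "l = n") (auto simp: Q min_le_iff_disj)
  qed simp
  show ?thesis by (rule that[of g \<Lambda> f \<gamma>]) (use P L g in auto)
qed

text \<open>By Borel-Cantelli almost every x lies in only finitely many of the exceptional sets. If
  s is in infinitely many \<open>C n\<close>, such an x has witnesses with mean at least n, as the
  other blocks cannot undo them. If s is in almost all \<open>Far n\<close>, the tails of the series
  of means and of values are small uniformly in the rectangle, and the finitely many remaining
  blocks are constant near x.\<close>

lemma combine_blocks:
  fixes C Far :: "nat \<Rightarrow> real set"
  assumes bl: "\<And>n. blockable (C n) (Far n)"
  obtains F :: "real \<times> real \<Rightarrow> real" where
    "F \<in> borel_measurable borel" "integrable lborel (\<lambda>x. indicator V1 x * F x)"
    "\<And>s. infinite {n. s \<in> C n} \<Longrightarrow> AE x in lborel. x \<in> V1 \<longrightarrow> upper_derivative s F x = \<infinity>"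
    "\<And>s. finite {n. s \<notin> Far n} \<Longrightarrow> AE x in lborel. x \<in> V1 \<longrightarrow> (mean F \<longlongrightarrow> F x) (rect_filter s x)"
proof -
  obtain f :: "nat \<Rightarrow> real \<times> real \<Rightarrow> real" and \<Lambda> \<gamma> g :: "nat \<Rightarrow> real"
  where blk: "\<And>n. blk (C n) (Far n) ((1/2)^(n+1) * g n) (real n + (\<Sum>l<n. \<Lambda> l) + 1) (1 / (real n + 1)) (f n) (\<Lambda> n) (\<gamma> n)"
    and g: "\<And>n. 0 < g n" "\<And>n. g n \<le> 1" "\<And>l n. l < n \<Longrightarrow> g n \<le> \<gamma> l"
    by (rule block_sequence[of C Far, OF bl]) (rule that)
  define \<epsilon> where "\<epsilon> n = (1/2)^(n+1) * g n" for n
  note b = blkD[OF blk, folded \<epsilon>_def]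
  have [measurable]: "f n \<in> borel_measurable borel" for n by (rule b(1))
  have \<epsilon>: "0 < \<epsilon> n" "\<epsilon> n \<le> (1/2)^(n+1)" for n
    using g(1,2)[of n] by (auto simp: \<epsilon>_def mult_left_le)
  have \<epsilon>\<gamma>: "\<epsilon> n \<le> (1/2)^(n+1) * \<gamma> l" if "l < n" for l n
    unfolding \<epsilon>_def using g(3)[OF that] by (intro mult_left_mono) auto
  have sum\<epsilon>: "summable \<epsilon>" by (rule summable_comparison_test'[OF summable_pow_half(1)]) (use \<epsilon> in \<open>auto simp: less_imp_le\<close>)
  define F where "F x = (\<Sum>l. f l x)" for x
  have F [measurable]: "F \<in> borel_measurable borel" unfolding F_def[abs_def] by measurable
  let ?I = "\<lambda>R l x. indicator R x * f l x"
  have mV: "V1 \<in> sets borel" by simp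
  have intR: "integrable lborel (?I R l)" "(\<integral>x. norm (?I R l x) \<partial>lborel) \<le> \<epsilon> l" if R: "R \<in> sets borel" "R \<subseteq> V1" for R l
  proof -
    note [measurable] = R(1)
    have le: "(\<integral>\<^sup>+x. ennreal (norm (?I R l x)) \<partial>lborel) \<le> ennreal (\<epsilon> l)"
    proof -
      have "(\<integral>\<^sup>+x. ennreal (norm (?I R l x)) \<partial>lborel) \<le> (\<integral>\<^sup>+x. indicator V1 x * ennreal \<bar>f l x\<bar> \<partial>lborel)"
        by (rule nn_integral_mono) (use R(2) in \<open>auto simp: indicator_def\<close>)
      then show ?thesis using b(4)[of l] by simp
    qed
    show i: "integrable lborel (?I R l)"
      by (rule integrableI_bounded) (use le in \<open>auto simp: order_le_less_trans\<close>)
    have "ennreal (\<integral>x. norm (?I R l x) \<partial>lborel) \<le> ennreal (\<epsilon> l)"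
      using le nn_integral_eq_integral[OF integrable_norm[OF i]] by simp
    then show "(\<integral>x. norm (?I R l x) \<partial>lborel) \<le> \<epsilon> l" using \<epsilon>(1)[of l] by simp
  qed
  have sumI: "summable (\<lambda>l. \<integral>x. norm (?I R l x) \<partial>lborel)" if R: "R \<in> sets borel" "R \<subseteq> V1" for R
    by (rule summable_comparison_test'[OF sum\<epsilon>]) (use intR(2)[OF R] in auto)
  have AEsum: "AE x in lborel. x \<in> V1 \<longrightarrow> summable (\<lambda>l. \<bar>f l x\<bar>)"
  proof -
    have "(\<integral>\<^sup>+x. (\<Sum>l. indicator V1 x * ennreal \<bar>f l x\<bar>) \<partial>lborel) = (\<Sum>l. \<integral>\<^sup>+x. indicator V1 x * ennreal \<bar>f l x\<bar> \<partial>lborel)"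
      by (rule nn_integral_suminf) (use measurable_indicator_abs[OF b(1)] in simp)
    also have "\<dots> \<le> (\<Sum>l. ennreal (\<epsilon> l))" by (intro suminf_le b(4)) auto
    also have "\<dots> = ennreal (\<Sum>l. \<epsilon> l)" using sum\<epsilon> \<epsilon> by (intro suminf_ennreal2) (auto simp: less_imp_le)
    finally have "(\<integral>\<^sup>+x. (\<Sum>l. indicator V1 x * ennreal \<bar>f l x\<bar>) \<partial>lborel) \<noteq> \<infinity>" by (auto simp: top_unique)
    then have "AE x in lborel. (\<Sum>l. indicator V1 x * ennreal \<bar>f l x\<bar>) \<noteq> \<infinity>"
      by (intro nn_integral_PInf_AE borel_measurable_suminf_order) (use measurable_indicator_abs[OF b(1)] in simp)
    then show ?thesis
    proof (rule AE_mp, intro AE_I2 impI)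
      fix x assume fin: "(\<Sum>l. indicator V1 x * ennreal \<bar>f l x\<bar>) \<noteq> \<infinity>" and x: "x \<in> V1"
      then have "(\<Sum>l. ennreal \<bar>f l x\<bar>) \<noteq> top" by (simp add: indicator_def)
      then show "summable (\<lambda>l. \<bar>f l x\<bar>)" by (intro summable_suminf_not_top) auto
    qed
  qed
  have AEsumR: "AE x in lborel. summable (\<lambda>l. norm (?I R l x))" if R: "R \<subseteq> V1" for R
    using AEsum
  proof (rule AE_mp, intro AE_I2 impI)
    fix x assume "x \<in> V1 \<longrightarrow> summable (\<lambda>l. \<bar>f l x\<bar>)"
    then show "summable (\<lambda>l. norm (?I R l x))" using R by (cases "x \<in> R") auto
  qed
  have sumF: "(\<Sum>l. ?I R l x) = indicator R x * F x" for R x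
    by (cases "x \<in> R") (auto simp: F_def)
  have intF: "integrable lborel (\<lambda>x. indicator V1 x * F x)"
    using integrable_suminf[of lborel "?I V1", OF intR(1)[OF mV order_refl] AEsumR[OF order_refl] sumI[OF mV order_refl]] unfolding sumF .
  have mean_sums: "(\<lambda>l. mean (f l) R) sums mean F R" if R: "R \<in> rectangles s" "R \<subseteq> V1" for R s
  proof -
    obtain u v c d where uv: "u < v" "c < d" and Req: "R = rc s u v c d" using R(1) unfolding rectangles_iff by blast
    have mR: "R \<in> sets borel" unfolding Req by simp
    have "(\<lambda>l. \<integral>x. ?I R l x \<partial>lborel) sums (\<integral>x. indicator R x * F x \<partial>lborel)"
      using sums_integral[of lborel "?I R", OF intR(1)[OF mR R(2)] AEsumR[OF R(2)] sumI[OF mR R(2)]] unfolding sumF .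
    then have "(\<lambda>l. (\<integral>x. ?I R l x \<partial>lborel) / measure lborel R) sums ((\<integral>x. indicator R x * F x \<partial>lborel) / measure lborel R)"
      by (rule sums_divide)
    then show ?thesis unfolding Req by (simp add: mean_eq)
  qed
  have mean_le: "\<bar>mean (f l) R\<bar> * measure lborel R \<le> \<epsilon> l" if R: "R \<in> rectangles s" "R \<subseteq> V1" for R s l
  proof -
    obtain u v c d where uv: "u < v" "c < d" and Req: "R = rc s u v c d" using R(1) unfolding rectangles_iff by blast
    have mR: "R \<in> sets borel" "0 < measure lborel R" unfolding Req using uv by (auto simp: measure_rc)
    have "\<bar>\<integral>x. ?I R l x \<partial>lborel\<bar> \<le> (\<integral>x. norm (?I R l x) \<partial>lborel)" using integral_norm_bound[of lborel "?I R l"] by simp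
    also have "\<dots> \<le> \<epsilon> l" by (rule intR(2)[OF mR(1) R(2)])
    finally have "\<bar>\<integral>x. ?I R l x \<partial>lborel\<bar> \<le> \<epsilon> l" .
    moreover have "mean (f l) R = (\<integral>x. ?I R l x \<partial>lborel) / measure lborel R" unfolding Req by (rule mean_eq) simp
    ultimately show ?thesis using mR(2) by (simp add: abs_divide)
  qed
  have BC: "AE x in lborel. eventually (\<lambda>n. x \<notin> A n) sequentially"
    if A: "\<And>n. A n \<in> sets borel" "\<And>n. emeasure lborel (A n) \<le> ennreal (\<epsilon> n)" for A :: "nat \<Rightarrow> (real \<times> real) set"
  proof -
    have "measure lborel (A n) \<le> \<epsilon> n" for n
      using A(2)[of n] \<epsilon>(1)[of n] by (simp add: measure_def enn2real_leI less_imp_le)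
    then have "summable (\<lambda>n. measure lborel (A n))"
      by (intro summable_comparison_test'[OF sum\<epsilon>]) auto
    then have "AE x in lborel. eventually (\<lambda>n. x \<in> space lborel - A n) sequentially"
      by (intro borel_cantelli_AE1) (use A(1) order_le_less_trans[OF A(2) ennreal_less_top] in auto)
    then show ?thesis by simp
  qed
  show ?thesis
  proof (rule that[OF F intF])
    fix s assume inf: "infinite {n. s \<in> C n}"
    define W where "W n x \<longleftrightarrow> (\<exists>R\<in>rectangles s.
        x \<in> R \<and> R \<subseteq> V1 \<and> diameter R < 1 / (real n + 1) \<and> \<gamma> n \<le> measure lborel R \<and> real n + (\<Sum>l<n. \<Lambda> l) + 1 < mean (f n) R)" for n x
    have "\<forall>n. \<exists>N\<in>sets borel. emeasure lborel N \<le> ennreal (\<epsilon> n) \<and> (s \<in> C n \<longrightarrow> (\<forall>x\<in>V1 - N. W n x))"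
    proof
      fix n
      show "\<exists>N\<in>sets borel. emeasure lborel N \<le> ennreal (\<epsilon> n) \<and> (s \<in> C n \<longrightarrow> (\<forall>x\<in>V1 - N. W n x))"
      proof (cases "s \<in> C n")
        case True
        obtain N where "N \<in> sets borel" "emeasure lborel N \<le> ennreal (\<epsilon> n)" "\<forall>x\<in>V1 - N. W n x"
          using b(6)[OF True, folded W_def] by (rule bexE) (erule conjE, rule that)
        then show ?thesis by (intro bexI[of _ N] conjI impI)
      next
        case False
        then show ?thesis by (intro bexI[of _ "{}"] conjI) simp_all
      qed
    qed
    then obtain A where A: "\<And>n. A n \<in> sets borel" "\<And>n. emeasure lborel (A n) \<le> ennreal (\<epsilon> n)"
      and A': "\<And>n x. s \<in> C n \<Longrightarrow> x \<in> V1 - A n \<Longrightarrow> W n x"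
      by metis
    show "AE x in lborel. x \<in> V1 \<longrightarrow> upper_derivative s F x = \<infinity>"
      using BC[OF A]
    proof (rule AE_mp, intro AE_I2 impI)
      fix x assume ev: "eventually (\<lambda>n. x \<notin> A n) sequentially" and x: "x \<in> V1"
      then obtain n0 where n0: "\<And>n. n \<ge> n0 \<Longrightarrow> x \<notin> A n" by (auto simp: eventually_sequentially)
      show "upper_derivative s F x = \<infinity>"
      proof (rule upper_derivative_infI)
        fix k :: nat
        obtain n where n: "n > max n0 k" "s \<in> C n" using inf unfolding infinite_nat_iff_unbounded by blast
        have "x \<notin> A n" by (rule n0) (use n(1) in linarith)
        then have "x \<in> V1 - A n" using x by blast
        then have "W n x" by (rule A'[OF n(2)])
        then obtain R where R: "R \<in> rectangles s" "x \<in> R" "R \<subseteq> V1" "diameter R < 1 / (real n + 1)" "\<gamma> n \<le> measure lborel R"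
          "real n + (\<Sum>l<n. \<Lambda> l) + 1 < mean (f n) R" unfolding W_def by (elim bexE conjE) (rule that)
        have ms: "(\<lambda>l. mean (f l) R) sums mean F R" by (rule mean_sums[OF R(1,3)])
        then have sm: "summable (\<lambda>l. mean (f l) R)" by (simp add: sums_iff)
        \<comment> \<open>The earlier blocks cost at most the sum of their \<Lambda>. The later ones
          cost at most 1, because R has area at least \<gamma> n and their L1 norms were chosen
          small relative to it. What remains of the mean is at least n.\<close>
        have "mean F R = (\<Sum>l. mean (f (l + Suc n)) R) + (\<Sum>l<Suc n. mean (f l) R)"
          using ms suminf_split_initial_segment[OF sm, of "Suc n"] by (simp add: sums_iff)
        moreover have "- (\<Sum>l<n. \<Lambda> l) \<le> (\<Sum>l<n. mean (f l) R)"
        proof -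
          obtain u v c d where uv: "u < v" "c < d" and Req: "R = rc s u v c d" using R(1) unfolding rectangles_iff by blast
          have "\<bar>mean (f l) R\<bar> \<le> \<Lambda> l" for l unfolding Req
            by (rule abs_mean_le) (use b(2) uv order_trans[OF abs_ge_zero b(2)] in auto)
          then have "(\<Sum>l<n. - \<Lambda> l) \<le> (\<Sum>l<n. mean (f l) R)" by (intro sum_mono) (meson abs_le_D2 minus_le_iff)
          then show ?thesis by (simp add: sum_negf)
        qed
        moreover have "- 1 \<le> (\<Sum>l. mean (f (l + Suc n)) R)"
        proof -
          have le: "\<bar>mean (f (l + Suc n)) R\<bar> \<le> (1/2)^(l + Suc n + 1)" for l
          proof -
            have \<gamma>: "0 < \<gamma> n" by (rule b(3))
            have "\<bar>mean (f (l + Suc n)) R\<bar> * \<gamma> n \<le> \<bar>mean (f (l + Suc n)) R\<bar> * measure lborel R" using R(5) by (intro mult_left_mono) auto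
            also have "\<dots> \<le> \<epsilon> (l + Suc n)" by (rule mean_le[OF R(1,3)])
            also have "\<dots> \<le> (1/2)^(l + Suc n + 1) * \<gamma> n" by (rule \<epsilon>\<gamma>) simp
            finally show ?thesis using \<gamma> by simp
          qed
          have s1: "summable (\<lambda>l. (1/2::real)^(l + Suc n + 1))" "(\<Sum>l. (1/2::real)^(l + Suc n + 1)) = (1/2)^Suc n"
            using tail_pow_half[of "Suc n"] by (auto simp: sums_iff)
          have sn: "summable (\<lambda>l. \<bar>mean (f (l + Suc n)) R\<bar>)"
            by (rule summable_comparison_test'[OF s1(1)]) (use le in auto)
          have "\<bar>\<Sum>l. mean (f (l + Suc n)) R\<bar> \<le> (\<Sum>l. \<bar>mean (f (l + Suc n)) R\<bar>)" by (rule summable_rabs[OF sn])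
          also have "\<dots> \<le> (\<Sum>l. (1/2::real)^(l + Suc n + 1))" by (intro suminf_le le sn s1)
          also have "\<dots> \<le> 1" unfolding s1(2) by (rule power_le_one) auto
          finally show ?thesis by linarith
        qed
        ultimately have "real n \<le> mean F R" using R(6) by simp
        moreover have "1 / (real n + 1) \<le> 1 / (real k + 1)" using n by (intro divide_left_mono) auto
        ultimately show "\<exists>R\<in>rectangles s. x \<in> R \<and> diameter R < 1 / (real k + 1) \<and> real k \<le> mean F R"
          using R n by (intro bexI[of _ R]) auto
      qed
    qed
  next
    fix s assume fin: "finite {n. s \<notin> Far n}"
    define W where "W n x \<longleftrightarrow> (\<forall>R\<in>rectangles s. x \<in> R \<longrightarrow> \<bar>mean (f n) R\<bar> \<le> \<epsilon> n)" for n x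
    have "\<forall>n. \<exists>N\<in>sets borel. emeasure lborel N \<le> ennreal (\<epsilon> n) \<and> (s \<in> Far n \<longrightarrow> (\<forall>x\<in>V1 - N. W n x))"
    proof
      fix n
      show "\<exists>N\<in>sets borel. emeasure lborel N \<le> ennreal (\<epsilon> n) \<and> (s \<in> Far n \<longrightarrow> (\<forall>x\<in>V1 - N. W n x))"
      proof (cases "s \<in> Far n")
        case True
        obtain N where "N \<in> sets borel" "emeasure lborel N \<le> ennreal (\<epsilon> n)" "\<forall>x\<in>V1 - N. W n x"
          using b(7)[OF True, folded W_def] by (rule bexE) (erule conjE, rule that)
        then show ?thesis by (intro bexI[of _ N] conjI impI)
      next
        case False
        then show ?thesis by (intro bexI[of _ "{}"] conjI) simp_all
      qed
    qed
    then obtain A where A: "\<And>n. A n \<in> sets borel" "\<And>n. emeasure lborel (A n) \<le> ennreal (\<epsilon> n)"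
      and A': "\<And>n x. s \<in> Far n \<Longrightarrow> x \<in> V1 - A n \<Longrightarrow> W n x"
      by metis
    have lc: "AE x in lborel. \<forall>l. loc_const (f l) x" unfolding AE_all_countable using b(5) by blast
    show "AE x in lborel. x \<in> V1 \<longrightarrow> (mean F \<longlongrightarrow> F x) (rect_filter s x)"
      using BC[OF A] AEsum lc
    proof eventually_elim
      case (elim x)
      show ?case
      proof
        assume x: "x \<in> V1"
        obtain n1 where n1: "\<And>n. n \<ge> n1 \<Longrightarrow> x \<notin> A n" using elim(1) by (auto simp: eventually_sequentially)
        obtain m where m: "{n. s \<notin> Far n} \<subseteq> {..m}" using fin finite_nat_iff_bounded_le by blast
        define n2 where "n2 = Suc m"
        have n2: "s \<in> Far n" if "n \<ge> n2" for n
        proof (rule ccontr)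
          assume "s \<notin> Far n"
          then have "n \<in> {..m}" using m by blast
          then show False using that by (simp add: n2_def)
        qed
        have sx: "summable (\<lambda>l. f l x)" by (rule summable_rabs_cancel) (use elim(2) x in simp)
        have mean\<epsilon>: "\<bar>mean (f l) R\<bar> \<le> \<epsilon> l" if "l \<ge> max n1 n2" "R \<in> rectangles s" "x \<in> R" for l R
          using A'[of l x] n1[of l] n2[of l] that x unfolding W_def by simp
        \<comment> \<open>The bound on means passes to the value at x: by local constancy a small
          rectangle around x has mean exactly f l x.\<close>
        have fx: "\<bar>f l x\<bar> \<le> \<epsilon> l" if "l \<ge> max n1 n2" for l
        proof -
          obtain r where r: "r > 0" "\<And>y. y \<in> ball x r \<Longrightarrow> f l y = f l x" using loc_const_ballE[OF elim(3)[rule_format, of l]] by blast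
          obtain R where R: "R \<in> rectangles s" "x \<in> R" "diameter R < r" using small_rectangle[OF r(1)] by blast
          obtain u v c d where uv: "u < v" "c < d" and Req: "R = rc s u v c d" using R(1) unfolding rectangles_iff by blast
          have "mean (f l) R = f l x"
            unfolding Req by (rule mean_const[OF _ uv]) (use rect_subset_ball[OF R] r(2) Req in auto)
          then show ?thesis using mean\<epsilon>[OF that R(1,2)] by simp
        qed
        show "(mean F \<longlongrightarrow> F x) (rect_filter s x)"
        proof (rule tendstoI)
          fix \<eta> :: real assume \<eta>: "0 < \<eta>"
          obtain n3 :: nat where n3: "(1/2::real)^n3 < \<eta> / 2" using real_arch_pow_inv[of "\<eta>/2" "1/2"] \<eta> by auto
          define n where "n = max n3 (max n1 n2)"
          have nn: "n3 \<le> n" "n1 \<le> n" "n2 \<le> n" by (auto simp: n_def)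
          have "\<forall>l. \<exists>r. 0 < r \<and> (\<forall>y\<in>ball x r. f l y = f l x)"
          proof
            fix l
            obtain r where "r > 0" "\<And>y. y \<in> ball x r \<Longrightarrow> f l y = f l x"
              by (rule loc_const_ballE[OF elim(3)[rule_format, of l]]) (rule that)
            then show "\<exists>r. 0 < r \<and> (\<forall>y\<in>ball x r. f l y = f l x)" by (intro exI[of _ r] conjI ballI)
          qed
          then obtain r where r': "\<forall>l. 0 < r l \<and> (\<forall>y\<in>ball x (r l). f l y = f l x)" by (rule choice[THEN exE])
          have r: "r l > 0" "y \<in> ball x (r l) \<Longrightarrow> f l y = f l x" for l y
            using r'[rule_format, of l] by (blast, blast)
          \<comment> \<open>Only the first n blocks need a radius of constancy, so the minimum is
            positive; 1 - norm x keeps the rectangle in the unit ball.\<close>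
          define \<delta> where "\<delta> = Min (insert (1 - norm x) (r ` {..<n}))"
          have \<delta>: "0 < \<delta>" "\<delta> \<le> 1 - norm x" "\<And>l. l < n \<Longrightarrow> \<delta> \<le> r l"
          proof -
            have fin: "finite (insert (1 - norm x) (r ` {..<n}))" by simp
            show "0 < \<delta>" unfolding \<delta>_def using r(1) x by (subst Min_gr_iff[OF fin]) auto
            show "\<delta> \<le> 1 - norm x" unfolding \<delta>_def by (rule Min_le[OF fin]) simp
            show "\<delta> \<le> r l" if "l < n" for l unfolding \<delta>_def by (rule Min_le[OF fin]) (use that in simp)
          qed
          show "\<forall>\<^sub>F R in rect_filter s x. dist (mean F R) (F x) < \<eta>"
            unfolding eventually_rect_filter
          proof (intro exI[of _ \<delta>] conjI ballI impI \<delta>(1))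
            fix R assume R: "R \<in> rectangles s" and "x \<in> R \<and> diameter R < \<delta>"
            then have xR: "x \<in> R" "diameter R < \<delta>" by auto
            have Rb: "R \<subseteq> ball x \<delta>" by (rule rect_subset_ball[OF R xR])
            have RV: "R \<subseteq> V1"
            proof
              fix y assume "y \<in> R"
              then have "dist x y < 1 - norm x" using Rb \<delta>(2) by auto
              then show "y \<in> V1" using norm_triangle_sub[of y x] by (simp add: dist_norm norm_minus_commute)
            qed
            obtain u v c d where uv: "u < v" "c < d" and Req: "R = rc s u v c d" using R unfolding rectangles_iff by blast
            have eq: "mean (f l) R = f l x" if "l < n" for l
            proof -
              have in_ball_r: "f l y = f l x" if "y \<in> R" for y
              proof (rule r(2))
                have "dist x y < \<delta>" using that Rb by auto
                then show "y \<in> ball x (r l)" using \<delta>(3)[OF \<open>l < n\<close>] by simp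
              qed
              show ?thesis unfolding Req by (rule mean_const[OF _ uv]) (use in_ball_r Req in blast)
            qed
            let ?h = "\<lambda>l. mean (f l) R - f l x"
            have ms: "?h sums (mean F R - F x)"
              unfolding F_def by (rule sums_diff[OF mean_sums[OF R RV, unfolded F_def[abs_def]] summable_sums[OF sx]])
            then have sm: "summable ?h" by (simp add: sums_iff)
            have "mean F R - F x = (\<Sum>l. ?h (l + n)) + (\<Sum>l<n. ?h l)"
              using ms suminf_split_initial_segment[OF sm, of n] by (simp add: sums_iff)
            also have "(\<Sum>l<n. ?h l) = 0" using eq by simp
            finally have d: "mean F R - F x = (\<Sum>l. ?h (l + n))" by simp
            have le: "\<bar>?h (l + n)\<bar> \<le> 2 * (1/2)^(l+n+1)" for l
            proof -
              have l: "l + n \<ge> max n1 n2" using nn by simp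
              show ?thesis using mean\<epsilon>[OF l R xR(1)] fx[OF l] \<epsilon>(2)[of "l + n"] by linarith
            qed
            have t: "(\<lambda>l. 2 * (1/2::real)^(l+n+1)) sums (2 * (1/2)^n)" by (rule sums_mult[OF tail_pow_half])
            have sn: "summable (\<lambda>l. \<bar>?h (l + n)\<bar>)"
              by (rule summable_comparison_test'[OF sums_summable[OF t]]) (use le in auto)
            have "\<bar>mean F R - F x\<bar> \<le> (\<Sum>l. \<bar>?h (l + n)\<bar>)" unfolding d by (rule summable_rabs[OF sn])
            also have "\<dots> \<le> (\<Sum>l. 2 * (1/2::real)^(l+n+1))" by (intro suminf_le le sn sums_summable[OF t])
            also have "\<dots> = 2 * (1/2)^n" using t by (simp add: sums_iff)
            also have "\<dots> \<le> 2 * (1/2)^n3" using nn by (intro mult_left_mono power_decreasing) auto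
            also have "\<dots> < \<eta>" using n3 by simp
            finally show "dist (mean F R) (F x) < \<eta>" by (simp add: dist_real_def)
          qed
        qed
      qed
    qed
  qed
qed

lemma upper_derivative_inf_iff:
  "upper_derivative s f x = \<infinity> \<longleftrightarrow>
     (\<forall>B. \<forall>\<delta>>0. \<exists>R\<in>rectangles s. x \<in> R \<and> diameter R < \<delta> \<and> B < mean f R)" (is "_ \<longleftrightarrow> ?Q")
proof
  assume inf: "upper_derivative s f x = \<infinity>"
  show ?Q
  proof (intro allI impI, rule ccontr)
    fix B \<delta> :: real
    assume "0 < \<delta>" and n: "\<not> (\<exists>R\<in>rectangles s. x \<in> R \<and> diameter R < \<delta> \<and> B < mean f R)"
    have "eventually (\<lambda>R. ereal (mean f R) \<le> ereal B) (rect_filter s x)"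
      unfolding eventually_rect_filter
    proof (intro exI[of _ \<delta>] conjI ballI impI \<open>0 < \<delta>\<close>)
      fix R assume "R \<in> rectangles s" "x \<in> R \<and> diameter R < \<delta>"
      then have "\<not> B < mean f R" using n by blast
      then show "ereal (mean f R) \<le> ereal B" by simp
    qed
    then have "upper_derivative s f x \<le> ereal B" unfolding upper_derivative_def by (rule Limsup_bounded)
    then show False using inf by simp
  qed
next
  assume Q: ?Q
  show "upper_derivative s f x = \<infinity>"
  proof (rule upper_derivative_infI)
    fix k :: nat
    have "0 < 1 / (real k + 1)" by simp
    with Q obtain R where "R \<in> rectangles s" "x \<in> R" "diameter R < 1 / (real k + 1)" "real k < mean f R" by blast
    then show "\<exists>R\<in>rectangles s. x \<in> R \<and> diameter R < 1 / (real k + 1) \<and> real k \<le> mean f R"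
      by (intro bexI[of _ R]) auto
  qed
qed

lemma upper_derivative_finite:
  assumes "(mean f \<longlongrightarrow> l) (rect_filter s x)"
  shows "upper_derivative s f x \<noteq> \<infinity>"
proof
  assume inf: "upper_derivative s f x = \<infinity>"
  have "eventually (\<lambda>R. mean f R < l + 1) (rect_filter s x)" by (rule order_tendstoD[OF assms]) simp
  then obtain \<delta> where \<delta>: "\<delta> > 0" "\<And>R. R \<in> rectangles s \<Longrightarrow> x \<in> R \<and> diameter R < \<delta> \<Longrightarrow> mean f R < l + 1"
    unfolding eventually_rect_filter by blast
  obtain R where "R \<in> rectangles s" "x \<in> R" "diameter R < \<delta>" "l + 1 < mean f R"
    using inf \<delta>(1) unfolding upper_derivative_inf_iff by blast
  then show False using \<delta>(2)[of R] by simp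
qed

section \<open>From sets of slopes to sequences of blocks: Whitney intervals\<close>

text \<open>The input of \<open>combine_blocks\<close> for a function on the unit ball whose
  divergent slopes in [0, pi/2) are exactly those of A.\<close>

definition admissible :: "real set \<Rightarrow> bool" where
  "admissible A \<longleftrightarrow> (\<exists>C Far :: nat \<Rightarrow> real set. (\<forall>n. blockable (C n) (Far n)) \<and>
     (\<forall>s\<in>A. infinite {n. s \<in> C n}) \<and> (\<forall>s\<in>{0..<pi/2} - A. finite {n. s \<notin> Far n}))"

lemma admissible_empty: "admissible {}"
  unfolding admissible_def
  by (intro exI[of _ "\<lambda>_. {}"] exI[of _ "\<lambda>_. UNIV"]) (auto intro: blockable_trivial)

text \<open>The endpoint 0 is not an interior point of [0, pi/2), so the Whitney argument does not
  reach it. Intervals shrinking to 0 serve instead: any other slope s keeps sin s and cos s above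
  1/(n+1) from some n on.\<close>

lemma admissible_0: "admissible {0}"
proof -
  define C where "C n = {s::real. \<bar>s - 0\<bar> \<le> 1 / (real n + 1) / 8}" for n
  define F where "F n = {s::real. far (1 / (real n + 1)) (s - 0)}" for n
  have "blockable (C n) (F n)" for n unfolding C_def F_def by (rule blockable_interval) auto
  moreover have "infinite {n. 0 \<in> C n}" by (simp add: C_def)
  moreover have "finite {n. s \<notin> F n}" if "s \<in> {0..<pi/2} - {0}" for s
  proof -
    have s: "0 < s" "s < pi/2" using that by auto
    have "0 < sin s" "0 < cos s" using s by (auto intro: sin_gt_zero cos_gt_zero)
    then obtain m :: nat where m: "1 / min (sin s) (cos s) < m" using reals_Archimedean2 by blast
    have "s \<in> F n" if "m \<le> n" for n
    proof -
      have m0: "0 < min (sin s) (cos s)" using \<open>0 < sin s\<close> \<open>0 < cos s\<close> by simp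
      have nm: "1 / min (sin s) (cos s) < real n + 1" using m that by linarith
      have inv: "1 / b \<le> a" if "1 / a < b" "0 < a" "0 < b" for a b :: real
        using that by (simp add: divide_simps mult.commute)
      have "1 / (real n + 1) \<le> min (sin s) (cos s)" by (rule inv[OF nm m0]) simp
      then have "1 / (real n + 1) \<le> \<bar>sin s\<bar>" "1 / (real n + 1) \<le> \<bar>cos s\<bar>"
        by (meson abs_ge_self min.boundedE order_trans)+
      then show ?thesis unfolding F_def far_def by simp
    qed
    then have "n \<le> m" if "s \<notin> F n" for n using that by (rule_tac ccontr) simp
    then have "{n. s \<notin> F n} \<subseteq> {..m}" by auto
    then show ?thesis by (rule finite_subset) simp
  qed
  ultimately show ?thesis unfolding admissible_def by blast
qed

text \<open>By the double angle formula: with c = sqrt 2 / 2, cosines on [0, pi/4] are at least c,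
  hence sin (y/2) \<ge> c * (y/2), and 2 * c^2 = 1.\<close>

lemma half_le_sin:
  fixes y :: real
  assumes y: "0 \<le> y" "y \<le> pi/2"
  shows "y / 2 \<le> sin y"
proof -
  let ?c = "sqrt 2 / 2 :: real"
  have z: "?c \<le> cos t" if "0 \<le> t" "t \<le> y / 2" for t
  proof -
    have "cos (pi/4) \<le> cos t" by (rule cos_monotone_0_pi_le) (use that y in auto)
    then show ?thesis by (simp add: cos_45)
  qed
  have s: "?c * (y/2) \<le> sin (y/2)"
  proof (cases "y = 0")
    case False
    then have "0 < y/2" using y by simp
    from MVT2[OF this, of sin cos] obtain t where t: "0 < t" "t < y/2" "sin (y/2) - sin 0 = (y/2 - 0) * cos t"
      by (metis DERIV_sin)
    have "?c * (y/2) \<le> cos t * (y/2)" by (rule mult_right_mono) (use z[of t] t y in auto)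
    moreover have "sin (y/2) = cos t * (y/2)" using t(3) by (simp add: mult.commute)
    ultimately show ?thesis by linarith
  qed simp
  have "y / 2 = 2 * (?c * (y/2)) * ?c" by simp
  also have "\<dots> \<le> 2 * sin (y/2) * cos (y/2)"
  proof (rule mult_mono)
    show "2 * (?c * (y/2)) \<le> 2 * sin (y/2)" using s by linarith
    show "?c \<le> cos (y/2)" by (rule z) (use y in auto)
    show "0 \<le> 2 * sin (y/2)" using y by (auto intro!: sin_ge_zero)
  qed simp
  also have "\<dots> = sin y" using sin_double[of "y/2"] by simp
  finally show ?thesis .
qed

text \<open>Failing \<open>far\<close> means that s - c is near some multiple of pi/2. The margin 2
  * e between c and both endpoints rules out the multiples pi/2 and - pi/2.\<close>

lemma far_shift:
  assumes e: "0 < e" "2 * e \<le> c" "c \<le> pi/2 - 2 * e" and s: "0 \<le> s" "s < pi/2" and n: "\<not> far e (s - c)"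
  shows "\<bar>s - c\<bar> < 2 * e"
proof -
  let ?y = "\<bar>s - c\<bar>"
  have y: "?y \<le> pi/2 - 2 * e" using e s by (auto simp: abs_if)
  have "(pi/2 - ?y) / 2 \<le> sin (pi/2 - ?y)" by (rule half_le_sin) (use y e in auto)
  also have "\<dots> = cos ?y" by (simp add: cos_sin_eq)
  also have "\<dots> = cos (s - c)" by (rule cos_abs_real)
  finally have "(pi/2 - ?y) / 2 \<le> cos (s - c)" .
  moreover have "e \<le> (pi/2 - ?y) / 2" using y by (simp add: field_simps)
  ultimately have "e \<le> \<bar>cos (s - c)\<bar>" by (meson abs_ge_self order_trans)
  then have "\<bar>sin (s - c)\<bar> < e" using n by (auto simp: far_def)
  also have "\<bar>sin (s - c)\<bar> = \<bar>sin ?y\<bar>"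
    using sin_minus[of "s - c"] by (cases "0 \<le> s - c") simp_all
  finally have "sin ?y < e" by (rule order_le_less_trans[OF abs_ge_self])
  moreover have "?y / 2 \<le> sin ?y" by (rule half_le_sin) (use y e in auto)
  ultimately have "?y / 2 < e" by (rule order_le_less_trans[rotated])
  then show ?thesis by simp
qed

text \<open>A grid interval is used for G k only if its length is comparable to its distance from
  the complement of G k. Every point of G k lies in such an interval, and a slope in all G k is met
  for each k. A slope outside G k0 is not far only from intervals of some G k containing it, so k <
  k0; for each such k its positive distance to the complement bounds the scale from below, and
  finitely many intervals remain.\<close>

lemma admissible_decreasing_Inter:
  assumes G: "\<And>k::nat. open (G k)" "\<And>k. G k \<subseteq> {0<..<pi/2}" "\<And>k. G (Suc k) \<subseteq> G k"
  shows "admissible (\<Inter>k. G k)"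
proof -
  define D where "D k s = infdist s (- G k)" for k and s :: real
  define e :: "nat \<Rightarrow> real" where "e j = (1/2)^j" for j
  define c where "c j i = real i * e j / 8" for j i
  \<comment> \<open>The lower bound 2 is the margin \<open>far_shift\<close> asks for, since 0 and
    pi/2 lie outside G k. The upper bound leaves room for the grid error e j / 8 when the distance
    of s itself lies between 3 * e j and 6 * e j.\<close>
  define act where "act k j i \<longleftrightarrow> 2 * e j \<le> D k (c j i) \<and> D k (c j i) < 8 * e j" for k j i
  define C where "C k j i = (if act k j i then {s. \<bar>s - c j i\<bar> \<le> e j / 8} else {})" for k j i
  define F where "F k j i = (if act k j i then {s. far (e j) (s - c j i)} else UNIV)" for k j i
  have e: "0 < e j" "e j \<le> 1" for j by (auto simp: e_def power_le_one)
  have bl: "blockable (C k j i) (F k j i)" for k j i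
    unfolding C_def F_def using blockable_interval[OF e] blockable_trivial by simp
  have ne: "- G k \<noteq> {}" and clo: "closed (- G k)" for k using G(1)[of k] G(2)[of k] by force+
  have DG: "s \<in> G k \<longleftrightarrow> 0 < D k s" for k s
    using in_closed_iff_infdist_zero[OF clo ne, of s k] infdist_nonneg[of s "- G k"] unfolding D_def by auto
  have Dle: "D k s \<le> \<bar>s\<bar>" "D k s \<le> \<bar>s - pi/2\<bar>" for k s
  proof -
    have "0 \<in> - G k" "pi/2 \<in> - G k" using G(2)[of k] by force+
    then show "D k s \<le> \<bar>s\<bar>" "D k s \<le> \<bar>s - pi/2\<bar>"
      unfolding D_def using infdist_le[of _ "- G k" s] by (force simp: dist_real_def)+
  qed
  have Dlip: "\<bar>D k s - D k t\<bar> \<le> \<bar>s - t\<bar>" for k s t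
    unfolding D_def using infdist_triangle_abs[of s "- G k" t] by (simp add: dist_real_def)
  define K where "K n = fst (prod_decode n)" for n
  define J where "J n = fst (prod_decode (snd (prod_decode n)))" for n
  define I where "I n = snd (prod_decode (snd (prod_decode n)))" for n
  have KJI: "K (prod_encode (k, prod_encode (j, i))) = k" "J (prod_encode (k, prod_encode (j, i))) = j"
    "I (prod_encode (k, prod_encode (j, i))) = i" for k j i
    by (auto simp: K_def J_def I_def)
  have enc: "prod_encode (K n, prod_encode (J n, I n)) = n" for n by (simp add: K_def J_def I_def)
  have good: "infinite {n. s \<in> C (K n) (J n) (I n)}" if s: "s \<in> (\<Inter>k. G k)" for s
  proof
    assume fin: "finite {n. s \<in> C (K n) (J n) (I n)}"
    have "k \<in> K ` {n. s \<in> C (K n) (J n) (I n)}" for k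
    proof -
      have sk: "s \<in> G k" using s by blast
      define d where "d = D k s"
      have d: "0 < d" using sk DG d_def by simp
      have s0: "0 < s" "s < pi/2" using sk G(2)[of k] by force+
      have d3: "d < 3" using Dle(1)[of k s] s0 pi_less_4 unfolding d_def by linarith
      obtain m where m: "(1/2::real)^m < d / 3" using real_arch_pow_inv[of "d/3" "1/2"] d by auto
      \<comment> \<open>The first dyadic size with 3 * e j \<le> d, hence d < 6 * e j by minimality;
        j > 0 because d < 3.\<close>
      define j where "j = (LEAST j. 3 * e j \<le> d)"
      have "3 * e m \<le> d" using m by (simp add: e_def)
      then have j: "3 * e j \<le> d" unfolding j_def by (rule LeastI)
      have "j \<noteq> 0"
      proof
        assume "j = 0"
        then have "e j = 1" by (simp add: e_def)
        then show False using j d3 by linarith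
      qed
      then obtain j' where j': "j = Suc j'" by (cases j) auto
      have "\<not> 3 * e j' \<le> d" using not_less_Least[of j' "\<lambda>j. 3 * e j \<le> d"] unfolding j_def[symmetric] j' by simp
      then have j6: "d < 6 * e j" unfolding j' by (simp add: e_def)
      define i where "i = nat \<lfloor>s / (e j / 8)\<rfloor>"
      have "0 \<le> s / (e j / 8)" using s0 e[of j] by simp
      then have "real i = of_int \<lfloor>s / (e j / 8)\<rfloor>" unfolding i_def by simp
      then have i: "real i \<le> s / (e j / 8)" "s / (e j / 8) < real i + 1" by linarith+
      have ej: "0 < e j / 8" using e[of j] by simp
      have "c j i \<le> s" using i(1) unfolding pos_le_divide_eq[OF ej] c_def by simp
      moreover have "s < c j i + e j / 8" using i(2) unfolding pos_divide_less_eq[OF ej] c_def by (simp add: distrib_right)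
      ultimately have sc: "\<bar>s - c j i\<bar> \<le> e j / 8" by linarith
      then have "\<bar>D k s - D k (c j i)\<bar> \<le> e j / 8" using Dlip[of k s "c j i"] by linarith
      then have "act k j i" unfolding act_def using j j6 e(1)[of j] unfolding d_def by linarith
      then have "s \<in> C k j i" using sc by (simp add: C_def)
      then show ?thesis by (intro image_eqI[of _ _ "prod_encode (k, prod_encode (j, i))"]) (auto simp: KJI)
    qed
    then have "K ` {n. s \<in> C (K n) (J n) (I n)} = UNIV" by blast
    then show False using finite_imageI[OF fin, of K] by simp
  qed
  have bad: "finite {n. s \<notin> F (K n) (J n) (I n)}" if s: "s \<in> {0..<pi/2} - (\<Inter>k. G k)" for s
  proof -
    obtain k0 where k0: "s \<notin> G k0" using s by blast
    have dec: "G k \<subseteq> G l" if "l \<le> k" for k l by (rule lift_Suc_antimono_le[of G l k, OF G(3) that])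
    have "\<exists>m. \<forall>j\<ge>m. 0 < D k s \<longrightarrow> 10 * e j \<le> D k s" for k
    proof (cases "0 < D k s")
      case True
      then obtain m where m: "(1/2::real)^m < D k s / 10" using real_arch_pow_inv[of "D k s/10" "1/2"] by auto
      have "10 * e j \<le> D k s" if "j \<ge> m" for j
      proof -
        have "e j \<le> e m" unfolding e_def by (rule power_decreasing) (use that in auto)
        moreover have "e m < D k s / 10" using m by (simp only: e_def)
        ultimately show ?thesis by linarith
      qed
      then show ?thesis by blast
    qed auto
    then obtain m where m: "\<And>k j. j \<ge> m k \<Longrightarrow> 0 < D k s \<Longrightarrow> 10 * e j \<le> D k s" by metis
    let ?T = "SIGMA k:{..<k0}. SIGMA j:{..<m k}. {..<16 * 2^j::nat}"
    have "{n. s \<notin> F (K n) (J n) (I n)} \<subseteq> (\<lambda>(k, j, i). prod_encode (k, prod_encode (j, i))) ` ?T"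
    proof
      fix n assume "n \<in> {n. s \<notin> F (K n) (J n) (I n)}"
      then have n: "s \<notin> F (K n) (J n) (I n)" by simp
      define k j i where "k = K n" and "j = J n" and "i = I n"
      have a: "act k j i" and nf: "\<not> far (e j) (s - c j i)"
        using n unfolding F_def k_def j_def i_def by (auto split: if_splits)
      have aD: "2 * e j \<le> D k (c j i)" "D k (c j i) < 8 * e j" using a by (auto simp: act_def)
      have "0 < D k (c j i)" using aD(1) e(1)[of j] by linarith
      then have "c j i \<in> G k" using DG by simp
      then have c0: "0 < c j i" "c j i < pi/2" using G(2)[of k] by force+
      have sc: "\<bar>s - c j i\<bar> < 2 * e j"
        by (rule far_shift[OF e(1) _ _ _ _ nf]) (use aD(1) Dle[of k "c j i"] c0 s in auto)
      \<comment> \<open>The distance to the complement is 1-Lipschitz, so s inherits positivity from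
        the margin 2 * e j and an upper bound from 8 * e j + 2 * e j.\<close>
      have Ds: "0 < D k s" "D k s < 10 * e j" using Dlip[of k s "c j i"] sc aD by linarith+
      have "s \<in> G k" using Ds(1) DG by simp
      then have k: "k < k0" using dec[of k0 k] k0 by (cases "k0 \<le> k") auto
      have j: "j < m k" using m[of k j] Ds by (cases "m k \<le> j") auto
      have "real i * e j < 16" using c0(2) pi_less_4 unfolding c_def by linarith
      then have "real i < 16 * 2^j" by (simp add: e_def power_one_over divide_simps)
      then have i: "i < 16 * 2^j" by (simp flip: of_nat_less_iff[where 'a=real])
      have "(k, j, i) \<in> ?T" using k j i by simp
      moreover have "n = prod_encode (k, prod_encode (j, i))" unfolding k_def j_def i_def by (rule enc[symmetric])
      ultimately show "n \<in> (\<lambda>(k, j, i). prod_encode (k, prod_encode (j, i))) ` ?T"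
        by (intro image_eqI[of _ _ "(k, j, i)"]) auto
    qed
    moreover have "finite ?T" by (intro finite_SigmaI) auto
    ultimately show ?thesis by (meson finite_imageI finite_subset)
  qed
  show ?thesis
    unfolding admissible_def
  proof (intro exI conjI allI ballI)
    show "blockable (C (K n) (J n) (I n)) (F (K n) (J n) (I n))" for n by (rule bl)
    show "infinite {n. s \<in> C (K n) (J n) (I n)}" if "s \<in> (\<Inter>k. G k)" for s by (rule good[OF that])
    show "finite {n. s \<notin> F (K n) (J n) (I n)}" if "s \<in> {0..<pi/2} - (\<Inter>k. G k)" for s by (rule bad[OF that])
  qed
qed

lemma admissible_G_delta:
  assumes "G_delta_set A"
  shows "admissible (A - {0})"
proof -
  obtain G :: "nat \<Rightarrow> real set" where G: "\<And>k. open (G k)" "A = (\<Inter>k. G k) \<inter> {0..<pi/2}"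
    using assms unfolding G_delta_set_def by blast
  define H where "H k = (\<Inter>l\<le>k. G l) \<inter> {0<..<pi/2}" for k
  have "admissible (\<Inter>k. H k)"
  proof (rule admissible_decreasing_Inter)
    show "open (H k)" for k unfolding H_def using G(1) by (intro open_Int open_INT) auto
    show "H k \<subseteq> {0<..<pi/2}" for k unfolding H_def by blast
    show "H (Suc k) \<subseteq> H k" for k unfolding H_def by (auto simp: atMost_Suc)
  qed
  also have "(\<Inter>k. H k) = A - {0}"
  proof (rule set_eqI)
    fix s
    have "s \<in> (\<Inter>k. H k) \<longleftrightarrow> (\<forall>l. s \<in> G l) \<and> s \<in> {0<..<pi/2}" unfolding H_def by blast
    also have "\<dots> \<longleftrightarrow> s \<in> A - {0}" unfolding G(2) by force
    finally show "s \<in> (\<Inter>k. H k) \<longleftrightarrow> s \<in> A - {0}" .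
  qed
  finally show ?thesis .
qed

lemma G_delta_sigma_admissible:
  assumes "G_delta_sigma_set S"
  obtains A :: "nat \<Rightarrow> real set" where "\<And>n. admissible (A n)" "S = (\<Union>n. A n)"
proof -
  obtain A :: "nat \<Rightarrow> real set" where A: "\<And>n. G_delta_set (A n)" "S = (\<Union>n. A n)"
    using assms unfolding G_delta_sigma_set_def by blast
  \<comment> \<open>Slope 0 gets the first slot and is removed from all other sets, which are then
    covered by \<open>admissible_G_delta\<close>.\<close>
  define B where "B n = (case n of 0 \<Rightarrow> S \<inter> {0} | Suc m \<Rightarrow> A m - {0})" for n
  have "admissible (B n)" for n
  proof (cases n)
    case 0
    then have "B n = S \<inter> {0}" by (simp add: B_def)
    also have "\<dots> = (if 0 \<in> S then {0} else {})" by simp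
    finally show ?thesis by (simp add: admissible_empty admissible_0)
  next
    case (Suc m)
    then show ?thesis using admissible_G_delta[OF A(1)[of m]] by (simp add: B_def)
  qed
  moreover have "S = (\<Union>n. B n)"
  proof
    show "S \<subseteq> (\<Union>n. B n)"
    proof
      fix s assume s: "s \<in> S"
      then obtain m where "s \<in> A m" using A(2) by blast
      then have "s \<in> B (if s = 0 then 0 else Suc m)" using s by (auto simp: B_def)
      then show "s \<in> (\<Union>n. B n)" by blast
    qed
    show "(\<Union>n. B n) \<subseteq> S" using A(2) by (auto simp: B_def split: nat.splits)
  qed
  ultimately show ?thesis by (rule that)
qed

section \<open>Necessity: openness of large means and semicontinuity of measure\<close>

lemma AE_hyperplane:
  fixes a :: "real \<times> real"
  assumes "a \<noteq> 0"
  shows "AE x in lborel. a \<bullet> x \<noteq> b"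
proof -
  have "{x. a \<bullet> x = b} \<in> null_sets lebesgue"
    using negligible_hyperplane[of a b] assms by (simp add: negligible_iff_null_sets)
  moreover have "{x. a \<bullet> x = b} \<in> sets lborel" using closed_hyperplane by simp
  ultimately have "{x. a \<bullet> x = b} \<in> null_sets lborel" by (simp add: null_sets_completion_iff)
  then show ?thesis by (rule AE_I') auto
qed

lemma AE_fu_fv: "AE x in lborel. fu s x \<noteq> a" "AE x in lborel. fv s x \<noteq> a"
proof -
  have u: "fu s x = (cos s, sin s) \<bullet> x" and v: "fv s x = (- sin s, cos s) \<bullet> x" for x
    by (auto simp: fu_def fv_def inner_prod_def mult.commute)
  have "(cos s, sin s) \<noteq> 0" "(- sin s, cos s) \<noteq> 0"
    by (auto simp: zero_prod_def dest: sin_zero_abs_cos_one)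
  then show "AE x in lborel. fu s x \<noteq> a" "AE x in lborel. fv s x \<noteq> a"
    unfolding u v by (auto intro: AE_hyperplane)
qed

lemma continuous_on_fu_fv2: "continuous_on UNIV (\<lambda>(s, x). fu s x)" "continuous_on UNIV (\<lambda>(s, x). fv s x)"
  unfolding fu_def fv_def split_beta by (intro continuous_intros)+

lemma isCont_indicator_rc:
  assumes "fu s x \<noteq> a" "fu s x \<noteq> b" "fv s x \<noteq> c" "fv s x \<noteq> d"
  shows "eventually (\<lambda>t. indicator (rc t a b c d) x = (indicator (rc s a b c d) x :: real)) (nhds s)"
proof -
  have U: "((\<lambda>t. fu t x) \<longlongrightarrow> fu s x) (nhds s)" and V: "((\<lambda>t. fv t x) \<longlongrightarrow> fv s x) (nhds s)"
    unfolding fu_def fv_def by (auto intro!: tendsto_intros filterlim_ident)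
  have ev: "eventually (\<lambda>t. (a < g t \<longleftrightarrow> a < g s) \<and> (g t < a \<longleftrightarrow> g s < a)) (nhds s)"
    if "(g \<longlongrightarrow> g s) (nhds s)" "g s \<noteq> a" for a and g :: "real \<Rightarrow> real"
  proof (cases "g s < a")
    case True
    show ?thesis using order_tendstoD(2)[OF that(1) True] by eventually_elim (use True in auto)
  next
    case False
    then have l: "a < g s" using that(2) by simp
    show ?thesis using order_tendstoD(1)[OF that(1) l] by eventually_elim (use l in auto)
  qed
  show ?thesis
    using ev[OF U assms(1)] ev[OF U assms(2)] ev[OF V assms(3)] ev[OF V assms(4)]
    by eventually_elim (simp add: indicator_def rc_def)
qed

text \<open>For a point off the four lines carrying the sides, membership in the rectangle is
  unchanged for nearby slopes. So the indicators converge almost everywhere, and dominated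
  convergence applies.\<close>

lemma tendsto_integral_rc:
  fixes g :: "real \<times> real \<Rightarrow> real"
  assumes g: "integrable lborel g" and s: "X \<longlonglongrightarrow> s"
  shows "(\<lambda>n. \<integral>x. indicator (rc (X n) a b c d) x * g x \<partial>lborel) \<longlonglongrightarrow> (\<integral>x. indicator (rc s a b c d) x * g x \<partial>lborel)"
proof (rule integral_dominated_convergence[where w="\<lambda>x. \<bar>g x\<bar>"])
  have [measurable]: "g \<in> borel_measurable borel" using borel_measurable_integrable[OF g] by simp
  show "(\<lambda>x. indicator (rc s a b c d) x * g x) \<in> borel_measurable lborel" by simp
  show "(\<lambda>x. indicator (rc (X n) a b c d) x * g x) \<in> borel_measurable lborel" for n by simp
  show "integrable lborel (\<lambda>x. \<bar>g x\<bar>)" using g by (rule integrable_abs)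
  show "AE x in lborel. norm (indicator (rc (X n) a b c d) x * g x) \<le> \<bar>g x\<bar>" for n
    by (rule AE_I2) (simp add: indicator_def)
  show "AE x in lborel. (\<lambda>n. indicator (rc (X n) a b c d) x * g x) \<longlonglongrightarrow> indicator (rc s a b c d) x * g x"
    using AE_fu_fv(1)[of s a] AE_fu_fv(1)[of s b] AE_fu_fv(2)[of s c] AE_fu_fv(2)[of s d]
  proof eventually_elim
    case (elim x)
    have "eventually (\<lambda>n. indicator (rc (X n) a b c d) x = (indicator (rc s a b c d) x :: real)) sequentially"
      using s isCont_indicator_rc[OF elim] by (auto dest: filterlim_iff[THEN iffD1])
    then have "eventually (\<lambda>n. indicator (rc (X n) a b c d) x * g x = indicator (rc s a b c d) x * g x) sequentially"
      by eventually_elim simp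
    then show ?case by (rule tendsto_eventually)
  qed
qed

text \<open>Size is measured by the sum of the sides, since this condition does not involve s. For
  fixed a, b, c, d the remaining conditions are strict inequalities between functions continuous in
  (s, x), so the whole set is a union of open sets.\<close>

definition large_mean :: "(real \<times> real \<Rightarrow> real) \<Rightarrow> nat \<Rightarrow> (real \<times> real \<times> real) set" where
  "large_mean g n = {(s, x). \<exists>a b c d. a < b \<and> c < d \<and> (b - a) + (d - c) < 1 / (real n + 1) \<and>
     x \<in> rc s a b c d \<and> real n < mean g (rc s a b c d)}"

lemma open_large_mean:
  assumes g: "integrable lborel g"
  shows "open (large_mean g n)"
proof -
  have gm: "g \<in> borel_measurable borel" using borel_measurable_integrable[OF g] by simp
  define W where "W a b c d = {(s, x). x \<in> rc s a b c d \<and> real n < mean g (rc s a b c d)}" for a b c d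
  have "open (W a b c d)" if "a < b" "c < d" for a b c d
  proof -
    have "continuous_on UNIV (\<lambda>s. mean g (rc s a b c d))"
      unfolding continuous_on_sequentially
    proof (intro allI ballI impI)
      fix X :: "nat \<Rightarrow> real" and s :: real assume "s \<in> UNIV" "(\<forall>n. X n \<in> UNIV) \<and> X \<longlonglongrightarrow> s"
      then have "(\<lambda>n. (\<integral>x. indicator (rc (X n) a b c d) x * g x \<partial>lborel) / ((b - a) * (d - c)))
        \<longlonglongrightarrow> (\<integral>x. indicator (rc s a b c d) x * g x \<partial>lborel) / ((b - a) * (d - c))"
        using that by (intro tendsto_divide tendsto_integral_rc g tendsto_const) auto
      then show "((\<lambda>s. mean g (rc s a b c d)) \<circ> X) \<longlonglongrightarrow> mean g (rc s a b c d)"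
        using that unfolding mean_eq[OF gm] o_def by (simp add: measure_rc)
    qed
    then have m: "continuous_on UNIV (\<lambda>p::real \<times> real \<times> real. mean g (rc (fst p) a b c d))"
      by (rule continuous_on_compose2) (auto intro: continuous_intros)
    have u: "continuous_on UNIV (\<lambda>p::real \<times> real \<times> real. fu (fst p) (snd p))"
      "continuous_on UNIV (\<lambda>p::real \<times> real \<times> real. fv (fst p) (snd p))"
      using continuous_on_fu_fv2 by (auto simp: split_beta)
    have "W a b c d = {p. a < fu (fst p) (snd p)} \<inter> {p. fu (fst p) (snd p) < b} \<inter> {p. c < fv (fst p) (snd p)}
      \<inter> {p. fv (fst p) (snd p) < d} \<inter> {p. real n < mean g (rc (fst p) a b c d)}"
      by (auto simp: W_def rc_def)
    also have "open \<dots>" by (intro open_Int open_Collect_less continuous_on_const u m)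
    finally show ?thesis .
  qed
  then have "open ({p. a < b \<and> c < d \<and> (b - a) + (d - c) < 1 / (real n + 1)} \<inter> W a b c d)" for a b c d
    by (cases "a < b \<and> c < d \<and> (b - a) + (d - c) < 1 / (real n + 1)") auto
  then have "open (\<Union>a b c d. {p. a < b \<and> c < d \<and> (b - a) + (d - c) < 1 / (real n + 1)} \<inter> W a b c d)"
    by (intro open_UN ballI)
  also have "\<dots> = large_mean g n"
    by (rule set_eqI) (simp add: large_mean_def W_def split_beta; blast)
  finally show ?thesis .
qed

lemma large_mean_antimono: "m \<le> n \<Longrightarrow> large_mean g n \<subseteq> large_mean g m"
proof
  fix p assume mn: "m \<le> n" and p: "p \<in> large_mean g n"
  obtain s x where sx: "p = (s, x)" by (cases p)
  obtain a b c d where *: "a < b" "c < d" "(b - a) + (d - c) < 1 / (real n + 1)" "x \<in> rc s a b c d" "real n < mean g (rc s a b c d)"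
    using p unfolding large_mean_def sx by auto
  have "1 / (real n + 1) \<le> 1 / (real m + 1)" using mn by (intro divide_left_mono) auto
  then have "(b - a) + (d - c) < 1 / (real m + 1)" "real m < mean g (rc s a b c d)" using * mn by linarith+
  then have "\<exists>a b c d. a < b \<and> c < d \<and> (b - a) + (d - c) < 1 / (real m + 1) \<and> x \<in> rc s a b c d \<and> real m < mean g (rc s a b c d)"
    using * by blast
  then show "p \<in> large_mean g m" unfolding large_mean_def sx by simp
qed

lemma upper_derivative_inf_iff_large_mean:
  "upper_derivative s g x = \<infinity> \<longleftrightarrow> (\<forall>n. (s, x) \<in> large_mean g n)"
proof
  assume inf: "upper_derivative s g x = \<infinity>"
  show "\<forall>n. (s, x) \<in> large_mean g n"
  proof
    fix n
    \<comment> \<open>Each side is at most the diameter, so halving the bound on the diameter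
      controls the sum of the sides.\<close>
    have "0 < 1 / (real n + 1) / 2" by simp
    then obtain R where R: "R \<in> rectangles s" "x \<in> R" "diameter R < 1 / (real n + 1) / 2" "real n < mean g R"
      using inf unfolding upper_derivative_inf_iff by blast
    obtain a b c d where ab: "a < b" "c < d" and Req: "R = rc s a b c d" using R(1) unfolding rectangles_iff by blast
    have "u + v < q" if "u \<le> r" "v \<le> r" "r < q / 2" for u v r q :: real using that by simp
    from this[OF side_le_diameter[OF ab, of s] R(3)[unfolded Req]]
    have "(b - a) + (d - c) < 1 / (real n + 1)" .
    then have "\<exists>a b c d. a < b \<and> c < d \<and> (b - a) + (d - c) < 1 / (real n + 1) \<and> x \<in> rc s a b c d \<and> real n < mean g (rc s a b c d)"
      using ab R unfolding Req by blast
    then show "(s, x) \<in> large_mean g n" unfolding large_mean_def by simp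
  qed
next
  assume *: "\<forall>n. (s, x) \<in> large_mean g n"
  show "upper_derivative s g x = \<infinity>"
  proof (rule upper_derivative_infI)
    fix k :: nat
    obtain a b c d where h: "a < b" "c < d" "(b - a) + (d - c) < 1 / (real k + 1)" "x \<in> rc s a b c d" "real k < mean g (rc s a b c d)"
      using *[rule_format, of k] unfolding large_mean_def by auto
    have "diameter (rc s a b c d) < 1 / (real k + 1)" using diameter_rc_le[of a b c d s] h by linarith
    moreover have "rc s a b c d \<in> rectangles s" unfolding rectangles_iff using h by blast
    ultimately show "\<exists>R\<in>rectangles s. x \<in> R \<and> diameter R < 1 / (real k + 1) \<and> real k \<le> mean g R"
      using h by (intro bexI[of _ "rc s a b c d"]) auto
  qed
qed

lemma open_section: "open U \<Longrightarrow> open (Pair s -` U)"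
  by (rule open_vimage) (auto intro: continuous_intros)

text \<open>For open U the indicator of the section is lower semicontinuous in s at every x. Fatou's
  lemma makes the measure lower semicontinuous too, so its sublevel sets are sequentially
  closed.\<close>

lemma open_emeasure_section_gt:
  fixes U :: "(real \<times> real \<times> real) set"
  assumes U: "open U" and [measurable]: "B \<in> sets borel"
  shows "open {s. t < emeasure lborel (Pair s -` U \<inter> B)}"
proof -
  have [measurable]: "Pair s -` U \<in> sets borel" for s using open_section[OF U, of s] by simp
  have "closed {s. emeasure lborel (Pair s -` U \<inter> B) \<le> t}"
    unfolding closed_sequential_limits
  proof (intro allI impI)
    fix X :: "nat \<Rightarrow> real" and s :: real assume X: "(\<forall>n. X n \<in> {s. emeasure lborel (Pair s -` U \<inter> B) \<le> t}) \<and> X \<longlonglongrightarrow> s"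
    then have le: "\<And>n. emeasure lborel (Pair (X n) -` U \<inter> B) \<le> t" and lim: "X \<longlonglongrightarrow> s" by auto
    have "emeasure lborel (Pair s -` U \<inter> B) = (\<integral>\<^sup>+x. indicator (Pair s -` U \<inter> B) x \<partial>lborel)" by simp
    also have "\<dots> \<le> (\<integral>\<^sup>+x. liminf (\<lambda>n. indicator (Pair (X n) -` U \<inter> B) x) \<partial>lborel)"
    proof (rule nn_integral_mono)
      fix x
      show "indicator (Pair s -` U \<inter> B) x \<le> liminf (\<lambda>n. indicator (Pair (X n) -` U \<inter> B) x :: ennreal)"
      proof (cases "x \<in> Pair s -` U \<inter> B")
        case True
        have "(\<lambda>n. (X n, x)) \<longlonglongrightarrow> (s, x)" using lim by (intro tendsto_intros)
        then have "eventually (\<lambda>n. (X n, x) \<in> U) sequentially"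
          by (rule topological_tendstoD) (use U True in auto)
        then have "eventually (\<lambda>n. 1 \<le> (indicator (Pair (X n) -` U \<inter> B) x :: ennreal)) sequentially"
          by eventually_elim (use True in auto)
        then have "1 \<le> liminf (\<lambda>n. indicator (Pair (X n) -` U \<inter> B) x :: ennreal)" by (rule Liminf_bounded)
        then show ?thesis using True by simp
      qed simp
    qed
    also have "\<dots> \<le> liminf (\<lambda>n. \<integral>\<^sup>+x. indicator (Pair (X n) -` U \<inter> B) x \<partial>lborel)"
      by (rule nn_integral_liminf) simp
    also have "\<dots> = liminf (\<lambda>n. emeasure lborel (Pair (X n) -` U \<inter> B))" by simp
    also have "\<dots> \<le> limsup (\<lambda>n. emeasure lborel (Pair (X n) -` U \<inter> B))" by (rule Liminf_le_Limsup) simp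
    also have "\<dots> \<le> t" by (rule Limsup_bounded) (use le in auto)
    finally show "s \<in> {s. emeasure lborel (Pair s -` U \<inter> B) \<le> t}" by simp
  qed
  then have "open (- {s. emeasure lborel (Pair s -` U \<inter> B) \<le> t})" by (rule open_Compl)
  then show ?thesis by (simp add: Collect_neg_eq[symmetric] not_le)
qed

text \<open>Positivity has to become a countable union of countable intersections of strict
  inequalities. Continuity from above needs finite measure, hence the balls. A single k can serve as
  radius and as threshold: if every k failed, the measure inside any fixed ball would be at most
  1/(k+1) for all large k, hence 0.\<close>

lemma emeasure_Inter_pos_iff:
  fixes U :: "nat \<Rightarrow> (real \<times> real) set"
  assumes U: "\<And>n. U n \<in> sets borel" "\<And>m n. m \<le> n \<Longrightarrow> U n \<subseteq> U m"
  shows "0 < emeasure lborel (\<Inter>n. U n) \<longleftrightarrow>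
    (\<exists>k::nat. \<forall>n. ennreal (1 / (real k + 1)) < emeasure lborel (U n \<inter> ball 0 (real k)))"
proof
  let ?E = "\<Inter>n. U n"
  have E [measurable]: "?E \<in> sets borel" by (rule sets.countable_INT'') (use U(1) in auto)
  assume pos: "0 < emeasure lborel ?E"
  have "\<exists>k. ennreal (1 / (real k + 1)) < emeasure lborel (?E \<inter> ball 0 (real k))"
  proof (rule ccontr)
    assume "\<not> ?thesis"
    then have le: "emeasure lborel (?E \<inter> ball 0 (real k)) \<le> ennreal (1 / (real k + 1))" for k by (simp add: not_less)
    have z: "emeasure lborel (?E \<inter> ball 0 (real m)) = 0" for m
    proof -
      have l: "(\<lambda>k. ennreal (1 / (real k + 1))) \<longlonglongrightarrow> ennreal 0"
        using LIMSEQ_inverse_real_of_nat by (intro tendsto_ennrealI) (simp add: inverse_eq_divide add.commute)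
      have "emeasure lborel (?E \<inter> ball 0 (real m)) \<le> ennreal 0"
      proof (rule LIMSEQ_le_const[OF l], intro exI[of _ m] allI impI)
        fix k assume mk: "m \<le> k"
        have "emeasure lborel (?E \<inter> ball 0 (real m)) \<le> emeasure lborel (?E \<inter> ball 0 (real k))"
          by (rule emeasure_mono) (use mk subset_ball[of "real m" "real k"] in auto)
        then show "emeasure lborel (?E \<inter> ball 0 (real m)) \<le> ennreal (1 / (real k + 1))" using le[of k] by simp
      qed
      then show ?thesis by simp
    qed
    have "?E = (\<Union>m. ?E \<inter> ball 0 (real m))"
    proof -
      have "\<exists>m. norm x < real m" for x :: "real \<times> real" by (rule reals_Archimedean2)
      then show ?thesis by auto
    qed
    also have "emeasure lborel (\<Union>m. ?E \<inter> ball 0 (real m)) = 0"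
      by (rule emeasure_UN_eq_0) (use z E in auto)
    finally show False using pos by simp
  qed
  then obtain k where k: "ennreal (1 / (real k + 1)) < emeasure lborel (?E \<inter> ball 0 (real k))" by blast
  have "emeasure lborel (?E \<inter> ball 0 (real k)) \<le> emeasure lborel (U n \<inter> ball 0 (real k))" for n
    by (rule emeasure_mono) (use U(1) in auto)
  then show "\<exists>k::nat. \<forall>n. ennreal (1 / (real k + 1)) < emeasure lborel (U n \<inter> ball 0 (real k))"
    using k order_less_le_trans by blast
next
  let ?E = "\<Inter>n. U n"
  assume "\<exists>k::nat. \<forall>n. ennreal (1 / (real k + 1)) < emeasure lborel (U n \<inter> ball 0 (real k))"
  then obtain k :: nat where k: "\<And>n. ennreal (1 / (real k + 1)) < emeasure lborel (U n \<inter> ball 0 (real k))" by blast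
  have "(\<lambda>n. emeasure lborel (U n \<inter> ball 0 (real k))) \<longlonglongrightarrow> emeasure lborel (\<Inter>n. U n \<inter> ball 0 (real k))"
  proof (rule Lim_emeasure_decseq)
    show "range (\<lambda>n. U n \<inter> ball 0 (real k)) \<subseteq> sets lborel" using U(1) by auto
    show "decseq (\<lambda>n. U n \<inter> ball 0 (real k))" using U(2) by (auto simp: decseq_def)
    show "emeasure lborel (U i \<inter> ball 0 (real k)) \<noteq> \<infinity>" for i
    proof -
      have "emeasure lborel (U i \<inter> ball 0 (real k)) \<le> emeasure lborel (ball (0::real \<times> real) (real k))"
        by (rule emeasure_mono) auto
      then show ?thesis using emeasure_lborel_ball_finite[of "0::real \<times> real" "real k"] by (metis infinity_ennreal_def linorder_not_less top.extremum_uniqueI)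
    qed
  qed
  then have "ennreal (1 / (real k + 1)) \<le> emeasure lborel (\<Inter>n. U n \<inter> ball 0 (real k))"
    by (rule LIMSEQ_le_const) (use k in \<open>auto intro: less_imp_le\<close>)
  also have "\<dots> \<le> emeasure lborel ?E" by (rule emeasure_mono) (use U(1) in auto)
  finally have le: "ennreal (1 / (real k + 1)) \<le> emeasure lborel ?E" .
  have "0 < ennreal (1 / (real k + 1))" by (simp add: ennreal_less_zero_iff)
  then show "0 < emeasure lborel ?E" using le by (rule order_less_le_trans)
qed

text \<open>S is recovered as the set of slopes whose divergence set has positive measure. For s in
  S that set contains some A of positive measure; for other s differentiation makes the upper
  derivative finite almost everywhere. The divergence set is an intersection of open sections, so
  \<open>emeasure_Inter_pos_iff\<close> applies.\<close>

lemma WR_set_imp_G_delta_sigma_set: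
  assumes "WR_set S"
  shows "G_delta_sigma_set S"
proof -
  obtain f :: "real \<times> real \<Rightarrow> real" where S: "S \<subseteq> {0..<pi/2}" and f: "integrable lebesgue f"
    and bad: "\<And>s. s \<in> {0..<pi/2} - S \<Longrightarrow> differentiates s f"
    and good: "\<And>s. s \<in> S \<Longrightarrow> \<exists>A\<in>sets lebesgue. 0 < emeasure lebesgue A \<and> (\<forall>x\<in>A. upper_derivative s f x = \<infinity>)"
    using assms unfolding WR_set_def by blast
  \<comment> \<open>A Borel version of f has the same means over rectangles, hence the same points
    of infinite upper derivative.\<close>
  obtain g where gm: "g \<in> borel_measurable lborel" and fg: "AE x in lborel. f x = g x"
    using completion_ex_borel_measurable_real[OF borel_measurable_integrable[OF f]] by blast
  have fgl: "AE x in lebesgue. f x = g x" using AE_completion[OF fg] .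
  have "integrable lebesgue g"
    by (rule integrable_cong_AE_imp[OF f measurable_completion[OF gm]]) (use fgl in \<open>auto simp: eq_commute\<close>)
  then have g: "integrable lborel g" using gm by (simp add: integrable_completion)
  have gm': "g \<in> borel_measurable borel" using gm by simp
  have mean_fg: "mean f R = mean g R" if "R \<in> rectangles s" for R s
  proof -
    obtain a b c d where "R = rc s a b c d" using \<open>R \<in> rectangles s\<close> unfolding rectangles_iff by blast
    then have R: "R \<in> sets lebesgue" using rc_sets by simp
    have "(LINT y:R|lebesgue. f y) = (LINT y:R|lebesgue. g y)"
      unfolding set_lebesgue_integral_def
    proof (rule integral_cong_AE)
      show "(\<lambda>x. indicator R x *\<^sub>R f x) \<in> borel_measurable lebesgue"
        using R borel_measurable_integrable[OF f] by simp
      show "(\<lambda>x. indicator R x *\<^sub>R g x) \<in> borel_measurable lebesgue"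
        using R measurable_completion[OF gm] by simp
      show "AE x in lebesgue. indicator R x *\<^sub>R f x = indicator R x *\<^sub>R g x" using fgl by eventually_elim simp
    qed
    then show ?thesis unfolding mean_def by simp
  qed
  have ud: "upper_derivative s f x = \<infinity> \<longleftrightarrow> upper_derivative s g x = \<infinity>" for s x
    unfolding upper_derivative_inf_iff using mean_fg by (metis (no_types, lifting))
  define U where "U n s = Pair s -` large_mean g n" for n s
  have Us: "U n s \<in> sets borel" for n s unfolding U_def using open_section[OF open_large_mean[OF g]] by simp
  have Ud: "U n s \<subseteq> U m s" if "m \<le> n" for m n s unfolding U_def using large_mean_antimono[OF that] by blast
  have E: "x \<in> (\<Inter>n. U n s) \<longleftrightarrow> upper_derivative s f x = \<infinity>" for s x
    using ud[of s x] upper_derivative_inf_iff_large_mean[of s g x] by (simp add: U_def)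
  have Em: "(\<Inter>n. U n s) \<in> sets borel" for s by (rule sets.countable_INT'') (use Us in auto)
  have char: "s \<in> S \<longleftrightarrow> 0 < emeasure lborel (\<Inter>n. U n s)" if s: "s \<in> {0..<pi/2}" for s
  proof
    assume "s \<in> S"
    then obtain A where A: "A \<in> sets lebesgue" "0 < emeasure lebesgue A" "\<And>x. x \<in> A \<Longrightarrow> upper_derivative s f x = \<infinity>"
      using good by blast
    have "A \<subseteq> (\<Inter>n. U n s)" using A(3) E by blast
    then have "emeasure lebesgue A \<le> emeasure lebesgue (\<Inter>n. U n s)" by (rule emeasure_mono) (use Em in simp)
    also have "\<dots> = emeasure lborel (\<Inter>n. U n s)" using Em by simp
    finally show "0 < emeasure lborel (\<Inter>n. U n s)" using A(2) by (rule order_less_le_trans[rotated])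
  next
    assume pos: "0 < emeasure lborel (\<Inter>n. U n s)"
    show "s \<in> S"
    proof (rule ccontr)
      assume "s \<notin> S"
      then have "AE x in lebesgue. (mean f \<longlongrightarrow> f x) (rect_filter s x)"
        using bad s unfolding differentiates_def by blast
      then have "AE x in lebesgue. x \<notin> (\<Inter>n. U n s)"
        unfolding E by eventually_elim (rule upper_derivative_finite)
      then have "AE x in lborel. x \<notin> (\<Inter>n. U n s)" by (simp add: AE_completion_iff)
      then have "emeasure lborel (\<Inter>n. U n s) = 0"
        using Em by (subst (asm) AE_iff_measurable[of "\<Inter>n. U n s"]) auto
      then show False using pos by simp
    qed
  qed
  define H where "H k n = {s. ennreal (1 / (real k + 1)) < emeasure lborel (U n s \<inter> ball 0 (real k))}" for k n :: nat
  have "S = (\<Union>k. (\<Inter>n. H k n) \<inter> {0..<pi/2})"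
  proof (rule set_eqI)
    fix s
    have "s \<in> S \<longleftrightarrow> s \<in> {0..<pi/2} \<and> 0 < emeasure lborel (\<Inter>n. U n s)" using char S by blast
    also have "\<dots> \<longleftrightarrow> s \<in> {0..<pi/2} \<and> (\<exists>k. \<forall>n. s \<in> H k n)"
      using emeasure_Inter_pos_iff[of "\<lambda>n. U n s", OF Us Ud] unfolding H_def by simp
    also have "\<dots> \<longleftrightarrow> s \<in> (\<Union>k. (\<Inter>n. H k n) \<inter> {0..<pi/2})" by blast
    finally show "s \<in> S \<longleftrightarrow> s \<in> (\<Union>k. (\<Inter>n. H k n) \<inter> {0..<pi/2})" .
  qed
  moreover have "open (H k n)" for k n
    unfolding H_def U_def by (rule open_emeasure_section_gt[OF open_large_mean[OF g]]) simp
  then have "G_delta_set ((\<Inter>n. H k n) \<inter> {0..<pi/2})" for k unfolding G_delta_set_def by blast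
  ultimately show ?thesis
    unfolding G_delta_sigma_set_def by (intro exI[of _ "\<lambda>k. (\<Inter>n. H k n) \<inter> {0..<pi/2}"] conjI allI)
qed

section \<open>Sufficiency: localisation, and gluing in disjoint strips\<close>

lemma admissible_function:
  assumes "admissible A"
  shows "\<exists>F. F \<in> borel_measurable borel \<and> integrable lborel (\<lambda>x. indicator V1 x * F x) \<and>
    (\<forall>s\<in>A. AE x in lborel. x \<in> V1 \<longrightarrow> upper_derivative s F x = \<infinity>) \<and>
    (\<forall>s\<in>{0..<pi/2} - A. AE x in lborel. x \<in> V1 \<longrightarrow> (mean F \<longlongrightarrow> F x) (rect_filter s x))"
proof -
  obtain C Far :: "nat \<Rightarrow> real set" where bl: "\<And>n. blockable (C n) (Far n)"
    and inf: "\<And>s. s \<in> A \<Longrightarrow> infinite {n. s \<in> C n}" and fin: "\<And>s. s \<in> {0..<pi/2} - A \<Longrightarrow> finite {n. s \<notin> Far n}"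
    using assms unfolding admissible_def by blast
  obtain F where F: "F \<in> borel_measurable borel" "integrable lborel (\<lambda>x. indicator V1 x * F x)"
    "\<And>s. infinite {n. s \<in> C n} \<Longrightarrow> AE x in lborel. x \<in> V1 \<longrightarrow> upper_derivative s F x = \<infinity>"
    "\<And>s. finite {n. s \<notin> Far n} \<Longrightarrow> AE x in lborel. x \<in> V1 \<longrightarrow> (mean F \<longlongrightarrow> F x) (rect_filter s x)"
    by (rule combine_blocks[of C Far, OF bl]) (rule that)
  show ?thesis
  proof (intro exI[of _ F] conjI ballI F(1,2))
    show "AE x in lborel. x \<in> V1 \<longrightarrow> upper_derivative s F x = \<infinity>" if "s \<in> A" for s by (rule F(3)[OF inf[OF that]])
    show "AE x in lborel. x \<in> V1 \<longrightarrow> (mean F \<longlongrightarrow> F x) (rect_filter s x)" if "s \<in> {0..<pi/2} - A" for s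
      by (rule F(4)[OF fin[OF that]])
  qed
qed

lemma mean_cmult: "mean (\<lambda>x. c * f x) R = c * mean f R"
proof -
  have "(LINT y:R|lebesgue. c * f y) = c * (LINT y:R|lebesgue. f y)"
    unfolding set_lebesgue_integral_def by (simp add: mult.left_commute)
  then show ?thesis by (simp add: mean_def)
qed

lemma eventually_subset_rect_filter:
  assumes "open U" "x \<in> U"
  shows "eventually (\<lambda>R. R \<in> rectangles s \<and> R \<subseteq> U) (rect_filter s x)"
proof -
  obtain r where r: "r > 0" "ball x r \<subseteq> U" using assms by (meson openE)
  show ?thesis
    unfolding eventually_rect_filter
  proof (intro exI[of _ r] conjI ballI impI r(1))
    fix R assume R: "R \<in> rectangles s" "x \<in> R \<and> diameter R < r"
    then show "R \<subseteq> U" using rect_subset_ball[of R s x r] r(2) by blast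
  qed
qed

text \<open>Differentiation at x depends only on f near x. The case c = 0 covers the open region
  where the glued function vanishes.\<close>

lemma tendsto_mean_local:
  assumes "open U" "x \<in> U" "\<And>y. y \<in> U \<Longrightarrow> f y = c * g y" "(mean g \<longlongrightarrow> g x) (rect_filter s x)"
  shows "(mean f \<longlongrightarrow> f x) (rect_filter s x)"
proof -
  have "((\<lambda>R. c * mean g R) \<longlongrightarrow> c * g x) (rect_filter s x)" by (rule tendsto_mult_left[OF assms(4)])
  then have "((\<lambda>R. c * mean g R) \<longlongrightarrow> f x) (rect_filter s x)" using assms(2,3) by simp
  moreover have "eventually (\<lambda>R. c * mean g R = mean f R) (rect_filter s x)"
    using eventually_subset_rect_filter[OF assms(1,2)]
  proof eventually_elim
    case (elim R)
    have "mean f R = mean (\<lambda>y. c * g y) R" by (rule mean_cong) (use assms(3) elim in blast)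
    then show ?case by (simp add: mean_cmult)
  qed
  ultimately show ?thesis by (rule Lim_transform_eventually)
qed

lemma upper_derivative_inf_local:
  assumes "open U" "x \<in> U" "0 < c" "\<And>y. y \<in> U \<Longrightarrow> f y = c * g y" "upper_derivative s g x = \<infinity>"
  shows "upper_derivative s f x = \<infinity>"
  unfolding upper_derivative_inf_iff
proof (intro allI impI)
  fix B \<delta> :: real assume \<delta>: "0 < \<delta>"
  obtain r where r: "r > 0" "ball x r \<subseteq> U" using assms by (meson openE)
  have "0 < min \<delta> r" using \<delta> r by simp
  then obtain R where R: "R \<in> rectangles s" "x \<in> R" "diameter R < min \<delta> r" "B / c < mean g R"
    using assms(5) unfolding upper_derivative_inf_iff by blast
  have "R \<subseteq> U" using rect_subset_ball[OF R(1,2), of r] R(3) r(2) by auto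
  then have "mean f R = mean (\<lambda>y. c * g y) R" by (intro mean_cong) (use assms(4) in blast)
  then have "mean f R = c * mean g R" by (simp add: mean_cmult)
  moreover have "B < c * mean g R" using R(4) assms(3) by (simp add: pos_divide_less_eq mult.commute)
  ultimately show "\<exists>R\<in>rectangles s. x \<in> R \<and> diameter R < \<delta> \<and> B < mean f R"
    using R by (intro bexI[of _ R]) auto
qed

text \<open>Pairwise disjoint open rectangles that fill a half square inside the unit ball up to
  countably many segments. On each of them the glued function is a positive multiple of a single
  function, so divergence produced by one set of slopes cannot be cancelled by another.\<close>

definition strip :: "nat \<Rightarrow> (real \<times> real) set" where
  "strip n = {x. 1 / (real n + 2) < 2 * fst x \<and> 2 * fst x < 1 / (real n + 1) \<and> \<bar>snd x\<bar> < 1 / 2}"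

lemma open_strip: "open (strip n)"
  unfolding strip_def by (intro open_Collect_conj open_Collect_less continuous_intros)

lemma strip_bounds:
  assumes "x \<in> strip n"
  shows "0 < fst x" "2 * fst x < 1" "\<bar>snd x\<bar> < 1 / 2"
proof -
  have "1 / (real n + 1) \<le> 1" "0 < 1 / (real n + 2)" by auto
  moreover have "1 / (real n + 2) < 2 * fst x" "2 * fst x < 1 / (real n + 1)" using assms unfolding strip_def by blast+
  ultimately show "0 < fst x" "2 * fst x < 1" by linarith+
  show "\<bar>snd x\<bar> < 1 / 2" using assms unfolding strip_def by blast
qed

lemma strip_subset: "strip n \<subseteq> V1"
proof
  fix x assume x: "x \<in> strip n"
  have "\<bar>fst x\<bar> < 1 / 2" "\<bar>snd x\<bar> < 1 / 2" using strip_bounds[OF x] by auto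
  moreover have "norm x \<le> \<bar>fst x\<bar> + \<bar>snd x\<bar>"
    using sqrt_sum_squares_le_sum_abs[of "fst x" "snd x"] by (simp add: norm_prod_def)
  ultimately show "x \<in> V1" by simp
qed

lemma strip_unique:
  assumes "x \<in> strip m" "x \<in> strip n"
  shows "m = n"
proof -
  have False if "i < j" "x \<in> strip i" "x \<in> strip j" for i j
  proof -
    have "1 / (real j + 1) \<le> 1 / (real i + 2)" using that(1) by (intro divide_left_mono) auto
    then show False using that(2,3) unfolding strip_def by simp
  qed
  then show ?thesis using assms by (meson linorder_neqE_nat)
qed

lemma strip_not_null: "0 < emeasure lborel (strip n)"
proof -
  have mid: "\<exists>q. u < 2 * q \<and> 2 * q < v" if "u < v" for u v :: real
    by (rule exI[of _ "(u + v) / 4"]) (use that in simp)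
  have "1 / (real n + 2) < 1 / (real n + 1)" by (intro divide_strict_left_mono) auto
  from mid[OF this] obtain q where "1 / (real n + 2) < 2 * q" "2 * q < 1 / (real n + 1)" by blast
  then have "(q, 0) \<in> strip n" by (simp add: strip_def)
  then have "\<not> negligible (strip n)" using open_not_negligible[OF open_strip] by blast
  then have "emeasure lebesgue (strip n) \<noteq> 0"
    using open_strip[of n] by (auto simp: negligible_iff_null_sets null_sets_def)
  then show ?thesis using open_strip[of n] by (simp add: zero_less_iff_neq_zero)
qed

lemma strip_cover:
  assumes "0 < fst x" "2 * fst x < 1" "\<bar>snd x\<bar> < 1 / 2" "\<And>n. 2 * fst x \<noteq> 1 / (real n + 1)"
  shows "\<exists>n. x \<in> strip n"
proof -
  obtain m :: nat where m: "1 / (2 * fst x) < m" using reals_Archimedean2 by blast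
  have inv: "1 / b < a" if "1 / a < b" "0 < a" "0 < b" for a b :: real
    using that by (simp add: divide_simps mult.commute)
  have ex: "1 / (real m + 2) < 2 * fst x" by (rule inv) (use m assms(1) in auto)
  define n where "n = (LEAST m. 1 / (real m + 2) < 2 * fst x)"
  have n: "1 / (real n + 2) < 2 * fst x" unfolding n_def by (rule LeastI[of "\<lambda>m. 1 / (real m + 2) < 2 * fst x", OF ex])
  have "2 * fst x < 1 / (real n + 1)"
  proof (cases n)
    case (Suc k)
    have "\<not> 1 / (real k + 2) < 2 * fst x"
      using not_less_Least[of k "\<lambda>m. 1 / (real m + 2) < 2 * fst x"] unfolding n_def[symmetric] Suc by simp
    then have "2 * fst x \<le> 1 / (real n + 1)" unfolding Suc by (simp add: add.commute)
    then show ?thesis using assms(4)[of n] by simp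
  qed (use assms(2) in simp)
  then show ?thesis using n assms(3) unfolding strip_def by blast
qed

text \<open>A slope in \<open>A n\<close> diverges almost everywhere in strip n, a set of positive
  measure. A slope outside all \<open>A n\<close> is differentiated in every strip and, trivially,
  in the open exterior; the lines between these regions are null.\<close>

lemma G_delta_sigma_set_imp_WR_set:
  assumes S: "S \<subseteq> {0..<pi/2}" and GS: "G_delta_sigma_set S"
  shows "WR_set S"
proof -
  obtain A :: "nat \<Rightarrow> real set" where A: "\<And>n. admissible (A n)" "S = (\<Union>n. A n)"
    by (rule G_delta_sigma_admissible[OF GS]) (rule that)
  have "\<forall>n. \<exists>F. F \<in> borel_measurable borel \<and> integrable lborel (\<lambda>x. indicator V1 x * F x) \<and>
    (\<forall>s\<in>A n. AE x in lborel. x \<in> V1 \<longrightarrow> upper_derivative s F x = \<infinity>) \<and>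
    (\<forall>s\<in>{0..<pi/2} - A n. AE x in lborel. x \<in> V1 \<longrightarrow> (mean F \<longlongrightarrow> F x) (rect_filter s x))"
    using admissible_function[OF A(1)] by blast
  from choice[OF this] obtain F where F': "\<forall>n. F n \<in> borel_measurable borel \<and> integrable lborel (\<lambda>x. indicator V1 x * F n x) \<and>
    (\<forall>s\<in>A n. AE x in lborel. x \<in> V1 \<longrightarrow> upper_derivative s (F n) x = \<infinity>) \<and>
    (\<forall>s\<in>{0..<pi/2} - A n. AE x in lborel. x \<in> V1 \<longrightarrow> (mean (F n) \<longlongrightarrow> F n x) (rect_filter s x))" by (rule exE)
  have F [measurable]: "F n \<in> borel_measurable borel" and Fi: "integrable lborel (\<lambda>x. indicator V1 x * F n x)" for n
    using F' by blast+
  have Fg: "AE x in lborel. x \<in> V1 \<longrightarrow> upper_derivative s (F n) x = \<infinity>" if "s \<in> A n" for s n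
    using F' that by blast
  have Fb: "AE x in lborel. x \<in> V1 \<longrightarrow> (mean (F n) \<longlongrightarrow> F n x) (rect_filter s x)" if "s \<in> {0..<pi/2} - A n" for s n
    using F' that by blast
  have [measurable]: "strip n \<in> sets borel" for n using open_strip by simp
  define I where "I n = (\<integral>x. \<bar>indicator V1 x * F n x\<bar> \<partial>lborel)" for n
  \<comment> \<open>The weights make the L1 norms of the pieces summable; the 1 in the denominator
    avoids division by 0 when I n = 0.\<close>
  define c where "c n = (1/2)^(n+1) / (1 + I n)" for n
  have I: "0 \<le> I n" for n unfolding I_def by (rule integral_nonneg_AE) simp
  have c: "0 < c n" "c n * I n \<le> (1/2)^(n+1)" for n
  proof -
    show "0 < c n" using I[of n] by (simp add: c_def)
    have "I n / (1 + I n) \<le> 1" using I[of n] by simp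
    then have "(1/2)^(n+1) * (I n / (1 + I n)) \<le> (1/2::real)^(n+1) * 1" by (intro mult_left_mono) auto
    then show "c n * I n \<le> (1/2)^(n+1)" by (simp add: c_def)
  qed
  define h where "h n x = c n * ((indicator V1 x * F n x) * indicator (strip n) x)" for n x
  have hi: "integrable lborel (h n)" for n
    unfolding h_def by (intro integrable_mult_right integrable_real_mult_indicator Fi) simp
  have h1: "h n x = c n * F n x" if "x \<in> strip n" for n x
    using that strip_subset[of n] by (auto simp: h_def)
  have h0: "h n x = 0" if "x \<notin> strip n" for n x using that by (simp add: h_def)
  define f where "f x = (\<Sum>n. h n x)" for x
  have hz: "h m x = 0" if "x \<in> strip n" "m \<noteq> n" for m n x
    using h0[of x m] strip_unique[OF that(1), of m] that(2) by blast
  have f1: "f x = c n * F n x" if x: "x \<in> strip n" for n x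
  proof -
    have "f x = (\<Sum>m\<in>{n}. h m x)"
      unfolding f_def by (rule suminf_finite) (use hz[OF x] in simp_all)
    then show ?thesis using h1[OF x] by simp
  qed
  have f0: "f x = 0" if "\<And>n. x \<notin> strip n" for x unfolding f_def using h0 that by simp
  have hs: "summable (\<lambda>n. norm (h n x))" for x
  proof (cases "\<exists>n. x \<in> strip n")
    case True
    then obtain n where n: "x \<in> strip n" by blast
    show ?thesis by (rule summable_finite[of "{n}"]) (use hz[OF n] in simp_all)
  qed (simp add: h0)
  have hn: "(\<integral>x. norm (h n x) \<partial>lborel) \<le> (1/2)^(n+1)" for n
  proof -
    have "(\<integral>x. norm (h n x) \<partial>lborel) \<le> (\<integral>x. c n * \<bar>indicator V1 x * F n x\<bar> \<partial>lborel)"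
    proof (rule integral_mono)
      show "integrable lborel (\<lambda>x. norm (h n x))" using hi by (rule integrable_norm)
      show "integrable lborel (\<lambda>x. c n * \<bar>indicator V1 x * F n x\<bar>)" using Fi by (intro integrable_mult_right integrable_abs)
      show "norm (h n x) \<le> c n * \<bar>indicator V1 x * F n x\<bar>" for x
        using c(1)[of n] by (auto simp: h_def abs_mult indicator_def)
    qed
    also have "\<dots> = c n * I n" unfolding I_def by simp
    finally show ?thesis using c(2)[of n] by linarith
  qed
  have fi: "integrable lborel f"
    unfolding f_def[abs_def]
  proof (rule integrable_suminf[OF hi])
    show "AE x in lborel. summable (\<lambda>n. norm (h n x))" using hs by simp
    show "summable (\<lambda>n. \<integral>x. norm (h n x) \<partial>lborel)"
      by (rule summable_comparison_test'[OF summable_pow_half(1)]) (use hn in auto)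
  qed
  have fl: "integrable lebesgue f" using fi borel_measurable_integrable[OF fi] by (simp add: integrable_completion)
  have good: "\<exists>B\<in>sets lebesgue. 0 < emeasure lebesgue B \<and> (\<forall>x\<in>B. upper_derivative s f x = \<infinity>)" if s: "s \<in> S" for s
  proof -
    obtain n where n: "s \<in> A n" using s A(2) by blast
    obtain N where N: "{x \<in> space lborel. \<not> (x \<in> V1 \<longrightarrow> upper_derivative s (F n) x = \<infinity>)} \<subseteq> N" "emeasure lborel N = 0" "N \<in> sets lborel"
      using AE_E[OF Fg[OF n]] by blast
    have B: "strip n - N \<in> sets lborel" using N(3) by simp
    have "emeasure lborel (strip n - N) = emeasure lborel (strip n)"
      by (rule emeasure_Diff_null_set) (use N(2,3) in auto)
    then have "0 < emeasure lebesgue (strip n - N)" using strip_not_null[of n] B by simp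
    moreover have "upper_derivative s f x = \<infinity>" if x: "x \<in> strip n - N" for x
    proof (rule upper_derivative_inf_local[OF open_strip _ c(1) f1])
      show "x \<in> strip n" using x by blast
      have "x \<in> V1" using x strip_subset[of n] by blast
      moreover have "x \<notin> {x \<in> space lborel. \<not> (x \<in> V1 \<longrightarrow> upper_derivative s (F n) x = \<infinity>)}" using x N(1) by blast
      ultimately show "upper_derivative s (F n) x = \<infinity>" by simp
    qed
    moreover have "strip n - N \<in> sets lebesgue" using B by (rule sets_completionI_sets)
    ultimately show ?thesis by blast
  qed
  have bad: "differentiates s f" if s: "s \<in> {0..<pi/2} - S" for s
  proof -
    have "AE x in lborel. \<forall>n. x \<in> V1 \<longrightarrow> (mean (F n) \<longlongrightarrow> F n x) (rect_filter s x)"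
      unfolding AE_all_countable using Fb s A(2) by blast
    moreover have "AE x in lborel. \<forall>n. fu 0 x \<noteq> 1 / (real n + 1) / 2"
      unfolding AE_all_countable using AE_fu_fv(1) by blast
    ultimately have "AE x in lborel. (mean f \<longlongrightarrow> f x) (rect_filter s x)"
      using AE_fu_fv(1)[of 0 0] AE_fu_fv(1)[of 0 "1/2"] AE_fu_fv(2)[of 0 "1/2"] AE_fu_fv(2)[of 0 "-1/2"]
    proof eventually_elim
      case (elim x)
      show ?case
      proof (cases "\<exists>n. x \<in> strip n")
        case True
        then obtain n where n: "x \<in> strip n" by blast
        show ?thesis
          by (rule tendsto_mean_local[OF open_strip n f1]) (use elim(1) strip_subset[of n] n in auto)
      next
        case False
        \<comment> \<open>The complement of the closed half square. A point that is in no strip and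
          on none of the excluded lines must lie in it, by \<open>strip_cover\<close>.\<close>
        define U :: "(real \<times> real) set" where "U = {x. fst x < 0} \<union> {x. 1 < 2 * fst x} \<union> {x. 1/2 < \<bar>snd x\<bar>}"
        have fz: "f y = 0 * 0" if "y \<in> U" for y
        proof -
          have "y \<notin> strip n" for n
          proof
            assume "y \<in> strip n"
            from strip_bounds[OF this] show False using that unfolding U_def by auto
          qed
          then show ?thesis using f0 by simp
        qed
        have xx: "fst x \<noteq> 0" "2 * fst x \<noteq> 1" "\<bar>snd x\<bar> \<noteq> 1/2"
          using elim(3-6) by (auto simp: fu_def fv_def abs_if)
        have half: "a = b / 2" if "2 * a = b" for a b :: real using that by simp
        have fu0: "fu 0 x = fst x" by (simp add: fu_def)
        have xn: "2 * fst x \<noteq> 1 / (real n + 1)" for n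
          using elim(2)[rule_format, of n] half[of "fst x" "1 / (real n + 1)"] unfolding fu0 by blast
        have "x \<in> U"
        proof (rule ccontr)
          assume "x \<notin> U"
          then have "0 < fst x" "2 * fst x < 1" "\<bar>snd x\<bar> < 1/2" using xx unfolding U_def by (auto simp: less_le)
          then show False using strip_cover[of x] xn False by blast
        qed
        moreover have "open U" unfolding U_def
          by (intro open_Un open_Collect_less continuous_intros)
        moreover have "mean (\<lambda>_. 0) = (\<lambda>_. 0)" by (rule ext) (rule mean_0)
        then have "(mean (\<lambda>_. 0) \<longlongrightarrow> 0) (rect_filter s x)" by simp
        ultimately show ?thesis
          by (intro tendsto_mean_local[of U x f 0 "\<lambda>_. 0"] fz) simp_all
      qed
    qed
    then show ?thesis unfolding differentiates_def by (rule AE_completion)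
  qed
  show ?thesis unfolding WR_set_def using S fl good bad by blast
qed

theorem theorem2:
  fixes S :: "real set"
  assumes "S \<subseteq> {0..<pi/2}"
  shows "WR_set S \<longleftrightarrow> G_delta_sigma_set S"
  using WR_set_imp_G_delta_sigma_set G_delta_sigma_set_imp_WR_set[OF assms] by blast

end
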